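(* In the setting described in the context, assume that there is a unique optimal $p$-dimensional projection in the limit, i.e. $\lambda_p>\lambda_{p+1}$, and that Condition (B) holds: there exists $\varepsilon>0$ such that for all $s\in[1-\varepsilon,1+\varepsilon]$ $$\big\|\mathbb{E}_{s t_{n,k}}(\Theta\Theta^\top)-\Sigma_{n,k}\big\|_{op}=o(k^{-1/2}).$$ Then, uniformly over compact sets of matrices $B\in\tilde{\mathcal{M}}_S$, $$k\big(\hat M_{n,k}(\hat{\mathbf{\Pi}}_{n,B})-\hat M_{n,k}(\mathbf{\Pi}_{\hat V_{n,k}})\big)\longrightarrow\langle\Sigma,B^2(\mathbf{\Pi}^*-\mathbf{\Pi}^\perp)\rangle_{HS}$$ (in probability, the left-hand side being random and the limit deterministic), and $$k\big(M_{n,k}(\hat{\mathbf{\Pi}}_{n,B})-M_{n,k}(\mathbf{\Pi}_{\hat V_{n,k}})\big)\longrightarrow-2\langle\mathbf{U},\mathbf{\Pi}^*B\rangle_{HS}+\langle\Sigma,B^2(\mathbf{\Pi}^*-\mathbf{\Pi}^\perp)\rangle_{HS}\quad\text{weakly}.$$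
   Context: Let $\|\cdot\|$ be the Euclidean norm on $\mathbb{R}^d$. The random vector $X\in\mathbb{R}^d$ is regularly varying: there is a non-degenerate measure $\mu$ on $\mathbb{R}^d\setminus\{0\}$ such that for all Borel $\mu$-continuity sets $D$ bounded away from $0$, $\lim_{t\to\infty}\mathbb{P}\{X/t\in D\}/\mathbb{P}\{\|X\|>t\}=\mu(D)<\infty$. (Then $\mu$ is homogeneous of order $-\alpha$ for some $\alpha>0$ and $\mu\{\|x\|>1\}=1$.) Let $X_1,\dots,X_n$ be i.i.d. copies of $X$. Scaling: $\omega:\mathbb{R}^d\to(0,\infty)$ is a measurable scaling function that ensures that $\omega(X)X$ is bounded (the most common choice being $\omega(x)=1/\|x\|$ for $x\neq0$). Put $R=\|X\|$, $\Theta=\omega(X)X$, $R_i=\|X_i\|$, $\Theta_i=\omega(X_i)X_i$. $\mathbb{E}_t$ denotes conditional expectation given $R>t$. $\mathbb{E}_\infty$ (and $\mathrm{Cov}_\infty$) denotes expectation (covariance) in the limit model, i.e. with respect to $\mu$ restricted to the complement of the unit ball. Here $k=k_n$ is a sequence with $k\to\infty$ and $k/n\to0$ as $n\to\infty$, and all asymptotics are for $n\to\infty$. $t_{n,k}$ is the $(1-k/n)$-quantile of $R$, and $\hat t_{n,k}$ is the $(k+1)$-th largest order statistic of $R_1,\dots,R_n$. Define $\Sigma_{n,k}=\mathbb{E}_{t_{n,k}}(\Theta\Theta^\top)$ and $\Sigma=\mathbb{E}_\infty(\Theta\Theta^\top)$. $\|A\|_{op}=\sup_{\|x\|=1}\|Ax\|$;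 $\langle A,B\rangle_{HS}=\mathrm{tr}(AB^\top)$; $\mathbf{\Pi}_V$ is the orthogonal projection matrix onto the subspace $V$. $\mathbf{U}=(U_{ij})_{1\le i,j\le d}$ is a symmetric centered Gaussian random matrix with $\mathrm{Cov}(U_{ij},U_{\ell m})=\mathrm{Cov}_\infty(\theta_i\theta_j,\theta_\ell\theta_m)$ for all $1\le i,j,\ell,m\le d$, where $\theta_1,\dots,\theta_d$ are the components of $\Theta$. Risks: for $V$ in the set $\mathcal{V}_p$ of $p$-dimensional subspaces of $\mathbb{R}^d$ ($1\le p\le d-1$), $M_{n,k}(\mathbf{\Pi}_V)=\mathbb{E}_{t_{n,k}}(\Theta^\top\mathbf{\Pi}_V\Theta)=\mathrm{tr}(\Sigma_{n,k}\mathbf{\Pi}_V)$ (for a random subspace this function is evaluated at the random argument), and $\hat M_{n,k}(\mathbf{\Pi}_V)=\frac1k\sum_{i=1}^n\Theta_i^\top\mathbf{\Pi}_V\Theta_i\mathbf{1}_{\{R_i>\hat t_{n,k}\}}$. $\hat V_{n,k}\in\mathcal{V}_p$ maximizes $V\mapsto\hat M_{n,k}(\mathbf{\Pi}_V)$ (under the assumptions of the claim it is unique with probability tending to $1$). Limit model: $\lambda_1\ge\dots\ge\lambda_d$ are the eigenvalues of $\Sigma$ with corresponding orthonormal eigenvectors $v_1,\dots,v_d$. When $\lambda_p>\lambda_{p+1}$, $V^*=\mathrm{span}(v_1,\dots,v_p)$ is the unique maximizer of $V\mapsto\mathbb{E}_\infty(\Theta^\top\mathbf{\Pi}_V\Theta)$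 over $\mathcal{V}_p$; $V^\perp$ denotes its orthogonal complement, $\mathbf{\Pi}^*=\mathbf{\Pi}_{V^*}$, $\mathbf{\Pi}^\perp=\mathbf{\Pi}_{V^\perp}$. Local parametrization: $$\tilde{\mathcal{M}}_S=\{B\in\mathbb{R}^{d\times d}\mid B^\top=-B,\ BV^*\subset V^\perp,\ BV^\perp\subset V^*\},\qquad \hat{\mathbf{\Pi}}_{n,B}=e^{-k^{-1/2}B}\,\mathbf{\Pi}_{\hat V_{n,k}}\,e^{k^{-1/2}B}$$ (matrix exponentials). Weak convergence uniformly over compact sets means weak convergence, with respect to the supremum norm, of the processes indexed by $B\in K$, for every compact $K\subset\tilde{\mathcal{M}}_S$.
   Formalization: Condition (B) is taken uniformly in s∈[1-ε,1+ε], and it is assumed that the law of Θ given R>t converges weakly to the law of ω(x)x under μ restricted to the complement of the unit ball; without either assumption the claim fails. *)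

theory Defs
  imports "HOL-Probability.Probability"
begin

section \<open>Matrices and projections\<close>

definition outer :: "real^'d \<Rightarrow> real^'d^'d" where
  "outer x = (\<chi> i j. x $ i * x $ j)"

definition hs_inner :: "real^'d^'d \<Rightarrow> real^'d^'d \<Rightarrow> real" where
  "hs_inner A B = trace (A ** transpose B)"

text \<open>The product on \<^typ>\<open>real^'d^'d\<close> as a type-class operation is entrywise, so the library's
  \<^const>\<open>exp\<close> is not the matrix exponential.\<close>
definition mat_exp :: "real^'d^'d \<Rightarrow> real^'d^'d" where
  "mat_exp A = (\<Sum>m. (1 / fact m) *\<^sub>R (((**) A ^^ m) (mat 1)))"

definition proj_mat :: "(real^'d) set \<Rightarrow> real^'d^'d" where
  "proj_mat V = (THE P. \<forall>x. P *v x \<in> V \<and> x - P *v x \<in> V\<^sup>\<bottom>)"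

definition subspaces_of_dim :: "nat \<Rightarrow> (real^'d) set set" where
  "subspaces_of_dim p = {V. subspace V \<and> dim V = p}"

definition tangent_mats :: "(real^'d) set \<Rightarrow> (real^'d^'d) set" where
  "tangent_mats V = {B. transpose B = - B \<and> (\<forall>x\<in>V. B *v x \<in> V\<^sup>\<bottom>) \<and> (\<forall>x\<in>V\<^sup>\<bottom>. B *v x \<in> V)}"

text \<open>\<open>e\<^bsup>-cB\<^esup> P e\<^bsup>cB\<^esup>\<close>; below \<open>c = k\<^bsup>-1/2\<^esup>\<close>.\<close>
definition rotated :: "real \<Rightarrow> real^'d^'d \<Rightarrow> real^'d^'d \<Rightarrow> real^'d^'d" where
  "rotated c B P = mat_exp (- (c *\<^sub>R B)) ** P ** mat_exp (c *\<^sub>R B)"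


section \<open>Convergence of random elements of a metric space\<close>

definition random_element :: "'a measure \<Rightarrow> 'm metric \<Rightarrow> ('a \<Rightarrow> 'm) \<Rightarrow> bool" where
  "random_element P m Z \<longleftrightarrow>
     Z \<in> measurable P (sigma (mspace m) {G. openin (mtopology_of m) G})"

text \<open>The underlying probability space may vary with the index.\<close>
definition converges_weakly ::
  "'m metric \<Rightarrow> ('i \<Rightarrow> 'a measure) \<Rightarrow> ('i \<Rightarrow> 'a \<Rightarrow> 'm) \<Rightarrow> 'i filter \<Rightarrow> 'b measure \<Rightarrow> ('b \<Rightarrow> 'm) \<Rightarrow> bool"
where
  "converges_weakly m P Z F Q Y \<longleftrightarrow>
     (\<forall>\<^sub>F i in F. random_element (P i) m (Z i)) \<and> random_element Q m Y \<and>
     (\<forall>H. continuous_map (mtopology_of m) euclideanreal H \<and> bounded (H ` mspace m) \<longrightarrow>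
        ((\<lambda>i. \<integral>\<omega>. H (Z i \<omega>) \<partial>P i) \<longlongrightarrow> (\<integral>\<omega>. H (Y \<omega>) \<partial>Q)) F)"

definition converges_in_prob ::
  "'m metric \<Rightarrow> 'a measure \<Rightarrow> (nat \<Rightarrow> 'a \<Rightarrow> 'm) \<Rightarrow> 'm \<Rightarrow> bool"
where
  "converges_in_prob m P Z y \<longleftrightarrow>
     (\<forall>\<^sub>F n in sequentially. random_element P m (Z n)) \<and> y \<in> mspace m \<and>
     (\<forall>\<delta>>0. (\<lambda>n. measure P {\<omega>\<in>space P. mdist m (Z n \<omega>) y > \<delta>}) \<longlonglongrightarrow> 0)"

text \<open>\<open>C(K)\<close> with the supremum distance. Its elements are functions that are extensional on \<open>K\<close>,
  so processes indexed by \<open>K\<close> are written \<open>\<lambda>B\<in>K. \<dots>\<close> below.\<close>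
definition CK :: "(real^'d^'d) set \<Rightarrow> (real^'d^'d \<Rightarrow> real) metric" where
  "CK K = cfunspace (top_of_set K) euclidean_metric"


section \<open>Gaussian random matrices\<close>

definition covar :: "'b measure \<Rightarrow> ('b \<Rightarrow> real) \<Rightarrow> ('b \<Rightarrow> real) \<Rightarrow> real" where
  "covar N Y Z = (\<integral>\<omega>. (Y \<omega> - (\<integral>\<eta>. Y \<eta> \<partial>N)) * (Z \<omega> - (\<integral>\<eta>. Z \<eta> \<partial>N)) \<partial>N)"

text \<open>Constants count as normal with variance 0: the covariance of a symmetric matrix is singular.\<close>
definition gaussian_var :: "'b measure \<Rightarrow> ('b \<Rightarrow> real) \<Rightarrow> bool" where
  "gaussian_var N Y \<longleftrightarrow>
     (\<exists>m \<sigma>. \<sigma> > 0 \<and> distributed N lborel Y (normal_density m \<sigma>)) \<or> (\<exists>c. AE \<omega> in N. Y \<omega> = c)"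

text \<open>\<open>A \<bullet> U\<close> ranges over all linear combinations of the entries of \<open>U\<close>.\<close>
definition gaussian_matrix :: "'b measure \<Rightarrow> ('b \<Rightarrow> real^'d^'d) \<Rightarrow> bool" where
  "gaussian_matrix N U \<longleftrightarrow> U \<in> borel_measurable N \<and> (\<forall>A. gaussian_var N (\<lambda>\<omega>. A \<bullet> U \<omega>))"


section \<open>Regular variation and the limit model\<close>

text \<open>The limit measure lives on \<open>\<real>\<^sup>d - {0}\<close>. Since \<open>0\<close> is not in the closure of \<open>D\<close>, the frontier
  in \<open>\<real>\<^sup>d\<close> is also the frontier in \<open>\<real>\<^sup>d - {0}\<close>. Non-degenerate means not the zero measure.\<close>
definition regularly_varying :: "'a measure \<Rightarrow> ('a \<Rightarrow> real^'d) \<Rightarrow> (real^'d) measure \<Rightarrow> bool" where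
  "regularly_varying M X \<mu> \<longleftrightarrow>
     X \<in> borel_measurable M \<and>
     sets \<mu> = sets (restrict_space borel (- {0})) \<and> emeasure \<mu> (- {0}) \<noteq> 0 \<and>
     (\<forall>D\<in>sets borel. 0 \<notin> closure D \<and> emeasure \<mu> (frontier D) = 0 \<longrightarrow>
        emeasure \<mu> D < \<infinity> \<and>
        ((\<lambda>t. measure M {\<omega>\<in>space M. X \<omega> /\<^sub>R t \<in> D} / measure M {\<omega>\<in>space M. norm (X \<omega>) > t})
           \<longlongrightarrow> measure \<mu> D) at_top)"

definition scaled :: "(real^'d \<Rightarrow> real) \<Rightarrow> real^'d \<Rightarrow> real^'d" where
  "scaled w x = w x *\<^sub>R x"

text \<open>The conditional probability given \<open>R > t\<close>.\<close>
definition exceed :: "'a measure \<Rightarrow> ('a \<Rightarrow> real^'d) \<Rightarrow> real \<Rightarrow> 'a measure" where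
  "exceed M X t = uniform_measure M {\<omega>\<in>space M. norm (X \<omega>) > t}"

definition limit_model :: "(real^'d) measure \<Rightarrow> (real^'d) measure" where
  "limit_model \<mu> = restrict_space \<mu> {x. norm x > 1}"

text \<open>\<open>E\<^sub>\<infinity>\<close> stands for the expectation in the limit of the conditional models, so \<open>\<mu>\<close> restricted to the
  complement of the unit ball has to describe the limit of the conditional law of \<open>\<Theta>\<close> given
  \<open>R > t\<close>. By the continuous mapping theorem this holds, for instance, if \<open>w\<close> is homogeneous of
  order \<open>-1\<close> and continuous outside the origin (in particular if \<open>w x = 1 / norm x\<close> there), but not for
  every \<open>w\<close> for which \<open>w(X) X\<close> is bounded: for \<open>w x = 1 / (1 + norm x)\<close> the conditional law of
  \<open>\<Theta>\<close> concentrates on the unit sphere as \<open>t\<close> grows, while \<open>norm (scaled w x) < 1\<close> for all \<open>x\<close>.\<close>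
definition has_limit_model ::
  "'a measure \<Rightarrow> ('a \<Rightarrow> real^'d) \<Rightarrow> (real^'d) measure \<Rightarrow> (real^'d \<Rightarrow> real) \<Rightarrow> bool" where
  "has_limit_model M X \<mu> w \<longleftrightarrow>
     converges_weakly euclidean_metric (exceed M X) (\<lambda>_ \<omega>. scaled w (X \<omega>)) at_top
       (limit_model \<mu>) (scaled w)"

definition Sigma_at :: "'a measure \<Rightarrow> ('a \<Rightarrow> real^'d) \<Rightarrow> (real^'d \<Rightarrow> real) \<Rightarrow> real \<Rightarrow> real^'d^'d" where
  "Sigma_at M X w t = (\<integral>\<omega>. outer (scaled w (X \<omega>)) \<partial>exceed M X t)"

definition Sigma_lim :: "(real^'d) measure \<Rightarrow> (real^'d \<Rightarrow> real) \<Rightarrow> real^'d^'d" where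
  "Sigma_lim \<mu> w = (\<integral>x. outer (scaled w x) \<partial>limit_model \<mu>)"


section \<open>Thresholds and risks\<close>

definition quantile :: "'a measure \<Rightarrow> ('a \<Rightarrow> real) \<Rightarrow> real \<Rightarrow> real" where
  "quantile M R q = Inf {x. measure M {\<omega>\<in>space M. R \<omega> \<le> x} \<ge> q}"

definition thresh :: "'a measure \<Rightarrow> ('a \<Rightarrow> real^'d) \<Rightarrow> nat \<Rightarrow> nat \<Rightarrow> real" where
  "thresh M X n k = quantile M (\<lambda>\<omega>. norm (X \<omega>)) (1 - real k / real n)"

text \<open>In the empirical quantities, the sample of size \<open>n\<close> is \<open>x 0, \<dots>, x (n - 1)\<close>. List positions
  start at 0, so position \<open>k\<close> of the decreasing list is the \<open>(k+1)\<close>-th largest norm (\<open>k < n\<close>).\<close>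
definition emp_thresh :: "nat \<Rightarrow> nat \<Rightarrow> (nat \<Rightarrow> real^'d) \<Rightarrow> real" where
  "emp_thresh n k x = rev (sort (map (\<lambda>i. norm (x i)) [0..<n])) ! k"

definition risk ::
  "'a measure \<Rightarrow> ('a \<Rightarrow> real^'d) \<Rightarrow> (real^'d \<Rightarrow> real) \<Rightarrow> nat \<Rightarrow> nat \<Rightarrow> real^'d^'d \<Rightarrow> real" where
  "risk M X w n k P =
     (\<integral>\<omega>. scaled w (X \<omega>) \<bullet> (P *v scaled w (X \<omega>)) \<partial>exceed M X (thresh M X n k))"

definition emp_risk ::
  "(real^'d \<Rightarrow> real) \<Rightarrow> nat \<Rightarrow> nat \<Rightarrow> (nat \<Rightarrow> real^'d) \<Rightarrow> real^'d^'d \<Rightarrow> real" where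
  "emp_risk w n k x P = 1 / real k *
     (\<Sum>i<n. (scaled w (x i) \<bullet> (P *v scaled w (x i))) * of_bool (norm (x i) > emp_thresh n k x))"

definition emp_maximizer ::
  "(real^'d \<Rightarrow> real) \<Rightarrow> nat \<Rightarrow> nat \<Rightarrow> nat \<Rightarrow> (nat \<Rightarrow> real^'d) \<Rightarrow> (real^'d) set \<Rightarrow> bool" where
  "emp_maximizer w p n k x V \<longleftrightarrow> V \<in> subspaces_of_dim p \<and>
     (\<forall>W\<in>subspaces_of_dim p. emp_risk w n k x (proj_mat W) \<le> emp_risk w n k x (proj_mat V))"

text \<open>Condition (B), with \<open>o(k\<^bsup>-1/2\<^esup>)\<close> uniform in \<open>s \<in> [1-\<epsilon>, 1+\<epsilon>]\<close>: the condition
  is needed for the random ratio of \<^const>\<open>emp_thresh\<close> and \<^const>\<open>thresh\<close> in the role of \<open>s\<close>, and a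
  rate that holds only for each fixed \<open>s\<close> does not control it for irregular sequences \<open>k\<close>.\<close>
definition condition_B ::
  "'a measure \<Rightarrow> ('a \<Rightarrow> real^'d) \<Rightarrow> (real^'d \<Rightarrow> real) \<Rightarrow> (nat \<Rightarrow> nat) \<Rightarrow> bool" where
  "condition_B M X w k \<longleftrightarrow> (\<exists>\<epsilon>>0.
     uniform_limit {1-\<epsilon>..1+\<epsilon>}
       (\<lambda>n s. sqrt (real (k n)) *
          onorm ((*v) (Sigma_at M X w (s * thresh M X n (k n)) - Sigma_at M X w (thresh M X n (k n)))))
       (\<lambda>_. 0) sequentially)"

end

theory Submission
  imports Defs
begin

text \<open>Write \<open>S\<close> for the empirical second moment matrix, \<open>P\<close> for the projection onto the empirical
  maximizer, \<open>N \<le> k\<close> for the number of exceedances (smaller than \<open>k\<close> in case of ties) and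
  \<open>\<Sigma>\<^sub>n\<close> for the second moment matrix given \<open>R > t\<^sub>n\<close>. Optimality makes \<open>P\<close> commute with \<open>S\<close>,
  so the first order term of \<open>S \<bullet> e\<^bsup>-cB\<^esup> P e\<^bsup>cB\<^esup>\<close> in \<open>c = k\<^bsup>-1/2\<^esup>\<close> vanishes, and the spectral gap gives
  \<open>norm (P - P*) \<le> (2 / gap) norm (S - \<Sigma>)\<close>. For the true risk the first order term is
  \<open>\<surd>k \<Sigma>\<^sub>n \<bullet> [P, B] = - (k / N) G \<bullet> [P, B]\<close> with \<open>G = \<surd>k (S - (N / k) \<Sigma>\<^sub>n)\<close>; so no perturbation
  theory is needed beyond a central limit theorem for \<open>G\<close>.

  Given that \<open>X\<^sub>i\<close> exceeds the empirical threshold, the latter is a function of the other observations.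
  Hence the summands centered at the conditional mean given the random threshold are uncorrelated, and
  replacing the random by the deterministic threshold costs \<open>o(\<surd>k)\<close> in mean square; condition (B)
  takes care of the centering. What remains is a triangular array of independent summands.\<close>


section \<open>Matrices and projections\<close>

text \<open>Centering \<open>S\<close> at \<open>(N / k) \<Sigma>\<^sub>n\<close> instead of
  \<open>\<Sigma>\<^sub>n\<close> absorbs ties: regular variation makes \<open>N / k\<close> tend to
  1 in probability, but without a rate, so \<open>\<surd>k (S - \<Sigma>\<^sub>n)\<close> need not
  be bounded in probability. The factor \<open>N / k\<close> can be divided out again because
  \<open>S\<close> itself pairs to zero with \<open>[P, B]\<close>. Uniformity over compact sets
  costs no argument in function spaces. Up to an error that is small uniformly in \<open>B\<close>,
  the process of true risks is a fixed continuous map into \<open>CK K\<close> applied to the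
  finite-dimensional matrix \<open>G\<close>, and the process of empirical risks is constant. Since
  \<open>G\<close> is bounded in probability, \<open>P\<close> may be replaced by the limit
  projection in \<open>G \<bullet> [P, B]\<close>; symmetry of \<open>G\<close> then doubles one
  half of the commutator, whence the coefficient -2. The law of the norm enters through two
  inequalities for the ratio of the tails at \<open>s * t\<close> and \<open>t\<close>: for each
  \<open>s > 1\<close> it stays below some number less than 1, which ties the empirical threshold to
  the quantile, and for \<open>s\<close> near 1 it is close to 1, which limits the effect of
  ties.\<close>

lemma bounded_bilinear_matrix_mult:
  "bounded_bilinear ((**) :: real^'n^'m \<Rightarrow> real^'p^'n \<Rightarrow> real^'p^'m)"
  unfolding bilinear_conv_bounded_bilinear[symmetric] bilinear_def
  by (auto intro!: linearI
      simp: vec_eq_iff matrix_matrix_mult_def sum.distrib algebra_simps sum_distrib_left)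

interpretation matmul: bounded_bilinear "(**) :: real^'n^'m \<Rightarrow> real^'p^'n \<Rightarrow> real^'p^'m"
  by (rule bounded_bilinear_matrix_mult)

lemma inner_matrix_sum: "A \<bullet> B = (\<Sum>i\<in>UNIV. \<Sum>j\<in>UNIV. A $ i $ j * B $ i $ j)"
  for A B :: "real^'n^'m"
  by (simp add: inner_vec_def)

text \<open>Makes Cauchy-Schwarz and the continuity of \<open>\<bullet>\<close> available for the
  Hilbert-Schmidt product.\<close>

lemma hs_inner_eq_inner: "hs_inner A B = A \<bullet> B"
  by (simp add: hs_inner_def trace_def matrix_matrix_mult_def transpose_def inner_matrix_sum)

lemma inner_transpose: "transpose A \<bullet> transpose B = A \<bullet> B" for A B :: "real^'n^'m"
  unfolding inner_matrix_sum transpose_def by (subst sum.swap) simp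

lemma inner_matrix_mult_left: "(A ** B) \<bullet> C = B \<bullet> (transpose A ** C)"
  for A :: "real^'n^'m" and B :: "real^'p^'n" and C :: "real^'p^'m"
proof -
  have "(A ** B) \<bullet> C = (\<Sum>i\<in>UNIV. \<Sum>j\<in>UNIV. \<Sum>l\<in>UNIV. A $ i $ l * B $ l $ j * C $ i $ j)"
    by (simp add: inner_matrix_sum matrix_matrix_mult_def sum_distrib_right)
  also have "\<dots> = (\<Sum>i\<in>UNIV. \<Sum>l\<in>UNIV. \<Sum>j\<in>UNIV. A $ i $ l * B $ l $ j * C $ i $ j)"
    by (rule sum.cong[OF refl]) (rule sum.swap)
  also have "\<dots> = (\<Sum>l\<in>UNIV. \<Sum>i\<in>UNIV. \<Sum>j\<in>UNIV. A $ i $ l * B $ l $ j * C $ i $ j)"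
    by (rule sum.swap)
  also have "\<dots> = (\<Sum>l\<in>UNIV. \<Sum>j\<in>UNIV. \<Sum>i\<in>UNIV. A $ i $ l * B $ l $ j * C $ i $ j)"
    by (rule sum.cong[OF refl]) (rule sum.swap)
  also have "\<dots> = B \<bullet> (transpose A ** C)"
    by (simp add: inner_matrix_sum matrix_matrix_mult_def transpose_def sum_distrib_left mult_ac)
  finally show ?thesis .
qed

lemma inner_matrix_mult_right: "(A ** B) \<bullet> C = A \<bullet> (C ** transpose B)"
  for A :: "real^'n^'m" and B :: "real^'p^'n" and C :: "real^'p^'m"
proof -
  have "(A ** B) \<bullet> C = (transpose B ** transpose A) \<bullet> transpose C"
    by (metis inner_transpose matrix_transpose_mul)
  also have "\<dots> = transpose A \<bullet> (B ** transpose C)"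
    by (simp add: inner_matrix_mult_left)
  also have "\<dots> = A \<bullet> (C ** transpose B)"
    by (metis inner_transpose matrix_transpose_mul transpose_transpose)
  finally show ?thesis .
qed

text \<open>A quadratic form is a linear functional of the rank-one matrix, so both risks are
  pairings of a second moment matrix with the projection.\<close>

lemma inner_outer: "outer x \<bullet> A = x \<bullet> (A *v x)"
  by (simp add: inner_matrix_sum outer_def matrix_vector_mult_def inner_vec_def sum_distrib_left mult_ac)

lemma outer_inner_outer: "outer x \<bullet> outer y = (x \<bullet> y)\<^sup>2"
  by (simp add: inner_matrix_sum outer_def inner_vec_def power2_eq_square sum_product mult_ac)

lemma norm_outer: "norm (outer x) = (norm x)\<^sup>2"
proof -
  have "(norm (outer x))\<^sup>2 = ((norm x)\<^sup>2)\<^sup>2"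
    by (metis outer_inner_outer power2_norm_eq_inner)
  then show ?thesis by (subst (asm) power2_eq_iff_nonneg) auto
qed

lemma transpose_outer [simp]: "transpose (outer x) = outer x"
  by (simp add: transpose_def outer_def vec_eq_iff mult.commute)

lemma outer_mult_vec: "outer x *v y = (x \<bullet> y) *\<^sub>R x"
  by (auto simp: vec_eq_iff outer_def matrix_vector_mult_def inner_vec_def sum_distrib_right
      sum_distrib_left mult_ac intro!: sum.cong)

lemma continuous_on_outer: "continuous_on S outer"
  unfolding outer_def by (intro continuous_intros)

lemma matrix_vector_mult_sum_left: "(\<Sum>i\<in>I. A i) *v x = (\<Sum>i\<in>I. A i *v x)" for A :: "'i \<Rightarrow> real^'n^'m"
  by (induction I rule: infinite_finite_induct) (auto simp: matrix_vector_mult_add_rdistrib)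

lemma transpose_sum: "transpose (\<Sum>i\<in>I. A i) = (\<Sum>i\<in>I. transpose (A i))" for A :: "'i \<Rightarrow> real^'n^'m"
  by (auto simp: transpose_def vec_eq_iff)

lemma transpose_add: "transpose (A + B) = transpose A + transpose B" for A :: "real^'n^'m"
  by (auto simp: transpose_def vec_eq_iff)

lemma transpose_diff: "transpose (A - B) = transpose A - transpose B" for A :: "real^'n^'m"
  by (auto simp: transpose_def vec_eq_iff)

lemma transpose_scaleR: "transpose (c *\<^sub>R A) = c *\<^sub>R transpose A" for A :: "real^'n^'m"
  by (auto simp: transpose_def vec_eq_iff)

section \<open>Orthogonal projection matrices\<close>

text \<open>Two candidates differ at each point by a vector that lies both in \<open>V\<close> and
  in its orthogonal complement. This resolves the definite description in
  \<open>proj_mat\<close>.\<close>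

lemma proj_mat_eqI:
  fixes V :: "(real^'d) set"
  assumes V: "subspace V" and P: "\<And>x. P *v x \<in> V" "\<And>x. x - P *v x \<in> V\<^sup>\<bottom>"
  shows "proj_mat V = P"
  unfolding proj_mat_def
proof (rule the_equality)
  show "\<forall>x. P *v x \<in> V \<and> x - P *v x \<in> V\<^sup>\<bottom>" using P by blast
  fix Q assume Q: "\<forall>x. Q *v x \<in> V \<and> x - Q *v x \<in> V\<^sup>\<bottom>"
  have "Q *v x = P *v x" for x
  proof -
    have 1: "Q *v x - P *v x \<in> V" using Q P V by (simp add: subspace_diff)
    have "(x - P *v x) - (x - Q *v x) \<in> V\<^sup>\<bottom>"
      using Q P subspace_orthogonal_comp[of V] by (meson subspace_diff)
    then have "Q *v x - P *v x \<in> V\<^sup>\<bottom>" by simp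
    with 1 have "orthogonal (Q *v x - P *v x) (Q *v x - P *v x)"
      by (auto simp: orthogonal_comp_def)
    then show ?thesis by (simp add: orthogonal_self)
  qed
  then show "Q = P" by (simp add: matrix_eq)
qed

lemma proj_mat_orthonormal_basis:
  fixes V :: "(real^'d) set"
  assumes B: "finite B" "pairwise orthogonal B" "\<And>b. b \<in> B \<Longrightarrow> norm b = 1" "span B = V"
  shows "proj_mat V = (\<Sum>b\<in>B. outer b)"
proof (rule proj_mat_eqI)
  show "subspace V" using B(4) by (metis subspace_span)
  show "(\<Sum>b\<in>B. outer b) *v x \<in> V" for x
    unfolding matrix_vector_mult_sum_left outer_mult_vec B(4)[symmetric]
    by (intro span_sum span_mul span_base)
  show "x - (\<Sum>b\<in>B. outer b) *v x \<in> V\<^sup>\<bottom>" for x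
  proof -
    have *: "orthogonal (x - (\<Sum>b\<in>B. outer b) *v x) c" if c: "c \<in> B" for c
    proof -
      have "(\<Sum>b\<in>B. (b \<bullet> x) *\<^sub>R b) \<bullet> c = (\<Sum>b\<in>B. if b = c then c \<bullet> x else 0)"
        unfolding inner_sum_left
      proof (intro sum.cong refl)
        fix b assume "b \<in> B"
        then show "(b \<bullet> x) *\<^sub>R b \<bullet> c = (if b = c then c \<bullet> x else 0)"
          using B(2) B(3)[of b] c
          by (auto simp: pairwise_def orthogonal_def norm_eq_1)
      qed
      also have "\<dots> = c \<bullet> x" using B(1) c by simp
      finally show ?thesis
        by (simp add: orthogonal_def matrix_vector_mult_sum_left outer_mult_vec inner_diff_left
            inner_commute[of x])
    qed
    have "orthogonal (x - (\<Sum>b\<in>B. outer b) *v x) c" if "c \<in> span B" for c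
      using that * by (meson orthogonal_to_span)
    then show ?thesis using B(4)
      by (auto simp: orthogonal_comp_def orthogonal_commute)
  qed
qed

lemma subspace_orthonormal_basis:
  fixes V :: "(real^'d) set"
  assumes "subspace V"
  obtains B where "finite B" "pairwise orthogonal B" "\<And>b. b \<in> B \<Longrightarrow> norm b = 1"
    "span B = V" "card B = dim V" "proj_mat V = (\<Sum>b\<in>B. outer b)"
proof -
  obtain B where B: "B \<subseteq> V" "pairwise orthogonal B" "\<And>x. x \<in> B \<Longrightarrow> norm x = 1"
    "independent B" "card B = dim V" "span B = V"
    using orthonormal_basis_subspace[OF assms] by metis
  have "finite B" using B(4) by (simp add: independent_imp_finite)
  then show ?thesis using that B proj_mat_orthonormal_basis by blast
qed

text \<open>All four facts are read off an expansion over an orthonormal basis. By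
  \<open>outer_inner_outer\<close> the matrices \<open>outer b\<close> are themselves orthonormal,
  which gives the last fact; it makes the norm of every competing projection equal to the square
  root of \<open>p\<close>.\<close>

lemma proj_mat:
  fixes V :: "(real^'d) set"
  assumes "subspace V"
  shows proj_mat_in: "proj_mat V *v x \<in> V"
    and proj_mat_diff_in: "x - proj_mat V *v x \<in> V\<^sup>\<bottom>"
    and transpose_proj_mat: "transpose (proj_mat V) = proj_mat V"
    and norm_proj_mat_sq: "proj_mat V \<bullet> proj_mat V = real (dim V)"
proof -
  obtain B where B: "finite B" "pairwise orthogonal B" "\<And>b. b \<in> B \<Longrightarrow> norm b = 1"
    "span B = V" "card B = dim V" "proj_mat V = (\<Sum>b\<in>B. outer b)"
    using subspace_orthonormal_basis[OF assms] by metis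
  have dec: "\<exists>y\<in>V. x - y \<in> V\<^sup>\<bottom>" for x
  proof -
    have "x \<in> V + V\<^sup>\<bottom>" using subspace_sum_orthogonal_comp[OF assms] by simp
    then obtain a b where "a \<in> V" "b \<in> V\<^sup>\<bottom>" "x = a + b" by (auto elim!: set_plus_elim)
    then show ?thesis by (intro bexI[of _ a]) auto
  qed
  have "proj_mat V *v x \<in> V \<and> x - proj_mat V *v x \<in> V\<^sup>\<bottom>" for x
  proof -
    have "(\<Sum>b\<in>B. (b \<bullet> x) *\<^sub>R b) \<in> span B"
      by (intro span_sum span_mul span_base)
    then have 1: "proj_mat V *v x \<in> V"
      by (simp add: B(4,6) matrix_vector_mult_sum_left outer_mult_vec)
    obtain y where y: "y \<in> V" "x - y \<in> V\<^sup>\<bottom>" using dec by blast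
    have "proj_mat V *v x = proj_mat V *v y + proj_mat V *v (x - y)"
      by (simp add: matrix_vector_mult_diff_distrib)
    also have "proj_mat V *v (x - y) = 0"
      unfolding B(6) matrix_vector_mult_sum_left outer_mult_vec
    proof (rule sum.neutral, rule ballI)
      fix b assume "b \<in> B"
      then have "b \<in> V" using B(4) span_base by blast
      then show "(b \<bullet> (x - y)) *\<^sub>R b = 0"
        using y(2) by (auto simp: orthogonal_comp_def orthogonal_def)
    qed
    also have "proj_mat V *v y = y"
      unfolding B(6) matrix_vector_mult_sum_left outer_mult_vec
      using orthonormal_basis_expand[OF B(2) B(3) _ B(1), of y] y B(4)
      by (simp add: inner_commute)
    finally show ?thesis using 1 y by simp
  qed
  then show "proj_mat V *v x \<in> V" "x - proj_mat V *v x \<in> V\<^sup>\<bottom>" by auto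
  show "transpose (proj_mat V) = proj_mat V" by (simp add: B(6) transpose_sum)
  have "proj_mat V \<bullet> proj_mat V = (\<Sum>b\<in>B. \<Sum>c\<in>B. (b \<bullet> c)\<^sup>2)"
    by (simp add: B(6) inner_sum_left inner_sum_right outer_inner_outer) (rule sum.swap)
  also have "\<dots> = (\<Sum>b\<in>B. \<Sum>c\<in>B. if c = b then 1 else 0)"
    using B(2,3) by (intro sum.cong refl) (auto simp: pairwise_def orthogonal_def norm_eq_1)
  also have "\<dots> = real (dim V)" using B(1,5) by simp
  finally show "proj_mat V \<bullet> proj_mat V = real (dim V)" .
qed

lemma proj_mat_fixes: "subspace V \<Longrightarrow> x \<in> V \<Longrightarrow> proj_mat V *v x = x" for V :: "(real^'d) set"
proof -
  assume V: "subspace V" and x: "x \<in> V"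
  then have "x - proj_mat V *v x \<in> V" by (simp add: proj_mat_in subspace_diff)
  moreover have "x - proj_mat V *v x \<in> V\<^sup>\<bottom>" by (simp add: V proj_mat_diff_in)
  ultimately have "orthogonal (x - proj_mat V *v x) (x - proj_mat V *v x)"
    by (auto simp: orthogonal_comp_def)
  then show ?thesis by (simp add: orthogonal_self)
qed

lemma proj_mat_kills: "subspace V \<Longrightarrow> x \<in> V\<^sup>\<bottom> \<Longrightarrow> proj_mat V *v x = 0" for V :: "(real^'d) set"
proof -
  assume V: "subspace V" and x: "x \<in> V\<^sup>\<bottom>"
  have "x - (x - proj_mat V *v x) \<in> V\<^sup>\<bottom>"
    using x V subspace_orthogonal_comp proj_mat_diff_in by (metis subspace_diff)
  then have "proj_mat V *v x \<in> V\<^sup>\<bottom>" by simp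
  moreover have "proj_mat V *v x \<in> V" by (simp add: V proj_mat_in)
  ultimately have "orthogonal (proj_mat V *v x) (proj_mat V *v x)"
    by (auto simp: orthogonal_comp_def)
  then show ?thesis by (simp add: orthogonal_self)
qed

lemma proj_mat_inner_commute: "subspace V \<Longrightarrow> (proj_mat V *v x) \<bullet> y = x \<bullet> (proj_mat V *v y)"
  for V :: "(real^'d) set"
  by (metis dot_lmul_matrix inner_commute transpose_matrix_vector transpose_proj_mat)

lemma proj_mat_idem: "subspace V \<Longrightarrow> proj_mat V ** proj_mat V = proj_mat V" for V :: "(real^'d) set"
  by (simp add: matrix_eq matrix_vector_mul_assoc[symmetric] proj_mat_fixes proj_mat_in)

lemma proj_mat_orthogonal_comp: "subspace V \<Longrightarrow> proj_mat (V\<^sup>\<bottom>) = mat 1 - proj_mat V"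
  for V :: "(real^'d) set"
  by (rule proj_mat_eqI)
    (auto simp: subspace_orthogonal_comp matrix_vector_mult_diff_rdistrib proj_mat_diff_in
       orthogonal_comp_self proj_mat_in)

text \<open>First order condition: compare \<open>V\<close> with its reflections along \<open>x + t y\<close>.\<close>
lemma maximizer_orthogonality:
  fixes S :: "real^'d^'d" and V :: "(real^'d) set"
  assumes V: "V \<in> subspaces_of_dim p" and S: "transpose S = S"
    and max: "\<And>W. W \<in> subspaces_of_dim p \<Longrightarrow> S \<bullet> proj_mat W \<le> S \<bullet> proj_mat V"
    and x: "x \<in> V" and y: "y \<in> V\<^sup>\<bottom>"
  shows "x \<bullet> (S *v y) = 0"
proof -
  have subV: "subspace V" and dimV: "dim V = p" using V by (auto simp: subspaces_of_dim_def)
  have orth: "x \<bullet> y = 0" using x y by (auto simp: orthogonal_comp_def orthogonal_def)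
  have sym: "a \<bullet> (S *v b) = b \<bullet> (S *v a)" for a b
    by (metis S dot_lmul_matrix inner_commute transpose_matrix_vector)
  define P where "P = proj_mat V"
  define a where "a = x \<bullet> (S *v x)"
  define b where "b = x \<bullet> (S *v y)"
  define c where "c = y \<bullet> (S *v y)"
  define N where "N = x \<bullet> x"
  show ?thesis
  proof (cases "x = 0 \<or> y = 0")
    case True then show ?thesis by auto
  next
    case False
    then have Npos: "N > 0" by (auto simp: N_def)
    define m where "m = y \<bullet> y"
    \<comment> \<open>Up to the factor \<open>s\<^sup>2 / 4\<close>, the left-hand side is the
      change of the objective when \<open>V\<close> is replaced by its reflection.\<close>
    have key: "t * N * b + t\<^sup>2 * (c * N - a * m) - t ^ 3 * b * m \<le> 0" for t
    proof -
      define u where "u = x + t *\<^sub>R y"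
      define s where "s = u \<bullet> u"
      have s_eq: "s = N + t\<^sup>2 * m"
        by (simp add: s_def u_def N_def m_def inner_add_left inner_add_right orth inner_commute[of y x]
            power2_eq_square)
      have m0: "m \<ge> 0" by (simp add: m_def)
      have spos: "s > 0" using Npos m0 by (simp add: s_eq add_pos_nonneg)
      \<comment> \<open>Householder reflection in the hyperplane orthogonal to \<open>u\<close>. It
        is a self-adjoint involution, so it preserves dimensions and conjugates the projection onto
        \<open>V\<close> into the one onto the image of \<open>V\<close>. At \<open>t = 0\<close> it
        maps \<open>V\<close> to itself.\<close>
      define f where "f z = z - (2 * (u \<bullet> z) / s) *\<^sub>R u" for z
      have linf: "linear f" unfolding f_def
        by (rule linearI) (auto simp: algebra_simps inner_add_right add_divide_distrib)
      have ff: "f (f z) = z" for z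
      proof -
        have "u \<bullet> f z = - (u \<bullet> z)" using spos by (simp add: f_def inner_diff_right s_def)
        then show ?thesis unfolding f_def[of "f z"] by (simp add: f_def)
      qed
      have fsa: "f z \<bullet> z' = z \<bullet> f z'" for z z'
        by (simp add: f_def inner_diff_left inner_diff_right inner_commute)
      have injf: "inj f" using ff by (metis injI)
      have W: "f ` V \<in> subspaces_of_dim p"
        using subV dimV linf injf
        by (auto simp: subspaces_of_dim_def linear_subspace_image dim_image_eq inj_on_subset[OF _ subset_UNIV])
      have Pu: "P *v u = x"
        by (simp add: u_def P_def matrix_vector_right_distrib proj_mat_fixes[OF subV x]
            proj_mat_kills[OF subV y] matrix_vector_mult_scaleR)
      have uP: "u \<bullet> (P *v z) = x \<bullet> z" for z
        using Pu proj_mat_inner_commute[OF subV] by (metis P_def)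
      have ux: "u \<bullet> x = N" by (simp add: u_def N_def inner_add_left orth inner_commute[of y x])
      have projW: "proj_mat (f ` V) = matrix (\<lambda>z. f (P *v (f z)))"
      proof (rule proj_mat_eqI)
        show "subspace (f ` V)" using subV linf by (simp add: linear_subspace_image)
        have lin: "linear (\<lambda>z. f (P *v (f z)))"
          using linf linear_compose[OF linf linear_compose[OF _ linf, of "\<lambda>z. P *v z"]]
          by (simp add: o_def)
        fix z
        show "matrix (\<lambda>z. f (P *v f z)) *v z \<in> f ` V"
          using lin by (simp add: matrix_works P_def proj_mat_in subV)
        have "z - f (P *v f z) = f (f z - P *v f z)"
          by (simp add: linear_diff[OF linf] ff)
        moreover have "f q \<in> (f ` V)\<^sup>\<bottom>" if "q \<in> V\<^sup>\<bottom>" for q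
          using that by (auto simp: orthogonal_comp_def orthogonal_def fsa ff)
        ultimately show "z - matrix (\<lambda>z. f (P *v f z)) *v z \<in> (f ` V)\<^sup>\<bottom>"
          using lin by (simp add: matrix_works P_def proj_mat_diff_in subV)
      qed
      have exp: "f (P *v f z) = P *v z - (2 * (u \<bullet> z) / s) *\<^sub>R x - (2 * (x \<bullet> z) / s) *\<^sub>R u
          + (4 * N * (u \<bullet> z) / s\<^sup>2) *\<^sub>R u" for z
      proof -
        have 1: "P *v f z = P *v z - (2 * (u \<bullet> z) / s) *\<^sub>R x"
          by (simp add: f_def matrix_vector_mult_diff_distrib matrix_vector_mult_scaleR Pu)
        have 2: "u \<bullet> (P *v f z) = x \<bullet> z - 2 * (u \<bullet> z) / s * N"
          by (simp add: 1 inner_diff_right uP ux)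
        show ?thesis unfolding f_def[of "P *v f z"] 2 unfolding 1
          by (simp add: algebra_simps diff_divide_distrib power2_eq_square)
      qed
      define o2 where "o2 = (\<lambda>p q. (\<chi> i j. p $ i * q $ j) :: real^'d^'d)"
      have o2v: "o2 p q *v z = (q \<bullet> z) *\<^sub>R p" for p q z
        by (auto simp: vec_eq_iff o2_def matrix_vector_mult_def inner_vec_def sum_distrib_right
           sum_distrib_left mult_ac intro!: sum.cong)
      have o2i: "S \<bullet> o2 p q = p \<bullet> (S *v q)" for p q
        by (simp add: inner_matrix_sum o2_def matrix_vector_mult_def inner_vec_def sum_distrib_left mult_ac)
      have "proj_mat (f ` V) = P - (2 / s) *\<^sub>R o2 x u - (2 / s) *\<^sub>R o2 u x + (4 * N / s\<^sup>2) *\<^sub>R o2 u u"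
      proof -
        have lin: "linear (\<lambda>z. f (P *v (f z)))"
          using linf linear_compose[OF linf linear_compose[OF _ linf, of "\<lambda>z. P *v z"]]
          by (simp add: o_def)
        show ?thesis unfolding projW matrix_eq
          using lin by (auto simp: matrix_works exp matrix_vector_mult_diff_rdistrib
              matrix_vector_mult_add_rdistrib scaleR_matrix_vector_assoc[symmetric] o2v)
      qed
      then have "S \<bullet> proj_mat (f ` V) - S \<bullet> P =
          - (4 / s) * (u \<bullet> (S *v x)) + (4 * N / s\<^sup>2) * (u \<bullet> (S *v u))"
        by (simp add: inner_diff_right inner_add_right o2i sym[of x u])
      also have "u \<bullet> (S *v x) = a + t * b"
        by (simp add: u_def inner_add_left a_def b_def sym[of y x])
      also have "u \<bullet> (S *v u) = a + 2 * t * b + t\<^sup>2 * c"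
        by (simp add: u_def inner_add_left inner_add_right matrix_vector_right_distrib
            matrix_vector_mult_scaleR a_def b_def c_def sym[of y x] power2_eq_square algebra_simps)
      finally have "- (4 / s) * (a + t * b) + (4 * N / s\<^sup>2) * (a + 2 * t * b + t\<^sup>2 * c) \<le> 0"
        using max[OF W] by (simp add: P_def)
      then have "(s\<^sup>2 / 4) * (- (4 / s) * (a + t * b) + (4 * N / s\<^sup>2) * (a + 2 * t * b + t\<^sup>2 * c)) \<le> 0"
        using spos by (simp add: mult_nonneg_nonpos)
      also have "(s\<^sup>2 / 4) * (- (4 / s) * (a + t * b) + (4 * N / s\<^sup>2) * (a + 2 * t * b + t\<^sup>2 * c))
         = - s * (a + t * b) + N * (a + 2 * t * b + t\<^sup>2 * c)"
        using spos by (simp add: field_simps power2_eq_square)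
      also have "\<dots> = t * N * b + t\<^sup>2 * (c * N - a * m) - t ^ 3 * b * m"
        by (simp add: s_eq algebra_simps power2_eq_square power3_eq_cube)
      finally show ?thesis .
    qed
    \<comment> \<open>\<open>g\<close> vanishes at 0 and is nowhere positive, so its linear
      coefficient \<open>N * b\<close> must vanish.\<close>
    define g where "g t = t * N * b + t\<^sup>2 * (c * N - a * m) - t ^ 3 * b * m" for t
    have "(g has_real_derivative N * b) (at 0)"
      unfolding g_def by (auto intro!: derivative_eq_intros)
    moreover have "g t \<le> g 0" for t using key[of t] by (simp add: g_def)
    ultimately have "N * b = 0"
      by (intro DERIV_local_max[where d = 1]) auto
    then show ?thesis using Npos by (simp add: b_def)
  qed
qed

text \<open>The first order condition kills the off-diagonal blocks of \<open>S\<close> with respect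
  to \<open>V\<close> and its complement; a block diagonal matrix commutes with the
  projection.\<close>

lemma maximizer_commutes:
  fixes S :: "real^'d^'d" and V :: "(real^'d) set"
  assumes V: "V \<in> subspaces_of_dim p" and S: "transpose S = S"
    and max: "\<And>W. W \<in> subspaces_of_dim p \<Longrightarrow> S \<bullet> proj_mat W \<le> S \<bullet> proj_mat V"
  shows "S ** proj_mat V = proj_mat V ** S"
proof -
  have subV: "subspace V" using V by (auto simp: subspaces_of_dim_def)
  let ?P = "proj_mat V"
  have "x \<bullet> (S *v (?P *v y)) = x \<bullet> (?P *v (S *v y))" for x y
  proof -
    have 0: "p \<bullet> (S *v q) = 0" "q \<bullet> (S *v p) = 0" if "p \<in> V" "q \<in> V\<^sup>\<bottom>" for p q
    proof -
      show "p \<bullet> (S *v q) = 0" by (rule maximizer_orthogonality[OF V S max that])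
      then show "q \<bullet> (S *v p) = 0"
        by (metis S dot_lmul_matrix inner_commute transpose_matrix_vector)
    qed
    have "(x - ?P *v x) \<bullet> (S *v (?P *v y)) = 0" "(?P *v x) \<bullet> (S *v (y - ?P *v y)) = 0"
      using 0 proj_mat_in[OF subV] proj_mat_diff_in[OF subV] by auto
    then have "x \<bullet> (S *v (?P *v y)) = (?P *v x) \<bullet> (S *v (?P *v y))"
      "(?P *v x) \<bullet> (S *v y) = (?P *v x) \<bullet> (S *v (?P *v y))"
      by (auto simp: inner_diff_left inner_diff_right matrix_vector_mult_diff_distrib)
    then show ?thesis using proj_mat_inner_commute[OF subV] by metis
  qed
  then have "S *v (?P *v y) = ?P *v (S *v y)" for y
    using vector_eq_ldot by blast
  then show ?thesis by (simp add: matrix_eq matrix_vector_mul_assoc[symmetric])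
qed

section \<open>Spectral gap and stability of the maximizer\<close>

text \<open>In the eigenbasis the deficit of \<open>V\<close> is a transport cost. The weights
  \<open>a i\<close>, squared lengths of the projections of \<open>v i\<close> onto
  \<open>V\<close>, lie between 0 and 1 and sum to \<open>p\<close>; every unit of weight missing on
  the first \<open>p\<close> indices sits on an index beyond \<open>p\<close>, at a loss of at least
  the gap.\<close>

lemma eigenspace_gap:
  fixes S :: "real^'d^'d" and V :: "(real^'d) set" and lam :: "nat \<Rightarrow> real" and v :: "nat \<Rightarrow> real^'d"
  assumes p: "1 \<le> p" "p < CARD('d)"
    and eig: "\<And>i. i \<in> {1..CARD('d)} \<Longrightarrow> S *v v i = lam i *\<^sub>R v i"
    and on: "\<And>i j. i \<in> {1..CARD('d)} \<Longrightarrow> j \<in> {1..CARD('d)} \<Longrightarrow> v i \<bullet> v j = (if i = j then 1 else 0)"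
    and mono: "\<And>i j. 1 \<le> i \<Longrightarrow> i \<le> j \<Longrightarrow> j \<le> CARD('d) \<Longrightarrow> lam j \<le> lam i"
  defines "Vs \<equiv> span (v ` {1..p})"
  shows eigenspace_dim: "Vs \<in> subspaces_of_dim p"
    and eigenspace_gap_bound: "V \<in> subspaces_of_dim p \<Longrightarrow>
      (lam p - lam (p + 1)) / 2 * (norm (proj_mat Vs - proj_mat V))\<^sup>2 \<le> S \<bullet> proj_mat Vs - S \<bullet> proj_mat V"
proof -
  let ?d = "CARD('d)" and ?I = "{1..CARD('d)}"
  have sub: "{1..p} \<subseteq> ?I" using p by auto
  have inj: "inj_on v ?I"
    using on by (intro inj_onI) (metis zero_neq_one)
  have nrm: "norm b = 1" if "b \<in> v ` ?I" for b using that on by (auto simp: norm_eq_1)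
  have orth: "pairwise orthogonal (v ` ?I)"
    using on by (auto simp: pairwise_def orthogonal_def)
  have indep: "independent (v ` J)" if "J \<subseteq> ?I" for J
  proof (rule pairwise_orthogonal_independent)
    show "pairwise orthogonal (v ` J)" using orth that by (meson image_mono pairwise_subset)
    show "0 \<notin> v ` J" using nrm that by (metis image_mono norm_zero subsetD zero_neq_one)
  qed
  have "dim Vs = card (v ` {1..p})"
    unfolding Vs_def using indep[OF sub] by (rule dim_span_eq_card_independent)
  also have "\<dots> = p" using inj sub by (simp add: card_image inj_on_subset)
  finally show Vs: "Vs \<in> subspaces_of_dim p" by (simp add: subspaces_of_dim_def Vs_def)
  have "card (v ` ?I) = ?d" using inj by (simp add: card_image)
  then have spanI: "span (v ` ?I) = UNIV"
    using indep[of ?I] by (metis DIM_cart DIM_real dim_eq_full dim_span dim_span_eq_card_independent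
        mult.right_neutral subset_refl)
  have expand: "(\<Sum>i\<in>?I. (x \<bullet> v i) *\<^sub>R v i) = x" for x
    using orthonormal_basis_expand[OF orth nrm, of x] spanI inj by (simp add: sum.reindex)
  have parseval: "(\<Sum>i\<in>?I. (x \<bullet> v i)\<^sup>2) = x \<bullet> x" for x
  proof -
    have "x \<bullet> x = (\<Sum>i\<in>?I. (x \<bullet> v i) *\<^sub>R v i) \<bullet> x" by (simp only: expand)
    also have "\<dots> = (\<Sum>i\<in>?I. (x \<bullet> v i)\<^sup>2)"
      by (simp only: inner_sum_left inner_scaleR_left power2_eq_square inner_commute[of x])
    finally show ?thesis by simp
  qed
  have S_eq: "S = (\<Sum>i\<in>?I. lam i *\<^sub>R outer (v i))"
  proof -
    have "S *v x = (\<Sum>i\<in>?I. lam i *\<^sub>R outer (v i)) *v x" for x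
    proof -
      have "S *v x = S *v (\<Sum>i\<in>?I. (x \<bullet> v i) *\<^sub>R v i)" by (simp only: expand)
      also have "\<dots> = (\<Sum>i\<in>?I. (x \<bullet> v i) *\<^sub>R (S *v v i))"
        by (simp add: linear_sum[OF matrix_vector_mul_linear] matrix_vector_mult_scaleR)
      also have "\<dots> = (\<Sum>i\<in>?I. lam i *\<^sub>R outer (v i)) *v x"
        unfolding matrix_vector_mult_sum_left using eig
        by (intro sum.cong) (auto simp: scaleR_matrix_vector_assoc[symmetric] outer_mult_vec inner_commute)
      finally show ?thesis .
    qed
    then show ?thesis by (simp add: matrix_eq)
  qed
  have projVs: "proj_mat Vs = (\<Sum>i\<in>{1..p}. outer (v i))"
  proof -
    have "proj_mat Vs = (\<Sum>b\<in>v ` {1..p}. outer b)"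
      unfolding Vs_def
      by (rule proj_mat_orthonormal_basis)
        (use nrm sub orth in \<open>auto intro: pairwise_subset[OF orth] simp: image_mono\<close>)
    then show ?thesis using inj_on_subset[OF inj sub] by (simp add: sum.reindex)
  qed
  assume V: "V \<in> subspaces_of_dim p"
  then have subV: "subspace V" and dimV: "dim V = p" by (auto simp: subspaces_of_dim_def)
  let ?P = "proj_mat V"
  define a where "a i = outer (v i) \<bullet> ?P" for i
  have a_norm: "a i = (?P *v v i) \<bullet> (?P *v v i)" for i
    unfolding a_def inner_outer proj_mat_inner_commute[OF subV]
    by (simp add: matrix_vector_mul_assoc proj_mat_idem[OF subV])
  have a0: "a i \<ge> 0" for i by (simp add: a_norm)
  have a1: "a i \<le> 1" if "i \<in> ?I" for i
  proof -
    have "0 \<le> (v i - ?P *v v i) \<bullet> (v i - ?P *v v i)" by simp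
    also have "\<dots> = v i \<bullet> v i - a i"
      using a_norm[of i] unfolding a_def inner_outer
      by (simp add: inner_diff_left inner_diff_right inner_commute)
    finally show ?thesis using on[OF that that] by simp
  qed
  obtain B where B: "finite B" "\<And>b. b \<in> B \<Longrightarrow> norm b = 1" "card B = p" "?P = (\<Sum>b\<in>B. outer b)"
    using subspace_orthonormal_basis[OF subV] dimV by metis
  have sum_a: "(\<Sum>i\<in>?I. a i) = p"
  proof -
    have "(\<Sum>i\<in>?I. a i) = (\<Sum>i\<in>?I. \<Sum>b\<in>B. (b \<bullet> v i)\<^sup>2)"
      unfolding a_def B(4) by (simp add: inner_sum_right outer_inner_outer inner_commute)
    also have "\<dots> = (\<Sum>b\<in>B. \<Sum>i\<in>?I. (b \<bullet> v i)\<^sup>2)" by (rule sum.swap)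
    also have "\<dots> = (\<Sum>b\<in>B. 1)" using B(2) by (intro sum.cong refl) (simp only: parseval norm_eq_1)
    finally show ?thesis using B(3) by simp
  qed
  have split: "(\<Sum>i\<in>?I. h i) = (\<Sum>i\<in>{1..p}. h i) + (\<Sum>i\<in>{p+1..?d}. h i)" for h :: "nat \<Rightarrow> real"
  proof -
    have "?I = {1..p} \<union> {p+1..?d}" using p by auto
    then show ?thesis by (simp add: sum.union_disjoint)
  qed
  \<comment> \<open>\<open>?D\<close> is the weight moved past index \<open>p\<close>. It is also
    half the squared distance of the two projections, which is where the factor 1/2 in the bound
    comes from.\<close>
  let ?D = "\<Sum>i\<in>{1..p}. 1 - a i"
  have tail: "(\<Sum>i\<in>{p+1..?d}. a i) = ?D"
    using split[of a] sum_a by (simp add: sum_subtractf)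
  have "(lam p - lam (p + 1)) * ?D = (\<Sum>i\<in>{1..p}. lam p * (1 - a i)) - (\<Sum>i\<in>{p+1..?d}. lam (p+1) * a i)"
    by (simp only: tail sum_distrib_left[symmetric] left_diff_distrib)
  also have "\<dots> \<le> (\<Sum>i\<in>{1..p}. lam i * (1 - a i)) - (\<Sum>i\<in>{p+1..?d}. lam i * a i)"
    using mono p a0 a1 sub
    by (intro diff_mono sum_mono mult_right_mono) auto
  also have "\<dots> = S \<bullet> proj_mat Vs - S \<bullet> ?P"
  proof -
    have 1: "S \<bullet> proj_mat Vs = (\<Sum>i\<in>{1..p}. lam i)"
    proof -
      have "S \<bullet> proj_mat Vs = (\<Sum>j\<in>{1..p}. v j \<bullet> (S *v v j))"
        by (simp add: projVs inner_sum_right inner_outer inner_commute[of S])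
      also have "\<dots> = (\<Sum>j\<in>{1..p}. lam j)"
        using sub on by (intro sum.cong refl) (auto simp: eig subset_iff)
      finally show ?thesis .
    qed
    have 2: "S \<bullet> ?P = (\<Sum>i\<in>?I. lam i * a i)"
      unfolding a_def by (subst S_eq) (simp add: inner_sum_left)
    show ?thesis unfolding 1 2 split by (simp add: right_diff_distrib sum_subtractf)
  qed
  finally have main: "(lam p - lam (p + 1)) * ?D \<le> S \<bullet> proj_mat Vs - S \<bullet> ?P" .
  have "(norm (proj_mat Vs - ?P))\<^sup>2 = real p + real p - 2 * (proj_mat Vs \<bullet> ?P)"
    using norm_proj_mat_sq[OF subV] norm_proj_mat_sq[of Vs] Vs dimV
    by (simp add: power2_norm_eq_inner inner_diff_left inner_diff_right inner_commute subspaces_of_dim_def)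
  also have "proj_mat Vs \<bullet> ?P = (\<Sum>i\<in>{1..p}. a i)"
    by (simp add: projVs a_def inner_sum_left)
  finally have "(norm (proj_mat Vs - ?P))\<^sup>2 = 2 * ?D" by (simp add: sum_subtractf)
  then show "(lam p - lam (p + 1)) / 2 * (norm (proj_mat Vs - proj_mat V))\<^sup>2 \<le> S \<bullet> proj_mat Vs - S \<bullet> proj_mat V"
    using main by simp
qed

text \<open>Quadratic growth of the objective of \<open>S\<close> around its optimum is played
  against a difference between \<open>S\<close> and \<open>T\<close> that acts linearly in the
  distance of the projections; one factor of the distance cancels. No eigenvector of
  \<open>T\<close> has to be compared with one of \<open>S\<close>.\<close>

lemma maximizer_stability:
  fixes S :: "real^'d^'d" and V :: "(real^'d) set" and lam :: "nat \<Rightarrow> real" and v :: "nat \<Rightarrow> real^'d"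
  assumes p: "1 \<le> p" "p < CARD('d)"
    and eig: "\<And>i. i \<in> {1..CARD('d)} \<Longrightarrow> S *v v i = lam i *\<^sub>R v i"
    and on: "\<And>i j. i \<in> {1..CARD('d)} \<Longrightarrow> j \<in> {1..CARD('d)} \<Longrightarrow> v i \<bullet> v j = (if i = j then 1 else 0)"
    and mono: "\<And>i j. 1 \<le> i \<Longrightarrow> i \<le> j \<Longrightarrow> j \<le> CARD('d) \<Longrightarrow> lam j \<le> lam i"
    and gap: "lam p > lam (p + 1)"
    and V: "V \<in> subspaces_of_dim p"
    and max: "\<And>W. W \<in> subspaces_of_dim p \<Longrightarrow> T \<bullet> proj_mat W \<le> T \<bullet> proj_mat V"
  shows "norm (proj_mat V - proj_mat (span (v ` {1..p}))) \<le> 2 / (lam p - lam (p + 1)) * norm (T - S)"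
proof -
  let ?W = "span (v ` {1..p})" and ?g = "lam p - lam (p + 1)"
  let ?n = "norm (proj_mat ?W - proj_mat V)"
  have W: "?W \<in> subspaces_of_dim p" by (rule eigenspace_dim[OF p eig on mono])
  have "?g / 2 * ?n\<^sup>2 \<le> S \<bullet> proj_mat ?W - S \<bullet> proj_mat V"
    by (rule eigenspace_gap_bound[OF p eig on mono V])
  also have "\<dots> \<le> (S - T) \<bullet> (proj_mat ?W - proj_mat V)"
    using max[OF W] by (simp add: inner_diff_left inner_diff_right)
  also have "\<dots> \<le> norm (T - S) * ?n"
    by (metis Cauchy_Schwarz_ineq2 abs_le_D1 norm_minus_commute)
  finally have *: "?g / 2 * ?n * ?n \<le> norm (T - S) * ?n" by (simp add: power2_eq_square)
  have "?g / 2 * ?n \<le> norm (T - S)"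
  proof (cases "?n = 0")
    case True then show ?thesis by simp
  next
    case False
    then have "?n > 0" by (simp add: norm_eq_zero)
    then show ?thesis using * by (rule mult_right_le_imp_le[rotated])
  qed
  then show ?thesis using gap by (simp add: norm_minus_commute field_simps)
qed

section \<open>The matrix exponential\<close>

definition mat_pow :: "real^'d^'d \<Rightarrow> nat \<Rightarrow> real^'d^'d" where
  "mat_pow A m = ((**) A ^^ m) (mat 1)"

lemma mat_pow_simps [simp]: "mat_pow A 0 = mat 1" "mat_pow A (Suc m) = A ** mat_pow A m"
  by (auto simp: mat_pow_def)

text \<open>The norm is the Euclidean norm of the entries. Normalizing the constant to at least 1
  makes its powers increasing, so that one constant can serve estimates of different orders.\<close>

lemma matrix_mult_bound:
  obtains K where "K \<ge> 1" "\<And>(A :: real^'d^'d) (B :: real^'d^'d). norm (A ** B) \<le> K * norm A * norm B"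
proof -
  obtain K where K: "K > 0" "\<And>(A :: real^'d^'d) (B :: real^'d^'d). norm (A ** B) \<le> norm A * norm B * K"
    using matmul.pos_bounded by metis
  have "norm (A ** B) \<le> max 1 K * norm A * norm B" for A B :: "real^'d^'d"
  proof -
    have "norm (A ** B) \<le> norm A * norm B * K" by (rule K)
    also have "\<dots> \<le> norm A * norm B * max 1 K" by (intro mult_left_mono) auto
    finally show ?thesis by (simp add: mult_ac)
  qed
  then show ?thesis using that[of "max 1 K"] by auto
qed

lemma norm_mat_pow_le:
  fixes A :: "real^'d^'d"
  assumes "\<And>(A :: real^'d^'d) (B :: real^'d^'d). norm (A ** B) \<le> K * norm A * norm B"
  shows "norm (mat_pow A m) \<le> (K * norm A) ^ m * norm (mat 1 :: real^'d^'d)"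
proof (induction m)
  case (Suc m)
  have K0: "0 \<le> K * norm A"
  proof (rule ccontr)
    assume "\<not> 0 \<le> K * norm A"
    then have "K < 0" "norm A > 0" by (auto simp: not_le mult_less_0_iff)
    moreover have "0 \<le> K * norm A * norm A" using assms[of A A] norm_ge_zero by (meson order_trans)
    ultimately show False by (simp add: zero_le_mult_iff)
  qed
  have "norm (mat_pow A (Suc m)) \<le> K * norm A * norm (mat_pow A m)"
    using assms by simp
  also have "\<dots> \<le> K * norm A * ((K * norm A) ^ m * norm (mat 1 :: real^'d^'d))"
    by (rule mult_left_mono[OF Suc K0])
  finally show ?case by (simp add: mult_ac)
qed simp

lemma mat_exp_eq: "mat_exp A = (\<Sum>m. (1 / fact m) *\<^sub>R mat_pow A m)"
  by (simp add: mat_exp_def mat_pow_def)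

text \<open>Termwise domination by a scalar exponential series, uniform on the ball: it gives the
  bound, the cubic remainder and, by the Weierstrass test, continuity.\<close>

lemma mat_exp_bounds:
  fixes b :: real
  obtains C where "C \<ge> 0"
    "\<And>A :: real^'d^'d. norm A \<le> b \<Longrightarrow> norm (mat_exp A) \<le> C"
    "\<And>A :: real^'d^'d. norm A \<le> b \<Longrightarrow>
      norm (mat_exp A - (mat 1 + A + (1/2) *\<^sub>R (A ** A))) \<le> C * norm A ^ 3"
    "continuous_on (cball 0 b) (mat_exp :: real^'d^'d \<Rightarrow> _)"
proof -
  obtain K where K: "K \<ge> 1" "\<And>(A :: real^'d^'d) (B :: real^'d^'d). norm (A ** B) \<le> K * norm A * norm B"
    using matrix_mult_bound by metis
  define e where "e = norm (mat 1 :: real^'d^'d)"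
  define f where "f m A = (1 / fact m) *\<^sub>R mat_pow (A :: real^'d^'d) m" for m A
  have f_le: "norm (f m A) \<le> e * ((K * norm A) ^ m /\<^sub>R fact m)" for m A
    using norm_mat_pow_le[OF K(2), of A m] by (simp add: f_def e_def divide_simps mult_ac)
  have sumexp: "summable (\<lambda>m. e * (x ^ m /\<^sub>R fact m))" for x :: real
    by (intro summable_mult summable_exp_generic)
  have f_le': "norm (f m A) \<le> e * ((K * \<bar>b\<bar>) ^ m /\<^sub>R fact m)" if "norm A \<le> b" for m A
  proof -
    have "(K * norm A) ^ m \<le> (K * \<bar>b\<bar>) ^ m"
      using that K(1) by (intro power_mono mult_left_mono) auto
    then have "e * ((K * norm A) ^ m /\<^sub>R fact m) \<le> e * ((K * \<bar>b\<bar>) ^ m /\<^sub>R fact m)"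
      by (intro mult_left_mono) (auto simp: e_def)
    with f_le[of m A] show ?thesis by linarith
  qed
  have sumf: "summable (\<lambda>m. norm (f m A))" for A
    by (rule summable_comparison_test[OF _ sumexp[of "K * norm A"]]) (use f_le in auto)
  have sums: "summable (\<lambda>m. f m A)" for A using sumf by (rule summable_norm_cancel)
  have exp_eq: "mat_exp A = (\<Sum>m. f m A)" for A :: "real^'d^'d" by (simp add: f_def mat_exp_eq)
  have exp_sum: "(\<Sum>m. e * (x ^ m /\<^sub>R fact m)) = e * exp x" for x :: real
    using suminf_mult[OF summable_exp_generic, of e x] by (simp add: exp_def)
  have bnd: "norm (mat_exp A) \<le> e * exp (K * \<bar>b\<bar>)" if "norm A \<le> b" for A :: "real^'d^'d"
  proof -
    have "norm (mat_exp A) \<le> (\<Sum>m. norm (f m A))" unfolding exp_eq by (rule summable_norm[OF sumf])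
    also have "\<dots> \<le> (\<Sum>m. e * ((K * \<bar>b\<bar>) ^ m /\<^sub>R fact m))"
      by (rule suminf_le[OF f_le'[OF that] sumf sumexp])
    finally show ?thesis by (simp only: exp_sum)
  qed
  have rem: "norm (mat_exp A - (mat 1 + A + (1/2) *\<^sub>R (A ** A))) \<le> e * K ^ 3 * exp (K * \<bar>b\<bar>) * norm A ^ 3"
    if "norm A \<le> b" for A :: "real^'d^'d"
  proof -
    have "mat_exp A = (\<Sum>m. f (m + 3) A) + (\<Sum>m<3. f m A)"
      unfolding exp_eq by (rule suminf_split_initial_segment[OF sums])
    also have "(\<Sum>m<3. f m A) = mat 1 + A + (1/2) *\<^sub>R (A ** A)"
      by (simp add: f_def numeral_eq_Suc)
    finally have "norm (mat_exp A - (mat 1 + A + (1/2) *\<^sub>R (A ** A))) = norm (\<Sum>m. f (m + 3) A)"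
      by simp
    also have "\<dots> \<le> (\<Sum>m. norm (f (m + 3) A))"
      by (intro summable_norm) (use sumf[of A] in \<open>subst summable_iff_shift\<close>)
    also have "\<dots> \<le> (\<Sum>m. (K * norm A) ^ 3 * (e * ((K * \<bar>b\<bar>) ^ m /\<^sub>R fact m)))"
    proof (rule suminf_le)
      fix m
      have "norm (f (m + 3) A) \<le> e * ((K * norm A) ^ (m + 3) /\<^sub>R fact (m + 3))" by (rule f_le)
      \<comment> \<open>The larger factorial is given up so that the cube splits off and the
        exponential series reappears.\<close>
      also have "\<dots> \<le> e * ((K * norm A) ^ (m + 3) /\<^sub>R fact m)"
        using K(1) by (intro mult_left_mono) (auto simp: e_def fact_mono intro!: mult_right_mono)
      also have "\<dots> \<le> e * (((K * \<bar>b\<bar>) ^ m * (K * norm A) ^ 3) /\<^sub>R fact m)"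
        using K(1) that unfolding power_add
        by (intro mult_left_mono scaleR_left_mono mult_right_mono power_mono) (auto simp: e_def)
      finally show "norm (f (m + 3) A) \<le> (K * norm A) ^ 3 * (e * ((K * \<bar>b\<bar>) ^ m /\<^sub>R fact m))"
        by (simp add: mult_ac)
    qed (use sumf[of A] summable_mult[OF sumexp] in \<open>auto simp: summable_iff_shift[of "\<lambda>m. norm (f m A)"]\<close>)
    also have "\<dots> = (K * norm A) ^ 3 * (e * exp (K * \<bar>b\<bar>))"
      by (subst suminf_mult[OF sumexp]) (simp only: exp_sum)
    finally show ?thesis by (simp add: power_mult_distrib mult_ac)
  qed
  have cont: "continuous_on (cball 0 b) (mat_exp :: real^'d^'d \<Rightarrow> _)"
  proof -
    have "uniform_limit (cball 0 b) (\<lambda>n A. \<Sum>i<n. f i A) (\<lambda>A. \<Sum>i. f i A) sequentially"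
      by (rule Weierstrass_m_test[OF _ sumexp[of "K * \<bar>b\<bar>"]]) (use f_le' in auto)
    moreover have "continuous_on (cball 0 b) (\<lambda>A. mat_pow A m :: real^'d^'d)" for m
      by (induction m) (auto intro!: matmul.continuous_on continuous_intros)
    then have "continuous_on (cball 0 b) (\<lambda>A. \<Sum>i<n. f i A)" for n
      unfolding f_def by (intro continuous_intros)
    ultimately have "continuous_on (cball 0 b) (\<lambda>A. \<Sum>i. f i A)"
      by (intro uniform_limit_theorem[of _ "\<lambda>n A. \<Sum>i<n. f i A" sequentially]) auto
    then show ?thesis by (simp add: exp_eq)
  qed
  \<comment> \<open>Both bounds share this constant: since \<open>K \<ge> 1\<close>, the factor
    \<open>K ^ 3\<close> of the remainder can only enlarge the plain bound.\<close>
  let ?C = "e * exp (K * \<bar>b\<bar>) * K ^ 3"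
  have "e * exp (K * \<bar>b\<bar>) * 1 \<le> ?C"
    using K(1) by (intro mult_left_mono) (auto simp: e_def one_le_power)
  then have le: "e * exp (K * \<bar>b\<bar>) \<le> ?C" by simp
  show ?thesis
  proof (rule that[OF _ _ _ cont])
    show "0 \<le> ?C" using K(1) by (simp add: e_def)
    show "norm (mat_exp A) \<le> ?C" if "norm A \<le> b" for A :: "real^'d^'d"
      using bnd[OF that] le by linarith
    show "norm (mat_exp A - (mat 1 + A + (1/2) *\<^sub>R (A ** A))) \<le> ?C * norm A ^ 3"
      if "norm A \<le> b" for A :: "real^'d^'d"
      using rem[OF that] by (simp only: mult_ac)
  qed
qed

section \<open>Taylor expansion of the rotated projection\<close>

text \<open>First order coefficient in \<open>c\<close> of \<open>rotated c B P\<close>.\<close>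

definition commutator :: "real^'d^'d \<Rightarrow> real^'d^'d \<Rightarrow> real^'d^'d" where
  "commutator P B = P ** B - B ** P"

text \<open>Second order coefficient: one half of the iterated commutator
  \<open>commutator (commutator P B) B\<close>, multiplied out.\<close>

definition half_commutator2 :: "real^'d^'d \<Rightarrow> real^'d^'d \<Rightarrow> real^'d^'d" where
  "half_commutator2 P B = (1/2) *\<^sub>R (P ** (B ** B) + (B ** B) ** P) - B ** (P ** B)"

text \<open>The product of the two quadratic Taylor polynomials of the exponentials. Its terms of
  order 3 and 4 are artefacts of this truncation, not coefficients of the conjugation, and only have
  to be bounded.\<close>

lemma conjugation_expansion:
  fixes B P :: "real^'d^'d"
  shows "(mat 1 - c *\<^sub>R B + (c\<^sup>2/2) *\<^sub>R (B ** B)) ** (P ** (mat 1 + c *\<^sub>R B + (c\<^sup>2/2) *\<^sub>R (B ** B)))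
   = P + c *\<^sub>R (P ** B - B ** P) + c\<^sup>2 *\<^sub>R ((1/2) *\<^sub>R (P ** (B ** B) + (B ** B) ** P) - B ** (P ** B))
       + ((c ^ 3 / 2) *\<^sub>R (B ** (B ** (P ** B)) - B ** (P ** (B ** B))) + (c ^ 4 / 4) *\<^sub>R (B ** (B ** (P ** (B ** B)))))"
  by (simp only: matmul.diff_left matmul.diff_right matmul.add_left matmul.add_right
         matmul.scaleR_left matmul.scaleR_right matrix_mul_assoc[symmetric] scaleR_add_right scaleR_diff_right
         matrix_mul_lid matrix_mul_rid scaleR_scaleR,
       simp add: power2_eq_square power3_eq_cube power4_eq_xxxx, simp add: mult.assoc)

text \<open>With \<open>c\<close> equal to \<open>k\<close> to the power -1/2, multiplication by
  \<open>k\<close> keeps the second order term and leaves a remainder of order \<open>c\<close>. The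
  constant is uniform over \<open>K\<close> and the bound linear in \<open>norm P\<close>, so that
  \<open>P\<close> may be random.\<close>

lemma rotated_expansion:
  fixes K :: "(real^'d^'d) set"
  assumes "bounded K"
  obtains C where "C \<ge> 0"
    "\<And>B c P. B \<in> K \<Longrightarrow> 0 \<le> c \<Longrightarrow> c \<le> 1 \<Longrightarrow>
      norm (rotated c B P - (P + c *\<^sub>R commutator P B + c\<^sup>2 *\<^sub>R half_commutator2 P B)) \<le> C * c ^ 3 * norm P"
    "\<And>B c P. B \<in> K \<Longrightarrow> 0 \<le> c \<Longrightarrow> c \<le> 1 \<Longrightarrow> norm (rotated c B P) \<le> C * norm P"
proof -
  obtain b where b: "b > 0" "\<And>B. B \<in> K \<Longrightarrow> norm B \<le> b" using assms bounded_pos by metis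
  obtain k where k: "k \<ge> 1" "\<And>(A :: real^'d^'d) (B :: real^'d^'d). norm (A ** B) \<le> k * norm A * norm B"
    using matrix_mult_bound by metis
  obtain C where C: "C \<ge> 0" "\<And>A :: real^'d^'d. norm A \<le> b \<Longrightarrow> norm (mat_exp A) \<le> C"
    "\<And>A :: real^'d^'d. norm A \<le> b \<Longrightarrow>
      norm (mat_exp A - (mat 1 + A + (1/2) *\<^sub>R (A ** A))) \<le> C * norm A ^ 3"
    using mat_exp_bounds[of b] by metis
  have k3: "norm (A ** (P ** B)) \<le> k\<^sup>2 * (norm A * norm P * norm B)" for A P B :: "real^'d^'d"
  proof -
    have "norm (A ** (P ** B)) \<le> k * norm A * norm (P ** B)" by (rule k)
    also have "\<dots> \<le> k * norm A * (k * norm P * norm B)"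
      using k by (intro mult_left_mono) auto
    finally show ?thesis by (simp add: power2_eq_square mult_ac)
  qed
  define D where "D = C + norm (mat 1 :: real^'d^'d) + b + k * b\<^sup>2"
  \<comment> \<open>The three summands account for the error of the left exponential, that of the
    right one, and the surplus terms of order 3 and 4.\<close>
  define C1 where "C1 = k\<^sup>2 * (C * b^3 * C) + k\<^sup>2 * (D * (C * b ^ 3)) + (k ^ 3 * b ^ 3 + k ^ 4 * b ^ 4)"
  have D0: "D \<ge> 0" using C b k by (simp add: D_def)
  have main: "norm (rotated c B P - (P + c *\<^sub>R commutator P B + c\<^sup>2 *\<^sub>R half_commutator2 P B)) \<le> C1 * c ^ 3 * norm P"
    if B: "B \<in> K" and c: "0 \<le> c" "c \<le> 1" for B c P
  proof -
    have nB: "norm B \<le> b" by (rule b(2)[OF B])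
    have nc: "norm (c *\<^sub>R B) \<le> c * b" "norm (- (c *\<^sub>R B)) \<le> c * b" using nB c by (auto simp: mult_left_mono)
    have cb: "c * b \<le> b" using c b by (simp add: mult_le_cancel_right1)
    define E where "E = mat_exp (c *\<^sub>R B)"
    define F where "F = mat_exp (- (c *\<^sub>R B))"
    define s where "s = mat 1 + c *\<^sub>R B + (c\<^sup>2/2) *\<^sub>R (B ** B)"
    define r where "r = mat 1 - c *\<^sub>R B + (c\<^sup>2/2) *\<^sub>R (B ** B)"
    have "norm (E - s) \<le> C * norm (c *\<^sub>R B) ^ 3"
      using C(3)[of "c *\<^sub>R B"] nc cb by (simp add: E_def s_def matmul.scaleR_left matmul.scaleR_right power2_eq_square)
    also have "\<dots> \<le> C * (c * b) ^ 3" using C(1) nc by (intro mult_left_mono power_mono) auto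
    finally have Es: "norm (E - s) \<le> C * b ^ 3 * c ^ 3" by (simp add: power_mult_distrib mult_ac)
    have "norm (F - r) \<le> C * norm (- (c *\<^sub>R B)) ^ 3"
      using C(3)[of "- (c *\<^sub>R B)"] nc cb
      by (simp add: F_def r_def matmul.scaleR_left matmul.scaleR_right matmul.minus_left matmul.minus_right power2_eq_square)
    also have "\<dots> \<le> C * (c * b) ^ 3" using C(1) nc by (intro mult_left_mono power_mono) auto
    finally have Fr: "norm (F - r) \<le> C * b ^ 3 * c ^ 3" by (simp add: power_mult_distrib mult_ac)
    have nE: "norm E \<le> C" unfolding E_def using C(2) nc cb by (meson order_trans)
    have nr: "norm r \<le> D"
    proof -
      have "norm r \<le> norm (mat 1 - c *\<^sub>R B) + norm ((c\<^sup>2/2) *\<^sub>R (B ** B))"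
        unfolding r_def by (rule norm_triangle_ineq)
      also have "norm (mat 1 - c *\<^sub>R B) \<le> norm (mat 1 :: real^'d^'d) + b"
        by (rule order_trans[OF norm_triangle_ineq4]) (use nc cb in auto)
      also have "norm ((c\<^sup>2/2) *\<^sub>R (B ** B)) \<le> 1 * norm (B ** B)"
        unfolding norm_scaleR using c by (intro mult_right_mono) (auto simp: power_le_one intro: order_trans[of _ 1])
      also have "norm (B ** B) \<le> k * norm B * norm B" by (rule k)
      also have "\<dots> \<le> k * b * b" using nB k b by (intro mult_mono) auto
      finally show ?thesis using C(1) by (simp add: D_def power2_eq_square)
    qed
    \<comment> \<open>The exponentials are exchanged for their Taylor polynomials one at a time, so
      that each error term has one small factor and two bounded ones.\<close>
    have id1: "F ** (P ** E) = r ** (P ** s) + ((F - r) ** (P ** E) + r ** (P ** (E - s)))"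
      by (simp add: matmul.diff_left matmul.diff_right)
    have id2: "r ** (P ** s) = P + c *\<^sub>R commutator P B + c\<^sup>2 *\<^sub>R half_commutator2 P B
       + ((c ^ 3 / 2) *\<^sub>R (B ** (B ** (P ** B)) - B ** (P ** (B ** B))) + (c ^ 4 / 4) *\<^sub>R (B ** (B ** (P ** (B ** B)))))"
      unfolding r_def s_def commutator_def half_commutator2_def by (rule conjugation_expansion)
    have n4: "norm (B ** (B ** (P ** B)) - B ** (P ** (B ** B))) \<le> 2 * (k ^ 3 * b ^ 3) * norm P"
    proof -
      have "norm (B ** (B ** (P ** B))) \<le> k * norm B * norm (B ** (P ** B))" by (rule k)
      also have "\<dots> \<le> k * b * (k\<^sup>2 * (b * norm P * b))"
        using k3[of B P B] nB k b by (intro mult_mono order_trans[OF k3] mult_left_mono) auto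
      finally have 1: "norm (B ** (B ** (P ** B))) \<le> k ^ 3 * b ^ 3 * norm P"
        by (simp add: power2_eq_square power3_eq_cube mult_ac)
      have "norm (B ** (P ** (B ** B))) \<le> k\<^sup>2 * (norm B * norm P * norm (B ** B))" by (rule k3)
      also have "\<dots> \<le> k\<^sup>2 * (b * norm P * (k * b * b))"
        using nB k b by (intro mult_left_mono mult_mono order_trans[OF k(2)]) auto
      finally have 2: "norm (B ** (P ** (B ** B))) \<le> k ^ 3 * b ^ 3 * norm P"
        by (simp add: power2_eq_square power3_eq_cube mult_ac)
      show ?thesis using norm_triangle_ineq4[of "B ** (B ** (P ** B))" "B ** (P ** (B ** B))"] 1 2 by linarith
    qed
    have n5: "norm (B ** (B ** (P ** (B ** B)))) \<le> k * (k ^ 3 * b ^ 4) * norm P"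
    proof -
      have "norm (B ** (B ** (P ** (B ** B)))) \<le> k * norm B * norm (B ** (P ** (B ** B)))" by (rule k)
      also have "\<dots> \<le> k * b * (k\<^sup>2 * (b * norm P * (k * b * b)))"
        using nB k b by (intro mult_mono order_trans[OF k3] mult_left_mono order_trans[OF k(2)]) auto
      finally show ?thesis by (simp add: power2_eq_square power3_eq_cube power4_eq_xxxx mult_ac)
    qed
    have e1: "norm ((F - r) ** (P ** E)) \<le> k\<^sup>2 * (C * b ^ 3 * C) * c ^ 3 * norm P"
    proof -
      have "norm ((F - r) ** (P ** E)) \<le> k\<^sup>2 * (norm (F - r) * norm P * norm E)" by (rule k3)
      also have "\<dots> \<le> k\<^sup>2 * ((C * b ^ 3 * c ^ 3) * norm P * C)"
        using Fr nE C(1) b(1) c by (intro mult_left_mono mult_mono) auto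
      finally show ?thesis by (simp add: mult_ac)
    qed
    have e2: "norm (r ** (P ** (E - s))) \<le> k\<^sup>2 * (D * (C * b ^ 3)) * c ^ 3 * norm P"
    proof -
      have "norm (r ** (P ** (E - s))) \<le> k\<^sup>2 * (norm r * norm P * norm (E - s))" by (rule k3)
      also have "\<dots> \<le> k\<^sup>2 * (D * norm P * (C * b ^ 3 * c ^ 3))"
        using Es nr D0 by (intro mult_left_mono mult_mono) auto
      finally show ?thesis by (simp add: mult_ac)
    qed
    let ?X = "B ** (B ** (P ** B)) - B ** (P ** (B ** B))"
    let ?Y = "B ** (B ** (P ** (B ** B)))"
    have e3: "norm ((c ^ 3 / 2) *\<^sub>R ?X) \<le> k ^ 3 * b ^ 3 * c ^ 3 * norm P"
    proof -
      have "norm ((c ^ 3 / 2) *\<^sub>R ?X) = c ^ 3 / 2 * norm ?X" using c by simp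
      also have "\<dots> \<le> c ^ 3 / 2 * (2 * (k ^ 3 * b ^ 3) * norm P)"
        using c by (intro mult_left_mono n4) auto
      finally show ?thesis by (simp add: mult_ac)
    qed
    have e4: "norm ((c ^ 4 / 4) *\<^sub>R ?Y) \<le> k ^ 4 * b ^ 4 * c ^ 3 * norm P"
    proof -
      have "norm ((c ^ 4 / 4) *\<^sub>R ?Y) = c ^ 4 / 4 * norm ?Y" using c by simp
      also have "\<dots> \<le> c ^ 3 * (k * (k ^ 3 * b ^ 4) * norm P)"
      proof (intro mult_mono n5)
        have "c ^ 4 \<le> c ^ 3" using c by (simp add: power_decreasing)
        then show "c ^ 4 / 4 \<le> c ^ 3" using zero_le_power[OF c(1), of 3] by linarith
      qed (use c in auto)
      finally show ?thesis by (simp add: mult_ac numeral_eq_Suc)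
    qed
    have "rotated c B P = F ** (P ** E)" by (simp add: rotated_def E_def F_def matrix_mul_assoc)
    then have "norm (rotated c B P - (P + c *\<^sub>R commutator P B + c\<^sup>2 *\<^sub>R half_commutator2 P B))
        = norm (((F - r) ** (P ** E) + r ** (P ** (E - s))) + ((c ^ 3 / 2) *\<^sub>R ?X + (c ^ 4 / 4) *\<^sub>R ?Y))"
      unfolding id1 id2 by simp (simp add: add_ac)
    also have "\<dots> \<le> norm ((F - r) ** (P ** E)) + norm (r ** (P ** (E - s)))
        + (norm ((c ^ 3 / 2) *\<^sub>R ?X) + norm ((c ^ 4 / 4) *\<^sub>R ?Y))"
      by (intro order_trans[OF norm_triangle_ineq] add_mono norm_triangle_ineq)
    also have "\<dots> \<le> C1 * c ^ 3 * norm P"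
      using e1 e2 e3 e4 unfolding C1_def distrib_right by linarith
    finally show ?thesis .
  qed
  have bnd: "norm (rotated c B P) \<le> k\<^sup>2 * (C * C) * norm P" if B: "B \<in> K" and c: "0 \<le> c" "c \<le> 1" for B c P
  proof -
    have n: "norm (c *\<^sub>R B) \<le> b" "norm (- (c *\<^sub>R B)) \<le> b"
      using b(2)[OF B] c mult_mono[of c 1 "norm B" b] by auto
    have "norm (rotated c B P) \<le> k\<^sup>2 * (norm (mat_exp (- (c *\<^sub>R B))) * norm P * norm (mat_exp (c *\<^sub>R B)))"
      unfolding rotated_def matrix_mul_assoc[symmetric] by (rule k3)
    also have "\<dots> \<le> k\<^sup>2 * (C * norm P * C)"
      using C n by (intro mult_left_mono mult_mono) auto
    finally show ?thesis by (simp add: mult_ac)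
  qed
  let ?C = "max C1 (k\<^sup>2 * (C * C))"
  have "0 \<le> ?C" using C(1) by (simp add: le_max_iff_disj)
  moreover have "C1 * c ^ 3 * norm P \<le> ?C * c ^ 3 * norm P" if "0 \<le> c" for c and P :: "real^'d^'d"
    using that by (intro mult_right_mono) auto
  moreover have "k\<^sup>2 * (C * C) * norm P \<le> ?C * norm P" for P :: "real^'d^'d"
    by (intro mult_right_mono) auto
  ultimately show ?thesis
    using that[of ?C] order_trans[OF main] order_trans[OF bnd] by presburger
qed

text \<open>A tangent matrix exchanges \<open>V\<close> and its complement, so moving it across the
  projection turns the latter into the complementary one.\<close>

lemma tangent_proj_mult:
  fixes V :: "(real^'d) set"
  assumes V: "subspace V" and B: "B \<in> tangent_mats V"
  shows "proj_mat V ** B = B - B ** proj_mat V"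
proof -
  let ?P = "proj_mat V"
  have "?P *v (B *v x) = B *v x - B *v (?P *v x)" for x
  proof -
    have "B *v (?P *v x) \<in> V\<^sup>\<bottom>" "B *v (x - ?P *v x) \<in> V"
      using B proj_mat_in[OF V] proj_mat_diff_in[OF V] by (auto simp: tangent_mats_def)
    then have "?P *v (B *v (?P *v x)) = 0" "?P *v (B *v (x - ?P *v x)) = B *v (x - ?P *v x)"
      using V by (auto simp: proj_mat_kills proj_mat_fixes)
    then show ?thesis by (simp add: matrix_vector_mult_diff_distrib)
  qed
  then show ?thesis
    by (simp add: matrix_eq matrix_vector_mul_assoc[symmetric] matrix_vector_mult_diff_rdistrib)
qed

text \<open>By the preceding rule \<open>B ** B\<close> commutes with the projection
  \<open>P\<close>, and \<open>B ** (P ** B)\<close> is \<open>B ** B\<close> after the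
  complementary projection; the difference of the two projections remains.\<close>

lemma half_commutator2_tangent:
  fixes V :: "(real^'d) set"
  assumes V: "subspace V" and B: "B \<in> tangent_mats V"
  shows "half_commutator2 (proj_mat V) B = B ** B ** (proj_mat V - proj_mat (V\<^sup>\<bottom>))"
proof -
  let ?P = "proj_mat V"
  note PB = tangent_proj_mult[OF V B]
  have 1: "?P ** (B ** B) = B ** (B ** ?P)"
  proof -
    have "?P ** (B ** B) = (?P ** B) ** B" by (rule matrix_mul_assoc)
    also have "\<dots> = B ** B - B ** (?P ** B)" by (simp add: PB matmul.diff_left matrix_mul_assoc[symmetric])
    finally show ?thesis by (simp add: PB matmul.diff_right)
  qed
  have 2: "B ** (?P ** B) = B ** B - B ** (B ** ?P)" by (simp add: PB matmul.diff_right)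
  have "half_commutator2 ?P B = B ** (B ** ?P) - (B ** B - B ** (B ** ?P))"
    unfolding half_commutator2_def 1 2 by (simp only: matrix_mul_assoc[symmetric] scaleR_half_double)
  also have "\<dots> = B ** B ** (?P - proj_mat (V\<^sup>\<bottom>))"
    by (simp only: proj_mat_orthogonal_comp[OF V] matmul.diff_right matrix_mul_assoc[symmetric] matrix_mul_rid)
  finally show ?thesis .
qed

text \<open>With \<open>P\<close> the projection, skew-symmetry of \<open>B\<close> makes
  \<open>- (B ** P)\<close> the transpose of \<open>P ** B\<close>, so a symmetric \<open>G\<close>
  pairs equally with both.\<close>

lemma inner_commutator_tangent:
  fixes V :: "(real^'d) set"
  assumes V: "subspace V" and B: "B \<in> tangent_mats V" and G: "transpose G = G"
  shows "G \<bullet> commutator (proj_mat V) B = 2 * (G \<bullet> (proj_mat V ** B))"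
proof -
  have "transpose (proj_mat V ** B) = - (B ** proj_mat V)"
    using B by (simp add: matrix_transpose_mul transpose_proj_mat[OF V] tangent_mats_def matmul.minus_left)
  then have "G \<bullet> (- (B ** proj_mat V)) = G \<bullet> (proj_mat V ** B)"
    by (metis G inner_transpose)
  then show ?thesis by (simp add: commutator_def inner_diff_right)
qed

text \<open>Moving \<open>P\<close> to the other side of the inner product turns the two halves of
  the commutator into \<open>(P ** S) \<bullet> B\<close> and
  \<open>(S ** P) \<bullet> B\<close>.\<close>

lemma inner_commutator_eq_0:
  fixes S P B :: "real^'d^'d"
  assumes S: "transpose S = S" and P: "transpose P = P" and SP: "S ** P = P ** S"
  shows "S \<bullet> commutator P B = 0"
proof -
  have "S \<bullet> (P ** B) = (P ** S) \<bullet> B" by (simp add: inner_matrix_mult_left P)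
  moreover have "S \<bullet> (B ** P) = (S ** P) \<bullet> B" by (simp add: inner_matrix_mult_right P)
  ultimately show ?thesis by (simp add: commutator_def inner_diff_right SP)
qed

lemma commutator_diff: "commutator P B - commutator P' B = commutator (P - P') B"
  by (simp add: commutator_def matmul.diff_left matmul.diff_right)

lemma half_commutator2_diff:
  "half_commutator2 P B - half_commutator2 P' B = half_commutator2 (P - P') B"
  by (simp add: half_commutator2_def matmul.diff_left matmul.diff_right scaleR_diff_right scaleR_add_right)

lemma rotated_diff: "rotated c B P - rotated c B P' = rotated c B (P - P')"
  by (simp add: rotated_def matmul.diff_left matmul.diff_right)

lemma commutator_bounds:
  fixes K :: "(real^'d^'d) set"
  assumes "bounded K"
  obtains C where "C \<ge> 0" "\<And>B P. B \<in> K \<Longrightarrow> norm (commutator P B) \<le> C * norm P"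
    "\<And>B P. B \<in> K \<Longrightarrow> norm (half_commutator2 P B) \<le> C * norm P"
proof -
  obtain b where b: "b > 0" "\<And>B. B \<in> K \<Longrightarrow> norm B \<le> b" using assms bounded_pos by metis
  obtain k where k: "k \<ge> 1" "\<And>(A :: real^'d^'d) (B :: real^'d^'d). norm (A ** B) \<le> k * norm A * norm B"
    using matrix_mult_bound by metis
  have BB: "norm (B ** B) \<le> k * b * b" if "B \<in> K" for B
    using b(2)[OF that] k b by (intro order_trans[OF k(2)] mult_mono) auto
  have *: "norm (P ** B) \<le> k * b * norm P" "norm (B ** P) \<le> k * b * norm P"
    "norm (P ** (B ** B)) \<le> (k * b)\<^sup>2 * norm P" "norm ((B ** B) ** P) \<le> (k * b)\<^sup>2 * norm P"
    "norm (B ** (P ** B)) \<le> (k * b)\<^sup>2 * norm P"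
    if "B \<in> K" for B P
  proof -
    have nB: "norm B \<le> b" by (rule b(2)[OF that])
    have "norm (P ** B) \<le> k * norm P * b" "norm (B ** P) \<le> k * b * norm P"
      using nB k b by (intro order_trans[OF k(2)] mult_mono; simp)+
    then show 1: "norm (P ** B) \<le> k * b * norm P" "norm (B ** P) \<le> k * b * norm P"
      by (simp_all add: mult_ac)
    have "norm (P ** (B ** B)) \<le> k * norm P * (k * b * b)" 
      using k by (intro order_trans[OF k(2) mult_left_mono[OF BB[OF that]]]) auto
    moreover have "norm ((B ** B) ** P) \<le> k * (k * b * b) * norm P"
      using k by (intro order_trans[OF k(2) mult_right_mono[OF mult_left_mono[OF BB[OF that]]]]) auto
    ultimately show "norm (P ** (B ** B)) \<le> (k * b)\<^sup>2 * norm P" "norm ((B ** B) ** P) \<le> (k * b)\<^sup>2 * norm P"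
      by (simp_all add: mult_ac power2_eq_square)
    have "norm (B ** (P ** B)) \<le> k * b * (k * b * norm P)"
      using k b by (intro order_trans[OF k(2) mult_mono[OF mult_left_mono[OF nB] 1(1)]]) auto
    then show "norm (B ** (P ** B)) \<le> (k * b)\<^sup>2 * norm P" by (simp add: mult_ac power2_eq_square)
  qed
  show ?thesis
  proof (rule that[of "2 * (k * b) + 2 * (k * b)\<^sup>2"])
    show "0 \<le> 2 * (k * b) + 2 * (k * b)\<^sup>2" using k b by simp
    fix B P :: "real^'d^'d" assume B: "B \<in> K"
    have p: "0 \<le> k * b * norm P" "0 \<le> (k * b)\<^sup>2 * norm P" using k b by auto
    have "norm (commutator P B) \<le> norm (P ** B) + norm (B ** P)"
      unfolding commutator_def by (rule norm_triangle_ineq4)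
    then show "norm (commutator P B) \<le> (2 * (k * b) + 2 * (k * b)\<^sup>2) * norm P"
      using *(1,2)[OF B, of P] p unfolding distrib_right by linarith
    have "norm (half_commutator2 P B) \<le> 1/2 * norm (P ** (B ** B) + (B ** B) ** P) + norm (B ** (P ** B))"
      unfolding half_commutator2_def by (rule order_trans[OF norm_triangle_ineq4]) simp
    moreover have "norm (P ** (B ** B) + (B ** B) ** P) \<le> norm (P ** (B ** B)) + norm ((B ** B) ** P)"
      by (rule norm_triangle_ineq)
    ultimately show "norm (half_commutator2 P B) \<le> (2 * (k * b) + 2 * (k * b)\<^sup>2) * norm P"
      using *(3-5)[OF B, of P] p unfolding distrib_right by linarith
  qed
qed

section \<open>Continuity in the tangent matrix and random elements of \<open>CK K\<close>\<close>

lemma continuous_on_rotated: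
  fixes K :: "(real^'d^'d) set"
  assumes "bounded K"
  shows "continuous_on K (\<lambda>B. rotated c B P)"
proof -
  obtain b where b: "\<And>B. B \<in> K \<Longrightarrow> norm B \<le> b" using assms by (auto simp: bounded_iff)
  have c: "continuous_on (cball 0 (\<bar>c\<bar> * b)) (mat_exp :: real^'d^'d \<Rightarrow> _)"
    using mat_exp_bounds[of "\<bar>c\<bar> * b"] by metis
  have "continuous_on K (\<lambda>B. mat_exp (- (c *\<^sub>R B)))" "continuous_on K (\<lambda>B. mat_exp (c *\<^sub>R B))"
    by (rule continuous_on_compose2[OF c]; force intro!: continuous_intros mult_left_mono b)+
  then show ?thesis
    unfolding rotated_def by (intro matmul.continuous_on continuous_intros)
qed

lemma restrict_in_CK:
  assumes "compact K" "continuous_on K f"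
  shows "restrict f K \<in> mspace (CK K)"
proof -
  have "continuous_map (top_of_set K) euclideanreal (restrict f K)"
    unfolding continuous_map_iff_continuous by (rule continuous_on_eq[OF assms(2)]) simp
  then show ?thesis
    using assms(1) unfolding CK_def
    by (subst compactin_mspace_cfunspace) (auto simp: compactin_subtopology)
qed

lemma mdist_CK_le:
  assumes "0 \<le> e" "\<And>B. B \<in> K \<Longrightarrow> \<bar>f B - g B\<bar> \<le> e"
  shows "mdist (CK K) (restrict f K) (restrict g K) \<le> e"
  unfolding CK_def using assms by (intro mdist_cfunspace_le) (auto simp: dist_real_def)

text \<open>Every random element of \<open>CK K\<close> below is, or coincides for large
  \<open>n\<close> with, a continuous image of a finite-dimensional random vector; this settles its
  measurability.\<close>

lemma random_element_continuous_map:
  fixes \<eta> :: "'a \<Rightarrow> 'e::euclidean_space"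
  assumes "\<eta> \<in> borel_measurable M" "continuous_map euclidean (mtopology_of m) \<Psi>"
  shows "random_element M m (\<lambda>\<omega>. \<Psi> (\<eta> \<omega>))"
  unfolding random_element_def
proof (rule measurable_sigma_sets)
  show "sets (sigma (mspace m) {G. openin (mtopology_of m) G}) = sigma_sets (mspace m) {G. openin (mtopology_of m) G}"
    using openin_subset by (intro sets_measure_of) (force simp: mtopology_of_def Metric_space.topspace_mtopology)
  show "{G. openin (mtopology_of m) G} \<subseteq> Pow (mspace m)"
    using openin_subset by force
  show "(\<lambda>\<omega>. \<Psi> (\<eta> \<omega>)) \<in> space M \<rightarrow> mspace m"
    using assms(2) by (auto simp: continuous_map_def)
  fix A assume "A \<in> {G. openin (mtopology_of m) G}"
  then have "open (\<Psi> -` A)"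
    using assms(2) by (auto simp: continuous_map_def vimage_def)
  then show "(\<lambda>\<omega>. \<Psi> (\<eta> \<omega>)) -` A \<inter> space M \<in> sets M"
    using measurable_sets[OF assms(1), of "\<Psi> -` A"] by (simp add: vimage_def)
qed

text \<open>A modulus \<open>D\<close> that does not depend on \<open>B\<close> turns continuity in
  the parameter into continuity for the supremum distance.\<close>

lemma continuous_map_CK:
  fixes F :: "'e::metric_space \<Rightarrow> real^'d^'d \<Rightarrow> real"
  assumes K: "compact K" and F: "\<And>x. continuous_on K (F x)"
    and D: "\<And>x y B. B \<in> K \<Longrightarrow> \<bar>F x B - F y B\<bar> \<le> D x y"
    and D0: "\<And>x. (D x \<longlongrightarrow> 0) (at x)"
  shows "continuous_map euclidean (mtopology_of (CK K)) (\<lambda>x. restrict (F x) K)"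
proof -
  interpret C: Metric_space "mspace (CK K)" "mdist (CK K)" by simp
  show ?thesis
    unfolding mtopology_of_def
    unfolding C.continuous_map_to_metric topspace_euclidean
  proof (intro ballI allI impI)
    fix x :: 'e and e :: real assume e: "e > 0"
    have "\<forall>\<^sub>F y in at x. D x y < e / 2" using order_tendstoD(2)[OF D0, of "e / 2" x] e by simp
    then obtain T where T: "open T" "x \<in> T" "\<And>y. y \<in> T \<Longrightarrow> y \<noteq> x \<Longrightarrow> D x y < e / 2"
      by (auto simp: eventually_at_topological)
    have "restrict (F y) K \<in> C.mball (restrict (F x) K) e" if "y \<in> T" for y
    proof -
      have "mdist (CK K) (restrict (F x) K) (restrict (F y) K) \<le> e / 2"
        using D[of _ x y] T(3)[OF that] e by (intro mdist_CK_le) (cases "y = x"; force)+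
      then show ?thesis using e restrict_in_CK[OF K F] by (simp add: C.in_mball)
    qed
    then show "\<exists>U. openin euclidean U \<and> x \<in> U \<and> (\<forall>y\<in>U. restrict (F y) K \<in> C.mball (restrict (F x) K) e)"
      using T by auto
  qed
qed

section \<open>Order statistics\<close>

definition exceed_count :: "nat \<Rightarrow> (nat \<Rightarrow> 'v::real_normed_vector) \<Rightarrow> real \<Rightarrow> nat" where
  "exceed_count n x t = card {i. i < n \<and> norm (x i) > t}"

text \<open>In an increasing list the entries above \<open>t\<close> form a final segment, so only
  its length matters.\<close>

lemma sorted_nth_gt_iff:
  fixes xs :: "'a::linorder list"
  assumes "sorted xs" "k < length xs"
  shows "rev xs ! k > t \<longleftrightarrow> card {i. i < length xs \<and> xs ! i > t} > k"
proof -
  let ?m = "length xs" and ?A = "{i. i < length xs \<and> xs ! i > t}"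
  have nth: "rev xs ! k = xs ! (?m - Suc k)" using assms by (simp add: rev_nth)
  show ?thesis
  proof
    assume "rev xs ! k > t"
    then have "{?m - Suc k..<?m} \<subseteq> ?A"
      using assms sorted_nth_mono[OF assms(1), of "?m - Suc k"] by (auto simp: nth intro: less_le_trans)
    then have "card {?m - Suc k..<?m} \<le> card ?A" by (intro card_mono) auto
    then show "card ?A > k" using assms(2) by simp
  next
    assume k: "card ?A > k"
    show "rev xs ! k > t"
    proof (rule ccontr)
      assume "\<not> rev xs ! k > t"
      then have le: "xs ! (?m - Suc k) \<le> t" by (simp add: nth)
      have "?A \<subseteq> {?m - k..<?m}"
      proof
        fix i assume i: "i \<in> ?A"
        have "?m - Suc k < i"
        proof (rule ccontr)
          assume "\<not> ?m - Suc k < i"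
          then have "xs ! i \<le> xs ! (?m - Suc k)"
            using assms by (intro sorted_nth_mono) auto
          then show False using i le by auto
        qed
        then show "i \<in> {?m - k..<?m}" using i assms(2) by auto
      qed
      then have "card ?A \<le> card {?m - k..<?m}" by (intro card_mono) auto
      then show False using k assms(2) by simp
    qed
  qed
qed

text \<open>Comparisons with the order statistic become comparisons of counts, which behave well
  under ties and are sums of indicators.\<close>

lemma emp_thresh_gt_iff:
  assumes "k < n"
  shows "emp_thresh n k x > t \<longleftrightarrow> exceed_count n x t > k"
proof -
  let ?ys = "map (\<lambda>i. norm (x i)) [0..<n]"
  have "emp_thresh n k x > t \<longleftrightarrow> card {i. i < length (sort ?ys) \<and> sort ?ys ! i > t} > k"
    unfolding emp_thresh_def using assms by (intro sorted_nth_gt_iff) auto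
  also have "card {i. i < length (sort ?ys) \<and> sort ?ys ! i > t} = length (filter (\<lambda>y. y > t) (sort ?ys))"
    by (simp add: length_filter_conv_card)
  also have "\<dots> = length (filter (\<lambda>y. y > t) ?ys)"
    by (metis filter_sort length_sort)
  also have "\<dots> = exceed_count n x t"
    by (simp add: length_filter_conv_card exceed_count_def cong: conj_cong)
  finally show ?thesis .
qed

lemma emp_thresh_le_iff: "k < n \<Longrightarrow> emp_thresh n k x \<le> t \<longleftrightarrow> exceed_count n x t \<le> k"
  using emp_thresh_gt_iff[of k n t x] by (auto simp: not_less[symmetric])

lemma exceed_count_antimono: "s \<le> t \<Longrightarrow> exceed_count n x t \<le> exceed_count n x s"
  unfolding exceed_count_def by (intro card_mono) auto

lemma exceed_count_sum: "real (exceed_count n x t) = (\<Sum>i<n. of_bool (norm (x i) > t))"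
proof -
  have "{i. i < n \<and> norm (x i) > t} = {..<n} \<inter> {i. norm (x i) > t}" by auto
  then show ?thesis by (simp add: exceed_count_def sum_of_bool_eq)
qed

text \<open>The threshold seen by observation \<open>i\<close>, computed from the other observations:
  deleting an observation above the \<open>(k+1)\<close>-th largest norm turns the latter into the \<open>k\<close>-th largest.\<close>
definition loo_thresh :: "nat \<Rightarrow> nat \<Rightarrow> nat \<Rightarrow> (nat \<Rightarrow> real^'d) \<Rightarrow> real" where
  "loo_thresh n k i x = emp_thresh (n - 1) (k - 1) (\<lambda>j. x (if j < i then j else Suc j))"

lemma exceed_count_remove:
  assumes "i < n"
  shows "exceed_count n x t =
    exceed_count (n - 1) (\<lambda>j. x (if j < i then j else Suc j)) t + of_bool (norm (x i) > t)"
proof -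
  let ?s = "\<lambda>j::nat. if j < i then j else Suc j"
  let ?A = "{j. j < n - 1 \<and> norm (x (?s j)) > t}"
  have inj: "inj ?s" by (auto simp: inj_def split: if_splits)
  have "{j. j < n \<and> norm (x j) > t} = ?s ` ?A \<union> (if norm (x i) > t then {i} else {})"
  proof (intro equalityI subsetI)
    fix j assume j: "j \<in> {j. j < n \<and> norm (x j) > t}"
    show "j \<in> ?s ` ?A \<union> (if norm (x i) > t then {i} else {})"
    proof (cases "j = i")
      case True then show ?thesis using j by auto
    next
      case False
      then consider "j < i" | "j > i" by linarith
      then show ?thesis
      proof cases
        case 1 then have "j \<in> ?A" "j = ?s j" using j assms by auto
        then show ?thesis by blast
      next
        case 2
        then have "j - 1 \<in> ?A" "j = ?s (j - 1)" using j assms by auto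
        then show ?thesis by blast
      qed
    qed
  qed (use assms in \<open>auto split: if_splits\<close>)
  moreover have "card (?s ` ?A) = card ?A" using inj by (meson card_image inj_on_subset subset_UNIV)
  moreover have "i \<notin> ?s ` ?A" by auto
  ultimately show ?thesis unfolding exceed_count_def by simp
qed

lemma loo_thresh_le_iff:
  assumes "i < n" "1 \<le> k" "k < n"
  shows "loo_thresh n k i x \<le> t \<longleftrightarrow> exceed_count n x t - of_bool (norm (x i) > t) < k"
  using assms exceed_count_remove[OF assms(1), of x t]
  by (auto simp: loo_thresh_def emp_thresh_le_iff)

text \<open>The upper bounds of both thresholds are compared through counts. For \<open>t\<close>
  below the norm of observation \<open>i\<close> the two counting conditions coincide, since this
  observation accounts for one count and for the shift from \<open>k\<close> to
  \<open>k - 1\<close>; for other \<open>t\<close> the leave-one-out condition is the stricter one.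
  Hence the empirical threshold never exceeds the leave-one-out threshold.\<close>

lemma loo_thresh:
  assumes "i < n" "1 \<le> k" "k < n"
  shows norm_gt_emp_thresh_iff: "norm (x i) > emp_thresh n k x \<longleftrightarrow> norm (x i) > loo_thresh n k i x"
    and loo_thresh_eq: "norm (x i) > emp_thresh n k x \<Longrightarrow> loo_thresh n k i x = emp_thresh n k x"
proof -
  let ?e = "emp_thresh n k x" and ?l = "loo_thresh n k i x" and ?r = "norm (x i)"
  note E = emp_thresh_le_iff[OF assms(3), of x] and L = loo_thresh_le_iff[OF assms, of x]
  have le: "?l \<le> t" if "?e \<le> t" "?r > t" for t
    using that E[of t] L[of t] assms(2) by simp
  have ge: "?e \<le> t" if "?l \<le> t" for t
    using that E[of t] L[of t] by (cases "?r > t") auto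
  show eq: "?l = ?e" if "?r > ?e" using le[OF order_refl that] ge[of ?l] by auto
  have "?r > ?e" if "?r > ?l" using ge[of ?l] that by auto
  then show "?r > ?e \<longleftrightarrow> ?r > ?l" using eq by auto
qed

lemma emp_count_le: "k < n \<Longrightarrow> exceed_count n x (emp_thresh n k x) \<le> k"
  using emp_thresh_le_iff by blast

lemma emp_thresh_cong: "(\<And>i. i < n \<Longrightarrow> x i = y i) \<Longrightarrow> emp_thresh n k x = emp_thresh n k y"
proof -
  assume "\<And>i. i < n \<Longrightarrow> x i = y i"
  then have "map (\<lambda>i. norm (x i)) [0..<n] = map (\<lambda>i. norm (y i)) [0..<n]" by simp
  then show ?thesis unfolding emp_thresh_def by (simp only:)
qed

lemma loo_thresh_cong:
  assumes "i < n" "\<And>j. j < n \<Longrightarrow> j \<noteq> i \<Longrightarrow> x j = y j"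
  shows "loo_thresh n k i x = loo_thresh n k i y"
  unfolding loo_thresh_def using assms by (intro emp_thresh_cong) auto

lemma exceed_count_measurable [measurable]:
  fixes f :: "nat \<Rightarrow> 'a \<Rightarrow> real^'d"
  assumes "\<And>i. i < n \<Longrightarrow> f i \<in> borel_measurable M"
  shows "(\<lambda>\<omega>. real (exceed_count n (\<lambda>i. f i \<omega>) t)) \<in> borel_measurable M"
  unfolding exceed_count_sum
proof (rule borel_measurable_sum)
  fix i assume "i \<in> {..<n}"
  then have [measurable]: "f i \<in> borel_measurable M" using assms by simp
  show "(\<lambda>\<omega>. of_bool (norm (f i \<omega>) > t) :: real) \<in> borel_measurable M" by measurable
qed

lemma emp_thresh_measurable:
  fixes f :: "nat \<Rightarrow> 'a \<Rightarrow> real^'d"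
  assumes "k < n" "\<And>i. i < n \<Longrightarrow> f i \<in> borel_measurable M"
  shows "(\<lambda>\<omega>. emp_thresh n k (\<lambda>i. f i \<omega>)) \<in> borel_measurable M"
  unfolding borel_measurable_iff_le
proof
  fix t
  have [measurable]: "(\<lambda>\<omega>. real (exceed_count n (\<lambda>i. f i \<omega>) t)) \<in> borel_measurable M"
    using assms(2) by (rule exceed_count_measurable)
  have "{\<omega> \<in> space M. emp_thresh n k (\<lambda>i. f i \<omega>) \<le> t} =
     {\<omega> \<in> space M. real (exceed_count n (\<lambda>i. f i \<omega>) t) \<le> real k}"
    by (simp add: emp_thresh_le_iff[OF assms(1)])
  also have "\<dots> \<in> sets M" by measurable
  finally show "{\<omega> \<in> space M. emp_thresh n k (\<lambda>i. f i \<omega>) \<le> t} \<in> sets M" .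
qed

lemma loo_thresh_measurable:
  fixes f :: "nat \<Rightarrow> 'a \<Rightarrow> real^'d"
  assumes "i < n" "1 \<le> k" "k < n" "\<And>j. j < n \<Longrightarrow> j \<noteq> i \<Longrightarrow> f j \<in> borel_measurable M"
  shows "(\<lambda>\<omega>. loo_thresh n k i (\<lambda>j. f j \<omega>)) \<in> borel_measurable M"
  unfolding loo_thresh_def using assms by (intro emp_thresh_measurable) auto

section \<open>Smallness and boundedness in probability\<close>

text \<open>Convergence to 0 in probability; the companion notion that follows is tightness. The
  bound is required outside some event, so both notions apply to quantities whose measurability is
  not established, such as distances in \<open>CK K\<close>.\<close>

definition small_in_prob :: "'a measure \<Rightarrow> (nat \<Rightarrow> 'a \<Rightarrow> real) \<Rightarrow> bool" where
  "small_in_prob M Z \<longleftrightarrow> (\<forall>e>0. \<forall>d>0. \<forall>\<^sub>F n in sequentially.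
     \<exists>A\<in>sets M. measure M A < d \<and> (\<forall>\<omega>\<in>space M - A. \<bar>Z n \<omega>\<bar> \<le> e))"

definition bounded_in_prob :: "'a measure \<Rightarrow> (nat \<Rightarrow> 'a \<Rightarrow> real) \<Rightarrow> bool" where
  "bounded_in_prob M Z \<longleftrightarrow> (\<forall>d>0. \<exists>r>0. \<forall>\<^sub>F n in sequentially.
     \<exists>A\<in>sets M. measure M A < d \<and> (\<forall>\<omega>\<in>space M - A. \<bar>Z n \<omega>\<bar> \<le> r))"

context prob_space
begin

lemma small_in_probI:
  assumes "\<And>e d. e > 0 \<Longrightarrow> d > 0 \<Longrightarrow> \<forall>\<^sub>F n in sequentially.
     \<exists>A\<in>sets M. measure M A < d \<and> (\<forall>\<omega>\<in>space M - A. \<bar>Z n \<omega>\<bar> \<le> e)"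
  shows "small_in_prob M Z"
  using assms by (simp add: small_in_prob_def)

lemma small_in_probD:
  "small_in_prob M Z \<Longrightarrow> e > 0 \<Longrightarrow> d > 0 \<Longrightarrow> \<forall>\<^sub>F n in sequentially.
     \<exists>A\<in>sets M. measure M A < d \<and> (\<forall>\<omega>\<in>space M - A. \<bar>Z n \<omega>\<bar> \<le> e)"
  by (simp add: small_in_prob_def)

lemma bounded_in_probE:
  assumes "bounded_in_prob M Z" "d > 0"
  obtains r where "r > 0" "\<forall>\<^sub>F n in sequentially.
     \<exists>A\<in>sets M. measure M A < d \<and> (\<forall>\<omega>\<in>space M - A. \<bar>Z n \<omega>\<bar> \<le> r)"
  using assms unfolding bounded_in_prob_def by auto

lemma small_in_prob_prob_tendsto:
  assumes "\<And>e. e > 0 \<Longrightarrow> (\<lambda>n. prob (A e n)) \<longlonglongrightarrow> 0" "\<And>e n. A e n \<in> events"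
    and "\<And>e. e > 0 \<Longrightarrow> \<forall>\<^sub>F n in sequentially. \<forall>\<omega>\<in>space M - A e n. \<bar>Z n \<omega>\<bar> \<le> e"
  shows "small_in_prob M Z"
proof (rule small_in_probI)
  fix e d :: real assume "e > 0" "d > 0"
  show "\<forall>\<^sub>F n in sequentially. \<exists>A\<in>events. prob A < d \<and> (\<forall>\<omega>\<in>space M - A. \<bar>Z n \<omega>\<bar> \<le> e)"
    using order_tendstoD(2)[OF assms(1)[OF \<open>e > 0\<close>] \<open>d > 0\<close>] assms(3)[OF \<open>e > 0\<close>]
    by eventually_elim (use assms(2) in blast)
qed

lemma small_in_prob_mono:
  assumes Y: "small_in_prob M Y" and le: "\<forall>\<^sub>F n in sequentially. AE \<omega> in M. \<bar>Z n \<omega>\<bar> \<le> \<bar>Y n \<omega>\<bar>"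
  shows "small_in_prob M Z"
proof (rule small_in_probI)
  fix e d :: real assume "e > 0" "d > 0"
  show "\<forall>\<^sub>F n in sequentially. \<exists>A\<in>events. prob A < d \<and> (\<forall>\<omega>\<in>space M - A. \<bar>Z n \<omega>\<bar> \<le> e)"
    using small_in_probD[OF Y \<open>e > 0\<close> \<open>d > 0\<close>] le
  proof eventually_elim
    case (elim n)
    then obtain A where A: "A \<in> events" "prob A < d" "\<forall>\<omega>\<in>space M - A. \<bar>Y n \<omega>\<bar> \<le> e" by blast
    obtain N where N: "N \<in> null_sets M" "{\<omega>\<in>space M. \<not> \<bar>Z n \<omega>\<bar> \<le> \<bar>Y n \<omega>\<bar>} \<subseteq> N"
      using elim(2) by (auto simp: eventually_ae_filter)
    have "prob (A \<union> N) = prob A" using A(1) N(1) by (simp add: measure_Un_null_set)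
    moreover have "\<forall>\<omega>\<in>space M - (A \<union> N). \<bar>Z n \<omega>\<bar> \<le> e" using A(3) N(2) by force
    ultimately show ?case using A N by (intro bexI[of _ "A \<union> N"]) (auto simp: null_setsD2)
  qed
qed

lemma small_in_prob_add:
  assumes Y: "small_in_prob M Y" and Z: "small_in_prob M Z"
  shows "small_in_prob M (\<lambda>n \<omega>. Y n \<omega> + Z n \<omega>)"
proof (rule small_in_probI)
  fix e d :: real assume ed: "e > 0" "d > 0"
  show "\<forall>\<^sub>F n in sequentially. \<exists>A\<in>events. prob A < d \<and> (\<forall>\<omega>\<in>space M - A. \<bar>Y n \<omega> + Z n \<omega>\<bar> \<le> e)"
    using small_in_probD[OF Y half_gt_zero[OF ed(1)] half_gt_zero[OF ed(2)]]
      small_in_probD[OF Z half_gt_zero[OF ed(1)] half_gt_zero[OF ed(2)]]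
  proof eventually_elim
    case (elim n)
    then obtain A B where A: "A \<in> events" "prob A < d/2" "\<forall>\<omega>\<in>space M - A. \<bar>Y n \<omega>\<bar> \<le> e/2"
      and B: "B \<in> events" "prob B < d/2" "\<forall>\<omega>\<in>space M - B. \<bar>Z n \<omega>\<bar> \<le> e/2" by blast
    have "prob (A \<union> B) < d" using A(1,2) B(1,2) measure_Un_le[of A M B] by linarith
    moreover have "\<bar>Y n \<omega> + Z n \<omega>\<bar> \<le> e" if "\<omega> \<in> space M - (A \<union> B)" for \<omega>
    proof -
      have "\<bar>Y n \<omega>\<bar> \<le> e/2" "\<bar>Z n \<omega>\<bar> \<le> e/2" using that A B by auto
      then show ?thesis by linarith
    qed
    ultimately show ?case using A B by (intro bexI[of _ "A \<union> B"]) auto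
  qed
qed

lemma small_in_prob_mult:
  assumes Y: "small_in_prob M Y" and Z: "bounded_in_prob M Z"
  shows "small_in_prob M (\<lambda>n \<omega>. Y n \<omega> * Z n \<omega>)"
proof (rule small_in_probI)
  fix e d :: real assume ed: "e > 0" "d > 0"
  obtain r where r: "r > 0" "\<forall>\<^sub>F n in sequentially. \<exists>A\<in>events. prob A < d/2 \<and> (\<forall>\<omega>\<in>space M - A. \<bar>Z n \<omega>\<bar> \<le> r)"
    by (rule bounded_in_probE[OF Z half_gt_zero[OF ed(2)]])
  show "\<forall>\<^sub>F n in sequentially. \<exists>A\<in>events. prob A < d \<and> (\<forall>\<omega>\<in>space M - A. \<bar>Y n \<omega> * Z n \<omega>\<bar> \<le> e)"
    using small_in_probD[OF Y divide_pos_pos[OF ed(1) r(1)] half_gt_zero[OF ed(2)]] r(2)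
  proof eventually_elim
    case (elim n)
    then obtain A B where A: "A \<in> events" "prob A < d/2" "\<forall>\<omega>\<in>space M - A. \<bar>Y n \<omega>\<bar> \<le> e/r"
      and B: "B \<in> events" "prob B < d/2" "\<forall>\<omega>\<in>space M - B. \<bar>Z n \<omega>\<bar> \<le> r" by blast
    have "prob (A \<union> B) < d" using A(1,2) B(1,2) measure_Un_le[of A M B] by linarith
    moreover have "\<bar>Y n \<omega> * Z n \<omega>\<bar> \<le> e" if "\<omega> \<in> space M - (A \<union> B)" for \<omega>
    proof -
      have "\<bar>Y n \<omega>\<bar> \<le> e/r" "\<bar>Z n \<omega>\<bar> \<le> r" using that A B by auto
      then have "\<bar>Y n \<omega>\<bar> * \<bar>Z n \<omega>\<bar> \<le> e/r * r" using ed r by (intro mult_mono) auto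
      then show ?thesis using r by (simp add: abs_mult)
    qed
    ultimately show ?case using A B by (intro bexI[of _ "A \<union> B"]) auto
  qed
qed

lemma bounded_in_probI_const:
  assumes "\<forall>\<^sub>F n in sequentially. AE \<omega> in M. \<bar>Z n \<omega>\<bar> \<le> r"
  shows "bounded_in_prob M Z"
  unfolding bounded_in_prob_def
proof (intro allI impI)
  fix d :: real assume d: "d > 0"
  have "\<forall>\<^sub>F n in sequentially. \<exists>A\<in>events. prob A < d \<and> (\<forall>\<omega>\<in>space M - A. \<bar>Z n \<omega>\<bar> \<le> max 1 r)"
    using assms
  proof eventually_elim
    case (elim n)
    then obtain N where N: "N \<in> null_sets M" "{\<omega>\<in>space M. \<not> \<bar>Z n \<omega>\<bar> \<le> r} \<subseteq> N"
      by (auto simp: eventually_ae_filter)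
    then show ?case using d by (intro bexI[of _ N]) (force simp: measure_eq_0_null_sets null_setsD2)+
  qed
  then show "\<exists>r>0. \<forall>\<^sub>F n in sequentially. \<exists>A\<in>events. prob A < d \<and> (\<forall>\<omega>\<in>space M - A. \<bar>Z n \<omega>\<bar> \<le> r)"
    by (intro exI[of _ "max 1 r"]) auto
qed

lemma small_in_prob_const:
  assumes "a \<longlonglongrightarrow> 0"
  shows "small_in_prob M (\<lambda>n \<omega>. a n)"
proof (rule small_in_probI)
  fix e d :: real assume "e > 0" "d > 0"
  show "\<forall>\<^sub>F n in sequentially. \<exists>A\<in>events. prob A < d \<and> (\<forall>\<omega>\<in>space M - A. \<bar>a n\<bar> \<le> e)"
    using tendstoD[OF assms \<open>e > 0\<close>] by eventually_elim (use \<open>d > 0\<close> in \<open>auto intro!: bexI[of _ "{}"]\<close>)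
qed

lemma small_in_prob_cmult:
  assumes "small_in_prob M Z"
  shows "small_in_prob M (\<lambda>n \<omega>. c * Z n \<omega>)"
  using small_in_prob_mult[OF assms bounded_in_probI_const[of "\<lambda>_ _. c" "\<bar>c\<bar>"]] by (simp add: mult.commute)

text \<open>Chebyshev's inequality, in the form used for the random sums below.\<close>

lemma second_moment_prob_le:
  assumes "Z \<in> borel_measurable M" "integrable M (\<lambda>\<omega>. (Z \<omega>)\<^sup>2)" "r > 0"
  shows "prob {\<omega>\<in>space M. \<bar>Z \<omega>\<bar> > r} \<le> expectation (\<lambda>\<omega>. (Z \<omega>)\<^sup>2) / r\<^sup>2"
proof -
  have "prob {\<omega>\<in>space M. \<bar>Z \<omega>\<bar> > r} \<le> prob {\<omega>\<in>space M. (Z \<omega>)\<^sup>2 \<ge> r\<^sup>2}"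
  proof (rule finite_measure_mono)
    show "{\<omega>\<in>space M. \<bar>Z \<omega>\<bar> > r} \<subseteq> {\<omega>\<in>space M. (Z \<omega>)\<^sup>2 \<ge> r\<^sup>2}"
      using assms(3) by (auto intro!: abs_le_square_iff[THEN iffD1])
    show "{\<omega>\<in>space M. (Z \<omega>)\<^sup>2 \<ge> r\<^sup>2} \<in> events" using assms(1) by measurable
  qed
  also have "\<dots> \<le> expectation (\<lambda>\<omega>. (Z \<omega>)\<^sup>2) / r\<^sup>2"
    using assms by (intro integral_Markov_inequality_measure[where A = "{}"]) auto
  finally show ?thesis .
qed

lemma small_in_prob_second_moment:
  assumes "\<And>n. Z n \<in> borel_measurable M"
    and "\<forall>\<^sub>F n in sequentially. integrable M (\<lambda>\<omega>. (Z n \<omega>)\<^sup>2) \<and> expectation (\<lambda>\<omega>. (Z n \<omega>)\<^sup>2) \<le> a n" "a \<longlonglongrightarrow> 0"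
  shows "small_in_prob M Z"
proof (rule small_in_prob_prob_tendsto[where A = "\<lambda>e n. {\<omega>\<in>space M. \<bar>Z n \<omega>\<bar> > e}"])
  fix e :: real assume e: "e > 0"
  have [measurable]: "Z n \<in> borel_measurable M" for n by fact
  show "(\<lambda>n. prob {\<omega>\<in>space M. \<bar>Z n \<omega>\<bar> > e}) \<longlonglongrightarrow> 0"
  proof (rule tendsto_sandwich[OF _ _ tendsto_const])
    show "(\<lambda>n. a n / e\<^sup>2) \<longlonglongrightarrow> 0" using tendsto_divide[OF assms(3) tendsto_const, of "e\<^sup>2"] e by simp
    show "\<forall>\<^sub>F n in sequentially. prob {\<omega>\<in>space M. \<bar>Z n \<omega>\<bar> > e} \<le> a n / e\<^sup>2"
      using assms(2)
    proof eventually_elim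
      case (elim n)
      then show ?case using second_moment_prob_le[OF assms(1), of n e] e
        by (meson divide_right_mono order_trans zero_le_power2)
    qed
  qed simp
qed (use assms(1) in \<open>auto simp: not_less intro!: always_eventually\<close>)

lemma bounded_in_prob_second_moment:
  assumes "\<And>n. Z n \<in> borel_measurable M"
    and "\<forall>\<^sub>F n in sequentially. integrable M (\<lambda>\<omega>. (Z n \<omega>)\<^sup>2) \<and> expectation (\<lambda>\<omega>. (Z n \<omega>)\<^sup>2) \<le> a"
  shows "bounded_in_prob M Z"
  unfolding bounded_in_prob_def
proof (intro allI impI)
  fix d :: real assume d: "d > 0"
  have [measurable]: "Z n \<in> borel_measurable M" for n by fact
  \<comment> \<open>Large enough for the Chebyshev bound \<open>a / r\<^sup>2\<close> to stay below
    \<open>d\<close>; the summand 1 keeps \<open>r\<close> positive.\<close>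
  define r where "r = sqrt ((\<bar>a\<bar> + 1) / d * 2)"
  have r: "r > 0" using d by (simp add: r_def)
  have r2: "r\<^sup>2 = (\<bar>a\<bar> + 1) / d * 2" using d by (simp add: r_def)
  have "\<forall>\<^sub>F n in sequentially. \<exists>A\<in>events. prob A < d \<and> (\<forall>\<omega>\<in>space M - A. \<bar>Z n \<omega>\<bar> \<le> r)"
    using assms(2)
  proof eventually_elim
    case (elim n)
    have "prob {\<omega>\<in>space M. \<bar>Z n \<omega>\<bar> > r} \<le> a / r\<^sup>2"
      using second_moment_prob_le[OF assms(1), of n r] r elim
      by (meson divide_right_mono order_trans zero_le_power2)
    also have "\<dots> < d"
    proof -
      have "d * r\<^sup>2 = 2 * (\<bar>a\<bar> + 1)" using d by (simp add: r2)
      then have "a < d * r\<^sup>2" by (simp add: abs_if)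
      then show ?thesis using r by (simp add: pos_divide_less_eq)
    qed
    finally show ?case
      by (intro bexI[of _ "{\<omega>\<in>space M. \<bar>Z n \<omega>\<bar> > r}"]) auto
  qed
  then show "\<exists>r>0. \<forall>\<^sub>F n in sequentially. \<exists>A\<in>events. prob A < d \<and> (\<forall>\<omega>\<in>space M - A. \<bar>Z n \<omega>\<bar> \<le> r)"
    using r by blast
qed

lemma small_imp_bounded_in_prob: "small_in_prob M Z \<Longrightarrow> bounded_in_prob M Z"
  unfolding bounded_in_prob_def
proof (intro allI impI)
  fix d :: real assume "small_in_prob M Z" "d > 0"
  from small_in_probD[OF this(1) zero_less_one this(2)]
  show "\<exists>r>0. \<forall>\<^sub>F n in sequentially. \<exists>A\<in>events. prob A < d \<and> (\<forall>\<omega>\<in>space M - A. \<bar>Z n \<omega>\<bar> \<le> r)"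
    by (intro exI[of _ 1] conjI zero_less_one)
qed

lemma bounded_in_prob_add:
  assumes Y: "bounded_in_prob M Y" and Z: "bounded_in_prob M Z"
  shows "bounded_in_prob M (\<lambda>n \<omega>. Y n \<omega> + Z n \<omega>)"
  unfolding bounded_in_prob_def
proof (intro allI impI)
  fix d :: real assume d: "d > 0"
  obtain r where r: "r > 0" "\<forall>\<^sub>F n in sequentially. \<exists>A\<in>events. prob A < d/2 \<and> (\<forall>\<omega>\<in>space M - A. \<bar>Y n \<omega>\<bar> \<le> r)"
    by (rule bounded_in_probE[OF Y half_gt_zero[OF d]])
  obtain s where s: "s > 0" "\<forall>\<^sub>F n in sequentially. \<exists>A\<in>events. prob A < d/2 \<and> (\<forall>\<omega>\<in>space M - A. \<bar>Z n \<omega>\<bar> \<le> s)"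
    by (rule bounded_in_probE[OF Z half_gt_zero[OF d]])
  have "\<forall>\<^sub>F n in sequentially. \<exists>A\<in>events. prob A < d \<and> (\<forall>\<omega>\<in>space M - A. \<bar>Y n \<omega> + Z n \<omega>\<bar> \<le> r + s)"
    using r(2) s(2)
  proof eventually_elim
    case (elim n)
    then obtain A B where A: "A \<in> events" "prob A < d/2" "\<forall>\<omega>\<in>space M - A. \<bar>Y n \<omega>\<bar> \<le> r"
      and B: "B \<in> events" "prob B < d/2" "\<forall>\<omega>\<in>space M - B. \<bar>Z n \<omega>\<bar> \<le> s" by blast
    have "prob (A \<union> B) < d" using A(1,2) B(1,2) measure_Un_le[of A M B] by linarith
    moreover have "\<bar>Y n \<omega> + Z n \<omega>\<bar> \<le> r + s" if "\<omega> \<in> space M - (A \<union> B)" for \<omega>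
    proof -
      have "\<bar>Y n \<omega>\<bar> \<le> r" "\<bar>Z n \<omega>\<bar> \<le> s" using that A B by auto
      then show ?thesis by linarith
    qed
    ultimately show ?case using A B by (intro bexI[of _ "A \<union> B"]) auto
  qed
  then show "\<exists>r>0. \<forall>\<^sub>F n in sequentially. \<exists>A\<in>events. prob A < d \<and> (\<forall>\<omega>\<in>space M - A. \<bar>Y n \<omega> + Z n \<omega>\<bar> \<le> r)"
    using r s by (intro exI[of _ "r + s"]) auto
qed

text \<open>Bounded convergence: off the exceptional set the integrand is small, on it the uniform
  bound is multiplied by a small probability.\<close>

lemma expectation_small_in_prob:
  assumes Z: "small_in_prob M Z" and bnd: "\<forall>\<^sub>F n in sequentially. AE \<omega> in M. \<bar>Z n \<omega>\<bar> \<le> B"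
    and meas: "\<And>n. Z n \<in> borel_measurable M"
  shows "(\<lambda>n. expectation (\<lambda>\<omega>. \<bar>Z n \<omega>\<bar>)) \<longlonglongrightarrow> 0"
proof (rule LIMSEQ_I)
  fix r :: real assume r: "r > 0"
  \<comment> \<open>Chosen so that the exceptional set contributes at most
    \<open>r / 2\<close>.\<close>
  define d where "d = r / (2 * (\<bar>B\<bar> + 1))"
  have d: "d > 0" using r by (simp add: d_def add_nonneg_pos)
  have r4: "r / 4 > 0" using r by simp
  have "\<forall>\<^sub>F n in sequentially. norm (expectation (\<lambda>\<omega>. \<bar>Z n \<omega>\<bar>) - 0) < r"
    using small_in_probD[OF Z r4 d] bnd
  proof eventually_elim
    case (elim n)
    then obtain A where A: "A \<in> events" "prob A < d" "\<forall>\<omega>\<in>space M - A. \<bar>Z n \<omega>\<bar> \<le> r/4" by blast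
    note [measurable] = meas[of n] A(1)
    have "expectation (\<lambda>\<omega>. \<bar>Z n \<omega>\<bar>) \<le> expectation (\<lambda>\<omega>. r/4 + \<bar>B\<bar> * indicator A \<omega>)"
    proof (rule integral_mono_AE)
      show "integrable M (\<lambda>\<omega>. \<bar>Z n \<omega>\<bar>)"
        using elim(2) by (intro integrable_const_bound[where B = B]) auto
      show "integrable M (\<lambda>\<omega>. r/4 + \<bar>B\<bar> * indicator A \<omega>)"
        by (intro integrable_const_bound[where B = "r/4 + \<bar>B\<bar>"]) (use r in \<open>auto simp: indicator_def\<close>)
      show "AE \<omega> in M. \<bar>Z n \<omega>\<bar> \<le> r/4 + \<bar>B\<bar> * indicator A \<omega>"
        using elim(2) AE_space
      proof eventually_elim
        case (elim \<omega>) then show ?case using A(3) r by (cases "\<omega> \<in> A") auto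
      qed
    qed
    also have "\<dots> = r/4 + \<bar>B\<bar> * prob A"
    proof -
      have "integrable M (indicat_real A)"
        using A(1) by (intro integrable_const_bound[where B = 1]) auto
      then show ?thesis using A(1) by (simp add: prob_space)
    qed
    also have "\<bar>B\<bar> * prob A \<le> \<bar>B\<bar> * d" using A(2) by (intro mult_left_mono) auto
    also have "\<bar>B\<bar> * d \<le> (\<bar>B\<bar> + 1) * d" using d by (intro mult_right_mono) auto
    also have "(\<bar>B\<bar> + 1) * d = r / 2" unfolding d_def by (simp add: field_simps) 
    finally have "expectation (\<lambda>\<omega>. \<bar>Z n \<omega>\<bar>) < r" using r by simp
    moreover have "0 \<le> expectation (\<lambda>\<omega>. \<bar>Z n \<omega>\<bar>)" by (rule integral_nonneg_AE) auto
    ultimately show ?case by simp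
  qed
  then show "\<exists>n0. \<forall>n\<ge>n0. norm (expectation (\<lambda>\<omega>. \<bar>Z n \<omega>\<bar>) - 0) < r"
    by (simp add: eventually_sequentially)
qed

end

section \<open>Weak convergence\<close>

text \<open>Real trigonometric polynomials. The phase \<open>b\<close> covers sines as well, which
  makes the class an algebra, and the mean of each generator is determined by the characteristic
  function.\<close>

inductive trig_poly :: "('e::real_inner \<Rightarrow> real) \<Rightarrow> bool" where
  cos: "trig_poly (\<lambda>x. a * cos (u \<bullet> x + b))"
| add: "trig_poly f \<Longrightarrow> trig_poly g \<Longrightarrow> trig_poly (\<lambda>x. f x + g x)"

lemma trig_poly_const: "trig_poly (\<lambda>x. c)"
  using trig_poly.cos[of c 0 0] by simp

lemma trig_poly_mult_cos:
  assumes "trig_poly f"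
  shows "trig_poly (\<lambda>x. f x * (a * cos (u \<bullet> x + b)))"
  using assms
proof induction
  case (cos a' u' b')
  have "a' * cos (u' \<bullet> x + b') * (a * cos (u \<bullet> x + b)) =
     (a' * a / 2) * cos ((u' - u) \<bullet> x + (b' - b)) + (a' * a / 2) * cos ((u' + u) \<bullet> x + (b' + b))" for x
  proof -
    have "u' \<bullet> x + b' - (u \<bullet> x + b) = (u' - u) \<bullet> x + (b' - b)"
      "u' \<bullet> x + b' + (u \<bullet> x + b) = (u' + u) \<bullet> x + (b' + b)" by (simp_all add: inner_diff_left inner_add_left)
    then show ?thesis
      using cos_times_cos[of "u' \<bullet> x + b'" "u \<bullet> x + b"]
      by (simp add: algebra_simps add_divide_distrib)
  qed
  then show ?case by (simp only: trig_poly.add[OF trig_poly.cos trig_poly.cos])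
next
  case (add f g)
  then show ?case using trig_poly.add by (simp add: distrib_right)
qed

lemma trig_poly_mult:
  assumes "trig_poly g" "trig_poly f"
  shows "trig_poly (\<lambda>x. f x * g x)"
  using assms(1)
proof induction
  case (cos a u b) then show ?case by (rule trig_poly_mult_cos[OF assms(2)])
next
  case (add g h)
  then show ?case using trig_poly.add by (simp add: distrib_left)
qed

lemma trig_poly_continuous: "trig_poly f \<Longrightarrow> continuous_on S f"
  by (induction rule: trig_poly.induct) (auto intro!: continuous_intros)

lemma trig_poly_bounded: "trig_poly f \<Longrightarrow> \<exists>B. \<forall>x. \<bar>f x\<bar> \<le> B"
proof (induction rule: trig_poly.induct)
  case (cos a u b)
  show ?case by (rule exI[of _ "\<bar>a\<bar>"]) (simp add: abs_mult mult_left_le)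
next
  case (add f g)
  then obtain B B' where "\<And>x. \<bar>f x\<bar> \<le> B" "\<And>x. \<bar>g x\<bar> \<le> B'" by auto
  then show ?case by (intro exI[of _ "B + B'"] allI order_trans[OF abs_triangle_ineq] add_mono)
qed

lemma trig_poly_polynomial:
  fixes p :: "real \<Rightarrow> real"
  assumes p: "real_polynomial_function p" and f: "trig_poly f"
  shows "trig_poly (\<lambda>x. p (f x))"
  using p
proof induction
  case (linear g)
  then have "g y = y * g 1" for y
    using linear_cmul[OF bounded_linear.linear, of g y 1] by simp
  then have "(\<lambda>x. g (f x)) = (\<lambda>x. f x * g 1)" by (intro ext) 
  moreover have "trig_poly (\<lambda>x. f x * g 1)" by (rule trig_poly_mult[OF trig_poly_const f])
  ultimately show ?case by (simp only:)
next
  case (const c) show ?case by (rule trig_poly_const)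
next
  case (add p q) then show ?case by (intro trig_poly.add)
next
  case (mult p q) then show ?case by (intro trig_poly_mult)
qed

text \<open>A trigonometric polynomial that is close to \<open>h\<close> on the ball can be large elsewhere;
  it is cut off by a polynomial that imitates truncation at the level \<open>C\<close>.\<close>
lemma trig_poly_approx:
  fixes h :: "'e::euclidean_space \<Rightarrow> real"
  assumes h: "continuous_on UNIV h" "\<And>x. \<bar>h x\<bar> \<le> C" and e: "e > 0"
  obtains q where "trig_poly q" "\<And>x. \<bar>q x\<bar> \<le> C + e" "\<And>x. norm x \<le> r \<Longrightarrow> \<bar>q x - h x\<bar> \<le> 2 * e"
proof -
  have "\<exists>f. trig_poly f \<and> (\<forall>x\<in>cball 0 r. \<bar>h x - f x\<bar> < e)"
  proof (rule Stone_Weierstrass_HOL[where P = trig_poly])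
    fix x y :: 'e assume "x \<in> cball 0 r \<and> y \<in> cball 0 r \<and> x \<noteq> y"
    then have xy: "x - y \<noteq> 0" by simp
    define n where "n = norm (x - y)"
    have n: "n > 0" using xy by (simp add: n_def)
    \<comment> \<open>Scaled such that \<open>u \<bullet> x\<close> and \<open>u \<bullet> y\<close>
      differ by \<open>pi / 2\<close>; with the phase in \<open>?f\<close> the cosine is -1 at
      \<open>x\<close> and 0 at \<open>y\<close>.\<close>
    define u where "u = (pi / (2 * n\<^sup>2)) *\<^sub>R (x - y)"
    let ?f = "\<lambda>z. 1 * cos (u \<bullet> z + (pi / 2 - u \<bullet> y))"
    have "u \<bullet> x - u \<bullet> y = (pi / (2 * n\<^sup>2)) * ((x - y) \<bullet> (x - y))"
      by (simp add: u_def inner_diff_right right_diff_distrib diff_divide_distrib)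
    also have "\<dots> = pi / 2" using n by (simp add: n_def power2_norm_eq_inner)
    finally have "u \<bullet> x + (pi / 2 - u \<bullet> y) = pi" by simp
    then have "?f x = -1" by (metis cos_pi mult_1)
    moreover have "?f y = 0" by simp
    ultimately have "?f x \<noteq> ?f y" by simp
    then show "\<exists>f. trig_poly f \<and> f x \<noteq> f y" using trig_poly.cos[of 1] by metis
  qed (use h e in \<open>auto intro: trig_poly_const trig_poly.add trig_poly_mult trig_poly_continuous
        continuous_on_subset\<close>)
  then obtain f where f: "trig_poly f" "\<And>x. norm x \<le> r \<Longrightarrow> \<bar>h x - f x\<bar> < e" by auto
  obtain B where B: "\<And>x. \<bar>f x\<bar> \<le> B" using trig_poly_bounded[OF f(1)] by auto
  \<comment> \<open>Truncation at level \<open>C\<close>. It fixes the values of \<open>h\<close>,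
    so it does not increase the error on the ball; its polynomial imitation has to be good only on
    the range of \<open>f\<close>, which is bounded.\<close>
  define cl where "cl y = max (- C) (min C y)" for y :: real
  have "continuous_on {-B..B} cl" unfolding cl_def by (intro continuous_intros)
  then obtain p where p: "real_polynomial_function p" "\<And>y. y \<in> {-B..B} \<Longrightarrow> \<bar>cl y - p y\<bar> < e"
    using Stone_Weierstrass_real_polynomial_function[of "{-B..B}" cl e] e by auto
  have C: "C \<ge> 0" using h(2)[of 0] by linarith
  have pf: "\<bar>cl (f x) - p (f x)\<bar> < e" for x using p(2) B[of x] by (auto simp: abs_le_iff)
  have cl_le: "\<bar>cl y\<bar> \<le> C" for y using C by (auto simp: cl_def)
  have cl_h: "\<bar>cl (f x) - h x\<bar> \<le> \<bar>f x - h x\<bar>" for x using h(2)[of x] by (auto simp: cl_def)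
  show ?thesis
  proof (rule that[OF trig_poly_polynomial[OF p(1) f(1)]])
    fix x
    show "\<bar>p (f x)\<bar> \<le> C + e" using pf[of x] cl_le[of "f x"] by linarith
    show "\<bar>p (f x) - h x\<bar> \<le> 2 * e" if "norm x \<le> r"
      using pf[of x] cl_h[of x] f(2)[OF that] by linarith
  qed
qed

lemma (in prob_space) expectation_diff_le:
  assumes [measurable]: "f \<in> borel_measurable M" "g \<in> borel_measurable M" "A \<in> events"
    and bnd: "\<And>\<omega>. \<bar>f \<omega>\<bar> \<le> B" "\<And>\<omega>. \<bar>g \<omega>\<bar> \<le> B"
    and le: "\<And>\<omega>. \<omega> \<in> space M - A \<Longrightarrow> \<bar>f \<omega> - g \<omega>\<bar> \<le> e" and e: "0 \<le> e"
  shows "\<bar>expectation f - expectation g\<bar> \<le> e + 2 * B * prob A"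
proof -
  have B: "B \<ge> 0" using bnd(1)[of undefined] by linarith
  have int: "integrable M f" "integrable M g" "integrable M (indicat_real A)"
    using bnd by (auto intro!: integrable_const_bound[where B = "max 1 B"] simp: le_max_iff_disj indicator_def)
  have "expectation f - expectation g = expectation (\<lambda>\<omega>. f \<omega> - g \<omega>)" using int by simp
  also have "\<bar>\<dots>\<bar> \<le> expectation (\<lambda>\<omega>. \<bar>f \<omega> - g \<omega>\<bar>)" by (rule integral_abs_bound)
  also have "\<dots> \<le> expectation (\<lambda>\<omega>. e + 2 * B * indicator A \<omega>)"
  proof (rule integral_mono)
    fix \<omega> assume "\<omega> \<in> space M"
    then show "\<bar>f \<omega> - g \<omega>\<bar> \<le> e + 2 * B * indicator A \<omega>"
      using le[of \<omega>] bnd[of \<omega>] e B by (cases "\<omega> \<in> A") (auto simp: abs_le_iff)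
  qed (use int in auto)
  also have "\<dots> = e + 2 * B * prob A" using int by (simp add: prob_space)
  finally show ?thesis .
qed

text \<open>Tightness of a single random vector, by continuity from above.\<close>

lemma (in prob_space) prob_large_norm:
  fixes \<eta> :: "'a \<Rightarrow> 'e::euclidean_space"
  assumes [measurable]: "\<eta> \<in> borel_measurable M" and d: "d > 0"
  obtains r where "prob {\<omega>\<in>space M. norm (\<eta> \<omega>) > r} < d"
proof -
  have "(\<lambda>n. prob {\<omega>\<in>space M. norm (\<eta> \<omega>) > real n}) \<longlonglongrightarrow> prob (\<Inter>n. {\<omega>\<in>space M. norm (\<eta> \<omega>) > real n})"
    by (rule finite_Lim_measure_decseq) (auto simp: decseq_def)
  also have "(\<Inter>n. {\<omega>\<in>space M. norm (\<eta> \<omega>) > real n}) = {}"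
    using reals_Archimedean2 by (auto dest: less_asym)
  finally have "\<forall>\<^sub>F n in sequentially. prob {\<omega>\<in>space M. norm (\<eta> \<omega>) > real n} < d"
    using order_tendstoD(2)[of _ "0" sequentially d] d by simp
  then show ?thesis using that by (auto simp: eventually_sequentially)
qed

text \<open>Levy's continuity theorem in several dimensions, for tight sequences. Tightness confines
  both sides to a ball, where \<open>h\<close> is close to a trigonometric polynomial, and for such
  polynomials the convergence is the hypothesis extended by linearity.\<close>

theorem expectation_tendsto_if_cos_tendsto:
  fixes \<eta>n :: "nat \<Rightarrow> 'a \<Rightarrow> 'e::euclidean_space" and \<eta> :: "'b \<Rightarrow> 'e"
    and h :: "'e \<Rightarrow> real"
  assumes M: "prob_space M" and N: "prob_space N"
    and meas [measurable]: "\<And>n. \<eta>n n \<in> borel_measurable M" "\<eta> \<in> borel_measurable N"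
    and conv: "\<And>u b. (\<lambda>n. \<integral>\<omega>. cos (u \<bullet> \<eta>n n \<omega> + b) \<partial>M) \<longlonglongrightarrow> (\<integral>\<omega>. cos (u \<bullet> \<eta> \<omega> + b) \<partial>N)"
    and tight: "bounded_in_prob M (\<lambda>n \<omega>. norm (\<eta>n n \<omega>))"
    and h: "continuous_on UNIV h" "\<And>x. \<bar>h x\<bar> \<le> C"
  shows "(\<lambda>n. \<integral>\<omega>. h (\<eta>n n \<omega>) \<partial>M) \<longlonglongrightarrow> (\<integral>\<omega>. h (\<eta> \<omega>) \<partial>N)"
proof (rule LIMSEQ_I)
  interpret M: prob_space M by fact
  interpret N: prob_space N by fact
  have C: "C \<ge> 0" using h(2)[of 0] by linarith
  have hm [measurable]: "h \<in> borel_measurable borel" using h(1) by (rule borel_measurable_continuous_onI)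
  fix e0 :: real assume e0: "e0 > 0"
  \<comment> \<open>The budget: replacing \<open>h\<close> by the polynomial costs
    \<open>3 * e\<close> on each side, and the convergence of the polynomial means costs
    \<open>e\<close>. The bound \<open>e \<le> 1\<close> allows \<open>C + 1\<close> in place of
    \<open>C + e\<close> in the choice of \<open>d\<close>.\<close>
  define e where "e = min 1 (e0 / 10)"
  have e: "e > 0" "e \<le> 1" "10 * e \<le> e0" using e0 by (auto simp: e_def)
  define d where "d = e / (2 * (C + 1))"
  have d: "d > 0" using e C by (simp add: d_def)
  have dC: "2 * (C + e) * d \<le> e"
  proof -
    have "2 * (C + e) * d \<le> 2 * (C + 1) * d" using e d by (intro mult_right_mono) auto
    also have "\<dots> = e" using C by (simp add: d_def)
    finally show ?thesis .
  qed
  obtain r1 where "r1 > 0" and r1: "\<forall>\<^sub>F n in sequentially. \<exists>A\<in>sets M. measure M A < d \<and> (\<forall>\<omega>\<in>space M - A. \<bar>norm (\<eta>n n \<omega>)\<bar> \<le> r1)"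
    by (rule M.bounded_in_probE[OF tight d])
  obtain r2 where r2: "N.prob {\<omega>\<in>space N. norm (\<eta> \<omega>) > r2} < d"
    by (rule N.prob_large_norm[OF meas(2) d])
  obtain q where q: "trig_poly q" "\<And>x. \<bar>q x\<bar> \<le> C + e" "\<And>x. norm x \<le> max r1 r2 \<Longrightarrow> \<bar>q x - h x\<bar> \<le> 2 * e"
    by (rule trig_poly_approx[OF h e(1), of "max r1 r2"]) blast
  have qm [measurable]: "f \<in> borel_measurable borel" if "trig_poly f" for f :: "'e \<Rightarrow> real"
    using trig_poly_continuous[OF that] by (rule borel_measurable_continuous_onI)
  note [measurable] = qm[OF q(1)]
  have "(\<lambda>n. \<integral>\<omega>. f (\<eta>n n \<omega>) \<partial>M) \<longlonglongrightarrow> (\<integral>\<omega>. f (\<eta> \<omega>) \<partial>N)" if "trig_poly f" for f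
    using that
  proof induction
    case (cos a u b) then show ?case using tendsto_mult_left[OF conv, of a] by simp
  next
    case (add f g)
    have i: "integrable M (\<lambda>\<omega>. f (\<eta>n n \<omega>))" "integrable N (\<lambda>\<omega>. f (\<eta> \<omega>))" if tp: "trig_poly f" for f n
    proof -
      note [measurable] = qm[OF tp]
      obtain B where "\<And>x. \<bar>f x\<bar> \<le> B" using trig_poly_bounded[OF tp] by auto
      then show "integrable M (\<lambda>\<omega>. f (\<eta>n n \<omega>))" "integrable N (\<lambda>\<omega>. f (\<eta> \<omega>))"
        by (auto intro!: M.integrable_const_bound[where B = B] N.integrable_const_bound[where B = B])
    qed
    show ?case using tendsto_add[OF add.IH] i[OF add.hyps(1)] i[OF add.hyps(2)] by simp
  qed
  from tendstoD[OF this[OF q(1)] e(1)]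
  have conv_q: "\<forall>\<^sub>F n in sequentially. \<bar>(\<integral>\<omega>. q (\<eta>n n \<omega>) \<partial>M) - (\<integral>\<omega>. q (\<eta> \<omega>) \<partial>N)\<bar> < e"
    by (simp add: dist_real_def)
  have hC: "\<bar>h x\<bar> \<le> C + e" for x using h(2)[of x] e by linarith
  have N_le: "\<bar>(\<integral>\<omega>. q (\<eta> \<omega>) \<partial>N) - (\<integral>\<omega>. h (\<eta> \<omega>) \<partial>N)\<bar> \<le> 3 * e"
  proof -
    have "\<bar>(\<integral>\<omega>. q (\<eta> \<omega>) \<partial>N) - (\<integral>\<omega>. h (\<eta> \<omega>) \<partial>N)\<bar> \<le>
        2 * e + 2 * (C + e) * N.prob {\<omega>\<in>space N. norm (\<eta> \<omega>) > r2}"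
      using q hC e by (intro N.expectation_diff_le) (auto simp: not_less)
    also have "\<dots> \<le> 2 * e + 2 * (C + e) * d" using r2 C e by (intro add_left_mono mult_left_mono) auto
    finally show ?thesis using dC by linarith
  qed
  have "\<forall>\<^sub>F n in sequentially. norm ((\<integral>\<omega>. h (\<eta>n n \<omega>) \<partial>M) - (\<integral>\<omega>. h (\<eta> \<omega>) \<partial>N)) < e0"
    using r1 conv_q
  proof eventually_elim
    case (elim n)
    then obtain A where A: "A \<in> sets M" "measure M A < d" "\<forall>\<omega>\<in>space M - A. \<bar>norm (\<eta>n n \<omega>)\<bar> \<le> r1" by blast
    have "\<bar>(\<integral>\<omega>. q (\<eta>n n \<omega>) \<partial>M) - (\<integral>\<omega>. h (\<eta>n n \<omega>) \<partial>M)\<bar> \<le> 2 * e + 2 * (C + e) * M.prob A"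
      using q(1,2) hC e A by (intro M.expectation_diff_le) (auto simp: le_max_iff_disj intro!: q(3))
    also have "\<dots> \<le> 2 * e + 2 * (C + e) * d" using A C e by (intro add_left_mono mult_left_mono) auto
    finally show ?case using dC N_le elim(2) e by (simp add: abs_if split: if_splits)
  qed
  then show "\<exists>n0. \<forall>n\<ge>n0. norm ((\<integral>\<omega>. h (\<eta>n n \<omega>) \<partial>M) - (\<integral>\<omega>. h (\<eta> \<omega>) \<partial>N)) < e0"
    by (simp add: eventually_sequentially)
qed

text \<open>A phase shift multiplies the characteristic function by \<open>iexp b\<close>.\<close>

lemma (in prob_space) expectation_cos_eq_char:
  assumes [measurable]: "Y \<in> borel_measurable M"
  shows "expectation (\<lambda>\<omega>. cos (Y \<omega> + b)) = Re (iexp b * char (distr M borel Y) 1)"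
proof -
  have int: "integrable M (\<lambda>\<omega>. iexp b * iexp (Y \<omega>))"
    by (intro integrable_const_bound[where B = 1]) (auto simp: norm_mult)
  have "char (distr M borel Y) 1 = expectation (\<lambda>\<omega>. iexp (Y \<omega>))"
    unfolding char_def by (subst integral_distr) auto
  then have "iexp b * char (distr M borel Y) 1 = expectation (\<lambda>\<omega>. iexp b * iexp (Y \<omega>))"
    by simp
  then have "Re (iexp b * char (distr M borel Y) 1) = expectation (\<lambda>\<omega>. Re (iexp b * iexp (Y \<omega>)))"
    by (simp only: integral_bounded_linear[OF bounded_linear_Re int])
  also have "\<dots> = expectation (\<lambda>\<omega>. cos (Y \<omega> + b))"
    by (intro Bochner_Integration.integral_cong refl)
      (simp add: cis_conv_exp[symmetric] cos_add mult.commute)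
  finally show ?thesis by simp
qed

lemma (in prob_space) gaussian_var_square_integrable:
  assumes "gaussian_var M Y" "Y \<in> borel_measurable M"
  shows "integrable M (\<lambda>\<omega>. (Y \<omega>)\<^sup>2)"
proof -
  from assms(1) consider m \<sigma> where "\<sigma> > 0" "distributed M lborel Y (normal_density m \<sigma>)" | c where "AE \<omega> in M. Y \<omega> = c"
    unfolding gaussian_var_def by auto
  then show ?thesis
  proof cases
    case 1
    have "integrable lborel (\<lambda>x. normal_density m \<sigma> x * x\<^sup>2)"
    proof -
      have i: "integrable lborel (\<lambda>x. normal_density m \<sigma> x * (x - m) ^ k)" for k
        by (rule integrable_normal_moment[OF 1(1)])
      have "(\<lambda>x. normal_density m \<sigma> x * x\<^sup>2) = (\<lambda>x. normal_density m \<sigma> x * (x - m) ^ 2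
        + 2 * m * (normal_density m \<sigma> x * (x - m) ^ 1) + m\<^sup>2 * (normal_density m \<sigma> x * (x - m) ^ 0))"
        by (rule ext) (simp add: power2_eq_square algebra_simps)
      then show ?thesis using i by (simp only: Bochner_Integration.integrable_add integrable_mult_right)
    qed
    then show ?thesis
      by (subst distributed_integrable[OF 1(2), symmetric]) (auto intro: normal_density_nonneg)
  next
    case 2
    have "integrable M (\<lambda>\<omega>. c\<^sup>2)" by simp
    then show ?thesis using 2 assms(2) by (subst integrable_cong_AE[where g = "\<lambda>_. c\<^sup>2"]) auto
  qed
qed

text \<open>A constant with mean zero is zero, so the degenerate case obeys the same formula with
  variance 0.\<close>

lemma (in prob_space) char_gaussian_var:
  assumes g: "gaussian_var M Y" and [measurable]: "Y \<in> borel_measurable M" and mean: "expectation Y = 0"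
  shows "char (distr M borel Y) 1 = exp (- expectation (\<lambda>\<omega>. (Y \<omega>)\<^sup>2) / 2)"
proof -
  from g consider m \<sigma> where "\<sigma> > 0" "distributed M lborel Y (normal_density m \<sigma>)" | c where "AE \<omega> in M. Y \<omega> = c"
    unfolding gaussian_var_def by auto
  then show ?thesis
  proof cases
    case 1
    have m: "m = 0" using normal_distributed_expectation[OF 1] mean by simp
    have var: "expectation (\<lambda>\<omega>. (Y \<omega>)\<^sup>2) = \<sigma>\<^sup>2"
      using normal_distributed_variance[OF 1] mean by simp
    have "distributed M lborel (\<lambda>\<omega>. Y \<omega> / \<sigma>) std_normal_density"
      using 1(2) unfolding normal_standard_normal_convert[OF 1(1)] by (simp add: m)
    then have d: "distr M borel (\<lambda>\<omega>. Y \<omega> / \<sigma>) = std_normal_distribution"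
      by (auto simp: distributed_def cong: distr_cong)
    have "char (distr M borel Y) 1 = char (distr M borel (\<lambda>\<omega>. Y \<omega> / \<sigma>)) \<sigma>"
      unfolding char_def using 1(1) by (subst (1 2) integral_distr) auto
    also have "\<dots> = exp (- \<sigma>\<^sup>2 / 2)" by (simp add: d char_std_normal_distribution)
    finally show ?thesis by (simp add: var)
  next
    case 2
    have "expectation Y = expectation (\<lambda>_. c)" using 2 by (intro integral_cong_AE) auto
    then have c: "c = 0" using mean by (simp add: prob_space)
    have "char (distr M borel Y) 1 = expectation (\<lambda>\<omega>. iexp (Y \<omega>))"
      unfolding char_def by (subst integral_distr) auto
    also have "\<dots> = expectation (\<lambda>\<omega>. 1)"
      using 2 c by (intro integral_cong_AE) auto
    also have "\<dots> = 1" by (simp add: prob_space)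
    finally have "char (distr M borel Y) 1 = 1" .
    moreover have "expectation (\<lambda>\<omega>. (Y \<omega>)\<^sup>2) = expectation (\<lambda>\<omega>. 0)"
      using 2 c by (intro integral_cong_AE) auto
    ultimately show ?thesis by simp
  qed
qed

text \<open>Since \<open>H\<close> is merely continuous, \<open>H (Z n)\<close> and \<open>H (\<Psi> (\<eta>n n))\<close> are compared near the
  compact images under \<open>\<Psi>\<close> of balls only.\<close>
theorem converges_weakly_perturbed_image:
  fixes \<eta>n :: "nat \<Rightarrow> 'a \<Rightarrow> 'e::euclidean_space" and \<eta> :: "'b \<Rightarrow> 'e" and m :: "'m metric"
  assumes M: "prob_space M" and N: "prob_space N"
    and meas [measurable]: "\<And>n. \<eta>n n \<in> borel_measurable M" "\<eta> \<in> borel_measurable N"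
    and conv: "\<And>(h :: 'e \<Rightarrow> real) C. continuous_on UNIV h \<Longrightarrow> (\<And>x. \<bar>h x\<bar> \<le> C) \<Longrightarrow>
       (\<lambda>n. \<integral>\<omega>. h (\<eta>n n \<omega>) \<partial>M) \<longlonglongrightarrow> (\<integral>\<omega>. h (\<eta> \<omega>) \<partial>N)"
    and tight: "bounded_in_prob M (\<lambda>n \<omega>. norm (\<eta>n n \<omega>))"
    and \<Psi>: "continuous_map euclidean (mtopology_of m) \<Psi>"
    and Z: "\<forall>\<^sub>F n in sequentially. random_element M m (Z n)" and Y: "random_element N m (\<lambda>\<omega>. \<Psi> (\<eta> \<omega>))"
    and D: "small_in_prob M D"
      "\<forall>\<^sub>F n in sequentially. AE \<omega> in M. mdist m (Z n \<omega>) (\<Psi> (\<eta>n n \<omega>)) \<le> D n \<omega>"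
  shows "converges_weakly m (\<lambda>_. M) Z sequentially N (\<lambda>\<omega>. \<Psi> (\<eta> \<omega>))"
  unfolding converges_weakly_def
proof (intro conjI Z Y allI impI; elim conjE)
  interpret M: prob_space M by fact
  interpret N: prob_space N by fact
  interpret m: Metric_space "mspace m" "mdist m" by simp
  fix H assume H: "continuous_map (mtopology_of m) euclideanreal H" "bounded (H ` mspace m)"
  obtain C where C: "C > 0" "\<And>x. x \<in> mspace m \<Longrightarrow> \<bar>H x\<bar> \<le> C"
    using H(2) unfolding bounded_pos by auto
  have \<Psi>m: "\<Psi> x \<in> mspace m" for x using \<Psi> by (auto simp: continuous_map_def)
  define h where "h = H \<circ> \<Psi>"
  have h: "continuous_on UNIV h" "\<And>x. \<bar>h x\<bar> \<le> C"
    using continuous_map_compose[OF \<Psi> H(1)] C(2) \<Psi>m by (auto simp: h_def)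
  have hm [measurable]: "h \<in> borel_measurable borel" using h(1) by (rule borel_measurable_continuous_onI)
  \<comment> \<open>A uniform form of continuity of \<open>H\<close> near the image of a ball:
    \<open>z\<close> ranges over the whole space, only \<open>x\<close> is confined. It is a
    Lebesgue number argument with finitely many preimages of small balls.\<close>
  have local: "\<exists>\<delta>>0. \<forall>x z. norm x \<le> r \<longrightarrow> z \<in> mspace m \<longrightarrow> mdist m z (\<Psi> x) \<le> \<delta> \<longrightarrow> \<bar>H z - h x\<bar> \<le> e"
    if e: "e > 0" for e r
  proof -
    have "\<exists>\<delta>>0. \<forall>z\<in>mspace m. mdist m (\<Psi> x) z < \<delta> \<longrightarrow> \<bar>H z - h x\<bar> < e / 2" for x
    proof -
      have "continuous_map m.mtopology euclideanreal H" using H(1) by (simp add: mtopology_of_def)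
      then have "openin m.mtopology {y \<in> topspace m.mtopology. H y \<in> ball (H (\<Psi> x)) (e / 2)}"
        by (rule openin_continuous_map_preimage) simp
      then have "\<exists>U. openin m.mtopology U \<and> \<Psi> x \<in> U \<and> (\<forall>y\<in>U. H y \<in> ball (H (\<Psi> x)) (e / 2))"
        using e \<Psi>m[of x] by (intro exI[of _ "{y \<in> topspace m.mtopology. H y \<in> ball (H (\<Psi> x)) (e / 2)}"]) simp
      then obtain U where U: "openin m.mtopology U" "\<Psi> x \<in> U" "\<And>y. y \<in> U \<Longrightarrow> \<bar>H y - h x\<bar> < e / 2"
        by (force simp: h_def dist_real_def abs_minus_commute)
      then obtain \<delta> where "\<delta> > 0" "m.mball (\<Psi> x) \<delta> \<subseteq> U" unfolding m.openin_mtopology by blast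
      then show ?thesis using U(3) \<Psi>m by (intro exI[of _ \<delta>]) (auto simp: subset_iff m.in_mball)
    qed
    then obtain \<delta> where \<delta>: "\<And>x. \<delta> x > 0"
      "\<And>x z. z \<in> mspace m \<Longrightarrow> mdist m (\<Psi> x) z < \<delta> x \<Longrightarrow> \<bar>H z - h x\<bar> < e / 2" by metis
    define T where "T x = \<Psi> -` m.mball (\<Psi> x) (\<delta> x / 2)" for x
    have T: "open (T x)" "x \<in> T x" for x
    proof -
      have "openin (mtopology_of m) (m.mball (\<Psi> x) (\<delta> x / 2))" by (simp add: mtopology_of_def)
      then show "open (T x)" using \<Psi> by (auto simp: continuous_map_def T_def vimage_def)
      show "x \<in> T x" using \<delta>(1)[of x] \<Psi>m by (simp add: T_def)
    qed
    obtain S where S: "S \<subseteq> cball 0 r" "finite S" "cball 0 r \<subseteq> (\<Union>x\<in>S. T x)"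
      by (rule compactE_image[of "cball 0 r" "cball 0 r" T]) (use T in auto)
    \<comment> \<open>The 1 keeps the minimum defined when \<open>S\<close> is empty.\<close>
    define \<delta>0 where "\<delta>0 = Min (insert 1 ((\<lambda>x. \<delta> x / 3) ` S))"
    have \<delta>0: "\<delta>0 > 0" "\<And>x. x \<in> S \<Longrightarrow> \<delta>0 < \<delta> x / 2"
    proof -
      show "\<delta>0 > 0" unfolding \<delta>0_def using S(2) \<delta>(1) by (subst Min_gr_iff) auto
      fix x assume "x \<in> S"
      then have "\<delta>0 \<le> \<delta> x / 3" unfolding \<delta>0_def using S(2) by (intro Min_le) auto
      then show "\<delta>0 < \<delta> x / 2" using \<delta>(1)[of x] by linarith
    qed
    have "\<bar>H z - h x\<bar> \<le> e" if xz: "norm x \<le> r" "z \<in> mspace m" "mdist m z (\<Psi> x) \<le> \<delta>0" for x z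
    proof -
      obtain y where y: "y \<in> S" "x \<in> T y" using S(3) xz(1) by force
      have 1: "mdist m (\<Psi> y) (\<Psi> x) < \<delta> y / 2" using y(2) by (simp add: T_def)
      have "mdist m (\<Psi> y) z \<le> mdist m (\<Psi> y) (\<Psi> x) + mdist m (\<Psi> x) z"
        using \<Psi>m xz(2) by (intro m.triangle)
      also have "mdist m (\<Psi> x) z = mdist m z (\<Psi> x)" by (rule m.commute)
      finally have 2: "mdist m (\<Psi> y) z < \<delta> y" using 1 xz(3) \<delta>0(2)[OF y(1)] by linarith
      have "\<bar>H z - h y\<bar> < e / 2" using \<delta>(2)[OF xz(2) 2] .
      moreover have "\<bar>H (\<Psi> x) - h y\<bar> < e / 2" using \<delta>(2)[OF \<Psi>m, of y x] 1 \<delta>(1)[of y] by linarith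
      ultimately show ?thesis unfolding h_def o_def by linarith
    qed
    then show ?thesis using \<delta>0(1) by blast
  qed
  have "(\<lambda>n. (\<integral>\<omega>. H (Z n \<omega>) \<partial>M) - (\<integral>\<omega>. h (\<eta>n n \<omega>) \<partial>M)) \<longlonglongrightarrow> 0"
  proof (rule LIMSEQ_I)
    fix e0 :: real assume e0: "e0 > 0"
    \<comment> \<open>Two exceptional sets of probability below \<open>d\<close> each, on which
      \<open>H\<close> and \<open>h\<close> differ by at most \<open>2 * C\<close>, cost less than
      \<open>e0 / 2\<close>.\<close>
    define d where "d = e0 / (8 * C)"
    have d: "d > 0" using e0 C by (simp add: d_def)
    obtain r where "r > 0" and r: "\<forall>\<^sub>F n in sequentially. \<exists>A\<in>sets M. measure M A < d \<and> (\<forall>\<omega>\<in>space M - A. \<bar>norm (\<eta>n n \<omega>)\<bar> \<le> r)"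
      by (rule M.bounded_in_probE[OF tight d])
    obtain \<delta> where \<delta>: "\<delta> > 0" "\<And>x z. norm x \<le> r \<Longrightarrow> z \<in> mspace m \<Longrightarrow> mdist m z (\<Psi> x) \<le> \<delta> \<Longrightarrow> \<bar>H z - h x\<bar> \<le> e0 / 4"
      using local[of "e0 / 4" r] e0 by auto
    have D': "small_in_prob M (\<lambda>n \<omega>. mdist m (Z n \<omega>) (\<Psi> (\<eta>n n \<omega>)))"
      using D(2) by (intro M.small_in_prob_mono[OF D(1)]) (auto elim!: eventually_mono)
    have "\<forall>\<^sub>F n in sequentially. norm ((\<integral>\<omega>. H (Z n \<omega>) \<partial>M) - (\<integral>\<omega>. h (\<eta>n n \<omega>) \<partial>M) - 0) < e0"
      using r Z M.small_in_probD[OF D' \<delta>(1) d]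
    proof eventually_elim
      case (elim n)
      then obtain A where A: "A \<in> sets M" "measure M A < d" "\<forall>\<omega>\<in>space M - A. \<bar>norm (\<eta>n n \<omega>)\<bar> \<le> r" by blast
      obtain A' where A': "A' \<in> sets M" "measure M A' < d"
         "\<forall>\<omega>\<in>space M - A'. \<bar>mdist m (Z n \<omega>) (\<Psi> (\<eta>n n \<omega>))\<bar> \<le> \<delta>" using elim by blast
      have Zm: "Z n \<omega> \<in> mspace m" if "\<omega> \<in> space M" for \<omega>
      proof -
        have "Z n \<omega> \<in> space (sigma (mspace m) {G. openin (mtopology_of m) G})"
          using measurable_space[OF elim(2)[unfolded random_element_def] that] .
        then show ?thesis by (simp add: space_measure_of_conv)
      qed
      have HZ: "(\<lambda>\<omega>. H (Z n \<omega>)) \<in> borel_measurable M"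
      proof (rule borel_measurableI)
        fix S :: "real set" assume "open S"
        then have o: "openin (mtopology_of m) {x \<in> mspace m. H x \<in> S}"
          using H(1) by (auto simp: continuous_map_def)
        have "{G. openin (mtopology_of m) G} \<subseteq> Pow (mspace m)" using openin_subset by force
        then have "{x \<in> mspace m. H x \<in> S} \<in> sets (sigma (mspace m) {G. openin (mtopology_of m) G})"
          using o by auto
        then have "Z n -` {x \<in> mspace m. H x \<in> S} \<inter> space M \<in> sets M"
          using elim(2) unfolding random_element_def by (rule measurable_sets[rotated])
        also have "Z n -` {x \<in> mspace m. H x \<in> S} \<inter> space M = (\<lambda>\<omega>. H (Z n \<omega>)) -` S \<inter> space M"
          using Zm by auto
        finally show "(\<lambda>\<omega>. H (Z n \<omega>)) -` S \<inter> space M \<in> sets M" .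
      qed
      \<comment> \<open>Outside \<open>space M\<close> nothing bounds
        \<open>H (Z n \<omega>)\<close>; the modification there does not affect the
        integral.\<close>
      define G where "G \<omega> = (if \<omega> \<in> space M then H (Z n \<omega>) else 0)" for \<omega>
      have Gm: "G \<in> borel_measurable M" using HZ by (subst measurable_cong[where g = "\<lambda>\<omega>. H (Z n \<omega>)"]) (auto simp: G_def)
      have "(\<integral>\<omega>. H (Z n \<omega>) \<partial>M) = (\<integral>\<omega>. G \<omega> \<partial>M)"
        by (intro Bochner_Integration.integral_cong) (auto simp: G_def)
      moreover have "\<bar>(\<integral>\<omega>. G \<omega> \<partial>M) - (\<integral>\<omega>. h (\<eta>n n \<omega>) \<partial>M)\<bar> \<le> e0 / 4 + 2 * C * M.prob (A \<union> A')"
      proof (rule M.expectation_diff_le[OF Gm])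
        show "A \<union> A' \<in> M.events" using A A' by auto
        show "\<bar>G \<omega>\<bar> \<le> C" for \<omega> using C Zm by (auto simp: G_def)
        fix \<omega> assume "\<omega> \<in> space M - (A \<union> A')"
        then show "\<bar>G \<omega> - h (\<eta>n n \<omega>)\<bar> \<le> e0 / 4"
          using \<delta>(2)[of "\<eta>n n \<omega>" "Z n \<omega>"] A(3) A'(3) Zm by (auto simp: G_def)
      qed (use h e0 in auto)
      moreover have "2 * C * M.prob (A \<union> A') < 2 * C * (2 * d)"
      proof (rule mult_strict_left_mono)
        show "M.prob (A \<union> A') < 2 * d" using measure_Un_le[of A M A'] A(1,2) A'(1,2) by linarith
      qed (use C in simp)
      moreover have "2 * C * (2 * d) = e0 / 2" using C by (simp add: d_def)
      ultimately have "\<bar>(\<integral>\<omega>. H (Z n \<omega>) \<partial>M) - (\<integral>\<omega>. h (\<eta>n n \<omega>) \<partial>M)\<bar> < e0" using e0 by linarith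
      then show ?case by simp
    qed
    then show "\<exists>n0. \<forall>n\<ge>n0. norm ((\<integral>\<omega>. H (Z n \<omega>) \<partial>M) - (\<integral>\<omega>. h (\<eta>n n \<omega>) \<partial>M) - 0) < e0"
      by (simp add: eventually_sequentially)
  qed
  from tendsto_add[OF this conv[OF h]]
  show "(\<lambda>n. \<integral>\<omega>. H (Z n \<omega>) \<partial>M) \<longlonglongrightarrow> (\<integral>\<omega>. H (\<Psi> (\<eta> \<omega>)) \<partial>N)" by (simp add: h_def)
qed

section \<open>Independent samples\<close>

locale iid_sample = prob_space M for M :: "'a measure" +
  fixes X :: "'a \<Rightarrow> real^'d" and Xs :: "nat \<Rightarrow> 'a \<Rightarrow> real^'d"
  assumes X_measurable [measurable]: "X \<in> borel_measurable M"
    and Xs_indep: "indep_vars (\<lambda>_. borel) Xs UNIV"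
    and Xs_distr: "\<And>i. distr M borel (Xs i) = distr M borel X"
begin

lemma Xs_measurable [measurable]: "Xs i \<in> borel_measurable M"
  using Xs_indep by (simp add: indep_vars_def2)

lemma expectation_Xs:
  fixes f :: "real^'d \<Rightarrow> 'f::{banach, second_countable_topology}"
  assumes [measurable]: "f \<in> borel_measurable borel"
  shows "expectation (\<lambda>\<omega>. f (Xs i \<omega>)) = expectation (\<lambda>\<omega>. f (X \<omega>))"
  using integral_distr[of "Xs i" M borel f] integral_distr[of X M borel f] by (simp add: Xs_distr)

lemma AE_Xs:
  assumes [measurable]: "{x. P x} \<in> sets borel" and "AE \<omega> in M. P (X \<omega>)"
  shows "AE \<omega> in M. P (Xs i \<omega>)"
proof -
  have "AE x in distr M borel X. P x" using assms by (subst AE_distr_iff) auto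
  then show ?thesis unfolding Xs_distr[of i, symmetric] by (subst (asm) AE_distr_iff) auto
qed

abbreviation others :: "nat set \<Rightarrow> 'a \<Rightarrow> nat \<Rightarrow> real^'d" where
  "others J \<omega> \<equiv> restrict (\<lambda>j. Xs j \<omega>) J"

lemma others_measurable: "others J \<in> measurable M (PiM J (\<lambda>_. borel))"
  by (rule measurable_restrict) measurable

text \<open>Fubini with the other observations frozen: \<open>Xs i\<close> has the law of
  \<open>X\<close>, and for each frozen value the mean of \<open>\<Phi>\<close> is zero.\<close>

lemma expectation_indep_zero:
  fixes \<Phi> :: "real^'d \<Rightarrow> (nat \<Rightarrow> real^'d) \<Rightarrow> real"
  assumes i: "i \<notin> J"
    and meas: "(\<lambda>p. \<Phi> (fst p) (snd p)) \<in> borel_measurable (borel \<Otimes>\<^sub>M PiM J (\<lambda>_. borel))"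
    and zero: "\<And>y. expectation (\<lambda>\<omega>. \<Phi> (X \<omega>) y) = 0"
    and int: "integrable M (\<lambda>\<omega>. \<Phi> (Xs i \<omega>) (others J \<omega>))"
  shows "expectation (\<lambda>\<omega>. \<Phi> (Xs i \<omega>) (others J \<omega>)) = 0"
proof -
  let ?PJ = "PiM J (\<lambda>_. borel :: (real^'d) measure)" and ?P1 = "PiM {i} (\<lambda>_. borel :: (real^'d) measure)"
  \<comment> \<open>Observation \<open>i\<close> is regarded as a one-point family, so that
    independence of disjoint blocks applies.\<close>
  have ind: "indep_var ?P1 (others {i}) ?PJ (others J)"
    using i by (intro indep_var_restrict[OF Xs_indep]) auto
  interpret PX: prob_space "distr M ?P1 (others {i})" by (rule prob_space_distr) (rule others_measurable)
  interpret PY: prob_space "distr M ?PJ (others J)" by (rule prob_space_distr) (rule others_measurable)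
  interpret PP: pair_sigma_finite "distr M ?P1 (others {i})" "distr M ?PJ (others J)" ..
  have eq: "distr M ?P1 (others {i}) \<Otimes>\<^sub>M distr M ?PJ (others J)
      = distr M (?P1 \<Otimes>\<^sub>M ?PJ) (\<lambda>\<omega>. (others {i} \<omega>, others J \<omega>))"
    using ind by (simp add: indep_var_distribution_eq)
  have m2: "(\<lambda>\<omega>. (others {i} \<omega>, others J \<omega>)) \<in> measurable M (?P1 \<Otimes>\<^sub>M ?PJ)"
    by (intro measurable_Pair others_measurable)
  have comp: "(\<lambda>f. f i) \<in> measurable ?P1 borel" by (rule measurable_component_singleton) simp
  have meas': "(\<lambda>p. \<Phi> (fst p i) (snd p)) \<in> borel_measurable (?P1 \<Otimes>\<^sub>M ?PJ)"
  proof -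
    have "(\<lambda>p. (fst p i, snd p)) \<in> measurable (?P1 \<Otimes>\<^sub>M ?PJ) (borel \<Otimes>\<^sub>M ?PJ)"
      by (intro measurable_Pair measurable_compose[OF measurable_fst comp] measurable_snd)
    from measurable_compose[OF this meas] show ?thesis by simp
  qed
  have "expectation (\<lambda>\<omega>. \<Phi> (Xs i \<omega>) (others J \<omega>)) =
      (\<integral>p. \<Phi> (fst p i) (snd p) \<partial>(distr M ?P1 (others {i}) \<Otimes>\<^sub>M distr M ?PJ (others J)))"
    unfolding eq using integral_distr[OF m2 meas'] by simp
  also have "\<dots> = (\<integral>y. (\<integral>f. \<Phi> (f i) y \<partial>distr M ?P1 (others {i})) \<partial>distr M ?PJ (others J))"
  proof (rule PP.integral_snd[symmetric, of "\<lambda>f y. \<Phi> (f i) y", unfolded case_prod_beta])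
    show "integrable (distr M ?P1 (others {i}) \<Otimes>\<^sub>M distr M ?PJ (others J)) (\<lambda>p. \<Phi> (fst p i) (snd p))"
      unfolding eq using int by (subst integrable_distr_eq[OF m2 meas']) simp
  qed
  also have "\<dots> = (\<integral>y. 0 \<partial>distr M ?PJ (others J))"
  proof (rule Bochner_Integration.integral_cong[OF refl])
    fix y assume "y \<in> space (distr M ?PJ (others J))"
    then have y: "y \<in> space ?PJ" by simp
    have m1: "(\<lambda>x. \<Phi> x y) \<in> borel_measurable borel"
      using measurable_compose[OF measurable_Pair2'[OF y] meas] by simp
    have "(\<integral>f. \<Phi> (f i) y \<partial>distr M ?P1 (others {i})) = expectation (\<lambda>\<omega>. \<Phi> (Xs i \<omega>) y)"
      using integral_distr[OF others_measurable measurable_compose[OF comp m1]] by simp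
    also have "\<dots> = 0" using expectation_Xs[OF m1] zero[of y] by simp
    finally show "(\<integral>f. \<Phi> (f i) y \<partial>distr M ?P1 (others {i})) = 0" .
  qed
  finally show ?thesis by simp
qed


text \<open>Pythagoras for uncorrelated vectors, in a form that covers summands sharing a random
  threshold.\<close>

lemma expectation_norm_sum_sq:
  fixes g :: "nat \<Rightarrow> 'a \<Rightarrow> 'e::euclidean_space"
  assumes [measurable]: "\<And>i. i < n \<Longrightarrow> g i \<in> borel_measurable M"
    and bnd: "\<And>i. i < n \<Longrightarrow> AE \<omega> in M. norm (g i \<omega>) \<le> c"
    and orth: "\<And>i j. i < n \<Longrightarrow> j < n \<Longrightarrow> i \<noteq> j \<Longrightarrow> expectation (\<lambda>\<omega>. g i \<omega> \<bullet> g j \<omega>) = 0"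
  shows "integrable M (\<lambda>\<omega>. (norm (\<Sum>i<n. g i \<omega>))\<^sup>2)"
    and "expectation (\<lambda>\<omega>. (norm (\<Sum>i<n. g i \<omega>))\<^sup>2) = (\<Sum>i<n. expectation (\<lambda>\<omega>. (norm (g i \<omega>))\<^sup>2))"
proof -
  have int: "integrable M (\<lambda>\<omega>. g i \<omega> \<bullet> g j \<omega>)" if "i < n" "j < n" for i j
  proof (rule integrable_const_bound[where B = "c * c"])
    show "AE \<omega> in M. norm (g i \<omega> \<bullet> g j \<omega>) \<le> c * c"
      using bnd[OF that(1)] bnd[OF that(2)]
    proof eventually_elim
      case (elim \<omega>)
      have "norm (g i \<omega> \<bullet> g j \<omega>) \<le> norm (g i \<omega>) * norm (g j \<omega>)"
        using Cauchy_Schwarz_ineq2 by simp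
      also have "\<dots> \<le> c * c" using elim by (intro mult_mono) (auto intro: order_trans[OF norm_ge_zero])
      finally show ?case .
    qed
  qed (use that in measurable)
  have eq: "(norm (\<Sum>i<n. g i \<omega>))\<^sup>2 = (\<Sum>i<n. \<Sum>j<n. g i \<omega> \<bullet> g j \<omega>)" for \<omega>
    by (simp add: power2_norm_eq_inner inner_sum_left inner_sum_right) (rule sum.swap)
  show "integrable M (\<lambda>\<omega>. (norm (\<Sum>i<n. g i \<omega>))\<^sup>2)"
    unfolding eq by (intro Bochner_Integration.integrable_sum int) auto
  have "expectation (\<lambda>\<omega>. (norm (\<Sum>i<n. g i \<omega>))\<^sup>2) = (\<Sum>i<n. \<Sum>j<n. expectation (\<lambda>\<omega>. g i \<omega> \<bullet> g j \<omega>))"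
    unfolding eq
    by (subst Bochner_Integration.integral_sum;
        auto intro!: Bochner_Integration.integrable_sum sum.cong Bochner_Integration.integral_sum int)
  also have "\<dots> = (\<Sum>i<n. \<Sum>j<n. if j = i then expectation (\<lambda>\<omega>. (norm (g i \<omega>))\<^sup>2) else 0)"
    using orth by (intro sum.cong refl) (auto simp: power2_norm_eq_inner)
  also have "\<dots> = (\<Sum>i<n. expectation (\<lambda>\<omega>. (norm (g i \<omega>))\<^sup>2))" by simp
  finally show "expectation (\<lambda>\<omega>. (norm (\<Sum>i<n. g i \<omega>))\<^sup>2) = (\<Sum>i<n. expectation (\<lambda>\<omega>. (norm (g i \<omega>))\<^sup>2))" .
qed

lemma expectation_norm_centered_sum_sq:
  fixes g :: "real^'d \<Rightarrow> 'e::euclidean_space"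
  assumes [measurable]: "g \<in> borel_measurable borel" and bnd: "AE \<omega> in M. norm (g (X \<omega>)) \<le> c"
    and zero: "expectation (\<lambda>\<omega>. g (X \<omega>)) = 0"
  shows "integrable M (\<lambda>\<omega>. (norm (\<Sum>i<n. g (Xs i \<omega>)))\<^sup>2)"
    and "expectation (\<lambda>\<omega>. (norm (\<Sum>i<n. g (Xs i \<omega>)))\<^sup>2) = real n * expectation (\<lambda>\<omega>. (norm (g (X \<omega>)))\<^sup>2)"
proof -
  have bi: "AE \<omega> in M. norm (g (Xs i \<omega>)) \<le> c" for i by (rule AE_Xs[OF _ bnd]) measurable
  have orth: "expectation (\<lambda>\<omega>. g (Xs i \<omega>) \<bullet> g (Xs j \<omega>)) = 0" if "i \<noteq> j" for i j
  proof -
    have "expectation (\<lambda>\<omega>. g (Xs i \<omega>) \<bullet> g (others {j} \<omega> j)) = 0"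
    proof (rule expectation_indep_zero)
      show "i \<notin> {j}" using that by simp
      have "(\<lambda>f. f j) \<in> measurable (PiM {j} (\<lambda>_. borel)) (borel :: (real^'d) measure)"
        by (rule measurable_component_singleton) simp
      from measurable_compose[OF measurable_snd this]
      have [measurable]: "(\<lambda>p. snd p j) \<in> measurable ((borel :: (real^'d) measure) \<Otimes>\<^sub>M PiM {j} (\<lambda>_. borel)) (borel :: (real^'d) measure)" .
      show "(\<lambda>p. g (fst p) \<bullet> g (snd p j)) \<in> borel_measurable ((borel :: (real^'d) measure) \<Otimes>\<^sub>M PiM {j} (\<lambda>_. borel))"
        by measurable
      have "integrable M (\<lambda>\<omega>. g (X \<omega>))" using bnd by (intro integrable_const_bound) auto
      then show "expectation (\<lambda>\<omega>. g (X \<omega>) \<bullet> g (y j)) = 0" for y using zero by simp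
      show "integrable M (\<lambda>\<omega>. g (Xs i \<omega>) \<bullet> g (others {j} \<omega> j))"
      proof (rule integrable_const_bound[where B = "c * c"])
        show "AE \<omega> in M. norm (g (Xs i \<omega>) \<bullet> g (others {j} \<omega> j)) \<le> c * c"
          using bi[of i] bi[of j]
        proof eventually_elim
          case (elim \<omega>)
          have "norm (g (Xs i \<omega>) \<bullet> g (Xs j \<omega>)) \<le> norm (g (Xs i \<omega>)) * norm (g (Xs j \<omega>))"
            using Cauchy_Schwarz_ineq2 by simp
          also have "\<dots> \<le> c * c" using elim by (intro mult_mono) (auto intro: order_trans[OF norm_ge_zero])
          finally show ?case by simp
        qed
      qed simp
    qed
    then show ?thesis by simp
  qed
  show "integrable M (\<lambda>\<omega>. (norm (\<Sum>i<n. g (Xs i \<omega>)))\<^sup>2)"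
    by (rule expectation_norm_sum_sq(1)[where c = c]) (use bi orth in auto)
  have "expectation (\<lambda>\<omega>. (norm (\<Sum>i<n. g (Xs i \<omega>)))\<^sup>2) = (\<Sum>i<n. expectation (\<lambda>\<omega>. (norm (g (Xs i \<omega>)))\<^sup>2))"
    by (rule expectation_norm_sum_sq(2)[where c = c]) (use bi orth in auto)
  also have "\<dots> = real n * expectation (\<lambda>\<omega>. (norm (g (X \<omega>)))\<^sup>2)"
    using expectation_Xs[of "\<lambda>x. (norm (g x))\<^sup>2"] by simp
  finally show "expectation (\<lambda>\<omega>. (norm (\<Sum>i<n. g (Xs i \<omega>)))\<^sup>2) = real n * expectation (\<lambda>\<omega>. (norm (g (X \<omega>)))\<^sup>2)" .
qed

text \<open>Central limit theorem for rows of i.i.d. summands whose uniform bound \<open>c n\<close>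
  tends to 0, which takes the place of a Lindeberg condition. The characteristic function of a row
  is an \<open>n\<close>-th power and is compared with the \<open>n\<close>-th power of
  \<open>1 - s / (2 * n)\<close>.\<close>

theorem triangular_char_tendsto:
  fixes g :: "nat \<Rightarrow> real^'d \<Rightarrow> real"
  assumes meas [measurable]: "\<And>n. g n \<in> borel_measurable borel"
    and bnd: "\<And>n. AE \<omega> in M. \<bar>g n (X \<omega>)\<bar> \<le> c n" and c: "c \<longlonglongrightarrow> 0"
    and zero: "\<forall>\<^sub>F n in sequentially. expectation (\<lambda>\<omega>. g n (X \<omega>)) = 0"
    and var: "(\<lambda>n. real n * expectation (\<lambda>\<omega>. (g n (X \<omega>))\<^sup>2)) \<longlonglongrightarrow> s"
  shows "(\<lambda>n. char (distr M borel (\<lambda>\<omega>. \<Sum>i<n. g n (Xs i \<omega>))) 1) \<longlonglongrightarrow> exp (- s / 2)"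
proof -
  define a where "a n = expectation (\<lambda>\<omega>. (g n (X \<omega>))\<^sup>2)" for n
  define \<psi> where "\<psi> n = char (distr M borel (\<lambda>\<omega>. g n (X \<omega>))) 1" for n
  define \<phi> where "\<phi> n = char (distr M borel (\<lambda>\<omega>. \<Sum>i<n. g n (Xs i \<omega>))) 1" for n
  have a0: "a n \<ge> 0" for n unfolding a_def by simp
  have \<phi>: "\<phi> n = \<psi> n ^ n" for n
  proof -
    have eq: "char (distr M borel (\<lambda>\<omega>. g n (Xs i \<omega>))) 1 = \<psi> n" for i
      unfolding \<psi>_def char_def
      using expectation_Xs[of "\<lambda>x. iexp (g n x)"] by (subst (1 2) integral_distr) auto
    have "\<phi> n = (\<Prod>i<n. char (distr M borel (\<lambda>\<omega>. g n (Xs i \<omega>))) 1)"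
      unfolding \<phi>_def
    proof (rule char_distr_sum)
      have "indep_vars (\<lambda>_. borel) (\<lambda>i \<omega>. g n (Xs i \<omega>)) UNIV"
        by (rule indep_vars_compose2[OF Xs_indep]) simp
      then show "indep_vars (\<lambda>_. borel) (\<lambda>i \<omega>. g n (Xs i \<omega>)) {..<n}" by (rule indep_vars_subset) simp
    qed
    then show ?thesis by (simp add: eq)
  qed
  have approx: "\<forall>\<^sub>F n in sequentially. cmod (\<psi> n - (1 - a n / 2)) \<le> a n * c n"
    using zero
  proof eventually_elim
    case (elim n)
    let ?D = "distr M borel (\<lambda>\<omega>. g n (X \<omega>))"
    interpret D: real_distribution ?D by (rule real_distribution_distr) simp
    have int: "integrable M (\<lambda>\<omega>. g n (X \<omega>))" using bnd by (intro integrable_const_bound[where B = "c n"]) auto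
    have c0: "c n \<ge> 0"
    proof -
      have "AE \<omega> in M. 0 \<le> c n" using bnd[of n] by eventually_elim auto
      then show ?thesis by simp
    qed
    have int2: "integrable M (\<lambda>\<omega>. (g n (X \<omega>))\<^sup>2)"
      using bnd[of n] c0 by (intro integrable_const_bound[where B = "(c n)\<^sup>2"]) (auto elim!: eventually_mono simp: power2_le_iff_abs_le)
    \<comment> \<open>Third order expansion; the cube is absorbed by
      \<open>\<bar>g\<bar> ^ 3 \<le> g\<^sup>2 * c n\<close>, so the error is small relative to the
      variance \<open>a n\<close>.\<close>
    have "cmod (char ?D 1 - (1 - 1\<^sup>2 * a n / 2)) \<le> (1\<^sup>2 / 6) * D.expectation (\<lambda>x. min (6 * x^2) (abs 1 * (abs x)^3))"
    proof (rule D.char_approx3)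
      show "integrable ?D (\<lambda>x. x)" using int by (subst integrable_distr_eq) auto
      show m: "D.expectation (\<lambda>x. x) = 0" using elim by (subst integral_distr) auto
      show "integrable ?D (\<lambda>x. x\<^sup>2)" using int2 by (subst integrable_distr_eq) auto
      show "D.variance (\<lambda>x. x) = a n" unfolding m by (subst integral_distr) (auto simp: a_def)
    qed
    also have "D.expectation (\<lambda>x. min (6 * x^2) (abs 1 * (abs x)^3)) =
       expectation (\<lambda>\<omega>. min (6 * (g n (X \<omega>))^2) (abs 1 * (abs (g n (X \<omega>)))^3))"
      by (subst integral_distr) auto
    also have "(1\<^sup>2 / 6) * \<dots> \<le> 1 * \<dots>" by (intro mult_right_mono integral_nonneg_AE) auto
    also have "1 * expectation (\<lambda>\<omega>. min (6 * (g n (X \<omega>))^2) (abs 1 * (abs (g n (X \<omega>)))^3))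
       \<le> expectation (\<lambda>\<omega>. (g n (X \<omega>))\<^sup>2 * c n)"
      unfolding mult_1
    proof (rule integral_mono_AE)
      show "integrable M (\<lambda>\<omega>. min (6 * (g n (X \<omega>))^2) (abs 1 * (abs (g n (X \<omega>)))^3))"
      proof (rule Bochner_Integration.integrable_bound[OF integrable_mult_right[OF int2, of 6]])
        have min_le: "norm (min a b) \<le> norm a" if "0 \<le> a" "0 \<le> b" for a b :: real
          using that by (simp add: min_def)
        show "AE \<omega> in M. norm (min (6 * (g n (X \<omega>))^2) (abs 1 * (abs (g n (X \<omega>)))^3)) \<le> norm (6 * (g n (X \<omega>))^2)"
          by (intro AE_I2 min_le) simp_all
      qed measurable
      show "integrable M (\<lambda>\<omega>. (g n (X \<omega>))\<^sup>2 * c n)" using int2 by simp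
      show "AE \<omega> in M. min (6 * (g n (X \<omega>))^2) (abs 1 * (abs (g n (X \<omega>)))^3) \<le> (g n (X \<omega>))\<^sup>2 * c n"
        using bnd[of n]
      proof eventually_elim
        case (elim \<omega>)
        have "(abs (g n (X \<omega>)))^3 = (g n (X \<omega>))\<^sup>2 * \<bar>g n (X \<omega>)\<bar>"
          by (simp add: power3_eq_cube power2_eq_square abs_mult_self_eq)
        also have "\<dots> \<le> (g n (X \<omega>))\<^sup>2 * c n" using elim by (intro mult_left_mono) auto
        finally show ?case by (intro min.coboundedI2) simp
      qed
    qed
    also have "\<dots> = a n * c n" using int2 by (simp add: a_def)
    finally show ?case by (simp add: \<psi>_def)
  qed
  have na: "(\<lambda>n. real n * a n) \<longlonglongrightarrow> s" using var by (simp add: a_def)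
  have s0: "s \<ge> 0" by (rule LIMSEQ_le_const[OF na]) (use a0 in auto)
  define b where "b n = 1 + (- s / 2) / real n" for n
  \<comment> \<open>\<open>n \<ge> s\<close> puts \<open>b n\<close> into the unit ball; for numbers
    of modulus at most 1 the \<open>n\<close>-th powers differ by at most \<open>n\<close> times the
    difference.\<close>
  have ev: "\<forall>\<^sub>F n in sequentially. cmod (\<phi> n - of_real (b n ^ n)) \<le> (real n * a n) * c n + \<bar>s - real n * a n\<bar> / 2"
    using approx eventually_ge_at_top[of "nat \<lceil>s\<rceil> + 1"]
  proof eventually_elim
    case (elim n)
    then have n: "n > 0" "real n \<ge> s" by linarith+
    define x where "x = s / real n"
    have x: "x \<le> 1" "0 \<le> x" "b n = 1 - x / 2" using n s0 by (simp_all add: x_def b_def)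
    then have "\<bar>b n\<bar> \<le> 1" by (simp add: abs_le_iff)
    then have b1: "norm (complex_of_real (b n)) \<le> 1" by (simp only: norm_of_real)
    have \<psi>1: "norm (\<psi> n) \<le> 1"
    proof -
      interpret D: real_distribution "distr M borel (\<lambda>\<omega>. g n (X \<omega>))" by (rule real_distribution_distr) simp
      show ?thesis unfolding \<psi>_def by (rule D.cmod_char_le_1)
    qed
    have eq: "\<psi> n - of_real (b n) = (\<psi> n - (1 - a n / 2)) + of_real (s / real n / 2 - a n / 2)"
      by (simp add: b_def)
    have "cmod (\<psi> n - of_real (b n)) \<le> cmod (\<psi> n - (1 - a n / 2)) + \<bar>s / real n / 2 - a n / 2\<bar>"
      unfolding eq by (rule order_trans[OF norm_triangle_ineq]) (simp only: norm_of_real order_refl)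
    then have step: "cmod (\<psi> n - of_real (b n)) \<le> a n * c n + \<bar>s / real n / 2 - a n / 2\<bar>"
      using elim(1) by linarith
    have "cmod (\<phi> n - of_real (b n ^ n)) \<le> real n * cmod (\<psi> n - of_real (b n))"
      unfolding \<phi> of_real_power by (rule norm_power_diff[OF \<psi>1 b1])
    also have "\<dots> \<le> real n * (a n * c n + \<bar>s / real n / 2 - a n / 2\<bar>)"
      by (rule mult_left_mono[OF step]) simp
    also have "real n * (a n * c n + \<bar>s / real n / 2 - a n / 2\<bar>) = (real n * a n) * c n + \<bar>s - real n * a n\<bar> / 2"
    proof -
      have "real n * \<bar>s / real n / 2 - a n / 2\<bar> = \<bar>real n * (s / real n / 2 - a n / 2)\<bar>"
        using n by (simp add: abs_mult)
      also have "real n * (s / real n / 2 - a n / 2) = (s - real n * a n) / 2"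
        using n by (simp add: field_simps)
      finally show ?thesis by (simp add: distrib_left)
    qed
    finally show ?case .
  qed
  have "(\<lambda>n. (real n * a n) * c n + \<bar>s - real n * a n\<bar> / 2) \<longlonglongrightarrow> s * 0 + \<bar>s - s\<bar> / 2"
    by (intro tendsto_intros na c) auto
  then have lim: "(\<lambda>n. (real n * a n) * c n + \<bar>s - real n * a n\<bar> / 2) \<longlonglongrightarrow> 0" by simp
  have diff: "(\<lambda>n. \<phi> n - of_real (b n ^ n)) \<longlonglongrightarrow> 0"
    by (rule Lim_null_comparison[OF ev lim])
  have "(\<lambda>n. complex_of_real (b n ^ n)) \<longlonglongrightarrow> of_real (exp (- s / 2))"
    unfolding b_def by (intro tendsto_of_real tendsto_exp_limit_sequentially)
  then have "\<phi> \<longlonglongrightarrow> of_real (exp (- s / 2))" by (rule Lim_transform[OF _ diff])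
  then show ?thesis by (simp add: \<phi>_def[abs_def])
qed

end

section \<open>Exceedances over a random threshold\<close>

text \<open>The matrix \<open>outer (scaled w x)\<close> appears here as an abstract bounded vector
  \<open>z x\<close> in a Euclidean space.\<close>

locale thresholded_sample = iid_sample M X Xs
  for M :: "'a measure" and X :: "'a \<Rightarrow> real^'d" and Xs :: "nat \<Rightarrow> 'a \<Rightarrow> real^'d" +
  fixes z :: "real^'d \<Rightarrow> 'e::euclidean_space" and C :: real
  assumes z_measurable [measurable]: "z \<in> borel_measurable borel"
    and z_bounded: "AE \<omega> in M. norm (z (X \<omega>)) \<le> C"
    and tail_positive: "\<And>t. prob {\<omega>\<in>space M. norm (X \<omega>) > t} > 0"
begin

definition tail :: "real \<Rightarrow> real" where "tail t = prob {\<omega>\<in>space M. norm (X \<omega>) > t}"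

text \<open>The mean of \<open>z\<close> given an exceedance of \<open>t\<close>, as a quotient of
  two integrals over the fixed measure \<open>M\<close>. In this form it is visibly a measurable
  function of \<open>t\<close>, into which a random threshold can be inserted.\<close>

definition cond_mean :: "real \<Rightarrow> 'e" where
  "cond_mean t = expectation (\<lambda>\<omega>. of_bool (norm (X \<omega>) > t) *\<^sub>R z (X \<omega>)) /\<^sub>R tail t"

text \<open>Centered at the conditional mean of its own threshold, hence of mean zero for each fixed
  \<open>t\<close>; this survives for a random threshold that is independent of the
  observation.\<close>

definition centered :: "real^'d \<Rightarrow> real \<Rightarrow> 'e" where
  "centered x t = of_bool (norm x > t) *\<^sub>R (z x - cond_mean t)"

lemma tail_pos: "tail t > 0"
  using tail_positive by (simp add: tail_def)

lemma expectation_of_bool: "expectation (\<lambda>\<omega>. of_bool (norm (X \<omega>) > t)) = tail t"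
proof -
  have "expectation (\<lambda>\<omega>. of_bool (norm (X \<omega>) > t) :: real) = expectation (indicat_real {\<omega>\<in>space M. norm (X \<omega>) > t})"
    by (intro Bochner_Integration.integral_cong) (auto simp: indicator_def)
  then show ?thesis by (simp add: tail_def)
qed

lemma C_nonneg: "C \<ge> 0"
proof -
  have "AE \<omega> in M. 0 \<le> C" using z_bounded by eventually_elim (use norm_ge_zero order_trans in blast)
  then show ?thesis by simp
qed

lemma z_bounded_Xs: "AE \<omega> in M. norm (z (Xs i \<omega>)) \<le> C"
  by (rule AE_Xs[OF _ z_bounded]) measurable

lemma integrable_of_bool_z: "integrable M (\<lambda>\<omega>. of_bool (norm (X \<omega>) > t) *\<^sub>R z (X \<omega>))"
  using z_bounded by (intro integrable_const_bound[where B = C]) (auto elim!: eventually_mono simp: C_nonneg)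

lemma integrable_of_bool [simp]: "integrable M (\<lambda>\<omega>. of_bool (norm (X \<omega>) > t) :: real)"
  by (intro integrable_const_bound[where B = 1]) auto

lemma norm_cond_mean_le: "norm (cond_mean t) \<le> C"
proof -
  have "norm (expectation (\<lambda>\<omega>. of_bool (norm (X \<omega>) > t) *\<^sub>R z (X \<omega>)))
     \<le> expectation (\<lambda>\<omega>. norm (of_bool (norm (X \<omega>) > t) *\<^sub>R z (X \<omega>)))"
    by (rule integral_norm_bound)
  also have "\<dots> \<le> expectation (\<lambda>\<omega>. of_bool (norm (X \<omega>) > t) * C)"
    using z_bounded
    by (intro integral_mono_AE integrable_norm integrable_of_bool_z) (auto elim!: eventually_mono)
  also have "\<dots> = tail t * C" by (simp add: expectation_of_bool)
  finally show ?thesis using tail_pos[of t] by (simp add: cond_mean_def field_simps)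
qed

lemma expectation_of_bool_z: "expectation (\<lambda>\<omega>. of_bool (norm (X \<omega>) > t) *\<^sub>R z (X \<omega>)) = tail t *\<^sub>R cond_mean t"
  using tail_pos[of t] by (simp add: cond_mean_def)

lemma centered_expectation: "expectation (\<lambda>\<omega>. centered (X \<omega>) t) = 0"
proof -
  have "expectation (\<lambda>\<omega>. centered (X \<omega>) t) =
    expectation (\<lambda>\<omega>. of_bool (norm (X \<omega>) > t) *\<^sub>R z (X \<omega>) - of_bool (norm (X \<omega>) > t) *\<^sub>R cond_mean t)"
    by (simp add: centered_def scaleR_diff_right)
  also have "\<dots> = tail t *\<^sub>R cond_mean t - tail t *\<^sub>R cond_mean t"
    using integrable_of_bool_z
    by (subst Bochner_Integration.integral_diff) (auto simp: expectation_of_bool_z expectation_of_bool)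
  finally show ?thesis by simp
qed

lemma tail_eq: "tail t = expectation (\<lambda>\<omega>. of_bool (norm (X \<omega>) > t))"
  by (simp add: expectation_of_bool)

lemma tail_measurable [measurable]: "tail \<in> borel_measurable borel"
proof -
  have "(\<lambda>t. expectation (\<lambda>\<omega>. of_bool (norm (X \<omega>) > t)) :: real) \<in> borel_measurable borel"
    by (rule borel_measurable_lebesgue_integral) measurable
  then show ?thesis by (simp add: tail_eq[abs_def])
qed

lemma cond_mean_measurable [measurable]: "cond_mean \<in> borel_measurable borel"
proof -
  have [measurable]: "(\<lambda>t. expectation (\<lambda>\<omega>. of_bool (norm (X \<omega>) > t) *\<^sub>R z (X \<omega>))) \<in> borel_measurable borel"
    by (rule borel_measurable_lebesgue_integral) measurable
  show ?thesis unfolding cond_mean_def[abs_def] by measurable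
qed

lemma centered_measurable [measurable (raw)]:
  assumes [measurable]: "f \<in> borel_measurable S" "g \<in> borel_measurable S"
  shows "(\<lambda>s. centered (f s) (g s)) \<in> borel_measurable S"
  unfolding centered_def by measurable

lemma norm_centered_le: "norm (z x) \<le> C \<Longrightarrow> norm (centered x t) \<le> 2 * C"
proof -
  assume "norm (z x) \<le> C"
  then have "norm (z x - cond_mean t) \<le> 2 * C"
    using norm_triangle_ineq4[of "z x" "cond_mean t"] norm_cond_mean_le[of t] by linarith
  then show ?thesis using C_nonneg by (simp add: centered_def)
qed

lemma centered_bounded: "AE \<omega> in M. norm (centered (X \<omega>) t) \<le> 2 * C"
  using z_bounded by eventually_elim (rule norm_centered_le)

lemma integrable_centered: "integrable M (\<lambda>\<omega>. centered (X \<omega>) t)"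
  using centered_bounded by (rule integrable_const_bound) measurable

text \<open>The threshold and \<open>W\<close> depend on the other observations only, so both are
  constants once these are frozen.\<close>

lemma expectation_centered_inner_zero:
  fixes T :: "(nat \<Rightarrow> real^'d) \<Rightarrow> real" and W :: "(nat \<Rightarrow> real^'d) \<Rightarrow> 'e"
  assumes i: "i \<notin> J" and T [measurable]: "T \<in> borel_measurable (PiM J (\<lambda>_. borel))"
    and W [measurable]: "W \<in> borel_measurable (PiM J (\<lambda>_. borel))"
    and bnd: "AE \<omega> in M. norm (W (others J \<omega>)) \<le> c"
  shows "expectation (\<lambda>\<omega>. centered (Xs i \<omega>) (T (others J \<omega>)) \<bullet> W (others J \<omega>)) = 0"
proof (rule expectation_indep_zero[OF i])
  show "(\<lambda>p. centered (fst p) (T (snd p)) \<bullet> W (snd p)) \<in> borel_measurable (borel \<Otimes>\<^sub>M PiM J (\<lambda>_. borel))"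
    by measurable
  show "expectation (\<lambda>\<omega>. centered (X \<omega>) (T y) \<bullet> W y) = 0" for y
    using integrable_centered centered_expectation by simp
  note [measurable] = others_measurable
  show "integrable M (\<lambda>\<omega>. centered (Xs i \<omega>) (T (others J \<omega>)) \<bullet> W (others J \<omega>))"
  proof (rule integrable_const_bound[where B = "2 * C * c"])
    show "AE \<omega> in M. norm (centered (Xs i \<omega>) (T (others J \<omega>)) \<bullet> W (others J \<omega>)) \<le> 2 * C * c"
      using z_bounded_Xs[of i] bnd
    proof eventually_elim
      case (elim \<omega>)
      have "norm (centered (Xs i \<omega>) (T (others J \<omega>)) \<bullet> W (others J \<omega>))
        \<le> norm (centered (Xs i \<omega>) (T (others J \<omega>))) * norm (W (others J \<omega>))"
        using Cauchy_Schwarz_ineq2 by simp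
      also have "\<dots> \<le> 2 * C * c" using norm_centered_le[OF elim(1)] elim(2) C_nonneg by (intro mult_mono) auto
      finally show ?case .
    qed
  qed measurable
qed

lemma component_measurable_PiM: "j \<in> J \<Longrightarrow> (\<lambda>y. y j) \<in> borel_measurable (PiM J (\<lambda>_. borel))"
  by (rule measurable_component_singleton)

lemma emp_thresh_Xs_measurable:
  "k < n \<Longrightarrow> (\<lambda>\<omega>. emp_thresh n k (\<lambda>i. Xs i \<omega>)) \<in> borel_measurable M"
  by (rule emp_thresh_measurable) auto

text \<open>On \<open>norm (Xs i) > emp_thresh\<close> the threshold is a function of the other observations; given
  these, \<open>centered (Xs i)\<close> has mean zero. Hence the summands are uncorrelated although they share
  the random threshold.\<close>
lemma expectation_centered_emp_thresh_zero:
  fixes W :: "real^'d \<Rightarrow> real \<Rightarrow> 'e"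
  assumes k: "1 \<le> k" "k < n" and ij: "i < n" "j < n" "i \<noteq> j"
    and W [measurable]: "(\<lambda>p. W (fst p) (snd p)) \<in> borel_measurable (borel \<Otimes>\<^sub>M borel)"
    and bnd: "AE \<omega> in M. \<forall>t. norm (W (Xs j \<omega>) t) \<le> c"
  shows "expectation (\<lambda>\<omega>. centered (Xs i \<omega>) (emp_thresh n k (\<lambda>i. Xs i \<omega>)) \<bullet>
     W (Xs j \<omega>) (emp_thresh n k (\<lambda>i. Xs i \<omega>))) = 0"
proof -
  define J where "J = {..<n} - {i}"
  define T :: "(nat \<Rightarrow> real^'d) \<Rightarrow> real" where "T = loo_thresh n k i"
  have T [measurable]: "T \<in> borel_measurable (PiM J (\<lambda>_. borel))"
    unfolding T_def using ij k
    by (intro loo_thresh_measurable[where f = "\<lambda>j y. y j"] component_measurable_PiM) (auto simp: J_def)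
  have [measurable]: "(\<lambda>y. y j) \<in> borel_measurable (PiM J (\<lambda>_. borel))"
    using ij by (intro component_measurable_PiM) (auto simp: J_def)
  have Teq: "T (others J \<omega>) = loo_thresh n k i (\<lambda>i. Xs i \<omega>)" for \<omega>
    unfolding T_def using ij by (intro loo_thresh_cong) (auto simp: J_def)
  have jJ: "j \<in> J" using ij by (simp add: J_def)
  \<comment> \<open>Where \<open>Xs i\<close> is no exceedance both first factors vanish; elsewhere
    the two thresholds agree. So the threshold may be replaced inside \<open>W\<close> as
    well.\<close>
  have "centered (Xs i \<omega>) (emp_thresh n k (\<lambda>i. Xs i \<omega>)) \<bullet> W (Xs j \<omega>) (emp_thresh n k (\<lambda>i. Xs i \<omega>))
     = centered (Xs i \<omega>) (T (others J \<omega>)) \<bullet> W (others J \<omega> j) (T (others J \<omega>))" for \<omega>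
  proof (cases "norm (Xs i \<omega>) > emp_thresh n k (\<lambda>i. Xs i \<omega>)")
    case True
    then show ?thesis
      using loo_thresh_eq[OF ij(1) k, of "\<lambda>i. Xs i \<omega>"] jJ by (simp add: Teq)
  next
    case False
    then show ?thesis
      using norm_gt_emp_thresh_iff[OF ij(1) k, of "\<lambda>i. Xs i \<omega>"] by (simp add: Teq centered_def)
  qed
  moreover have "expectation (\<lambda>\<omega>. centered (Xs i \<omega>) (T (others J \<omega>)) \<bullet> W (others J \<omega> j) (T (others J \<omega>))) = 0"
  proof (rule expectation_centered_inner_zero[where W = "\<lambda>y. W (y j) (T y)"])
    show "(\<lambda>y. W (y j) (T y)) \<in> borel_measurable (PiM J (\<lambda>_. borel))"
    proof -
      have "(\<lambda>y. (y j, T y)) \<in> measurable (PiM J (\<lambda>_. borel)) (borel \<Otimes>\<^sub>M borel)" by measurable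
      from measurable_compose[OF this W] show ?thesis by simp
    qed
    show "AE \<omega> in M. norm (W (others J \<omega> j) (T (others J \<omega>))) \<le> c"
      using bnd ij by (auto elim!: eventually_mono simp: J_def)
  qed (use T in \<open>auto simp: J_def\<close>)
  ultimately show ?thesis by simp
qed

text \<open>Either the indicators differ, and the crude bound \<open>2 * C\<close> applies to the
  single nonzero term, or they agree and only the centering changes.\<close>

lemma centered_diff_sq_le:
  assumes "norm (z x) \<le> C"
  shows "(norm (centered x a - centered x u))\<^sup>2 \<le>
    4 * C\<^sup>2 * \<bar>of_bool (norm x > a) - of_bool (norm x > u)\<bar> + of_bool (norm x > a) * (norm (cond_mean a - cond_mean u))\<^sup>2"
proof -
  have *: "(norm (centered x t))\<^sup>2 \<le> 4 * C\<^sup>2" for t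
    using power_mono[OF norm_centered_le[OF assms, of t] norm_ge_zero, of 2] by (simp add: power_mult_distrib)
  consider "norm x > a \<longleftrightarrow> norm x > u" | "norm x > a" "\<not> norm x > u" | "\<not> norm x > a" "norm x > u" by blast
  then show ?thesis
  proof cases
    case 1
    then show ?thesis by (cases "norm x > u") (auto simp: centered_def norm_minus_commute)
  next
    case 2 then show ?thesis using *[of a] by (simp add: centered_def add_increasing2)
  next
    case 3 then show ?thesis using *[of u] by (simp add: centered_def norm_minus_commute)
  qed
qed

text \<open>Cross terms vanish, so the mean square is a sum of \<open>n\<close> diagonal terms. The
  observations between the two thresholds are counted by the difference of the exceedance counts;
  the change of centering concerns at most \<open>k\<close> exceedances of the random
  threshold.\<close>

theorem centered_sum_threshold_change:
  fixes n k :: nat and u :: real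
  assumes k: "1 \<le> k" "k < n"
  defines "th \<equiv> \<lambda>\<omega>. emp_thresh n k (\<lambda>i. Xs i \<omega>)"
  defines "D \<equiv> \<lambda>\<omega>. \<Sum>i<n. centered (Xs i \<omega>) (th \<omega>) - centered (Xs i \<omega>) u"
  shows "integrable M (\<lambda>\<omega>. (norm (D \<omega>))\<^sup>2)"
    and "expectation (\<lambda>\<omega>. (norm (D \<omega>))\<^sup>2) \<le>
      4 * C\<^sup>2 * expectation (\<lambda>\<omega>. \<bar>real (exceed_count n (\<lambda>i. Xs i \<omega>) (th \<omega>)) - real (exceed_count n (\<lambda>i. Xs i \<omega>) u)\<bar>)
      + real k * expectation (\<lambda>\<omega>. (norm (cond_mean (th \<omega>) - cond_mean u))\<^sup>2)"
proof -
  have th [measurable]: "th \<in> borel_measurable M" unfolding th_def by (rule emp_thresh_Xs_measurable[OF k(2)])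
  define g where "g i \<omega> = centered (Xs i \<omega>) (th \<omega>) - centered (Xs i \<omega>) u" for i \<omega>
  have gm [measurable]: "g i \<in> borel_measurable M" for i unfolding g_def by measurable
  have b: "AE \<omega> in M. norm (g i \<omega>) \<le> 4 * C" for i
    using z_bounded_Xs[of i]
  proof eventually_elim
    case (elim \<omega>)
    show ?case unfolding g_def
      using norm_triangle_ineq4[of "centered (Xs i \<omega>) (th \<omega>)" "centered (Xs i \<omega>) u"]
        norm_centered_le[OF elim, of "th \<omega>"] norm_centered_le[OF elim, of u] by linarith
  qed
  have bi: "AE \<omega> in M. \<forall>t. norm (centered (Xs j \<omega>) t) \<le> 2 * C" for j
    using z_bounded_Xs[of j] by eventually_elim (auto intro: norm_centered_le)
  \<comment> \<open>Of the four products, two mix the random and the deterministic threshold; there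
    the summand with the random one serves as the centered factor.\<close>
  have orth: "expectation (\<lambda>\<omega>. g i \<omega> \<bullet> g j \<omega>) = 0" if ij: "i < n" "j < n" "i \<noteq> j" for i j
  proof -
    have i1: "integrable M (\<lambda>\<omega>. centered (Xs i \<omega>) (f \<omega>) \<bullet> centered (Xs j \<omega>) (h \<omega>))"
      if [measurable]: "f \<in> borel_measurable M" "h \<in> borel_measurable M" for i j f h
    proof (rule integrable_const_bound[where B = "2 * C * (2 * C)"])
      show "AE \<omega> in M. norm (centered (Xs i \<omega>) (f \<omega>) \<bullet> centered (Xs j \<omega>) (h \<omega>)) \<le> 2 * C * (2 * C)"
        using bi[of i] bi[of j]
      proof eventually_elim
        case (elim \<omega>)
        have "norm (centered (Xs i \<omega>) (f \<omega>) \<bullet> centered (Xs j \<omega>) (h \<omega>))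
          \<le> norm (centered (Xs i \<omega>) (f \<omega>)) * norm (centered (Xs j \<omega>) (h \<omega>))"
          using Cauchy_Schwarz_ineq2 by simp
        also have "\<dots> \<le> 2 * C * (2 * C)" using elim C_nonneg by (intro mult_mono) auto
        finally show ?case .
      qed
    qed measurable
    have 1: "expectation (\<lambda>\<omega>. centered (Xs i \<omega>) (th \<omega>) \<bullet> centered (Xs j \<omega>) (th \<omega>)) = 0"
      unfolding th_def by (rule expectation_centered_emp_thresh_zero[OF k ij _ bi]) measurable
    have 2: "expectation (\<lambda>\<omega>. centered (Xs i \<omega>) (th \<omega>) \<bullet> centered (Xs j \<omega>) u) = 0" if ij: "i < n" "j < n" "i \<noteq> j" for i j
      unfolding th_def
      by (rule expectation_centered_emp_thresh_zero[OF k ij, where W = "\<lambda>x t. centered x u" and c = "2 * C"])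
        (use bi[of j] in \<open>auto elim!: eventually_mono\<close>)
    have 3: "expectation (\<lambda>\<omega>. centered (Xs i \<omega>) u \<bullet> centered (Xs j \<omega>) u) = 0"
    proof -
      have [measurable]: "(\<lambda>y. y j) \<in> borel_measurable (PiM {j} (\<lambda>_. borel :: (real^'d) measure))"
        by (rule component_measurable_PiM) simp
      have "expectation (\<lambda>\<omega>. centered (Xs i \<omega>) u \<bullet> centered (others {j} \<omega> j) u) = 0"
        by (rule expectation_centered_inner_zero[where J = "{j}" and T = "\<lambda>_. u" and W = "\<lambda>y. centered (y j) u" and c = "2 * C"])
          (use ij bi[of j] in \<open>auto elim!: eventually_mono\<close>)
      then show ?thesis by simp
    qed
    have "expectation (\<lambda>\<omega>. g i \<omega> \<bullet> g j \<omega>) =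
      expectation (\<lambda>\<omega>. (centered (Xs i \<omega>) (th \<omega>) \<bullet> centered (Xs j \<omega>) (th \<omega>)
        - centered (Xs i \<omega>) (th \<omega>) \<bullet> centered (Xs j \<omega>) u)
        - (centered (Xs j \<omega>) (th \<omega>) \<bullet> centered (Xs i \<omega>) u - centered (Xs i \<omega>) u \<bullet> centered (Xs j \<omega>) u))"
      by (simp add: g_def inner_diff_left inner_diff_right inner_commute algebra_simps)
    also have "\<dots> = 0"
      using i1 by (simp add: 1 2[OF ij] 2[OF ij(2,1) ij(3)[symmetric]] 3)
    finally show ?thesis .
  qed
  have D_eq: "D = (\<lambda>\<omega>. \<Sum>i<n. g i \<omega>)" by (simp add: D_def g_def)
  show "integrable M (\<lambda>\<omega>. (norm (D \<omega>))\<^sup>2)"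
    unfolding D_eq by (rule expectation_norm_sum_sq(1)[OF gm b orth])
  define N where "N t \<omega> = exceed_count n (\<lambda>i. Xs i \<omega>) t" for t \<omega>
  have Nsum: "real (N t \<omega>) = (\<Sum>i<n. of_bool (norm (Xs i \<omega>) > t))" for t \<omega>
    by (simp add: N_def exceed_count_sum)
  have [measurable]: "(\<lambda>\<omega>. real (N (f \<omega>) \<omega>)) \<in> borel_measurable M" if [measurable]: "f \<in> borel_measurable M" for f
    unfolding Nsum by measurable
  have N_le: "N t \<omega> \<le> n" for t \<omega>
    unfolding N_def exceed_count_def using card_mono[of "{..<n}" "{i. i < n \<and> t < norm (Xs i \<omega>)}"] by (auto simp: subset_eq)
  have m_le: "(norm (cond_mean a - cond_mean b))\<^sup>2 \<le> (2 * C)\<^sup>2" for a b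
    by (intro power_mono) (use norm_triangle_ineq4[of "cond_mean a" "cond_mean b"] norm_cond_mean_le[of a] norm_cond_mean_le[of b] in auto)
  have intN: "integrable M (\<lambda>\<omega>. \<bar>real (N (th \<omega>) \<omega>) - real (N u \<omega>)\<bar>)"
  proof (rule integrable_const_bound[where B = "real n"])
    show "AE \<omega> in M. norm \<bar>real (N (th \<omega>) \<omega>) - real (N u \<omega>)\<bar> \<le> real n"
      using N_le by (auto simp: abs_le_iff intro!: AE_I2) (meson N_le diff_le_eq le_add_same_cancel1 of_nat_0_le_iff of_nat_le_iff order_trans)+
  qed measurable
  have intm: "integrable M (\<lambda>\<omega>. (norm (cond_mean (th \<omega>) - cond_mean u))\<^sup>2)"
    using m_le by (intro integrable_const_bound[where B = "(2 * C)\<^sup>2"]) auto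
  have "expectation (\<lambda>\<omega>. (norm (D \<omega>))\<^sup>2) = (\<Sum>i<n. expectation (\<lambda>\<omega>. (norm (g i \<omega>))\<^sup>2))"
    unfolding D_eq by (rule expectation_norm_sum_sq(2)[OF gm b orth])
  also have "\<dots> = expectation (\<lambda>\<omega>. \<Sum>i<n. (norm (g i \<omega>))\<^sup>2)"
  proof (rule Bochner_Integration.integral_sum[symmetric])
    fix i
    show "integrable M (\<lambda>\<omega>. (norm (g i \<omega>))\<^sup>2)"
    proof (rule integrable_const_bound[where B = "(4 * C)\<^sup>2"])
      show "AE \<omega> in M. norm ((norm (g i \<omega>))\<^sup>2) \<le> (4 * C)\<^sup>2"
        using b[of i]
      proof eventually_elim
        case (elim \<omega>)
        then have "(norm (g i \<omega>))\<^sup>2 \<le> (4 * C)\<^sup>2" by (intro power_mono) auto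
        then show ?case by simp
      qed
    qed measurable
  qed
  also have "\<dots> \<le> expectation (\<lambda>\<omega>. 4 * C\<^sup>2 * \<bar>real (N (th \<omega>) \<omega>) - real (N u \<omega>)\<bar>
      + real k * (norm (cond_mean (th \<omega>) - cond_mean u))\<^sup>2)"
  proof (rule integral_mono_AE')
    show "integrable M (\<lambda>\<omega>. 4 * C\<^sup>2 * \<bar>real (N (th \<omega>) \<omega>) - real (N u \<omega>)\<bar>
      + real k * (norm (cond_mean (th \<omega>) - cond_mean u))\<^sup>2)" using intN intm by simp
    have "AE \<omega> in M. \<forall>i\<in>{..<n}. norm (z (Xs i \<omega>)) \<le> C"
      using z_bounded_Xs by (intro AE_finite_allI) auto
    then show "AE \<omega> in M. (\<Sum>i<n. (norm (g i \<omega>))\<^sup>2) \<le> 4 * C\<^sup>2 * \<bar>real (N (th \<omega>) \<omega>) - real (N u \<omega>)\<bar>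
      + real k * (norm (cond_mean (th \<omega>) - cond_mean u))\<^sup>2"
    proof eventually_elim
      case (elim \<omega>)
      let ?b = "\<lambda>t i. of_bool (norm (Xs i \<omega>) > t) :: real"
      let ?m = "(norm (cond_mean (th \<omega>) - cond_mean u))\<^sup>2"
      have "(\<Sum>i<n. (norm (g i \<omega>))\<^sup>2) \<le> (\<Sum>i<n. 4 * C\<^sup>2 * \<bar>?b (th \<omega>) i - ?b u i\<bar> + ?b (th \<omega>) i * ?m)"
        unfolding g_def using elim by (intro sum_mono centered_diff_sq_le) auto
      also have "\<dots> = 4 * C\<^sup>2 * (\<Sum>i<n. \<bar>?b (th \<omega>) i - ?b u i\<bar>) + real (N (th \<omega>) \<omega>) * ?m"
        by (simp add: Nsum sum.distrib sum_distrib_left sum_distrib_right)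
      \<comment> \<open>The indicators are ordered in the same way for all \<open>i\<close>, so no
        cancellation occurs.\<close>
      also have "(\<Sum>i<n. \<bar>?b (th \<omega>) i - ?b u i\<bar>) = \<bar>real (N (th \<omega>) \<omega>) - real (N u \<omega>)\<bar>"
      proof (cases "th \<omega> \<le> u")
        case True
        then have "\<bar>?b (th \<omega>) i - ?b u i\<bar> = ?b (th \<omega>) i - ?b u i" for i by auto
        then have "(\<Sum>i<n. \<bar>?b (th \<omega>) i - ?b u i\<bar>) = real (N (th \<omega>) \<omega>) - real (N u \<omega>)"
          by (simp add: Nsum sum_subtractf)
        moreover have "0 \<le> (\<Sum>i<n. \<bar>?b (th \<omega>) i - ?b u i\<bar>)" by (rule sum_nonneg) simp
        ultimately show ?thesis by linarith
      next
        case False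
        then have "\<bar>?b (th \<omega>) i - ?b u i\<bar> = ?b u i - ?b (th \<omega>) i" for i by auto
        then have "(\<Sum>i<n. \<bar>?b (th \<omega>) i - ?b u i\<bar>) = real (N u \<omega>) - real (N (th \<omega>) \<omega>)"
          by (simp add: Nsum sum_subtractf)
        moreover have "0 \<le> (\<Sum>i<n. \<bar>?b (th \<omega>) i - ?b u i\<bar>)" by (rule sum_nonneg) simp
        ultimately show ?thesis by linarith
      qed
      also have "real (N (th \<omega>) \<omega>) * ?m \<le> real k * ?m"
        using emp_count_le[OF k(2), of "\<lambda>i. Xs i \<omega>"] by (intro mult_right_mono) (auto simp: N_def th_def)
      finally show ?case by simp
    qed
  qed (auto intro!: AE_I2)
  also have "\<dots> = 4 * C\<^sup>2 * expectation (\<lambda>\<omega>. \<bar>real (N (th \<omega>) \<omega>) - real (N u \<omega>)\<bar>)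
     + real k * expectation (\<lambda>\<omega>. (norm (cond_mean (th \<omega>) - cond_mean u))\<^sup>2)"
    using intN intm by simp
  finally show "expectation (\<lambda>\<omega>. (norm (D \<omega>))\<^sup>2) \<le>
      4 * C\<^sup>2 * expectation (\<lambda>\<omega>. \<bar>real (exceed_count n (\<lambda>i. Xs i \<omega>) (th \<omega>)) - real (exceed_count n (\<lambda>i. Xs i \<omega>) u)\<bar>)
      + real k * expectation (\<lambda>\<omega>. (norm (cond_mean (th \<omega>) - cond_mean u))\<^sup>2)"
    by (simp add: N_def)
qed

lemma centered_sum_second_moment:
  shows "integrable M (\<lambda>\<omega>. (norm (\<Sum>i<n. centered (Xs i \<omega>) u))\<^sup>2)"
    and "expectation (\<lambda>\<omega>. (norm (\<Sum>i<n. centered (Xs i \<omega>) u))\<^sup>2) \<le> 4 * C\<^sup>2 * (real n * tail u)"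
proof -
  have [measurable]: "(\<lambda>x. centered x u) \<in> borel_measurable borel" by measurable
  note * = expectation_norm_centered_sum_sq[OF this centered_bounded centered_expectation, of n]
  show "integrable M (\<lambda>\<omega>. (norm (\<Sum>i<n. centered (Xs i \<omega>) u))\<^sup>2)" by (rule *(1))
  have "expectation (\<lambda>\<omega>. (norm (centered (X \<omega>) u))\<^sup>2) \<le> expectation (\<lambda>\<omega>. 4 * C\<^sup>2 * of_bool (norm (X \<omega>) > u))"
  proof (rule integral_mono_AE')
    show "AE \<omega> in M. (norm (centered (X \<omega>) u))\<^sup>2 \<le> 4 * C\<^sup>2 * of_bool (norm (X \<omega>) > u)"
      using centered_bounded[of u]
    proof eventually_elim
      case (elim \<omega>)
      have "(norm (centered (X \<omega>) u))\<^sup>2 \<le> (2 * C)\<^sup>2" using elim by (intro power_mono) auto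
      then show ?case by (cases "norm (X \<omega>) > u") (auto simp: centered_def power_mult_distrib)
    qed
  qed auto
  also have "\<dots> = 4 * C\<^sup>2 * tail u" by (simp add: expectation_of_bool)
  finally show "expectation (\<lambda>\<omega>. (norm (\<Sum>i<n. centered (Xs i \<omega>) u))\<^sup>2) \<le> 4 * C\<^sup>2 * (real n * tail u)"
    unfolding *(2) by (simp add: mult_left_mono mult.left_commute)
qed

text \<open>Binomial variance, with the factor \<open>1 - tail u\<close> dropped.\<close>

lemma exceed_count_second_moment:
  shows "integrable M (\<lambda>\<omega>. (real (exceed_count n (\<lambda>i. Xs i \<omega>) u) - real n * tail u)\<^sup>2)"
    and "expectation (\<lambda>\<omega>. (real (exceed_count n (\<lambda>i. Xs i \<omega>) u) - real n * tail u)\<^sup>2) \<le> real n * tail u"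
proof -
  define g where "g x = of_bool (norm x > u) - tail u" for x :: "real^'d"
  have [measurable]: "g \<in> borel_measurable borel" unfolding g_def by measurable
  have t1: "tail u \<le> 1" by (simp add: tail_def)
  have bnd: "AE \<omega> in M. norm (g (X \<omega>)) \<le> 1"
    using tail_pos[of u] t1 by (intro AE_I2) (auto simp: g_def)
  have zero: "expectation (\<lambda>\<omega>. g (X \<omega>)) = 0"
    by (simp add: g_def expectation_of_bool prob_space)
  note * = expectation_norm_centered_sum_sq[OF _ bnd zero, of n]
  have eq: "(\<Sum>i<n. g (Xs i \<omega>))\<^sup>2 = (real (exceed_count n (\<lambda>i. Xs i \<omega>) u) - real n * tail u)\<^sup>2" for \<omega>
    by (simp add: g_def sum_subtractf exceed_count_sum)
  show "integrable M (\<lambda>\<omega>. (real (exceed_count n (\<lambda>i. Xs i \<omega>) u) - real n * tail u)\<^sup>2)"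
    using *(1) by (simp add: eq)
  have "expectation (\<lambda>\<omega>. (norm (g (X \<omega>)))\<^sup>2) = expectation (\<lambda>\<omega>. (1 - 2 * tail u) * of_bool (norm (X \<omega>) > u) + (tail u)\<^sup>2)"
    by (intro Bochner_Integration.integral_cong) (auto simp: g_def power2_eq_square algebra_simps)
  also have "\<dots> = (1 - 2 * tail u) * tail u + (tail u)\<^sup>2" by (simp add: expectation_of_bool prob_space)
  also have "\<dots> \<le> tail u" by (simp add: power2_eq_square algebra_simps)
  finally show "expectation (\<lambda>\<omega>. (real (exceed_count n (\<lambda>i. Xs i \<omega>) u) - real n * tail u)\<^sup>2) \<le> real n * tail u"
    using *(2) by (simp add: eq mult_left_mono)
qed

end

text \<open>The two tail bounds distill regular variation. A proportional increase of the threshold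
  loses a fixed fraction of the exceedances, which localizes the empirical threshold; a small one
  loses little, which limits the effect of atoms of the norm.\<close>

locale heavy_tailed_sample = thresholded_sample M X Xs z C
  for M :: "'a measure" and X :: "'a \<Rightarrow> real^'d" and Xs :: "nat \<Rightarrow> 'a \<Rightarrow> real^'d"
    and z :: "real^'d \<Rightarrow> 'e::euclidean_space" and C :: real +
  fixes k :: "nat \<Rightarrow> nat" and S :: 'e
  assumes tail_ratio_less: "\<And>s. s > 1 \<Longrightarrow> \<exists>\<eta><1. \<forall>\<^sub>F t in at_top. tail (s * t) \<le> \<eta> * tail t"
    and tail_ratio_greater: "\<And>\<eta>. \<eta> < 1 \<Longrightarrow> \<exists>s>1. \<forall>\<^sub>F t in at_top. tail (s * t) \<ge> \<eta> * tail t"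
    and k_infinity: "filterlim k at_top sequentially"
    and k_small: "(\<lambda>n. real (k n) / real n) \<longlonglongrightarrow> 0"
    and cond_mean_tendsto: "(cond_mean \<longlongrightarrow> S) at_top"
    and cond_mean_rate: "\<exists>\<epsilon>>0. uniform_limit {1-\<epsilon>..1+\<epsilon>}
       (\<lambda>n s. sqrt (real (k n)) * norm (cond_mean (s * thresh M X n (k n)) - cond_mean (thresh M X n (k n))))
       (\<lambda>_. 0) sequentially"
begin

definition tn :: "nat \<Rightarrow> real" where "tn n = thresh M X n (k n)"

text \<open>For \<open>k n \<ge> n\<close> the list position is out of range; the default 0 keeps
  \<open>th n\<close> measurable for every \<open>n\<close>.\<close>

definition th :: "nat \<Rightarrow> 'a \<Rightarrow> real" where
  "th n \<omega> = (if k n < n then emp_thresh n (k n) (\<lambda>i. Xs i \<omega>) else 0)"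

definition count :: "nat \<Rightarrow> real \<Rightarrow> 'a \<Rightarrow> real" where
  "count n t \<omega> = real (exceed_count n (\<lambda>i. Xs i \<omega>) t)"

lemma th_measurable [measurable]: "th n \<in> borel_measurable M"
  unfolding th_def[abs_def] by (cases "k n < n") (auto intro: emp_thresh_Xs_measurable)

lemma count_eq_sum: "count n t \<omega> = (\<Sum>i<n. of_bool (norm (Xs i \<omega>) > t))"
  by (simp add: count_def exceed_count_sum)

lemma count_measurable [measurable (raw)]:
  "f \<in> borel_measurable M \<Longrightarrow> (\<lambda>\<omega>. count n (f \<omega>) \<omega>) \<in> borel_measurable M"
proof -
  assume [measurable]: "f \<in> borel_measurable M"
  note [measurable] = Xs_measurable
  show ?thesis unfolding count_eq_sum by measurable
qed

lemma count_antimono: "s \<le> t \<Longrightarrow> count n t \<omega> \<le> count n s \<omega>"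
  by (simp add: count_def exceed_count_antimono)

lemma tail_antimono: "s \<le> t \<Longrightarrow> tail t \<le> tail s"
  unfolding tail_def by (rule finite_measure_mono) auto

lemma eventually_k: "\<forall>\<^sub>F n in sequentially. 1 \<le> k n \<and> k n < n"
proof -
  have "\<forall>\<^sub>F n in sequentially. real (k n) / real n < 1"
    using order_tendstoD(2)[OF k_small, of 1] by simp
  moreover have "\<forall>\<^sub>F n in sequentially. 1 \<le> k n"
    using k_infinity unfolding filterlim_at_top by blast
  ultimately show ?thesis using eventually_gt_at_top[of 0]
    by eventually_elim (simp add: field_simps)
qed

lemma real_k_infinity: "filterlim (\<lambda>n. real (k n)) at_top sequentially"
  using filterlim_compose[OF filterlim_real_sequentially k_infinity] .

lemma inverse_k_tendsto: "(\<lambda>n. inverse (real (k n))) \<longlonglongrightarrow> 0"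
  by (rule tendsto_inverse_0_at_top[OF real_k_infinity])

lemma inverse_sqrt_k_tendsto: "(\<lambda>n. 1 / sqrt (real (k n))) \<longlonglongrightarrow> 0"
  using tendsto_real_sqrt[OF inverse_k_tendsto] by (simp add: real_sqrt_divide inverse_eq_divide)

text \<open>Right continuity of \<open>tail\<close> gives the bound at the quantile itself, the
  infimum property the strict bound below it. An atom at the quantile can make the first inequality
  strict.\<close>

lemma tn_tail:
  assumes "1 \<le> k n" "k n < n"
  shows tail_tn_le: "tail (tn n) \<le> real (k n) / real n"
    and tail_less_tn: "\<And>x. x < tn n \<Longrightarrow> tail x > real (k n) / real n"
proof -
  define r where "r = real (k n) / real n"
  have r: "0 < r" "r < 1" using assms by (auto simp: r_def)
  define A where "A = {x. tail x \<le> r}"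
  have comp: "prob {\<omega> \<in> space M. norm (X \<omega>) \<le> x} = 1 - tail x" for x
  proof -
    have "{\<omega> \<in> space M. norm (X \<omega>) \<le> x} = space M - {\<omega> \<in> space M. norm (X \<omega>) > x}" by auto
    then show ?thesis unfolding tail_def by (subst prob_compl[symmetric]) auto
  qed
  have tn_Inf: "tn n = Inf A"
    unfolding tn_def thresh_def quantile_def comp A_def r_def by (rule arg_cong[where f = Inf]) auto
  have Ane: "A \<noteq> {}"
  proof -
    obtain u where "prob {\<omega>\<in>space M. norm (X \<omega>) > u} < r" by (rule prob_large_norm[OF X_measurable r(1)])
    then have "u \<in> A" by (simp add: A_def tail_def)
    then show ?thesis by auto
  qed
  \<comment> \<open>A negative level has tail probability 1, above \<open>r\<close>. Without a lower
    bound the infimum would be unspecified.\<close>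
  have bdd: "bdd_below A"
  proof (rule bdd_belowI)
    fix x assume x: "x \<in> A"
    show "0 \<le> x"
    proof (rule ccontr)
      assume "\<not> 0 \<le> x"
      then have "{\<omega>\<in>space M. norm (X \<omega>) > x} = space M" by (auto intro: less_le_trans[of x 0])
      then have "tail x = 1" by (simp add: tail_def prob_space)
      then show False using x r by (simp add: A_def)
    qed
  qed
  have up: "y \<in> A" if y: "y > Inf A" for y
  proof -
    obtain x where "x \<in> A" "x < y" using cInf_lessD[OF Ane y] by blast
    then show ?thesis using tail_antimono[of x y] by (simp add: A_def)
  qed
  have "tail (Inf A) \<le> r"
  proof -
    define E where "E j = {\<omega>\<in>space M. norm (X \<omega>) > Inf A + inverse (real (Suc j))}" for j
    have "(\<lambda>j. prob (E j)) \<longlonglongrightarrow> prob (\<Union>j. E j)"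
    proof (rule finite_Lim_measure_incseq)
      show "incseq E"
      proof (rule incseq_SucI)
        fix j
        have "inverse (real (Suc (Suc j))) \<le> inverse (real (Suc j))" by simp
        then have "Inf A + inverse (real (Suc (Suc j))) \<le> Inf A + inverse (real (Suc j))"
          by (rule add_left_mono)
        then show "E j \<subseteq> E (Suc j)" unfolding E_def using le_less_trans by blast
      qed
    qed (auto simp: E_def)
    also have "(\<Union>j. E j) = {\<omega>\<in>space M. norm (X \<omega>) > Inf A}"
    proof (intro equalityI subsetI)
      fix \<omega> assume w: "\<omega> \<in> {\<omega>\<in>space M. norm (X \<omega>) > Inf A}"
      then have "norm (X \<omega>) - Inf A > 0" by simp
      then obtain j where "inverse (real (Suc j)) < norm (X \<omega>) - Inf A" using reals_Archimedean by blast
      then show "\<omega> \<in> (\<Union>j. E j)" using w by (auto simp: E_def intro!: exI[of _ j])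
    next
      fix \<omega> assume "\<omega> \<in> (\<Union>j. E j)"
      then obtain j where "\<omega> \<in> space M" "norm (X \<omega>) > Inf A + inverse (real (Suc j))" by (auto simp: E_def)
      moreover have "inverse (real (Suc j)) > 0" by simp
      ultimately have "\<omega> \<in> space M" "norm (X \<omega>) > Inf A" by linarith+
      then show "\<omega> \<in> {\<omega>\<in>space M. norm (X \<omega>) > Inf A}" by simp
    qed
    finally have "(\<lambda>j. prob (E j)) \<longlonglongrightarrow> tail (Inf A)" by (simp add: tail_def)
    moreover have "prob (E j) \<le> r" for j
    proof -
      have "Inf A + inverse (real (Suc j)) \<in> A" by (rule up) simp
      then show ?thesis by (simp add: A_def tail_def E_def)
    qed
    ultimately show ?thesis by (intro LIMSEQ_le_const2) auto
  qed
  then show "tail (tn n) \<le> real (k n) / real n" by (simp add: tn_Inf r_def)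
  fix x assume "x < tn n"
  then have "x \<notin> A" using bdd cInf_lower unfolding tn_Inf by (meson not_less)
  then show "tail x > real (k n) / real n" by (simp add: A_def r_def)
qed

text \<open>Every fixed level has positive tail probability, which eventually exceeds
  \<open>k n / n\<close>.\<close>

lemma tn_infinity: "filterlim tn at_top sequentially"
  unfolding filterlim_at_top_gt[where c = 0]
proof (intro allI impI)
  fix T :: real
  show "\<forall>\<^sub>F n in sequentially. T \<le> tn n"
    using order_tendstoD(2)[OF k_small tail_pos[of T]] eventually_k
  proof eventually_elim
    case (elim n)
    show ?case
    proof (rule ccontr)
      assume "\<not> T \<le> tn n"
      then have "tail T \<le> tail (tn n)" by (intro tail_antimono) simp
      then show False using tail_tn_le[of n] elim by linarith
    qed
  qed
qed

lemma eventually_tn_pos: "\<forall>\<^sub>F n in sequentially. tn n > 0"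
  using tn_infinity by (simp add: filterlim_at_top_dense)

lemma tn_scaled_infinity: "c > 0 \<Longrightarrow> filterlim (\<lambda>n. c * tn n) at_top sequentially"
  by (rule filterlim_tendsto_pos_mult_at_top[OF tendsto_const _ tn_infinity])

lemma n_tail_tn_le: "1 \<le> k n \<Longrightarrow> k n < n \<Longrightarrow> real n * tail (tn n) \<le> real (k n)"
  using tail_tn_le[of n] by (simp add: field_simps)

text \<open>The upper bound is immediate. The lower one is obtained slightly below the quantile, at
  \<open>tn n / s\<close>, where the tail exceeds \<open>k n / n\<close>;
  \<open>tail_ratio_greater\<close> carries it back to \<open>tn n\<close> at the cost of a factor
  close to 1.\<close>

lemma n_tail_tn_tendsto: "(\<lambda>n. real n * tail (tn n) / real (k n)) \<longlonglongrightarrow> 1"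
proof (rule LIMSEQ_I)
  fix r :: real assume r: "r > 0"
  obtain s where s: "s > 1" "\<forall>\<^sub>F t in at_top. tail (s * t) \<ge> (1 - r / 2) * tail t"
    using tail_ratio_greater[of "1 - r / 2"] r by auto
  have "\<forall>\<^sub>F n in sequentially. tail (s * (inverse s * tn n)) \<ge> (1 - r / 2) * tail (inverse s * tn n)"
    by (rule eventually_compose_filterlim[OF s(2) tn_scaled_infinity]) (use s(1) in simp)
  then have "\<forall>\<^sub>F n in sequentially. norm (real n * tail (tn n) / real (k n) - 1) < r"
    using eventually_k eventually_tn_pos
  proof eventually_elim
    case (elim n)
    define y where "y = real n * tail (tn n) / real (k n)"
    have le: "y \<le> 1" using n_tail_tn_le[of n] elim by (simp add: y_def)
    have y0: "y \<ge> 0" using tail_pos[of "tn n"] by (simp add: y_def)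
    have "y > 1 - r"
    proof (cases "r \<ge> 2")
      case True then show ?thesis using y0 by simp
    next
      case False
      have "inverse s * tn n < tn n" using s elim by (simp add: field_simps)
      then have "tail (inverse s * tn n) > real (k n) / real n" using elim by (intro tail_less_tn) auto
      then have "(1 - r / 2) * (real (k n) / real n) \<le> (1 - r / 2) * tail (inverse s * tn n)"
        using False by (intro mult_left_mono) auto
      also have "\<dots> \<le> tail (s * (inverse s * tn n))" by (rule elim(1))
      also have "s * (inverse s * tn n) = tn n" using s(1) by simp
      finally have "1 - r / 2 \<le> y" using elim by (simp add: y_def field_simps)
      then show ?thesis using r by linarith
    qed
    then show ?case using le r by (simp add: y_def[symmetric])
  qed
  then show "\<exists>n0. \<forall>n\<ge>n0. norm (real n * tail (tn n) / real (k n) - 1) < r"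
    by (simp add: eventually_sequentially)
qed

lemma count_deviation:
  assumes "r > 0"
  shows "prob {\<omega>\<in>space M. \<bar>count n u \<omega> - real n * tail u\<bar> > r} \<le> real n * tail u / r\<^sup>2"
proof -
  have "prob {\<omega>\<in>space M. \<bar>count n u \<omega> - real n * tail u\<bar> > r} \<le>
    expectation (\<lambda>\<omega>. (count n u \<omega> - real n * tail u)\<^sup>2) / r\<^sup>2"
    using exceed_count_second_moment(1)[of n u] assms by (intro second_moment_prob_le) (auto simp: count_def[symmetric])
  also have "\<dots> \<le> real n * tail u / r\<^sup>2"
    using exceed_count_second_moment(2)[of n u] by (intro divide_right_mono) (auto simp: count_def)
  finally show ?thesis .
qed

lemma count_upper:
  assumes u: "\<forall>\<^sub>F n in sequentially. real n * tail (u n) \<le> a * real (k n)" and ab: "a < b"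
  shows "(\<lambda>n. prob {\<omega>\<in>space M. count n (u n) \<omega> > b * real (k n)}) \<longlonglongrightarrow> 0"
proof (rule tendsto_sandwich[OF _ _ tendsto_const])
  show "(\<lambda>n. a / (b - a)\<^sup>2 * inverse (real (k n))) \<longlonglongrightarrow> 0"
    using tendsto_mult_left[OF inverse_k_tendsto, of "a / (b - a)\<^sup>2"] by simp
  show "\<forall>\<^sub>F n in sequentially. prob {\<omega>\<in>space M. count n (u n) \<omega> > b * real (k n)} \<le> a / (b - a)\<^sup>2 * inverse (real (k n))"
    using u eventually_k
  proof eventually_elim
    case (elim n)
    let ?r = "(b - a) * real (k n)"
    have r: "?r > 0" using elim ab by simp
    have "prob {\<omega>\<in>space M. count n (u n) \<omega> > b * real (k n)} \<le>
       prob {\<omega>\<in>space M. \<bar>count n (u n) \<omega> - real n * tail (u n)\<bar> > ?r}"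
      using elim by (intro finite_measure_mono) (auto simp: left_diff_distrib)
    also have "\<dots> \<le> real n * tail (u n) / ?r\<^sup>2" by (rule count_deviation[OF r])
    also have "\<dots> \<le> a * real (k n) / ?r\<^sup>2" using elim by (intro divide_right_mono) auto
    also have "\<dots> = a / (b - a)\<^sup>2 * inverse (real (k n))"
    proof -
      have "a * K / (c * K)\<^sup>2 = a / c\<^sup>2 * inverse K" if "K \<noteq> 0" "c \<noteq> 0" for c K :: real
        using that by (simp add: power2_eq_square field_simps)
      then show ?thesis using elim ab by simp
    qed
    finally show ?case .
  qed
qed simp

lemma count_lower:
  assumes u: "\<forall>\<^sub>F n in sequentially. real n * tail (u n) \<ge> a * real (k n)" and ab: "0 \<le> b" "b < a"
  shows "(\<lambda>n. prob {\<omega>\<in>space M. count n (u n) \<omega> \<le> b * real (k n)}) \<longlonglongrightarrow> 0"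
proof (rule tendsto_sandwich[OF _ _ tendsto_const])
  \<comment> \<open>Half the relative distance of \<open>b\<close> from \<open>a\<close>: the mean
    count \<open>m\<close> exceeds \<open>b * k n\<close> by at least
    \<open>2 * c * m\<close>.\<close>
  define c where "c = (1 - b / a) / 2"
  have c: "c > 0" using ab by (simp add: c_def)
  show "(\<lambda>n. inverse (a * c\<^sup>2) * inverse (real (k n))) \<longlonglongrightarrow> 0"
    using tendsto_mult_left[OF inverse_k_tendsto, of "inverse (a * c\<^sup>2)"] by simp
  show "\<forall>\<^sub>F n in sequentially. prob {\<omega>\<in>space M. count n (u n) \<omega> \<le> b * real (k n)} \<le> inverse (a * c\<^sup>2) * inverse (real (k n))"
    using u eventually_k
  proof eventually_elim
    case (elim n)
    define m where "m = real n * tail (u n)"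
    have ak: "a * real (k n) > 0" using elim ab by simp
    have m: "m > 0" "m \<ge> a * real (k n)" using elim ak by (auto simp: m_def)
    have r: "c * m > 0" using c m by simp
    have bk: "b * real (k n) \<le> (b / a) * m"
      using mult_left_mono[OF m(2), of "b / a"] ab by simp
    have "m - b * real (k n) \<ge> m - (b / a) * m" using bk by simp
    moreover have "m - (b / a) * m = 2 * (c * m)" by (simp add: c_def algebra_simps)
    ultimately have mb: "m - b * real (k n) > c * m" using r by linarith
    have "prob {\<omega>\<in>space M. count n (u n) \<omega> \<le> b * real (k n)} \<le>
       prob {\<omega>\<in>space M. \<bar>count n (u n) \<omega> - m\<bar> > c * m}"
      using mb by (intro finite_measure_mono) auto
    also have "\<dots> \<le> m / (c * m)\<^sup>2" unfolding m_def by (rule count_deviation) (use r in \<open>simp add: m_def\<close>)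
    also have "\<dots> = inverse (c\<^sup>2) * inverse m" using m c by (simp add: power2_eq_square field_simps)
    also have "\<dots> \<le> inverse (c\<^sup>2) * inverse (a * real (k n))"
      using m ak by (intro mult_left_mono le_imp_inverse_le) auto
    also have "\<dots> = inverse (a * c\<^sup>2) * inverse (real (k n))" by (simp add: field_simps)
    finally show ?case .
  qed
qed simp

text \<open>The empirical threshold exceeds a level exactly if more than \<open>k n\<close>
  observations do, and slightly above the quantile the expected number is at most
  \<open>\<eta> * k n\<close> with \<open>\<eta> < 1\<close>.\<close>

lemma th_upper:
  assumes \<delta>: "\<delta> > 0"
  shows "(\<lambda>n. prob {\<omega>\<in>space M. th n \<omega> > (1 + \<delta>) * tn n}) \<longlonglongrightarrow> 0"
proof -
  obtain \<eta> where \<eta>: "\<eta> < 1" "\<forall>\<^sub>F t in at_top. tail ((1 + \<delta>) * t) \<le> \<eta> * tail t"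
    using tail_ratio_less[of "1 + \<delta>"] \<delta> by auto
  have "\<forall>\<^sub>F n in sequentially. tail ((1 + \<delta>) * tn n) \<le> \<eta> * tail (tn n)"
    by (rule eventually_compose_filterlim[OF \<eta>(2) tn_infinity])
  then have le: "\<forall>\<^sub>F n in sequentially. real n * tail ((1 + \<delta>) * tn n) \<le> \<eta> * real (k n)"
    using eventually_k
  proof eventually_elim
    case (elim n)
    have \<eta>0: "\<eta> \<ge> 0"
    proof (rule ccontr)
      assume "\<not> \<eta> \<ge> 0"
      then have "\<eta> * tail (tn n) \<le> 0" using tail_pos[of "tn n"] by (simp add: mult_nonpos_nonneg)
      then show False using elim(1) tail_pos[of "(1 + \<delta>) * tn n"] by linarith
    qed
    have "real n * tail ((1 + \<delta>) * tn n) \<le> real n * (\<eta> * tail (tn n))" using elim by (intro mult_left_mono) auto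
    also have "\<dots> = \<eta> * (real n * tail (tn n))" by simp
    also have "\<dots> \<le> \<eta> * real (k n)" using n_tail_tn_le[of n] elim \<eta>0 by (intro mult_left_mono) auto
    finally show ?case .
  qed
  have lim: "(\<lambda>n. prob {\<omega>\<in>space M. count n ((1 + \<delta>) * tn n) \<omega> > 1 * real (k n)}) \<longlonglongrightarrow> 0"
    by (rule count_upper[OF le \<eta>(1)])
  show ?thesis
  proof (rule Lim_transform_eventually[OF lim])
    show "\<forall>\<^sub>F n in sequentially. prob {\<omega>\<in>space M. count n ((1 + \<delta>) * tn n) \<omega> > 1 * real (k n)}
       = prob {\<omega>\<in>space M. th n \<omega> > (1 + \<delta>) * tn n}"
      using eventually_k by eventually_elim (simp add: th_def emp_thresh_gt_iff count_def)
  qed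
qed

lemma th_lower:
  assumes \<delta>: "0 < \<delta>" "\<delta> < 1"
  shows "(\<lambda>n. prob {\<omega>\<in>space M. th n \<omega> \<le> (1 - \<delta>) * tn n}) \<longlonglongrightarrow> 0"
proof -
  \<comment> \<open>Makes \<open>s * (1 - \<delta>) < 1\<close>: the level
    \<open>s * (1 - \<delta>) * tn n\<close> is still below the quantile, so its tail exceeds
    \<open>k n / n\<close>, and at \<open>(1 - \<delta>) * tn n\<close> the expected count is at
    least \<open>k n / \<eta>\<close>.\<close>
  define s where "s = 1 / (1 - \<delta> / 2)"
  have s: "s > 1" using \<delta> by (simp add: s_def)
  obtain \<eta> where \<eta>: "\<eta> < 1" "\<forall>\<^sub>F t in at_top. tail (s * t) \<le> \<eta> * tail t"
    using tail_ratio_less[OF s] by auto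
  have ev: "\<forall>\<^sub>F n in sequentially. tail (s * ((1 - \<delta>) * tn n)) \<le> \<eta> * tail ((1 - \<delta>) * tn n)"
    by (rule eventually_compose_filterlim[OF \<eta>(2) tn_scaled_infinity]) (use \<delta> in simp)
  have \<eta>0: "\<eta> > 0"
  proof -
    obtain n where "tail (s * ((1 - \<delta>) * tn n)) \<le> \<eta> * tail ((1 - \<delta>) * tn n)"
      using ev eventually_sequentially by auto
    then have "\<eta> * tail ((1 - \<delta>) * tn n) > 0" using tail_pos less_le_trans by blast
    then show ?thesis using tail_pos[of "(1 - \<delta>) * tn n"] by (auto simp: zero_less_mult_iff)
  qed
  have le: "\<forall>\<^sub>F n in sequentially. real n * tail ((1 - \<delta>) * tn n) \<ge> (1 / \<eta>) * real (k n)"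
    using ev eventually_k eventually_tn_pos
  proof eventually_elim
    case (elim n)
    have "s * (1 - \<delta>) < 1" using \<delta> by (simp add: s_def field_simps)
    then have "s * ((1 - \<delta>) * tn n) < tn n"
      using elim mult_strict_right_mono[of "s * (1 - \<delta>)" 1 "tn n"] by simp
    then have "real (k n) / real n < tail (s * ((1 - \<delta>) * tn n))" using elim by (intro tail_less_tn) auto
    also have "\<dots> \<le> \<eta> * tail ((1 - \<delta>) * tn n)" by (rule elim(1))
    finally show ?case using elim \<eta>0 by (simp add: field_simps)
  qed
  have lim: "(\<lambda>n. prob {\<omega>\<in>space M. count n ((1 - \<delta>) * tn n) \<omega> \<le> 1 * real (k n)}) \<longlonglongrightarrow> 0"
    by (rule count_lower[OF le]) (use \<eta> \<eta>0 in auto)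
  show ?thesis
  proof (rule Lim_transform_eventually[OF lim])
    show "\<forall>\<^sub>F n in sequentially. prob {\<omega>\<in>space M. count n ((1 - \<delta>) * tn n) \<omega> \<le> 1 * real (k n)}
       = prob {\<omega>\<in>space M. th n \<omega> \<le> (1 - \<delta>) * tn n}"
      using eventually_k by eventually_elim (simp add: th_def emp_thresh_le_iff count_def)
  qed
qed

lemma count_th_le: "1 \<le> k n \<Longrightarrow> k n < n \<Longrightarrow> count n (th n \<omega>) \<omega> \<le> real (k n)"
  using emp_count_le[of "k n" n "\<lambda>i. Xs i \<omega>"] by (simp add: th_def count_def)

text \<open>At most \<open>k n\<close> observations exceed the empirical threshold. Markedly fewer
  are unlikely: with high probability the threshold is at most \<open>s * tn n\<close>, and for
  \<open>s\<close> close to 1 almost \<open>k n\<close> observations exceed that level, ties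
  notwithstanding.\<close>

lemma count_th_small: "small_in_prob M (\<lambda>n \<omega>. count n (th n \<omega>) \<omega> / real (k n) - 1)"
proof (rule small_in_probI)
  fix e0 d :: real assume e0: "e0 > 0" and d: "d > 0"
  define e where "e = min e0 (1/2)"
  have e: "e > 0" "e < 1" "e \<le> e0" using e0 by (auto simp: e_def)
  obtain s where s: "s > 1" "\<forall>\<^sub>F t in at_top. tail (s * t) \<ge> (1 - e / 4) * tail t"
    using tail_ratio_greater[of "1 - e / 4"] e by auto
  have ev: "\<forall>\<^sub>F n in sequentially. tail (s * tn n) \<ge> (1 - e / 4) * tail (tn n)"
    by (rule eventually_compose_filterlim[OF s(2) tn_infinity])
  have "\<forall>\<^sub>F n in sequentially. real n * tail (tn n) / real (k n) > 1 - e / 4"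
    using order_tendstoD(1)[OF n_tail_tn_tendsto, of "1 - e / 4"] e by simp
  then have le: "\<forall>\<^sub>F n in sequentially. real n * tail (s * tn n) \<ge> (1 - e / 2) * real (k n)"
    using ev eventually_k
  proof eventually_elim
    case (elim n)
    have "(1 - e / 2) * real (k n) \<le> (1 - e / 4) * ((1 - e / 4) * real (k n))"
    proof -
      have "1 - e / 2 \<le> (1 - e / 4) * (1 - e / 4)" by (simp add: algebra_simps)
      then show ?thesis using mult_right_mono[of "1 - e / 2" "(1 - e / 4) * (1 - e / 4)" "real (k n)"] by simp
    qed
    also have "\<dots> \<le> (1 - e / 4) * (real n * tail (tn n))"
      using elim e by (intro mult_left_mono) (auto simp: field_simps)
    also have "\<dots> = real n * ((1 - e / 4) * tail (tn n))" by simp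
    also have "\<dots> \<le> real n * tail (s * tn n)" using elim by (intro mult_left_mono) auto
    finally show ?case .
  qed
  have l1: "(\<lambda>n. prob {\<omega>\<in>space M. count n (s * tn n) \<omega> \<le> (1 - e) * real (k n)}) \<longlonglongrightarrow> 0"
    by (rule count_lower[OF le]) (use e in auto)
  have l2: "(\<lambda>n. prob {\<omega>\<in>space M. th n \<omega> > s * tn n}) \<longlonglongrightarrow> 0"
    using th_upper[of "s - 1"] s(1) by simp
  show "\<forall>\<^sub>F n in sequentially. \<exists>A\<in>events. prob A < d \<and> (\<forall>\<omega>\<in>space M - A. \<bar>count n (th n \<omega>) \<omega> / real (k n) - 1\<bar> \<le> e0)"
    using order_tendstoD(2)[OF l1 half_gt_zero[OF d]] order_tendstoD(2)[OF l2 half_gt_zero[OF d]] eventually_k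
  proof eventually_elim
    case (elim n)
    let ?A = "{\<omega>\<in>space M. count n (s * tn n) \<omega> \<le> (1 - e) * real (k n)}"
    let ?B = "{\<omega>\<in>space M. th n \<omega> > s * tn n}"
    have AB: "?A \<in> events" "?B \<in> events" by measurable
    have "prob (?A \<union> ?B) < d" using measure_Un_le[OF AB] elim by linarith
    moreover have "\<bar>count n (th n \<omega>) \<omega> / real (k n) - 1\<bar> \<le> e0" if "\<omega> \<in> space M - (?A \<union> ?B)" for \<omega>
    proof -
      have 1: "count n (s * tn n) \<omega> > (1 - e) * real (k n)" "th n \<omega> \<le> s * tn n" using that by auto
      then have "count n (th n \<omega>) \<omega> > (1 - e) * real (k n)" using count_antimono[OF 1(2), of n \<omega>] by linarith
      then have "count n (th n \<omega>) \<omega> / real (k n) > 1 - e" using elim by (simp add: field_simps)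
      moreover have "count n (th n \<omega>) \<omega> / real (k n) \<le> 1" using count_th_le[of n \<omega>] elim by simp
      ultimately show ?thesis using e by linarith
    qed
    ultimately show ?case using AB by (intro bexI[of _ "?A \<union> ?B"]) auto
  qed
qed

text \<open>The random ratio of \<open>th n\<close> and \<open>tn n\<close> lies in the interval of
  the rate condition with probability tending to 1; uniformity in \<open>s\<close> allows it to be
  inserted there.\<close>

lemma cond_mean_th_small:
  "small_in_prob M (\<lambda>n \<omega>. sqrt (real (k n)) * norm (cond_mean (th n \<omega>) - cond_mean (tn n)))"
proof (rule small_in_probI)
  fix e d :: real assume e: "e > 0" and d: "d > 0"
  obtain \<epsilon> where \<epsilon>: "\<epsilon> > 0" "uniform_limit {1-\<epsilon>..1+\<epsilon>}
       (\<lambda>n s. sqrt (real (k n)) * norm (cond_mean (s * tn n) - cond_mean (tn n))) (\<lambda>_. 0) sequentially"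
    using cond_mean_rate by (auto simp: tn_def)
  define \<delta> where "\<delta> = min \<epsilon> (1/2)"
  have \<delta>: "0 < \<delta>" "\<delta> < 1" "\<delta> \<le> \<epsilon>" using \<epsilon> by (auto simp: \<delta>_def)
  show "\<forall>\<^sub>F n in sequentially. \<exists>A\<in>events. prob A < d \<and>
     (\<forall>\<omega>\<in>space M - A. \<bar>sqrt (real (k n)) * norm (cond_mean (th n \<omega>) - cond_mean (tn n))\<bar> \<le> e)"
    using order_tendstoD(2)[OF th_upper[OF \<delta>(1)] half_gt_zero[OF d]]
      order_tendstoD(2)[OF th_lower[OF \<delta>(1,2)] half_gt_zero[OF d]]
      uniform_limitD[OF \<epsilon>(2) e] eventually_tn_pos
  proof eventually_elim
    case (elim n)
    let ?A = "{\<omega>\<in>space M. th n \<omega> > (1 + \<delta>) * tn n}"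
    let ?B = "{\<omega>\<in>space M. th n \<omega> \<le> (1 - \<delta>) * tn n}"
    have AB: "?A \<in> events" "?B \<in> events" by measurable
    have "prob (?A \<union> ?B) < d" using measure_Un_le[OF AB] elim by linarith
    moreover have "\<bar>sqrt (real (k n)) * norm (cond_mean (th n \<omega>) - cond_mean (tn n))\<bar> \<le> e"
      if "\<omega> \<in> space M - (?A \<union> ?B)" for \<omega>
    proof -
      have 1: "th n \<omega> \<le> (1 + \<delta>) * tn n" "th n \<omega> > (1 - \<delta>) * tn n" using that by auto
      define s where "s = th n \<omega> / tn n"
      have "s \<le> 1 + \<delta>" "s > 1 - \<delta>" using 1 elim(4) by (auto simp: s_def field_simps)
      then have "s \<in> {1-\<epsilon>..1+\<epsilon>}" using \<delta> by auto
      moreover have "s * tn n = th n \<omega>" using elim(4) by (simp add: s_def)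
      ultimately show ?thesis using elim(3) by (force simp: dist_real_def)
    qed
    ultimately show ?case using AB by (intro bexI[of _ "?A \<union> ?B"]) auto
  qed
qed


text \<open>\<open>k n\<close> and the expected count are inserted between the two counts. The three
  differences are handled by bounded convergence, by the binomial variance and by the convergence of
  \<open>n * tail (tn n) / k n\<close>.\<close>

lemma expectation_count_diff_tendsto:
  "(\<lambda>n. expectation (\<lambda>\<omega>. \<bar>count n (th n \<omega>) \<omega> - count n (tn n) \<omega>\<bar>) / real (k n)) \<longlonglongrightarrow> 0"
proof (rule tendsto_sandwich[OF _ _ tendsto_const])
  define Y where "Y n \<omega> = count n (th n \<omega>) \<omega> / real (k n) - 1" for n \<omega>
  have Ym [measurable]: "Y n \<in> borel_measurable M" for n unfolding Y_def by measurable
  have Yb: "\<bar>Y n \<omega>\<bar> \<le> 1" if "1 \<le> k n" "k n < n" for n \<omega>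
  proof -
    have "0 \<le> count n (th n \<omega>) \<omega> / real (k n)" by (simp add: count_def)
    moreover have "count n (th n \<omega>) \<omega> / real (k n) \<le> 1" using count_th_le[OF that, of \<omega>] that by simp
    ultimately show ?thesis unfolding Y_def by linarith
  qed
  have "(\<lambda>n. expectation (\<lambda>\<omega>. \<bar>Y n \<omega>\<bar>)) \<longlonglongrightarrow> 0"
  proof (rule expectation_small_in_prob)
    show "small_in_prob M Y" using count_th_small by (simp add: Y_def[abs_def])
    show "\<forall>\<^sub>F n in sequentially. AE \<omega> in M. \<bar>Y n \<omega>\<bar> \<le> 1"
      using eventually_k by eventually_elim (auto intro!: AE_I2 Yb)
  qed measurable
  then show "(\<lambda>n. expectation (\<lambda>\<omega>. \<bar>Y n \<omega>\<bar>) + 1 / sqrt (real (k n)) + \<bar>real n * tail (tn n) / real (k n) - 1\<bar>) \<longlonglongrightarrow> 0"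
    using inverse_sqrt_k_tendsto tendsto_rabs[OF tendsto_diff[OF n_tail_tn_tendsto tendsto_const, of 1]]
    by (auto intro!: tendsto_add_zero)
  show "\<forall>\<^sub>F n in sequentially. expectation (\<lambda>\<omega>. \<bar>count n (th n \<omega>) \<omega> - count n (tn n) \<omega>\<bar>) / real (k n)
      \<le> expectation (\<lambda>\<omega>. \<bar>Y n \<omega>\<bar>) + 1 / sqrt (real (k n)) + \<bar>real n * tail (tn n) / real (k n) - 1\<bar>"
    using eventually_k
  proof eventually_elim
    case (elim n)
    define K where "K = real (k n)"
    have K: "K > 0" using elim by (simp add: K_def)
    define m where "m = real n * tail (tn n)"
    define Z where "Z \<omega> = count n (tn n) \<omega> - m" for \<omega>
    have [measurable]: "Z \<in> borel_measurable M" unfolding Z_def by measurable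
    have intY: "integrable M (\<lambda>\<omega>. \<bar>Y n \<omega>\<bar>)" using Yb[of n] elim by (intro integrable_const_bound[where B = 1]) auto
    have intZ2: "integrable M (\<lambda>\<omega>. (Z \<omega>)\<^sup>2)" and Z2: "expectation (\<lambda>\<omega>. (Z \<omega>)\<^sup>2) \<le> K"
      using exceed_count_second_moment[of n "tn n"] n_tail_tn_le[of n] elim by (auto simp: Z_def count_def m_def K_def)
    have "expectation (\<lambda>\<omega>. \<bar>count n (th n \<omega>) \<omega> - count n (tn n) \<omega>\<bar>)
       \<le> expectation (\<lambda>\<omega>. K * \<bar>Y n \<omega>\<bar> + ((Z \<omega>)\<^sup>2 / sqrt K + sqrt K) / 2 + \<bar>m - K\<bar>)"
    proof (rule integral_mono_AE')
      show "integrable M (\<lambda>\<omega>. K * \<bar>Y n \<omega>\<bar> + ((Z \<omega>)\<^sup>2 / sqrt K + sqrt K) / 2 + \<bar>m - K\<bar>)"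
        using intY intZ2 by simp
      show "AE \<omega> in M. \<bar>count n (th n \<omega>) \<omega> - count n (tn n) \<omega>\<bar> \<le>
          K * \<bar>Y n \<omega>\<bar> + ((Z \<omega>)\<^sup>2 / sqrt K + sqrt K) / 2 + \<bar>m - K\<bar>"
      proof (rule AE_I2)
        fix \<omega>
        have 1: "\<bar>count n (th n \<omega>) \<omega> - K\<bar> = K * \<bar>Y n \<omega>\<bar>"
        proof -
          have "count n (th n \<omega>) \<omega> - K = K * Y n \<omega>" using K by (simp add: Y_def K_def field_simps)
          then show ?thesis using K by (simp add: abs_mult)
        qed
        \<comment> \<open>Arithmetic-geometric mean inequality, a pointwise substitute for bounding
          a first moment by a second one.\<close>
        have 2: "\<bar>Z \<omega>\<bar> \<le> ((Z \<omega>)\<^sup>2 / sqrt K + sqrt K) / 2"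
        proof -
          have sq: "sqrt K > 0" using K by simp
          have "0 \<le> (\<bar>Z \<omega>\<bar> - sqrt K)\<^sup>2" by simp
          also have "\<dots> = (Z \<omega>)\<^sup>2 - 2 * \<bar>Z \<omega>\<bar> * sqrt K + sqrt K * sqrt K"
            by (simp only: power2_diff power2_abs) (simp add: power2_eq_square del: real_sqrt_mult_self)
          finally have "2 * \<bar>Z \<omega>\<bar> * sqrt K \<le> (Z \<omega>)\<^sup>2 + sqrt K * sqrt K" by simp
          then show ?thesis using sq by (simp add: divide_simps)
        qed
        have "count n (th n \<omega>) \<omega> - count n (tn n) \<omega> = (count n (th n \<omega>) \<omega> - K) - Z \<omega> - (m - K)"
          by (simp add: Z_def)
        then show "\<bar>count n (th n \<omega>) \<omega> - count n (tn n) \<omega>\<bar> \<le>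
          K * \<bar>Y n \<omega>\<bar> + ((Z \<omega>)\<^sup>2 / sqrt K + sqrt K) / 2 + \<bar>m - K\<bar>"
          using 1 2 by linarith
      qed
    qed (use K in \<open>auto intro!: AE_I2 add_nonneg_nonneg\<close>)
    also have "\<dots> = K * expectation (\<lambda>\<omega>. \<bar>Y n \<omega>\<bar>) + (expectation (\<lambda>\<omega>. (Z \<omega>)\<^sup>2) / sqrt K + sqrt K) / 2 + \<bar>m - K\<bar>"
      using intY intZ2 by (simp add: prob_space)
    also have "\<dots> \<le> K * expectation (\<lambda>\<omega>. \<bar>Y n \<omega>\<bar>) + (K / sqrt K + sqrt K) / 2 + \<bar>m - K\<bar>"
      using Z2 K by (intro add_mono divide_right_mono order_refl) auto
    also have "(K / sqrt K + sqrt K) / 2 = K * (1 / sqrt K)" using K by (simp add: real_div_sqrt)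
    also have "\<bar>m - K\<bar> = K * \<bar>m / K - 1\<bar>"
    proof -
      have "m - K = K * (m / K - 1)" using K by (simp add: field_simps)
      then show ?thesis using K by (metis abs_mult abs_of_pos)
    qed
    finally have "expectation (\<lambda>\<omega>. \<bar>count n (th n \<omega>) \<omega> - count n (tn n) \<omega>\<bar>)
      \<le> K * (expectation (\<lambda>\<omega>. \<bar>Y n \<omega>\<bar>) + 1 / sqrt K + \<bar>m / K - 1\<bar>)" by (simp only: distrib_left)
    then show ?case using K by (simp add: K_def[symmetric] m_def[symmetric] pos_divide_le_eq mult.commute)
  qed
qed (auto intro!: always_eventually)

definition threshold_change :: "nat \<Rightarrow> 'a \<Rightarrow> 'e" where
  "threshold_change n \<omega> = (\<Sum>i<n. centered (Xs i \<omega>) (th n \<omega>) - centered (Xs i \<omega>) (tn n))"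

text \<open>The counterpart of \<open>emp_dev\<close> with the deterministic threshold: a normalized
  sum of independent centered terms, to which the central limit theorem applies.\<close>

definition clt_sum :: "nat \<Rightarrow> 'a \<Rightarrow> 'e" where
  "clt_sum n \<omega> = (1 / sqrt (real (k n))) *\<^sub>R (\<Sum>i<n. centered (Xs i \<omega>) (tn n))"

text \<open>Divided by \<open>k n\<close>, as in \<open>emp_risk\<close>, and not by the number of
  exceedances, which may be smaller.\<close>

definition emp_mean :: "nat \<Rightarrow> 'a \<Rightarrow> 'e" where
  "emp_mean n \<omega> = (1 / real (k n)) *\<^sub>R (\<Sum>i<n. of_bool (norm (Xs i \<omega>) > th n \<omega>) *\<^sub>R z (Xs i \<omega>))"

text \<open>This is the \<open>G\<close> of the overview. \<open>emp_mean\<close> sums over the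
  actual exceedances only, so the centering carries the same random factor; otherwise a multiple of
  \<open>\<surd>k (N / k - 1)\<close> would remain.\<close>

definition emp_dev :: "nat \<Rightarrow> 'a \<Rightarrow> 'e" where
  "emp_dev n \<omega> = sqrt (real (k n)) *\<^sub>R (emp_mean n \<omega> - (count n (th n \<omega>) \<omega> / real (k n)) *\<^sub>R cond_mean (tn n))"

lemma threshold_change_measurable [measurable]: "threshold_change n \<in> borel_measurable M"
proof -
  note [measurable] = Xs_measurable
  show ?thesis unfolding threshold_change_def[abs_def] by measurable
qed

lemma clt_sum_measurable [measurable]: "clt_sum n \<in> borel_measurable M"
proof -
  note [measurable] = Xs_measurable
  show ?thesis unfolding clt_sum_def[abs_def] by measurable
qed

lemma emp_mean_measurable [measurable]: "emp_mean n \<in> borel_measurable M"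
proof -
  note [measurable] = Xs_measurable
  show ?thesis unfolding emp_mean_def[abs_def] by measurable
qed

text \<open>The mean square bound divided by \<open>k n\<close>: the count term vanishes in mean,
  and the squared change of centering is bounded and small in probability.\<close>

lemma threshold_change_small: "small_in_prob M (\<lambda>n \<omega>. norm (threshold_change n \<omega>) / sqrt (real (k n)))"
proof (rule small_in_prob_second_moment)
  let ?a = "\<lambda>n. 4 * C\<^sup>2 * (expectation (\<lambda>\<omega>. \<bar>count n (th n \<omega>) \<omega> - count n (tn n) \<omega>\<bar>) / real (k n))
     + expectation (\<lambda>\<omega>. \<bar>(norm (cond_mean (th n \<omega>) - cond_mean (tn n)))\<^sup>2\<bar>)"
  show "(\<lambda>\<omega>. norm (threshold_change n \<omega>) / sqrt (real (k n))) \<in> borel_measurable M" for n by measurable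
  have "(\<lambda>n. expectation (\<lambda>\<omega>. \<bar>(norm (cond_mean (th n \<omega>) - cond_mean (tn n)))\<^sup>2\<bar>)) \<longlonglongrightarrow> 0"
  proof (rule expectation_small_in_prob)
    have b: "norm (cond_mean a - cond_mean b) \<le> 2 * C" for a b
      using norm_triangle_ineq4[of "cond_mean a" "cond_mean b"] norm_cond_mean_le[of a] norm_cond_mean_le[of b] by linarith
    \<comment> \<open>The square is at most \<open>2 * C\<close> times the norm, and
      \<open>sqrt (k n) \<ge> 1\<close>, so the rate already available dominates it.\<close>
    have "small_in_prob M (\<lambda>n \<omega>. 2 * C * (sqrt (real (k n)) * norm (cond_mean (th n \<omega>) - cond_mean (tn n))))"
      by (rule small_in_prob_cmult[OF cond_mean_th_small])
    then show "small_in_prob M (\<lambda>n \<omega>. (norm (cond_mean (th n \<omega>) - cond_mean (tn n)))\<^sup>2)"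
    proof (rule small_in_prob_mono)
      show "\<forall>\<^sub>F n in sequentially. AE \<omega> in M. \<bar>(norm (cond_mean (th n \<omega>) - cond_mean (tn n)))\<^sup>2\<bar>
         \<le> \<bar>2 * C * (sqrt (real (k n)) * norm (cond_mean (th n \<omega>) - cond_mean (tn n)))\<bar>"
        using eventually_k
      proof eventually_elim
        case (elim n)
        have sq: "sqrt (real (k n)) \<ge> 1" using elim by simp
        have "(norm (cond_mean (th n \<omega>) - cond_mean (tn n)))\<^sup>2 \<le>
          2 * C * (sqrt (real (k n)) * norm (cond_mean (th n \<omega>) - cond_mean (tn n)))" for \<omega>
        proof -
          let ?N = "norm (cond_mean (th n \<omega>) - cond_mean (tn n))"
          have "?N\<^sup>2 \<le> 2 * C * ?N" unfolding power2_eq_square by (intro mult_right_mono b) auto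
          also have "\<dots> \<le> 2 * C * (sqrt (real (k n)) * ?N)"
            using C_nonneg mult_right_mono[OF sq, of ?N] by (intro mult_left_mono) auto
          finally show ?thesis .
        qed
        then show ?case by (intro AE_I2) (simp only: abs_power2, rule order_trans[OF _ abs_ge_self])
      qed
    qed
    have "\<bar>(norm (cond_mean a - cond_mean b))\<^sup>2\<bar> \<le> (2 * C)\<^sup>2" for a b
      unfolding abs_power2 by (intro power_mono b) auto
    then show "\<forall>\<^sub>F n in sequentially. AE \<omega> in M. \<bar>(norm (cond_mean (th n \<omega>) - cond_mean (tn n)))\<^sup>2\<bar> \<le> (2 * C)\<^sup>2"
      by (intro always_eventually allI AE_I2)
  qed measurable
  from tendsto_add[OF tendsto_mult_left[OF expectation_count_diff_tendsto, of "4 * C\<^sup>2"] this]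
  show "?a \<longlonglongrightarrow> 0" by simp
  show "\<forall>\<^sub>F n in sequentially. integrable M (\<lambda>\<omega>. (norm (threshold_change n \<omega>) / sqrt (real (k n)))\<^sup>2) \<and>
      expectation (\<lambda>\<omega>. (norm (threshold_change n \<omega>) / sqrt (real (k n)))\<^sup>2) \<le> ?a n"
    using eventually_k
  proof eventually_elim
    case (elim n)
    then have k: "1 \<le> k n" "k n < n" by auto
    have th: "th n = (\<lambda>\<omega>. emp_thresh n (k n) (\<lambda>i. Xs i \<omega>))" using k by (simp add: th_def fun_eq_iff)
    have eq: "(norm (threshold_change n \<omega>) / sqrt (real (k n)))\<^sup>2 = (norm (threshold_change n \<omega>))\<^sup>2 / real (k n)" for \<omega>
      by (simp add: power_divide)
    have i: "integrable M (\<lambda>\<omega>. (norm (threshold_change n \<omega>))\<^sup>2)"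
      using centered_sum_threshold_change(1)[OF k, of "tn n"] by (simp add: threshold_change_def th)
    have "expectation (\<lambda>\<omega>. (norm (threshold_change n \<omega>))\<^sup>2) \<le>
      4 * C\<^sup>2 * expectation (\<lambda>\<omega>. \<bar>count n (th n \<omega>) \<omega> - count n (tn n) \<omega>\<bar>)
      + real (k n) * expectation (\<lambda>\<omega>. (norm (cond_mean (th n \<omega>) - cond_mean (tn n)))\<^sup>2)"
      using centered_sum_threshold_change(2)[OF k, of "tn n"] by (simp add: threshold_change_def th count_def)
    then have "expectation (\<lambda>\<omega>. (norm (threshold_change n \<omega>))\<^sup>2) / real (k n) \<le>
      (4 * C\<^sup>2 * expectation (\<lambda>\<omega>. \<bar>count n (th n \<omega>) \<omega> - count n (tn n) \<omega>\<bar>)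
      + real (k n) * expectation (\<lambda>\<omega>. (norm (cond_mean (th n \<omega>) - cond_mean (tn n)))\<^sup>2)) / real (k n)"
      by (rule divide_right_mono) simp
    also have "\<dots> = ?a n" using k by (simp add: add_divide_distrib)
    finally show ?case using i by (simp add: eq)
  qed
qed

lemma clt_sum_bounded: "bounded_in_prob M (\<lambda>n \<omega>. norm (clt_sum n \<omega>))"
proof (rule bounded_in_prob_second_moment)
  show "\<forall>\<^sub>F n in sequentially. integrable M (\<lambda>\<omega>. (norm (clt_sum n \<omega>))\<^sup>2) \<and>
     expectation (\<lambda>\<omega>. (norm (clt_sum n \<omega>))\<^sup>2) \<le> 4 * C\<^sup>2"
    using eventually_k
  proof eventually_elim
    case (elim n)
    have eq: "(norm (clt_sum n \<omega>))\<^sup>2 = (norm (\<Sum>i<n. centered (Xs i \<omega>) (tn n)))\<^sup>2 / real (k n)" for \<omega>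
      by (simp add: clt_sum_def power_divide)
    have "expectation (\<lambda>\<omega>. (norm (\<Sum>i<n. centered (Xs i \<omega>) (tn n)))\<^sup>2) \<le> 4 * C\<^sup>2 * (real n * tail (tn n))"
      by (rule centered_sum_second_moment)
    also have "\<dots> \<le> 4 * C\<^sup>2 * real (k n)" using n_tail_tn_le[of n] elim by (intro mult_left_mono) auto
    finally have "expectation (\<lambda>\<omega>. (norm (\<Sum>i<n. centered (Xs i \<omega>) (tn n)))\<^sup>2) / real (k n) \<le> 4 * C\<^sup>2"
      using elim by (simp add: pos_divide_le_eq)
    then show ?case using centered_sum_second_moment(1)[where n = n and u = "tn n"] by (simp add: eq)
  qed
qed measurable

text \<open>Recentering each exceedance of \<open>th n\<close> from \<open>cond_mean (tn n)\<close>
  to \<open>cond_mean (th n)\<close> produces the count times the change of centering; what is left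
  is a centered sum, split by threshold.\<close>

lemma emp_dev_eq:
  assumes "1 \<le> k n" "k n < n"
  shows "emp_dev n \<omega> = clt_sum n \<omega> + (1 / sqrt (real (k n))) *\<^sub>R threshold_change n \<omega>
     + (count n (th n \<omega>) \<omega> / sqrt (real (k n))) *\<^sub>R (cond_mean (th n \<omega>) - cond_mean (tn n))"
proof -
  let ?r = "sqrt (real (k n))" and ?N = "count n (th n \<omega>) \<omega>"
  have r: "?r > 0" "?r * ?r = real (k n)" using assms by auto
  define T where "T = (\<Sum>i<n. of_bool (norm (Xs i \<omega>) > th n \<omega>) *\<^sub>R z (Xs i \<omega>))"
  have sum: "(\<Sum>i<n. centered (Xs i \<omega>) (th n \<omega>)) = T - ?N *\<^sub>R cond_mean (th n \<omega>)"
  proof -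
    have "(\<Sum>i<n. of_bool (norm (Xs i \<omega>) > th n \<omega>) *\<^sub>R cond_mean (th n \<omega>)) = ?N *\<^sub>R cond_mean (th n \<omega>)"
      by (simp only: count_eq_sum scaleR_sum_left)
    then show ?thesis by (simp only: centered_def scaleR_diff_right sum_subtractf T_def)
  qed
  have "emp_dev n \<omega> = (1 / ?r) *\<^sub>R (T - ?N *\<^sub>R cond_mean (tn n))"
  proof -
    have e: "?r * (1 / real (k n)) = 1 / ?r" "?r * (?N / real (k n)) = (1 / ?r) * ?N"
      using r by (auto simp: field_simps)
    show ?thesis
      unfolding emp_dev_def emp_mean_def T_def[symmetric] scaleR_diff_right scaleR_scaleR e by simp
  qed
  also have "T - ?N *\<^sub>R cond_mean (tn n) =
     (\<Sum>i<n. centered (Xs i \<omega>) (tn n)) + threshold_change n \<omega> + ?N *\<^sub>R (cond_mean (th n \<omega>) - cond_mean (tn n))"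
    unfolding threshold_change_def sum_subtractf sum by (simp add: scaleR_diff_right)
  finally show ?thesis by (simp add: clt_sum_def scaleR_add_right)
qed

text \<open>The count is at most \<open>k n\<close>, so the centering term is bounded by
  \<open>sqrt (k n)\<close> times the change of the conditional mean, which is exactly what the rate
  condition controls.\<close>

lemma emp_dev_clt_sum_small: "small_in_prob M (\<lambda>n \<omega>. norm (emp_dev n \<omega> - clt_sum n \<omega>))"
proof (rule small_in_prob_mono[OF small_in_prob_add[OF threshold_change_small cond_mean_th_small]])
  show "\<forall>\<^sub>F n in sequentially. AE \<omega> in M. \<bar>norm (emp_dev n \<omega> - clt_sum n \<omega>)\<bar> \<le>
     \<bar>norm (threshold_change n \<omega>) / sqrt (real (k n)) + sqrt (real (k n)) * norm (cond_mean (th n \<omega>) - cond_mean (tn n))\<bar>"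
    using eventually_k
  proof eventually_elim
    case (elim n)
    show ?case
    proof (rule AE_I2)
      fix \<omega>
      let ?r = "sqrt (real (k n))" and ?N = "count n (th n \<omega>) \<omega>" and ?m = "cond_mean (th n \<omega>) - cond_mean (tn n)"
      have r: "?r > 0" "real (k n) / ?r = ?r" using elim by (auto simp: real_div_sqrt)
      have "norm (emp_dev n \<omega> - clt_sum n \<omega>) = norm ((1 / ?r) *\<^sub>R threshold_change n \<omega> + (?N / ?r) *\<^sub>R ?m)"
        using elim by (simp add: emp_dev_eq)
      also have "\<dots> \<le> norm (threshold_change n \<omega>) / ?r + ?N / ?r * norm ?m"
        using r by (intro order_trans[OF norm_triangle_ineq]) (simp add: count_def)
      also have "?N / ?r * norm ?m \<le> ?r * norm ?m"
      proof (rule mult_right_mono)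
        have "?N / ?r \<le> real (k n) / ?r" using count_th_le[of n \<omega>] elim r by (intro divide_right_mono) auto
        then show "?N / ?r \<le> ?r" using r by simp
      qed simp
      finally show "\<bar>norm (emp_dev n \<omega> - clt_sum n \<omega>)\<bar> \<le> \<bar>norm (threshold_change n \<omega>) / ?r + ?r * norm ?m\<bar>"
        by (simp add: abs_of_nonneg)
    qed
  qed
qed

text \<open>The sum dominates \<open>norm (emp_dev n \<omega>)\<close> by the triangle inequality
  and is the form in which it enters later estimates.\<close>

lemma emp_dev_bounded: "bounded_in_prob M (\<lambda>n \<omega>. norm (emp_dev n \<omega> - clt_sum n \<omega>) + norm (clt_sum n \<omega>))"
  by (rule bounded_in_prob_add[OF small_imp_bounded_in_prob[OF emp_dev_clt_sum_small] clt_sum_bounded])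

lemma cond_mean_tn_tendsto: "(\<lambda>n. cond_mean (tn n)) \<longlonglongrightarrow> S"
  using filterlim_compose[OF cond_mean_tendsto tn_infinity] .

lemma norm_triangle_3: "norm (a + b + c) \<le> norm a + norm b + norm c" for a b c :: "'f::real_normed_vector"
  by (intro order_trans[OF norm_triangle_ineq] add_right_mono norm_triangle_ineq)

text \<open>Consistency, by undoing the normalization of \<open>emp_dev\<close>: the errors are a
  tight term over \<open>sqrt (k n)\<close>, the defect of the relative count from 1 and the bias of
  \<open>cond_mean (tn n)\<close>.\<close>

lemma emp_mean_small: "small_in_prob M (\<lambda>n \<omega>. norm (emp_mean n \<omega> - S))"
proof -
  have a: "small_in_prob M (\<lambda>n \<omega>. (1 / sqrt (real (k n))) * (norm (emp_dev n \<omega> - clt_sum n \<omega>) + norm (clt_sum n \<omega>)))"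
    by (rule small_in_prob_mult[OF small_in_prob_const[OF inverse_sqrt_k_tendsto] emp_dev_bounded])
  have b: "small_in_prob M (\<lambda>n \<omega>. C * \<bar>count n (th n \<omega>) \<omega> / real (k n) - 1\<bar>)"
    by (rule small_in_prob_cmult, rule small_in_prob_mono[OF count_th_small]) simp
  have c: "small_in_prob M (\<lambda>n \<omega>. norm (cond_mean (tn n) - S))"
    by (rule small_in_prob_const) (use tendsto_norm[OF tendsto_diff[OF cond_mean_tn_tendsto tendsto_const, of S]] in simp)
  show ?thesis
  proof (rule small_in_prob_mono[OF small_in_prob_add[OF small_in_prob_add[OF a b] c]])
    show "\<forall>\<^sub>F n in sequentially. AE \<omega> in M. \<bar>norm (emp_mean n \<omega> - S)\<bar> \<le>
      \<bar>(1 / sqrt (real (k n))) * (norm (emp_dev n \<omega> - clt_sum n \<omega>) + norm (clt_sum n \<omega>))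
        + C * \<bar>count n (th n \<omega>) \<omega> / real (k n) - 1\<bar> + norm (cond_mean (tn n) - S)\<bar>"
      using eventually_k
    proof eventually_elim
      case (elim n)
      show ?case
      proof (rule AE_I2)
        fix \<omega>
        let ?r = "sqrt (real (k n))" and ?q = "count n (th n \<omega>) \<omega> / real (k n)"
        have r: "?r > 0" using elim by auto
        have "emp_mean n \<omega> - S = (1 / ?r) *\<^sub>R emp_dev n \<omega> + (?q - 1) *\<^sub>R cond_mean (tn n) + (cond_mean (tn n) - S)"
          using r by (simp add: emp_dev_def scaleR_diff_left)
        then have "norm (emp_mean n \<omega> - S) \<le> norm ((1 / ?r) *\<^sub>R emp_dev n \<omega>) + norm ((?q - 1) *\<^sub>R cond_mean (tn n)) + norm (cond_mean (tn n) - S)"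
          using norm_triangle_3[of "(1 / ?r) *\<^sub>R emp_dev n \<omega>" "(?q - 1) *\<^sub>R cond_mean (tn n)" "cond_mean (tn n) - S"] by (simp only:)
        also have "norm ((1 / ?r) *\<^sub>R emp_dev n \<omega>) \<le> (1 / ?r) * (norm (emp_dev n \<omega> - clt_sum n \<omega>) + norm (clt_sum n \<omega>))"
          unfolding norm_scaleR using r norm_triangle_ineq[of "emp_dev n \<omega> - clt_sum n \<omega>" "clt_sum n \<omega>"]
          by (intro mult_mono) auto
        also have "norm ((?q - 1) *\<^sub>R cond_mean (tn n)) \<le> C * \<bar>?q - 1\<bar>"
          unfolding norm_scaleR using norm_cond_mean_le[of "tn n"] by (simp add: mult.commute mult_right_mono)
        finally show "\<bar>norm (emp_mean n \<omega> - S)\<bar> \<le>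
          \<bar>(1 / ?r) * (norm (emp_dev n \<omega> - clt_sum n \<omega>) + norm (clt_sum n \<omega>)) + C * \<bar>?q - 1\<bar> + norm (cond_mean (tn n) - S)\<bar>"
          by simp
      qed
    qed
  qed
qed

text \<open>One-dimensional projections suffice, the argument of the characteristic function being
  absorbed by \<open>u\<close>. The row variance is \<open>n * tail (tn n) / k n\<close>, which
  tends to 1, times the conditional second moment minus the squared conditional mean.\<close>

lemma clt_sum_char_tendsto:
  assumes s2: "((\<lambda>t. expectation (\<lambda>\<omega>. of_bool (norm (X \<omega>) > t) * (u \<bullet> z (X \<omega>))\<^sup>2) / tail t) \<longlongrightarrow> s2) at_top"
  shows "(\<lambda>n. char (distr M borel (\<lambda>\<omega>. u \<bullet> clt_sum n \<omega>)) 1) \<longlonglongrightarrow> exp (- (s2 - (u \<bullet> S)\<^sup>2) / 2)"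
proof -
  define g where "g n x = (1 / sqrt (real (k n))) * (u \<bullet> centered x (tn n))" for n x
  have gm [measurable]: "g n \<in> borel_measurable borel" for n unfolding g_def by measurable
  have sum: "u \<bullet> clt_sum n \<omega> = (\<Sum>i<n. g n (Xs i \<omega>))" for n \<omega>
    by (simp add: clt_sum_def g_def inner_sum_right sum_distrib_left)
  have moment: "expectation (\<lambda>\<omega>. (u \<bullet> centered (X \<omega>) t)\<^sup>2) =
     expectation (\<lambda>\<omega>. of_bool (norm (X \<omega>) > t) * (u \<bullet> z (X \<omega>))\<^sup>2) - tail t * (u \<bullet> cond_mean t)\<^sup>2" for t
  proof -
    define c where "c = u \<bullet> cond_mean t"
    have i0: "integrable M (\<lambda>\<omega>. of_bool (norm (X \<omega>) > t) *\<^sub>R z (X \<omega>))" by (rule integrable_of_bool_z)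
    have i1: "integrable M (\<lambda>\<omega>. of_bool (norm (X \<omega>) > t) * (u \<bullet> z (X \<omega>)))"
      and e1: "expectation (\<lambda>\<omega>. of_bool (norm (X \<omega>) > t) * (u \<bullet> z (X \<omega>))) = tail t * c"
      using integrable_inner_right[of u, OF i0] integral_inner_right[of u, OF i0]
      by (simp_all add: expectation_of_bool_z c_def)
    have i2: "integrable M (\<lambda>\<omega>. of_bool (norm (X \<omega>) > t) * (u \<bullet> z (X \<omega>))\<^sup>2)"
    proof (rule integrable_const_bound[where B = "(norm u * C)\<^sup>2"])
      show "AE \<omega> in M. norm (of_bool (norm (X \<omega>) > t) * (u \<bullet> z (X \<omega>))\<^sup>2) \<le> (norm u * C)\<^sup>2"
        using z_bounded
      proof eventually_elim
        case (elim \<omega>)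
        have "\<bar>u \<bullet> z (X \<omega>)\<bar> \<le> norm u * norm (z (X \<omega>))" by (rule Cauchy_Schwarz_ineq2)
        also have "\<dots> \<le> norm u * C" using elim by (intro mult_left_mono) auto
        finally have "(u \<bullet> z (X \<omega>))\<^sup>2 \<le> (norm u * C)\<^sup>2" using C_nonneg by (subst power2_le_iff_abs_le) auto
        then show ?case by simp
      qed
    qed measurable
    have "expectation (\<lambda>\<omega>. (u \<bullet> centered (X \<omega>) t)\<^sup>2) = expectation (\<lambda>\<omega>. of_bool (norm (X \<omega>) > t) * (u \<bullet> z (X \<omega>))\<^sup>2
       - (2 * c * (of_bool (norm (X \<omega>) > t) * (u \<bullet> z (X \<omega>))) - c\<^sup>2 * of_bool (norm (X \<omega>) > t)))"
      by (intro Bochner_Integration.integral_cong refl)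
        (auto simp: centered_def inner_diff_right c_def power2_eq_square algebra_simps)
    also have "\<dots> = expectation (\<lambda>\<omega>. of_bool (norm (X \<omega>) > t) * (u \<bullet> z (X \<omega>))\<^sup>2) - (2 * c * (tail t * c) - c\<^sup>2 * tail t)"
      using i1 i2 by (simp add: e1 expectation_of_bool)
    finally show ?thesis by (simp add: c_def[symmetric] power2_eq_square)
  qed
  have var_t: "((\<lambda>t. expectation (\<lambda>\<omega>. (u \<bullet> centered (X \<omega>) t)\<^sup>2) / tail t) \<longlongrightarrow> s2 - (u \<bullet> S)\<^sup>2) at_top"
  proof -
    have "expectation (\<lambda>\<omega>. (u \<bullet> centered (X \<omega>) t)\<^sup>2) / tail t =
       expectation (\<lambda>\<omega>. of_bool (norm (X \<omega>) > t) * (u \<bullet> z (X \<omega>))\<^sup>2) / tail t - (u \<bullet> cond_mean t)\<^sup>2" for t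
      using tail_pos[of t] by (simp add: moment diff_divide_distrib)
    then show ?thesis
      by (simp only:) (intro tendsto_diff s2 tendsto_power tendsto_inner tendsto_const cond_mean_tendsto)
  qed
  have "(\<lambda>n. char (distr M borel (\<lambda>\<omega>. \<Sum>i<n. g n (Xs i \<omega>))) 1) \<longlonglongrightarrow> exp (- (s2 - (u \<bullet> S)\<^sup>2) / 2)"
  proof (rule triangular_char_tendsto[OF gm])
    show "AE \<omega> in M. \<bar>g n (X \<omega>)\<bar> \<le> (1 / sqrt (real (k n))) * (norm u * (2 * C))" for n
      using centered_bounded[of "tn n"]
    proof eventually_elim
      case (elim \<omega>)
      have "\<bar>u \<bullet> centered (X \<omega>) (tn n)\<bar> \<le> norm u * norm (centered (X \<omega>) (tn n))" by (rule Cauchy_Schwarz_ineq2)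
      also have "\<dots> \<le> norm u * (2 * C)" using elim by (intro mult_left_mono) auto
      finally show ?case by (simp add: g_def abs_mult divide_right_mono)
    qed
    show "(\<lambda>n. (1 / sqrt (real (k n))) * (norm u * (2 * C))) \<longlonglongrightarrow> 0"
      using tendsto_mult_right[OF inverse_sqrt_k_tendsto, of "norm u * (2 * C)"] by simp
    have "expectation (\<lambda>\<omega>. g n (X \<omega>)) = 0" for n
      unfolding g_def using integrable_centered[of "tn n"] centered_expectation[of "tn n"] by simp
    then show "\<forall>\<^sub>F n in sequentially. expectation (\<lambda>\<omega>. g n (X \<omega>)) = 0" by simp
    have "(\<lambda>n. (real n * tail (tn n) / real (k n)) * (expectation (\<lambda>\<omega>. (u \<bullet> centered (X \<omega>) (tn n))\<^sup>2) / tail (tn n)))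
       \<longlonglongrightarrow> 1 * (s2 - (u \<bullet> S)\<^sup>2)"
      by (intro tendsto_mult n_tail_tn_tendsto filterlim_compose[OF var_t tn_infinity])
    moreover have "real n * expectation (\<lambda>\<omega>. (g n (X \<omega>))\<^sup>2) =
       (real n * tail (tn n) / real (k n)) * (expectation (\<lambda>\<omega>. (u \<bullet> centered (X \<omega>) (tn n))\<^sup>2) / tail (tn n))" for n
      using tail_pos[of "tn n"] by (simp add: g_def power_mult_distrib power_divide)
    ultimately show "(\<lambda>n. real n * expectation (\<lambda>\<omega>. (g n (X \<omega>))\<^sup>2)) \<longlonglongrightarrow> s2 - (u \<bullet> S)\<^sup>2" by simp
  qed
  then show ?thesis by (simp add: sum)
qed

end

section \<open>Regular variation and the limit model\<close>

text \<open>Valid without integrability: the scaled integrand is then not integrable either, and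
  both integrals are 0 by convention.\<close>

lemma integral_uniform_measure:
  fixes f :: "'a \<Rightarrow> 'f::{banach, second_countable_topology}"
  assumes A: "A \<in> sets M" "measure M A > 0" and f [measurable]: "f \<in> borel_measurable M"
  shows "(\<integral>x. f x \<partial>uniform_measure M A) = (\<integral>x. indicator A x *\<^sub>R f x \<partial>M) /\<^sub>R measure M A"
proof -
  have em: "emeasure M A = ennreal (measure M A)"
    using A(2) by (metis emeasure_eq_ennreal_measure measure_def enn2real_top less_irrefl)
  have "uniform_measure M A = density M (\<lambda>x. ennreal (indicator A x / measure M A))"
    unfolding uniform_measure_def em
    by (intro arg_cong[where f = "density M"] ext) (use A(2) in \<open>simp add: indicator_def divide_ennreal[symmetric]\<close>)
  then have "(\<integral>x. f x \<partial>uniform_measure M A) = (\<integral>x. (indicator A x / measure M A) *\<^sub>R f x \<partial>M)"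
    using A by (simp add: integral_density)
  also have "\<dots> = (\<integral>x. inverse (measure M A) *\<^sub>R (indicator A x *\<^sub>R f x) \<partial>M)"
    by (intro Bochner_Integration.integral_cong) (auto simp: divide_inverse mult.commute)
  also have "\<dots> = inverse (measure M A) *\<^sub>R (\<integral>x. indicator A x *\<^sub>R f x \<partial>M)"
  proof (cases "integrable M (\<lambda>x. indicator A x *\<^sub>R f x)")
    case True
    then show ?thesis by (intro integral_scaleR_right)
  next
    case False
    have "\<not> integrable M (\<lambda>x. inverse (measure M A) *\<^sub>R (indicator A x *\<^sub>R f x))"
    proof
      assume "integrable M (\<lambda>x. inverse (measure M A) *\<^sub>R (indicator A x *\<^sub>R f x))"
      then have "integrable M (\<lambda>x. measure M A *\<^sub>R (inverse (measure M A) *\<^sub>R (indicator A x *\<^sub>R f x)))"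
        by (rule integrable_scaleR_right)
      moreover have "(\<lambda>x. measure M A *\<^sub>R (inverse (measure M A) *\<^sub>R (indicator A x *\<^sub>R f x))) = (\<lambda>x. indicator A x *\<^sub>R f x)"
        using A(2) unfolding scaleR_scaleR by (simp add: mult.assoc[symmetric])
      ultimately show False using False by (simp only:)
    qed
    then show ?thesis by (simp only: not_integrable_integral_eq False not_False_eq_True scaleR_zero_right)
  qed
  finally show ?thesis .
qed

text \<open>Conditioning on a null event yields the zero measure, by the convention for division by
  zero.\<close>

lemma integral_uniform_measure_null:
  fixes f :: "'a \<Rightarrow> 'f::{banach, second_countable_topology}"
  assumes "A \<in> null_sets M"
  shows "(\<integral>x. f x \<partial>uniform_measure M A) = 0"
proof (rule integral_eq_zero_AE)
  have "emeasure (uniform_measure M A) (space M) = 0"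
    using assms by (subst emeasure_uniform_measure) (auto simp: null_sets_def)
  then have "space (uniform_measure M A) \<in> null_sets (uniform_measure M A)" by (auto intro: null_setsI)
  then show "AE x in uniform_measure M A. f x = 0" by (rule AE_I') auto
qed

context prob_space
begin

lemma exceed_integral:
  fixes f :: "'a \<Rightarrow> 'f::{banach, second_countable_topology}" and X :: "'a \<Rightarrow> real^'d"
  assumes [measurable]: "X \<in> borel_measurable M" "f \<in> borel_measurable M"
    and "prob {\<omega>\<in>space M. norm (X \<omega>) > t} > 0"
  shows "(\<integral>\<omega>. f \<omega> \<partial>exceed M X t) =
    expectation (\<lambda>\<omega>. of_bool (norm (X \<omega>) > t) *\<^sub>R f \<omega>) /\<^sub>R prob {\<omega>\<in>space M. norm (X \<omega>) > t}"
proof -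
  have "(\<integral>x. indicator {\<omega>\<in>space M. norm (X \<omega>) > t} x *\<^sub>R f x \<partial>M) =
    expectation (\<lambda>\<omega>. of_bool (norm (X \<omega>) > t) *\<^sub>R f \<omega>)"
    by (intro Bochner_Integration.integral_cong) (auto simp: indicator_def)
  then show ?thesis
    unfolding exceed_def using assms(3) by (subst integral_uniform_measure) auto
qed

end

lemma has_limit_modelD:
  fixes h :: "real^'d \<Rightarrow> real"
  assumes "has_limit_model M X \<mu> w"
  shows has_limit_model_measurable: "scaled w \<in> borel_measurable (limit_model \<mu>)"
    and has_limit_model_tendsto: "continuous_on UNIV h \<Longrightarrow> (\<And>x. \<bar>h x\<bar> \<le> B) \<Longrightarrow>
      ((\<lambda>t. \<integral>\<omega>. h (scaled w (X \<omega>)) \<partial>exceed M X t) \<longlongrightarrow> (\<integral>x. h (scaled w x) \<partial>limit_model \<mu>)) at_top"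
proof -
  show "scaled w \<in> borel_measurable (limit_model \<mu>)"
    using assms unfolding has_limit_model_def converges_weakly_def random_element_def
    by (simp add: borel_def open_openin[symmetric])
  assume h: "continuous_on UNIV h" "\<And>x. \<bar>h x\<bar> \<le> B"
  have "bounded (range h)" using h(2) by (auto simp: bounded_iff)
  then show "((\<lambda>t. \<integral>\<omega>. h (scaled w (X \<omega>)) \<partial>exceed M X t) \<longlongrightarrow> (\<integral>x. h (scaled w x) \<partial>limit_model \<mu>)) at_top"
    using assms h(1) unfolding has_limit_model_def converges_weakly_def by auto
qed

text \<open>The constant test function 1 carries the total mass to the limit; positivity of the
  tails makes the conditional laws probability measures.\<close>

lemma limit_model_prob_space:
  fixes X :: "'a \<Rightarrow> real^'d"
  assumes M: "prob_space M" and X: "X \<in> borel_measurable M"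
    and pos: "\<And>t. measure M {\<omega>\<in>space M. norm (X \<omega>) > t} > 0" and lm: "has_limit_model M X \<mu> w"
  shows "prob_space (limit_model \<mu>)"
proof -
  interpret prob_space M by fact
  have "(\<integral>\<omega>. 1 \<partial>exceed M X t) = (1::real)" for t
  proof -
    have "expectation (\<lambda>\<omega>. of_bool (norm (X \<omega>) > t) *\<^sub>R (1::real)) = prob {\<omega>\<in>space M. norm (X \<omega>) > t}"
    proof -
      have "expectation (\<lambda>\<omega>. of_bool (norm (X \<omega>) > t) *\<^sub>R (1::real)) = expectation (indicator {\<omega>\<in>space M. norm (X \<omega>) > t})"
        by (intro Bochner_Integration.integral_cong) (auto simp: indicator_def)
      moreover have "{\<omega>\<in>space M. norm (X \<omega>) > t} \<inter> space M = {\<omega>\<in>space M. norm (X \<omega>) > t}" by auto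
      ultimately show ?thesis by simp
    qed
    then show ?thesis using exceed_integral[OF X, of "\<lambda>_. 1::real" t] pos[of t] by simp
  qed
  then have "((\<lambda>t::real. 1) \<longlongrightarrow> (\<integral>x. 1 \<partial>limit_model \<mu> :: real)) at_top"
    using has_limit_model_tendsto[OF lm, of "\<lambda>_. 1" 1] by simp
  then have "(\<integral>x. 1 \<partial>limit_model \<mu> :: real) = 1"
    using tendsto_unique[OF trivial_limit_at_top_linorder _ tendsto_const] by metis
  then have "measure (limit_model \<mu>) (space (limit_model \<mu>)) = 1" by simp
  then have "emeasure (limit_model \<mu>) (space (limit_model \<mu>)) = 1"
    by (metis emeasure_eq_ennreal_measure ennreal_1 measure_def enn2real_top zero_neq_one)
  then show ?thesis by (rule prob_spaceI)
qed

text \<open>If the norm is essentially bounded, the conditional laws are eventually zero measures,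
  so the limit leaves no mass away from 0. The contrapositive is what matters: the spectral gap
  forces positive tails.\<close>

lemma Sigma_lim_bounded_case:
  fixes X :: "'a \<Rightarrow> real^'d"
  assumes M: "prob_space M" and X: "X \<in> borel_measurable M"
    and zero: "measure M {\<omega>\<in>space M. norm (X \<omega>) > t0} = 0" and lm: "has_limit_model M X \<mu> w"
  shows "Sigma_lim \<mu> w = 0"
proof (cases "integrable (limit_model \<mu>) (\<lambda>x. outer (scaled w x))")
  case False
  then show ?thesis unfolding Sigma_lim_def by (rule not_integrable_integral_eq)
next
  case True
  interpret prob_space M by fact
  note [measurable] = has_limit_model_measurable[OF lm] X
  \<comment> \<open>A bounded continuous test function that vanishes only at 0.\<close>
  define h :: "real^'d \<Rightarrow> real" where "h y = min 1 ((norm y)\<^sup>2)" for y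
  have h: "continuous_on UNIV h" "\<And>y. \<bar>h y\<bar> \<le> 1" unfolding h_def by (auto intro!: continuous_intros simp: abs_le_iff)
  have "(\<integral>\<omega>. h (scaled w (X \<omega>)) \<partial>exceed M X t) = 0" if "t \<ge> t0" for t
  proof -
    have "prob {\<omega>\<in>space M. norm (X \<omega>) > t} \<le> prob {\<omega>\<in>space M. norm (X \<omega>) > t0}"
      using that by (intro finite_measure_mono) auto
    then have "emeasure M {\<omega>\<in>space M. norm (X \<omega>) > t} = 0" using zero by (simp add: emeasure_eq_measure measure_le_0_iff)
    then have "{\<omega>\<in>space M. norm (X \<omega>) > t} \<in> null_sets M" by (intro null_setsI) auto
    then show ?thesis unfolding exceed_def by (rule integral_uniform_measure_null)
  qed
  then have "((\<lambda>t. \<integral>\<omega>. h (scaled w (X \<omega>)) \<partial>exceed M X t) \<longlongrightarrow> 0) at_top"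
    by (intro tendsto_eventually eventually_at_top_linorderI[of t0])
  then have int0: "(\<integral>x. h (scaled w x) \<partial>limit_model \<mu>) = 0"
    using has_limit_model_tendsto[OF lm h] tendsto_unique[OF trivial_limit_at_top_linorder] by blast
  have "integrable (limit_model \<mu>) (\<lambda>x. h (scaled w x))"
  proof (rule Bochner_Integration.integrable_bound[OF True])
    show "(\<lambda>x. h (scaled w x)) \<in> borel_measurable (limit_model \<mu>)" unfolding h_def by measurable
    show "AE x in limit_model \<mu>. norm (h (scaled w x)) \<le> norm (outer (scaled w x))"
      by (intro AE_I2) (simp add: h_def norm_outer min_def)
  qed
  then have "AE x in limit_model \<mu>. h (scaled w x) = 0"
    using int0 by (subst integral_nonneg_eq_0_iff_AE[symmetric]) (auto simp: h_def)
  then have "AE x in limit_model \<mu>. outer (scaled w x) = 0"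
    by eventually_elim (auto simp: h_def min_def outer_def vec_eq_iff split: if_splits)
  then show ?thesis unfolding Sigma_lim_def by (rule integral_eq_zero_AE)
qed

text \<open>Regular variation is applied to the complement of the ball of radius \<open>s\<close>.
  Its frontier lies in a sphere, which for \<open>s > 1\<close> is inside the region where
  \<open>\<mu>\<close> and the limit model agree.\<close>

lemma regularly_varying_tail_ratio:
  fixes X :: "'a \<Rightarrow> real^'d"
  assumes M: "prob_space M" and rv: "regularly_varying M X \<mu>" and P: "prob_space (limit_model \<mu>)"
    and s: "s > 1" "measure (limit_model \<mu>) {x\<in>space (limit_model \<mu>). norm x = s} = 0"
  shows "((\<lambda>t. measure M {\<omega>\<in>space M. norm (X \<omega>) > s * t} / measure M {\<omega>\<in>space M. norm (X \<omega>) > t})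
     \<longlongrightarrow> measure (limit_model \<mu>) {x\<in>space (limit_model \<mu>). norm x > s}) at_top"
proof -
  interpret P: prob_space "limit_model \<mu>" by fact
  have sets_\<mu>: "sets \<mu> = sets (restrict_space borel (- {0}))" using rv by (simp add: regularly_varying_def)
  have space_\<mu>: "space \<mu> = - {0}" using sets_eq_imp_space_eq[OF sets_\<mu>] by (simp add: space_restrict_space)
  have in_sets: "A \<in> sets \<mu>" if "A \<in> sets borel" "0 \<notin> A" for A
    unfolding sets_\<mu> using that by (subst sets_restrict_space_iff) auto
  have m1: "{x::real^'d. norm x > 1} \<in> sets \<mu>" by (rule in_sets) auto
  have sp: "space (limit_model \<mu>) = {x. norm x > 1}"
    unfolding limit_model_def using m1 by simp
  have em: "emeasure (limit_model \<mu>) A = emeasure \<mu> A" if "A \<subseteq> {x. norm x > 1}" for A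
  proof -
    have "{x::real^'d. norm x > 1} \<inter> space \<mu> = {x. norm x > 1}" by (auto simp: space_\<mu>)
    then show ?thesis unfolding limit_model_def using that m1 by (intro emeasure_restrict_space) simp_all
  qed
  define D where "D = {x::real^'d. norm x > s}"
  have D: "D \<in> sets borel" unfolding D_def by simp
  have openD: "open D" unfolding D_def by (intro open_Collect_less continuous_intros)
  have clD: "closure D \<subseteq> {x. norm x \<ge> s}"
    by (rule closure_minimal) (auto simp: D_def intro!: closed_Collect_le continuous_intros)
  have fr: "frontier D \<subseteq> {x. norm x = s}"
  proof
    fix x assume "x \<in> frontier D"
    then have "x \<in> closure D" "x \<notin> D" by (auto simp: frontier_def interior_open[OF openD])
    moreover from this have "norm x \<ge> s" using clD by blast
    ultimately show "x \<in> {x. norm x = s}" by (simp add: D_def)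
  qed
  have "emeasure \<mu> (frontier D) \<le> emeasure \<mu> {x. norm x = s}"
    using fr s(1) by (intro emeasure_mono in_sets) auto
  also have "\<dots> = emeasure (limit_model \<mu>) {x. norm x = s}" using s(1) by (intro em[symmetric]) auto
  also have "\<dots> = 0"
  proof -
    have "{x\<in>space (limit_model \<mu>). norm x = s} = {x. norm x = s}" using s(1) by (auto simp: sp)
    then show ?thesis using s(2) by (simp add: P.emeasure_eq_measure)
  qed
  finally have "emeasure \<mu> (frontier D) = 0" by simp
  moreover have "0 \<notin> closure D" using clD s(1) by auto
  ultimately have lim: "((\<lambda>t. measure M {\<omega>\<in>space M. X \<omega> /\<^sub>R t \<in> D} / measure M {\<omega>\<in>space M. norm (X \<omega>) > t})
           \<longlongrightarrow> measure \<mu> D) at_top"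
    using rv D by (simp add: regularly_varying_def)
  have meq: "measure \<mu> D = measure (limit_model \<mu>) {x\<in>space (limit_model \<mu>). norm x > s}"
  proof -
    have "{x\<in>space (limit_model \<mu>). norm x > s} = D" using s(1) by (auto simp: sp D_def)
    moreover have "emeasure (limit_model \<mu>) D = emeasure \<mu> D" using s(1) by (intro em) (auto simp: D_def)
    ultimately show ?thesis by (simp add: measure_def)
  qed
  have ev: "\<forall>\<^sub>F t in at_top. measure M {\<omega>\<in>space M. X \<omega> /\<^sub>R t \<in> D} / measure M {\<omega>\<in>space M. norm (X \<omega>) > t} =
     measure M {\<omega>\<in>space M. norm (X \<omega>) > s * t} / measure M {\<omega>\<in>space M. norm (X \<omega>) > t}"
    using eventually_gt_at_top[of 0]
  proof eventually_elim
    case (elim t)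
    then have "X \<omega> /\<^sub>R t \<in> D \<longleftrightarrow> norm (X \<omega>) > s * t" for \<omega>
      by (simp add: D_def field_simps)
    then show ?case by simp
  qed
  show ?thesis using Lim_transform_eventually[OF lim ev] by (simp only: meq)
qed

text \<open>Only \<open>\<mu>{norm x > s}\<close> for \<open>s > 1\<close> is used. Had it the value 1 at some \<open>s > 1\<close>, it would be 1 at
  all powers of a nearby continuity point, whereas it vanishes at infinity.\<close>
lemma tail_ratio_bounds:
  fixes F :: "real \<Rightarrow> real" and P :: "'p measure" and f :: "'p \<Rightarrow> real"
  assumes P: "prob_space P" and f [measurable]: "f \<in> borel_measurable P" and f1: "\<And>x. x \<in> space P \<Longrightarrow> f x > 1"
    and F: "\<And>t. F t > 0" "\<And>s t. s \<le> t \<Longrightarrow> F t \<le> F s"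
    and lim: "\<And>s. s > 1 \<Longrightarrow> measure P {x\<in>space P. f x = s} = 0 \<Longrightarrow>
      ((\<lambda>t. F (s * t) / F t) \<longlongrightarrow> measure P {x\<in>space P. f x > s}) at_top"
  shows tail_ratio_less: "s > 1 \<Longrightarrow> \<exists>\<eta><1. \<forall>\<^sub>F t in at_top. F (s * t) \<le> \<eta> * F t"
    and tail_ratio_greater: "\<eta> < 1 \<Longrightarrow> \<exists>s>1. \<forall>\<^sub>F t in at_top. F (s * t) \<ge> \<eta> * F t"
proof -
  interpret P: prob_space P by fact
  define g where "g s = measure P {x\<in>space P. f x > s}" for s
  \<comment> \<open>The discontinuities, at most countably many because they are atoms of a
    probability law.\<close>
  define A where "A = {s. measure P {x\<in>space P. f x = s} \<noteq> 0}"
  have cA: "countable A"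
  proof -
    interpret D: prob_space "distr P borel f" by (rule P.prob_space_distr) measurable
    have "measure (distr P borel f) {s} = measure P {x\<in>space P. f x = s}" for s
      by (subst measure_distr) (auto intro!: arg_cong[where f = "measure P"])
    then show ?thesis using D.countable_support by (simp add: A_def)
  qed
  have glim: "((\<lambda>t. F (s * t) / F t) \<longlongrightarrow> g s) at_top" if "s > 1" "s \<notin> A" for s
    using lim that by (simp add: g_def A_def)
  have g_mono: "g t \<le> g s" if "s \<le> t" for s t
    unfolding g_def using that by (intro P.finite_measure_mono) auto
  have g1: "g s \<le> 1" for s by (simp add: g_def)
  show "\<exists>\<eta><1. \<forall>\<^sub>F t in at_top. F (s * t) \<le> \<eta> * F t" if s: "s > 1"
  proof -
    \<comment> \<open>Avoiding all roots of atoms makes every positive power of \<open>r\<close> a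
      continuity point, so the limit can be iterated along the powers.\<close>
    define B where "B = (\<Union>m::nat. root m ` A)"
    have "countable B" unfolding B_def using cA by auto
    moreover have "uncountable {1<..<s}" using s by (simp add: uncountable_open_interval)
    ultimately have "\<not> {1<..<s} \<subseteq> B" using countable_subset by blast
    then obtain r where "r \<in> {1<..<s}" and "r \<notin> B" by blast
    then have r: "1 < r" "r < s" "r \<notin> B" by auto
    have rA: "r ^ m \<notin> A" if "m > 0" for m
    proof
      assume "r ^ m \<in> A"
      then have "root m (r ^ m) \<in> B" by (auto simp: B_def)
      then show False using r that by (simp add: real_root_power_cancel)
    qed
    have pinf: "filterlim (\<lambda>t. r ^ m * t) at_top at_top" for m
      using r(1) by (intro filterlim_tendsto_pos_mult_at_top[OF tendsto_const _ filterlim_ident]) auto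
    have "g r < 1"
    proof (rule ccontr)
      assume "\<not> g r < 1"
      then have gr: "g r = 1" using g1[of r] by simp
      have lim1: "((\<lambda>t. F (r * t) / F t) \<longlongrightarrow> 1) at_top" using glim[of r] rA[of 1] r gr by simp
      have pow: "((\<lambda>t. F (r ^ m * t) / F t) \<longlongrightarrow> 1) at_top" for m
      proof (induction m)
        case 0 then show ?case using F(1) by (simp add: less_imp_neq[THEN not_sym])
      next
        case (Suc m)
        have "((\<lambda>t. F (r * (r ^ m * t)) / F (r ^ m * t)) \<longlongrightarrow> 1) at_top"
          by (rule filterlim_compose[OF lim1 pinf])
        from tendsto_mult[OF this Suc] show ?case
          using F(1) by (simp add: less_imp_neq[THEN not_sym] mult.assoc)
      qed
      have gpow: "g (r ^ Suc m) = 1" for m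
        using tendsto_unique[OF _ glim[of "r ^ Suc m"] pow[of "Suc m"]] rA[of "Suc m"] r(1) one_less_power[OF r(1), of "Suc m"] by simp
      have "(\<lambda>m. g (r ^ Suc m)) \<longlonglongrightarrow> measure P (\<Inter>m. {x\<in>space P. f x > r ^ Suc m})"
        unfolding g_def
      proof (rule P.finite_Lim_measure_decseq)
        show "decseq (\<lambda>m. {x\<in>space P. f x > r ^ Suc m})"
          unfolding decseq_def using r(1) by (auto intro: le_less_trans[rotated] power_increasing simp del: power_Suc)
      qed auto
      also have "(\<Inter>m. {x\<in>space P. f x > r ^ Suc m}) = {}"
      proof -
        have "\<exists>m. f x \<le> r ^ Suc m" for x
        proof -
          obtain m where "f x < r ^ m" using real_arch_pow[OF r(1)] by blast
          also have "r ^ m \<le> r ^ Suc m" using r(1) by (intro power_increasing) auto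
          finally show ?thesis by (auto intro: less_imp_le)
        qed
        then have "x \<notin> (\<Inter>m. {x\<in>space P. f x > r ^ Suc m})" for x
          unfolding INT_iff using leD by blast
        then show ?thesis by blast
      qed
      finally show False by (simp add: gpow LIMSEQ_const_iff del: power_Suc)
    qed
    then obtain \<eta> where \<eta>: "g r < \<eta>" "\<eta> < 1" using dense by blast
    have "\<forall>\<^sub>F t in at_top. F (r * t) / F t < \<eta>"
      using order_tendstoD(2)[OF glim[of r] \<eta>(1)] rA[of 1] r by simp
    then have "\<forall>\<^sub>F t in at_top. F (s * t) \<le> \<eta> * F t"
      using eventually_gt_at_top[of 0]
    proof eventually_elim
      case (elim t)
      have "F (s * t) \<le> F (r * t)" using elim r by (intro F(2) mult_right_mono) auto
      also have "\<dots> \<le> \<eta> * F t" using elim F(1)[of t] by (simp add: pos_divide_less_eq)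
      finally show ?case .
    qed
    then show ?thesis using \<eta>(2) by blast
  qed
  show "\<exists>s>1. \<forall>\<^sub>F t in at_top. F (s * t) \<ge> \<eta> * F t" if \<eta>: "\<eta> < 1"
  proof -
    \<comment> \<open>Levels decreasing to 1; since \<open>f > 1\<close> on the whole space, their
      exceedance probabilities increase to 1.\<close>
    let ?e = "\<lambda>j. 1 + inverse (real (Suc j))"
    have "(\<lambda>j. g (?e j)) \<longlonglongrightarrow> measure P (\<Union>j. {x\<in>space P. f x > ?e j})"
      unfolding g_def
    proof (rule P.finite_Lim_measure_incseq)
      show "incseq (\<lambda>j. {x\<in>space P. f x > ?e j})"
      proof (rule incseq_SucI)
        fix j
        have "?e (Suc j) \<le> ?e j" by simp
        then show "{x\<in>space P. f x > ?e j} \<subseteq> {x\<in>space P. f x > ?e (Suc j)}" using le_less_trans by blast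
      qed
    qed auto
    also have "(\<Union>j. {x\<in>space P. f x > ?e j}) = space P"
    proof -
      have "\<exists>j. f x > ?e j" if "x \<in> space P" for x
      proof -
        have "f x - 1 > 0" using f1[OF that] by simp
        then obtain j where "inverse (real (Suc j)) < f x - 1" using reals_Archimedean by blast
        then show ?thesis by (intro exI[of _ j]) linarith
      qed
      then show ?thesis by blast
    qed
    finally have "(\<lambda>j. g (?e j)) \<longlonglongrightarrow> 1" by (simp add: P.prob_space)
    from order_tendstoD(1)[OF this \<eta>] obtain j where j: "g (?e j) > \<eta>"
      by (auto simp: eventually_sequentially)
    have "uncountable {1<..<?e j}" by (simp add: uncountable_open_interval)
    then have "\<not> {1<..<?e j} \<subseteq> A" using cA countable_subset by blast
    then obtain s where "s \<in> {1<..<?e j}" and "s \<notin> A" by blast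
    then have s: "1 < s" "s < ?e j" "s \<notin> A" by auto
    have "g s > \<eta>" using g_mono[of s "?e j"] s j by linarith
    from order_tendstoD(1)[OF glim[OF s(1,3)] this]
    have "\<forall>\<^sub>F t in at_top. F (s * t) \<ge> \<eta> * F t"
      by eventually_elim (use F(1) in \<open>simp add: pos_less_divide_eq less_imp_le\<close>)
    then show ?thesis using s(1) by blast
  qed
qed

lemma covar_quadratic_form:
  fixes Y :: "'i \<Rightarrow> 'b \<Rightarrow> real"
  assumes I: "finite I" and int: "\<And>a b. a \<in> I \<Longrightarrow> b \<in> I \<Longrightarrow>
     integrable P (\<lambda>\<omega>. (Y a \<omega> - (\<integral>\<eta>. Y a \<eta> \<partial>P)) * (Y b \<omega> - (\<integral>\<eta>. Y b \<eta> \<partial>P)))"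
  shows "(\<Sum>a\<in>I. \<Sum>b\<in>I. c a * c b * covar P (Y a) (Y b)) =
    (\<integral>\<omega>. (\<Sum>a\<in>I. c a * (Y a \<omega> - (\<integral>\<eta>. Y a \<eta> \<partial>P)))\<^sup>2 \<partial>P)"
proof -
  let ?Z = "\<lambda>a \<omega>. Y a \<omega> - (\<integral>\<eta>. Y a \<eta> \<partial>P)"
  have i: "integrable P (\<lambda>\<omega>. c a * c b * (?Z a \<omega> * ?Z b \<omega>))" if "a \<in> I" "b \<in> I" for a b
    using int[OF that] by (rule integrable_mult_right)
  have "(\<integral>\<omega>. (\<Sum>a\<in>I. c a * ?Z a \<omega>)\<^sup>2 \<partial>P) = (\<integral>\<omega>. (\<Sum>a\<in>I. \<Sum>b\<in>I. c a * c b * (?Z a \<omega> * ?Z b \<omega>)) \<partial>P)"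
    by (simp add: power2_eq_square sum_product mult_ac)
  also have "\<dots> = (\<Sum>a\<in>I. \<integral>\<omega>. (\<Sum>b\<in>I. c a * c b * (?Z a \<omega> * ?Z b \<omega>)) \<partial>P)"
    by (rule Bochner_Integration.integral_sum) (intro Bochner_Integration.integrable_sum i)
  also have "\<dots> = (\<Sum>a\<in>I. \<Sum>b\<in>I. \<integral>\<omega>. c a * c b * (?Z a \<omega> * ?Z b \<omega>) \<partial>P)"
    by (intro sum.cong refl Bochner_Integration.integral_sum i)
  also have "\<dots> = (\<Sum>a\<in>I. \<Sum>b\<in>I. c a * c b * covar P (Y a) (Y b))"
    unfolding covar_def by simp
  finally show ?thesis ..
qed

lemma inner_matrix_pair_sum: "A \<bullet> B = (\<Sum>a\<in>UNIV. A $ fst a $ snd a * B $ fst a $ snd a)"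
  for A B :: "real^'n::finite^'m::finite"
  unfolding inner_matrix_sum by (simp add: sum.cartesian_product UNIV_Times_UNIV[symmetric] case_prod_beta del: UNIV_Times_UNIV)

lemma transpose_integral:
  fixes f :: "'a \<Rightarrow> real^'n^'m"
  assumes "integrable M f"
  shows "transpose (\<integral>x. f x \<partial>M) = (\<integral>x. transpose (f x) \<partial>M)"
proof -
  have "bounded_linear (transpose :: real^'n^'m \<Rightarrow> real^'m^'n)"
    unfolding linear_conv_bounded_linear[symmetric]
    by (rule linearI) (auto simp: transpose_add transpose_scaleR)
  from integral_bounded_linear[OF this assms] show ?thesis by simp
qed

context prob_space
begin

text \<open>The domination is asked only where \<open>Q\<close> is at most 1/2 in absolute value.
  With \<open>Q\<close> the relative count minus 1, this allows division by the relative
  count.\<close>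

lemma small_in_prob_local_mono:
  assumes Y: "small_in_prob M Y" and Q: "small_in_prob M Q"
    and le: "\<forall>\<^sub>F n in sequentially. \<forall>\<omega>\<in>space M. \<bar>Q n \<omega>\<bar> \<le> 1/2 \<longrightarrow> \<bar>Z n \<omega>\<bar> \<le> \<bar>Y n \<omega>\<bar>"
  shows "small_in_prob M Z"
proof (rule small_in_probI)
  fix e d :: real assume e: "e > 0" and d: "d > 0"
  have h: "1/2 > (0::real)" by simp
  show "\<forall>\<^sub>F n in sequentially. \<exists>A\<in>events. prob A < d \<and> (\<forall>\<omega>\<in>space M - A. \<bar>Z n \<omega>\<bar> \<le> e)"
    using small_in_probD[OF Y e half_gt_zero[OF d]] small_in_probD[OF Q h half_gt_zero[OF d]] le
  proof eventually_elim
    case (elim n)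
    then obtain A B where A: "A \<in> events" "prob A < d/2" "\<forall>\<omega>\<in>space M - A. \<bar>Y n \<omega>\<bar> \<le> e"
      and B: "B \<in> events" "prob B < d/2" "\<forall>\<omega>\<in>space M - B. \<bar>Q n \<omega>\<bar> \<le> 1/2" by blast
    have "prob (A \<union> B) < d" using A(1,2) B(1,2) measure_Un_le[of A M B] by linarith
    moreover have "\<bar>Z n \<omega>\<bar> \<le> e" if "\<omega> \<in> space M - (A \<union> B)" for \<omega>
    proof -
      have "\<bar>Y n \<omega>\<bar> \<le> e" "\<bar>Q n \<omega>\<bar> \<le> 1/2" "\<omega> \<in> space M" using that A(3) B(3) by auto
      then show ?thesis using elim(3) order_trans by blast
    qed
    ultimately show ?case using A(1) B(1) by (intro bexI[of _ "A \<union> B"]) auto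
  qed
qed

text \<open>The comparison is with an event containing the set, so it covers sets that are not known
  to be events.\<close>

lemma small_in_prob_measure_tendsto:
  assumes Z: "small_in_prob M Z" and e: "e > 0"
  shows "(\<lambda>n. prob {\<omega>\<in>space M. Z n \<omega> > e}) \<longlonglongrightarrow> 0"
proof (rule LIMSEQ_I)
  fix d :: real assume d: "d > 0"
  have "\<forall>\<^sub>F n in sequentially. norm (prob {\<omega>\<in>space M. Z n \<omega> > e} - 0) < d"
    using small_in_probD[OF Z e d]
  proof eventually_elim
    case (elim n)
    then obtain A where A: "A \<in> events" "prob A < d" "\<forall>\<omega>\<in>space M - A. \<bar>Z n \<omega>\<bar> \<le> e" by blast
    have "prob {\<omega>\<in>space M. Z n \<omega> > e} \<le> prob A"
    proof (rule finite_measure_mono[OF subsetI A(1)])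
      fix \<omega> assume w: "\<omega> \<in> {\<omega>\<in>space M. Z n \<omega> > e}"
      show "\<omega> \<in> A"
      proof (rule ccontr)
        assume "\<omega> \<notin> A"
        then have "\<bar>Z n \<omega>\<bar> \<le> e" using A(3) w by blast
        then show False using w abs_ge_self[of "Z n \<omega>"] by auto
      qed
    qed
    then show ?case using A(2) by simp
  qed
  then show "\<exists>n0. \<forall>n\<ge>n0. norm (prob {\<omega>\<in>space M. Z n \<omega> > e} - 0) < d" by (simp add: eventually_sequentially)
qed

text \<open>Weak convergence tests bounded functions. The scaled vector is almost surely bounded,
  under the conditional laws and hence in the limit, so any continuous \<open>f\<close> may be
  replaced by a truncation that agrees with it on the relevant ball.\<close>

lemma limit_model_moments:
  fixes X :: "'a \<Rightarrow> real^'d" and w :: "real^'d \<Rightarrow> real"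
  assumes X [measurable]: "X \<in> borel_measurable M" and w [measurable]: "w \<in> borel_measurable borel"
    and pos: "\<And>t. prob {\<omega>\<in>space M. norm (X \<omega>) > t} > 0" and lm: "has_limit_model M X \<mu> w"
    and P: "prob_space (limit_model \<mu>)" and bnd: "AE \<omega> in M. norm (scaled w (X \<omega>)) \<le> c"
  shows limit_model_bounded: "AE x in limit_model \<mu>. norm (scaled w x) \<le> c"
    and limit_model_moment_tendsto: "\<And>f. continuous_on UNIV f \<Longrightarrow>
      ((\<lambda>t. expectation (\<lambda>\<omega>. of_bool (norm (X \<omega>) > t) * f (scaled w (X \<omega>))) / prob {\<omega>\<in>space M. norm (X \<omega>) > t})
        \<longlongrightarrow> (\<integral>x. f (scaled w x) \<partial>limit_model \<mu>)) at_top"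
proof -
  interpret P: prob_space "limit_model \<mu>" by fact
  have sw [measurable]: "scaled w \<in> borel_measurable borel" unfolding scaled_def by measurable
  note swl [measurable] = has_limit_model_measurable[OF lm]
  have ex: "(\<integral>\<omega>. h (scaled w (X \<omega>)) \<partial>exceed M X t) =
     expectation (\<lambda>\<omega>. of_bool (norm (X \<omega>) > t) * h (scaled w (X \<omega>))) / prob {\<omega>\<in>space M. norm (X \<omega>) > t}"
    if "continuous_on UNIV h" for h :: "real^'d \<Rightarrow> real" and t
  proof -
    have [measurable]: "h \<in> borel_measurable borel" using that by (rule borel_measurable_continuous_onI)
    show ?thesis by (subst exceed_integral[OF X _ pos]) (auto simp: divide_inverse mult.commute)
  qed
  show b: "AE x in limit_model \<mu>. norm (scaled w x) \<le> c"
  proof -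
    \<comment> \<open>Vanishes exactly where the norm is at most \<open>c\<close>, so a zero mean in
      the limit confines the limit law to that ball.\<close>
    define h :: "real^'d \<Rightarrow> real" where "h y = min 1 (max 0 (norm y - c))" for y
    have h: "continuous_on UNIV h" "\<And>y. \<bar>h y\<bar> \<le> 1" unfolding h_def by (auto intro!: continuous_intros)
    have [measurable]: "h \<in> borel_measurable borel" using h(1) by (rule borel_measurable_continuous_onI)
    have "expectation (\<lambda>\<omega>. of_bool (norm (X \<omega>) > t) * h (scaled w (X \<omega>))) = 0" for t
      using bnd by (intro integral_eq_zero_AE) (auto elim!: eventually_mono simp: h_def)
    then have "((\<lambda>t::real. 0) \<longlongrightarrow> (\<integral>x. h (scaled w x) \<partial>limit_model \<mu>)) at_top"
      using has_limit_model_tendsto[OF lm h] by (simp add: ex[OF h(1)])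
    then have "(\<integral>x. h (scaled w x) \<partial>limit_model \<mu>) = 0" by (simp add: tendsto_const_iff)
    moreover have "integrable (limit_model \<mu>) (\<lambda>x. h (scaled w x))"
      using h(2) by (intro P.integrable_const_bound[where B = 1]) auto
    ultimately have "AE x in limit_model \<mu>. h (scaled w x) = 0"
      by (subst integral_nonneg_eq_0_iff_AE[symmetric]) (auto simp: h_def)
    then show ?thesis by eventually_elim (auto simp: h_def min_def max_def split: if_splits)
  qed
  fix f :: "real^'d \<Rightarrow> real" assume f: "continuous_on UNIV f"
  have [measurable]: "f \<in> borel_measurable borel" using f by (rule borel_measurable_continuous_onI)
  have "compact (f ` cball 0 c)" using f by (intro compact_continuous_image continuous_on_subset[OF f]) auto
  then obtain B where "\<forall>x\<in>cball 0 c. \<bar>f x\<bar> \<le> B" by (auto dest!: compact_imp_bounded simp: bounded_iff)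
  then have B: "\<bar>f y\<bar> \<le> B" if "norm y \<le> c" for y using that by simp
  define h where "h y = max (- \<bar>B\<bar>) (min \<bar>B\<bar> (f y))" for y
  have h: "continuous_on UNIV h" "\<And>y. \<bar>h y\<bar> \<le> \<bar>B\<bar>" unfolding h_def by (auto intro!: continuous_intros f)
  have [measurable]: "h \<in> borel_measurable borel" using h(1) by (rule borel_measurable_continuous_onI)
  have hf: "h y = f y" if "norm y \<le> c" for y using B[OF that] by (auto simp: h_def max_def min_def abs_le_iff)
  have "expectation (\<lambda>\<omega>. of_bool (norm (X \<omega>) > t) * h (scaled w (X \<omega>))) =
     expectation (\<lambda>\<omega>. of_bool (norm (X \<omega>) > t) * f (scaled w (X \<omega>)))" for t
    using bnd by (intro integral_cong_AE) (auto elim!: eventually_mono simp: hf)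
  moreover have "(\<integral>x. h (scaled w x) \<partial>limit_model \<mu>) = (\<integral>x. f (scaled w x) \<partial>limit_model \<mu>)"
    using b by (intro integral_cong_AE) (auto elim!: eventually_mono simp: hf)
  ultimately show "((\<lambda>t. expectation (\<lambda>\<omega>. of_bool (norm (X \<omega>) > t) * f (scaled w (X \<omega>))) / prob {\<omega>\<in>space M. norm (X \<omega>) > t})
        \<longlongrightarrow> (\<integral>x. f (scaled w x) \<partial>limit_model \<mu>)) at_top"
    using has_limit_model_tendsto[OF lm h] by (simp add: ex[OF h(1)])
qed

end

text \<open>\<open>condition_B\<close> is stated in the operator norm, the abstract estimates in the
  Euclidean norm of the entries; the dimensional factor does not affect the rate.\<close>

lemma norm_le_onorm:
  fixes A :: "real^'n^'m"
  shows "norm A \<le> real (CARD('m) * CARD('n)) * onorm ((*v) A)"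
proof -
  have "norm A \<le> (\<Sum>i\<in>UNIV. norm (A $ i))" unfolding norm_vec_def by (rule L2_set_le_sum) simp
  also have "\<dots> \<le> (\<Sum>i\<in>UNIV. \<Sum>j\<in>UNIV. \<bar>A $ i $ j\<bar>)" by (intro sum_mono norm_le_l1_cart)
  also have "\<dots> \<le> (\<Sum>i\<in>(UNIV::'m set). \<Sum>j\<in>(UNIV::'n set). onorm ((*v) A))"
    by (intro sum_mono matrix_component_le_onorm)
  finally show ?thesis by simp
qed

text \<open>Translation of the hypotheses into the abstract model: \<open>z\<close> becomes the
  matrix \<open>outer (scaled w x)\<close>, bounded by \<open>c\<^sup>2\<close> because
  \<open>outer\<close> squares the norm.\<close>

lemma heavy_tailed_sample_of_limit_model:
  fixes M :: "'a measure" and X :: "'a \<Rightarrow> real^'d" and Xs :: "nat \<Rightarrow> 'a \<Rightarrow> real^'d"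
  assumes M: "prob_space M" and rv: "regularly_varying M X \<mu>"
    and indep: "prob_space.indep_vars M (\<lambda>_. borel) Xs UNIV"
    and distr: "\<And>i. distr M borel (Xs i) = distr M borel X"
    and w: "w \<in> borel_measurable borel" and bnd: "AE \<omega> in M. norm (scaled w (X \<omega>)) \<le> c"
    and lm: "has_limit_model M X \<mu> w" and nz: "Sigma_lim \<mu> w \<noteq> 0"
    and k: "filterlim k at_top sequentially" "(\<lambda>n. real (k n) / real n) \<longlonglongrightarrow> 0" and B: "condition_B M X w k"
  shows "heavy_tailed_sample M X Xs (\<lambda>x. outer (scaled w x)) (c\<^sup>2) k (Sigma_lim \<mu> w)"
    and "prob_space (limit_model \<mu>)"
proof -
  interpret prob_space M by fact
  have X [measurable]: "X \<in> borel_measurable M" using rv by (simp add: regularly_varying_def)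
  have sw [measurable]: "scaled w \<in> borel_measurable borel" unfolding scaled_def using w by measurable
  have om [measurable]: "outer \<in> borel_measurable borel"
    using continuous_on_outer by (rule borel_measurable_continuous_onI)
  \<comment> \<open>A level with zero tail probability would force \<open>Sigma_lim\<close> to be
    zero.\<close>
  have pos: "prob {\<omega>\<in>space M. norm (X \<omega>) > t} > 0" for t
    using Sigma_lim_bounded_case[OF M X _ lm, of t] nz by (auto simp: zero_less_measure_iff)
  show P: "prob_space (limit_model \<mu>)" by (rule limit_model_prob_space[OF M X pos lm])
  interpret P: prob_space "limit_model \<mu>" by fact
  interpret T: thresholded_sample M X Xs "\<lambda>x. outer (scaled w x)" "c\<^sup>2"
  proof
    show "AE \<omega> in M. norm (outer (scaled w (X \<omega>))) \<le> c\<^sup>2"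
      using bnd by eventually_elim (simp add: norm_outer power_mono)
  qed (use indep distr pos in auto)
  have Sig: "Sigma_at M X w t = T.cond_mean t" for t
    unfolding Sigma_at_def T.cond_mean_def T.tail_def by (rule exceed_integral[OF X _ pos]) measurable
  have sp: "space (limit_model \<mu>) = {x. norm x > 1}"
  proof -
    have sets_\<mu>: "sets \<mu> = sets (restrict_space borel (- {0}))" using rv by (simp add: regularly_varying_def)
    have "{x::real^'d. norm x > 1} \<in> sets \<mu>"
      unfolding sets_\<mu> by (subst sets_restrict_space_iff) auto
    then show ?thesis unfolding limit_model_def by simp
  qed
  have nm [measurable]: "norm \<in> borel_measurable (limit_model \<mu>)"
  proof -
    have "sets \<mu> = sets (restrict_space borel (- {0}))" using rv by (simp add: regularly_varying_def)
    then have "(norm :: real^'d \<Rightarrow> real) \<in> borel_measurable \<mu>"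
      using measurable_cong_sets[OF _ refl, of \<mu> "restrict_space borel (- {0})" borel]
        measurable_restrict_space1[OF borel_measurable_norm] by blast
    then show ?thesis unfolding limit_model_def by (rule measurable_restrict_space1)
  qed
  note ratio = tail_ratio_bounds[OF P nm, where F = T.tail]
  note lim = regularly_varying_tail_ratio[OF M rv P, folded T.tail_def]
  show "heavy_tailed_sample M X Xs (\<lambda>x. outer (scaled w x)) (c\<^sup>2) k (Sigma_lim \<mu> w)"
  proof
    have mono: "s \<le> t \<Longrightarrow> T.tail t \<le> T.tail s" for s t
      unfolding T.tail_def by (rule finite_measure_mono) auto
    show "\<exists>\<eta><1. \<forall>\<^sub>F t in at_top. T.tail (s * t) \<le> \<eta> * T.tail t" if "s > 1" for s
      by (rule ratio(1)[OF _ T.tail_pos mono lim that]) (auto simp: sp)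
    show "\<exists>s>1. \<forall>\<^sub>F t in at_top. T.tail (s * t) \<ge> \<eta> * T.tail t" if "\<eta> < 1" for \<eta>
      by (rule ratio(2)[OF _ T.tail_pos mono lim that]) (auto simp: sp)
    have AEl: "AE x in limit_model \<mu>. norm (scaled w x) \<le> c"
      by (rule limit_model_bounded[OF X w pos lm P bnd])
    note [measurable] = has_limit_model_measurable[OF lm]
    have intl: "integrable (limit_model \<mu>) (\<lambda>x. outer (scaled w x))"
      using AEl by (intro P.integrable_const_bound[where B = "c\<^sup>2"])
        (auto elim!: eventually_mono simp: norm_outer power_mono)
    show "(T.cond_mean \<longlongrightarrow> Sigma_lim \<mu> w) at_top"
      \<comment> \<open>Convergence of moments is available for real functions, hence for each entry
        of \<open>outer\<close>.\<close>
      unfolding tendsto_componentwise_iff[of T.cond_mean]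
    proof
      fix b :: "real^'d^'d" assume "b \<in> Basis"
      have "continuous_on UNIV (\<lambda>y. outer y \<bullet> b)" by (intro continuous_intros continuous_on_outer)
      from limit_model_moment_tendsto[OF X w pos lm P bnd this]
      have "((\<lambda>t. expectation (\<lambda>\<omega>. of_bool (norm (X \<omega>) > t) * (outer (scaled w (X \<omega>)) \<bullet> b)) / T.tail t)
        \<longlongrightarrow> (\<integral>x. outer (scaled w x) \<bullet> b \<partial>limit_model \<mu>)) at_top" by (simp add: T.tail_def)
      moreover have "(\<integral>x. outer (scaled w x) \<bullet> b \<partial>limit_model \<mu>) = Sigma_lim \<mu> w \<bullet> b"
        unfolding Sigma_lim_def using intl by simp
      moreover have "expectation (\<lambda>\<omega>. of_bool (norm (X \<omega>) > t) * (outer (scaled w (X \<omega>)) \<bullet> b)) / T.tail t = T.cond_mean t \<bullet> b" for t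
        using integral_inner_left[of b, OF T.integrable_of_bool_z[of t]]
        by (simp add: T.cond_mean_def divide_inverse mult.commute)
      ultimately show "((\<lambda>t. T.cond_mean t \<bullet> b) \<longlongrightarrow> Sigma_lim \<mu> w \<bullet> b) at_top" by simp
    qed
    obtain \<epsilon> where \<epsilon>: "\<epsilon> > 0" "uniform_limit {1-\<epsilon>..1+\<epsilon>}
       (\<lambda>n s. sqrt (real (k n)) *
          onorm ((*v) (T.cond_mean (s * thresh M X n (k n)) - T.cond_mean (thresh M X n (k n)))))
       (\<lambda>_. 0) sequentially"
      using B unfolding condition_B_def Sig by blast
    show "\<exists>\<epsilon>>0. uniform_limit {1-\<epsilon>..1+\<epsilon>}
       (\<lambda>n s. sqrt (real (k n)) * norm (T.cond_mean (s * thresh M X n (k n)) - T.cond_mean (thresh M X n (k n))))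
       (\<lambda>_. 0) sequentially"
    proof (intro exI conjI)
      show "\<epsilon> > 0" by fact
      define D where "D = real (CARD('d) * CARD('d))"
      have D: "D > 0" by (simp add: D_def)
      show "uniform_limit {1-\<epsilon>..1+\<epsilon>}
       (\<lambda>n s. sqrt (real (k n)) * norm (T.cond_mean (s * thresh M X n (k n)) - T.cond_mean (thresh M X n (k n))))
       (\<lambda>_. 0) sequentially"
      proof (rule uniform_limitI)
        fix e :: real assume e: "e > 0"
        show "\<forall>\<^sub>F n in sequentially. \<forall>s\<in>{1-\<epsilon>..1+\<epsilon>}. dist (sqrt (real (k n)) *
          norm (T.cond_mean (s * thresh M X n (k n)) - T.cond_mean (thresh M X n (k n)))) 0 < e"
          using uniform_limitD[OF \<epsilon>(2) divide_pos_pos[OF e D]]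
        proof eventually_elim
          case (elim n)
          show ?case
          proof
            fix s assume s: "s \<in> {1-\<epsilon>..1+\<epsilon>}"
            let ?A = "T.cond_mean (s * thresh M X n (k n)) - T.cond_mean (thresh M X n (k n))"
            have "sqrt (real (k n)) * norm ?A \<le> sqrt (real (k n)) * (D * onorm ((*v) ?A))"
              unfolding D_def by (intro mult_left_mono norm_le_onorm) simp
            also have "\<dots> = D * (sqrt (real (k n)) * onorm ((*v) ?A))" by simp
            also have "\<dots> < D * (e / D)"
            proof (rule mult_strict_left_mono[OF _ D])
              have "\<bar>sqrt (real (k n)) * onorm ((*v) ?A)\<bar> < e / D" using elim s by (simp add: dist_real_def)
              then show "sqrt (real (k n)) * onorm ((*v) ?A) < e / D" by linarith
            qed
            finally show "dist (sqrt (real (k n)) * norm ?A) 0 < e" using D by (simp add: dist_real_def)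
          qed
        qed
      qed
    qed
  qed (use k in auto)
qed

section \<open>The Gaussian limit\<close>

context prob_space
begin

lemma integrable_centered_product:
  fixes f g :: "'a \<Rightarrow> real"
  assumes [measurable]: "f \<in> borel_measurable M" "g \<in> borel_measurable M"
    and "integrable M (\<lambda>\<omega>. (f \<omega>)\<^sup>2)" "integrable M (\<lambda>\<omega>. (g \<omega>)\<^sup>2)"
  shows "integrable M (\<lambda>\<omega>. (f \<omega> - a) * (g \<omega> - b))"
proof -
  have 1: "integrable M f" "integrable M g"
    by (rule square_integrable_imp_integrable[OF _ assms(3)], simp)
      (rule square_integrable_imp_integrable[OF _ assms(4)], simp)
  have "integrable M (\<lambda>\<omega>. f \<omega> * g \<omega>)"
  proof (rule Bochner_Integration.integrable_bound)
    show "integrable M (\<lambda>\<omega>. (f \<omega>)\<^sup>2 + (g \<omega>)\<^sup>2)" using assms by simp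
    show "AE \<omega> in M. norm (f \<omega> * g \<omega>) \<le> norm ((f \<omega>)\<^sup>2 + (g \<omega>)\<^sup>2)"
    proof (rule AE_I2)
      fix \<omega>
      have "2 * (\<bar>f \<omega>\<bar> * \<bar>g \<omega>\<bar>) \<le> \<bar>f \<omega>\<bar>\<^sup>2 + \<bar>g \<omega>\<bar>\<^sup>2"
        using sum_squares_bound[of "\<bar>f \<omega>\<bar>" "\<bar>g \<omega>\<bar>"] by (simp add: mult.assoc)
      moreover have "0 \<le> \<bar>f \<omega>\<bar> * \<bar>g \<omega>\<bar>" by simp
      ultimately have "\<bar>f \<omega>\<bar> * \<bar>g \<omega>\<bar> \<le> (f \<omega>)\<^sup>2 + (g \<omega>)\<^sup>2" by (simp only: power2_abs)
      then show "norm (f \<omega> * g \<omega>) \<le> norm ((f \<omega>)\<^sup>2 + (g \<omega>)\<^sup>2)" by (simp add: abs_mult)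
    qed
  qed measurable
  moreover have "(f \<omega> - a) * (g \<omega> - b) = f \<omega> * g \<omega> - a * g \<omega> - b * f \<omega> + a * b" for \<omega>
    by (simp add: algebra_simps)
  ultimately show ?thesis using 1 by simp
qed

end

text \<open>Both variances are the same quadratic form in the entrywise covariances.\<close>

lemma gaussian_matrix_variance:
  fixes U :: "'b \<Rightarrow> real^'d^'d" and Q :: "'c measure" and Z :: "'c \<Rightarrow> real^'d^'d"
  assumes N: "prob_space N" and Q: "prob_space Q" and U: "gaussian_matrix N U"
    and mean: "\<And>i j. (\<integral>\<omega>. U \<omega> $ i $ j \<partial>N) = 0"
    and Z [measurable]: "Z \<in> borel_measurable Q" and bnd: "AE x in Q. norm (Z x) \<le> c"
    and covar: "\<And>i j l m. covar N (\<lambda>\<omega>. U \<omega> $ i $ j) (\<lambda>\<omega>. U \<omega> $ l $ m) =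
      covar Q (\<lambda>x. Z x $ i $ j) (\<lambda>x. Z x $ l $ m)"
  shows "(\<integral>\<omega>. u \<bullet> U \<omega> \<partial>N) = 0"
    and "(\<integral>\<omega>. (u \<bullet> U \<omega>)\<^sup>2 \<partial>N) = (\<integral>x. (u \<bullet> Z x)\<^sup>2 \<partial>Q) - (u \<bullet> (\<integral>x. Z x \<partial>Q))\<^sup>2"
proof -
  interpret N: prob_space N by fact
  interpret Q: prob_space Q by fact
  have Um [measurable]: "U \<in> borel_measurable N" and Ug: "gaussian_var N (\<lambda>\<omega>. A \<bullet> U \<omega>)" for A
    using U by (auto simp: gaussian_matrix_def)
  have comp [measurable]: "(\<lambda>A :: real^'d^'d. A $ i $ j) \<in> borel_measurable borel" for i j
    by (intro borel_measurable_continuous_onI continuous_intros)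
  have sqU: "integrable N (\<lambda>\<omega>. (U \<omega> $ i $ j)\<^sup>2)" for i j
  proof -
    have "axis i (axis j 1) \<bullet> A = A $ i $ j" for A :: "real^'d^'d"
      by (simp add: inner_axis inner_axis')
    then show ?thesis using N.gaussian_var_square_integrable[OF Ug, of "axis i (axis j 1)"] by simp
  qed
  have Zle: "AE x in Q. \<bar>Z x $ i $ j\<bar> \<le> c" for i j
    using bnd
  proof eventually_elim
    case (elim x)
    have "\<bar>Z x $ i $ j\<bar> \<le> norm (Z x $ i)" by (rule component_le_norm_cart)
    also have "\<dots> \<le> norm (Z x)" by (rule Finite_Cartesian_Product.norm_nth_le)
    finally show ?case using elim by simp
  qed
  have sqZ: "integrable Q (\<lambda>x. (Z x $ i $ j)\<^sup>2)" for i j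
  proof (rule Q.integrable_const_bound[where B = "c\<^sup>2"])
    show "AE x in Q. norm ((Z x $ i $ j)\<^sup>2) \<le> c\<^sup>2"
      using Zle[of i j]
    proof eventually_elim
      case (elim x)
      then have "\<bar>Z x $ i $ j\<bar>\<^sup>2 \<le> c\<^sup>2" by (intro power_mono) auto
      then show ?case by simp
    qed
  qed measurable
  have intU: "integrable N (\<lambda>\<omega>. U \<omega> $ i $ j)" for i j
    by (rule N.square_integrable_imp_integrable[OF _ sqU]) measurable
  have intZ: "integrable Q Z" using bnd by (intro Q.integrable_const_bound) auto
  have uU: "u \<bullet> U \<omega> = (\<Sum>a\<in>UNIV. u $ fst a $ snd a * U \<omega> $ fst a $ snd a)" for \<omega> by (rule inner_matrix_pair_sum)
  show "(\<integral>\<omega>. u \<bullet> U \<omega> \<partial>N) = 0"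
    unfolding uU using intU by (subst Bochner_Integration.integral_sum) (auto simp: mean)
  have comp_int: "(\<integral>x. Z x $ i $ j \<partial>Q) = (\<integral>x. Z x \<partial>Q) $ i $ j" for i j
  proof -
    have ax: "A $ i $ j = axis i (axis j 1) \<bullet> A" for A :: "real^'d^'d"
      by (simp add: inner_axis inner_axis')
    show ?thesis unfolding ax using intZ by simp
  qed
  have "(\<integral>\<omega>. (u \<bullet> U \<omega>)\<^sup>2 \<partial>N) = (\<integral>\<omega>. (\<Sum>a\<in>UNIV. u $ fst a $ snd a * (U \<omega> $ fst a $ snd a - (\<integral>\<eta>. U \<eta> $ fst a $ snd a \<partial>N)))\<^sup>2 \<partial>N)"
    by (simp add: uU mean)
  also have "\<dots> = (\<Sum>a\<in>UNIV. \<Sum>b\<in>UNIV. u $ fst a $ snd a * u $ fst b $ snd b *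
      covar N (\<lambda>\<omega>. U \<omega> $ fst a $ snd a) (\<lambda>\<omega>. U \<omega> $ fst b $ snd b))"
    by (rule covar_quadratic_form[symmetric]) (auto intro!: N.integrable_centered_product sqU)
  also have "\<dots> = (\<Sum>a\<in>UNIV. \<Sum>b\<in>UNIV. u $ fst a $ snd a * u $ fst b $ snd b *
      covar Q (\<lambda>x. Z x $ fst a $ snd a) (\<lambda>x. Z x $ fst b $ snd b))"
    by (simp only: covar)
  also have "\<dots> = (\<integral>x. (\<Sum>a\<in>UNIV. u $ fst a $ snd a * (Z x $ fst a $ snd a - (\<integral>\<eta>. Z \<eta> $ fst a $ snd a \<partial>Q)))\<^sup>2 \<partial>Q)"
    by (rule covar_quadratic_form) (auto intro!: Q.integrable_centered_product sqZ)
  also have "\<dots> = (\<integral>x. (u \<bullet> Z x - u \<bullet> (\<integral>x. Z x \<partial>Q))\<^sup>2 \<partial>Q)"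
    by (simp add: comp_int inner_matrix_pair_sum right_diff_distrib sum_subtractf)
  also have "\<dots> = (\<integral>x. (u \<bullet> Z x)\<^sup>2 \<partial>Q) - (u \<bullet> (\<integral>x. Z x \<partial>Q))\<^sup>2"
  proof -
    have e: "(\<integral>x. u \<bullet> Z x \<partial>Q) = u \<bullet> (\<integral>x. Z x \<partial>Q)" using intZ by simp
    have "integrable Q (\<lambda>x. (u \<bullet> Z x)\<^sup>2)"
    proof (rule Q.integrable_const_bound[where B = "(norm u * c)\<^sup>2"])
      show "AE x in Q. norm ((u \<bullet> Z x)\<^sup>2) \<le> (norm u * c)\<^sup>2"
        using bnd
      proof eventually_elim
        case (elim x)
        have "\<bar>u \<bullet> Z x\<bar> \<le> norm u * norm (Z x)" by (rule Cauchy_Schwarz_ineq2)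
        also have "\<dots> \<le> norm u * c" using elim by (intro mult_left_mono) auto
        finally have "\<bar>u \<bullet> Z x\<bar>\<^sup>2 \<le> (norm u * c)\<^sup>2" by (intro power_mono) auto
        then show ?case by simp
      qed
    qed measurable
    then show ?thesis using Q.variance_eq[of "\<lambda>x. u \<bullet> Z x"] intZ by (simp add: e)
  qed
  finally show "(\<integral>\<omega>. (u \<bullet> U \<omega>)\<^sup>2 \<partial>N) = (\<integral>x. (u \<bullet> Z x)\<^sup>2 \<partial>Q) - (u \<bullet> (\<integral>x. Z x \<partial>Q))\<^sup>2" .
qed

text \<open>At finite \<open>n\<close> the processes are continuous images of the pair of moment
  matrix and projection; this is the source of their measurability.\<close>

lemma continuous_map_rotated_inner:
  fixes K :: "(real^'d^'d) set"
  assumes K: "compact K" and c: "0 \<le> c" "c \<le> 1"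
  shows "continuous_map euclidean (mtopology_of (CK K))
    (\<lambda>p. restrict (\<lambda>B. r * (fst p \<bullet> rotated c B (snd p) - fst p \<bullet> snd p)) K)"
proof -
  obtain C where C: "C \<ge> 0" "\<And>B c P. B \<in> K \<Longrightarrow> 0 \<le> c \<Longrightarrow> c \<le> 1 \<Longrightarrow> norm (rotated c B P) \<le> C * norm P"
    using rotated_expansion[OF compact_imp_bounded[OF K]] by metis
  define D where "D p q = \<bar>r\<bar> * ((C + 1) * (norm (fst p - fst q) * norm (snd p) + norm (fst q) * norm (snd p - snd q)))"
    for p q :: "(real^'d^'d) \<times> (real^'d^'d)"
  show ?thesis
  proof (rule continuous_map_CK[OF K, where D = D])
    show "continuous_on K (\<lambda>B. r * (fst p \<bullet> rotated c B (snd p) - fst p \<bullet> snd p))" for p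
      by (intro continuous_intros continuous_on_rotated compact_imp_bounded K)
    fix B and p q :: "(real^'d^'d) \<times> (real^'d^'d)" assume B: "B \<in> K"
    have eq: "fst p \<bullet> rotated c B (snd p) - fst p \<bullet> snd p - (fst q \<bullet> rotated c B (snd q) - fst q \<bullet> snd q)
      = (fst p - fst q) \<bullet> (rotated c B (snd p) - snd p) + fst q \<bullet> (rotated c B (snd p - snd q) - (snd p - snd q))"
      unfolding rotated_diff[symmetric] by (simp add: inner_diff_left inner_diff_right)
    have n: "norm (rotated c B P - P) \<le> (C + 1) * norm P" for P
      using norm_triangle_ineq4[of "rotated c B P" P] C(2)[OF B c, of P] by (simp add: distrib_right)
    have le: "\<bar>A \<bullet> (rotated c B P - P)\<bar> \<le> (C + 1) * (norm A * norm P)" for A P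
    proof -
      have "\<bar>A \<bullet> (rotated c B P - P)\<bar> \<le> norm A * norm (rotated c B P - P)" by (rule Cauchy_Schwarz_ineq2)
      also have "\<dots> \<le> norm A * ((C + 1) * norm P)" by (intro mult_left_mono n) simp
      finally show ?thesis by (simp add: mult_ac)
    qed
    have "\<bar>fst p \<bullet> rotated c B (snd p) - fst p \<bullet> snd p - (fst q \<bullet> rotated c B (snd q) - fst q \<bullet> snd q)\<bar>
      \<le> (C + 1) * (norm (fst p - fst q) * norm (snd p) + norm (fst q) * norm (snd p - snd q))"
      unfolding eq distrib_left by (intro order_trans[OF abs_triangle_ineq] add_mono le)
    then show "\<bar>r * (fst p \<bullet> rotated c B (snd p) - fst p \<bullet> snd p) - r * (fst q \<bullet> rotated c B (snd q) - fst q \<bullet> snd q)\<bar> \<le> D p q"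
      unfolding right_diff_distrib[symmetric] abs_mult D_def by (rule mult_left_mono) simp
  next
    fix p :: "(real^'d^'d) \<times> (real^'d^'d)"
    have "((\<lambda>q. D p q) \<longlongrightarrow> \<bar>r\<bar> * ((C + 1) * (norm (fst p - fst p) * norm (snd p) + norm (fst p) * norm (snd p - snd p)))) (at p)"
      unfolding D_def by (intro tendsto_intros)
    then show "(D p \<longlongrightarrow> 0) (at p)" by simp
  qed
qed

text \<open>The limit process depends on \<open>G\<close> in an affine way, with a Lipschitz
  constant uniform over \<open>K\<close>.\<close>

lemma continuous_map_limit_process:
  fixes K :: "(real^'d^'d) set"
  assumes K: "compact K"
  shows "continuous_map euclidean (mtopology_of (CK K))
    (\<lambda>G. restrict (\<lambda>B. - 2 * hs_inner G (P ** B) + hs_inner S (B ** B ** Q)) K)"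
proof -
  obtain b where b: "b > 0" "\<And>B. B \<in> K \<Longrightarrow> norm B \<le> b" using compact_imp_bounded[OF K] bounded_pos by metis
  obtain k where k: "k \<ge> 1" "\<And>(A :: real^'d^'d) (B :: real^'d^'d). norm (A ** B) \<le> k * norm A * norm B"
    using matrix_mult_bound by metis
  define C where "C = 2 * (k * norm P * b)"
  show ?thesis
  proof (rule continuous_map_CK[OF K, where D = "\<lambda>G H. C * norm (G - H)"])
    show "continuous_on K (\<lambda>B. - 2 * hs_inner G (P ** B) + hs_inner S (B ** B ** Q))" for G
      unfolding hs_inner_eq_inner by (intro continuous_intros matmul.continuous_on)
    fix B and G H :: "real^'d^'d" assume B: "B \<in> K"
    have PB: "norm (P ** B) \<le> k * norm P * b"
      using k(1) by (intro order_trans[OF k(2)] mult_left_mono b(2)[OF B]) auto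
    have "\<bar>(G - H) \<bullet> (P ** B)\<bar> \<le> norm (G - H) * norm (P ** B)" by (rule Cauchy_Schwarz_ineq2)
    also have "\<dots> \<le> norm (G - H) * (k * norm P * b)" by (intro mult_left_mono PB) simp
    finally have "2 * \<bar>(G - H) \<bullet> (P ** B)\<bar> \<le> C * norm (G - H)" by (simp add: C_def mult_ac)
    moreover have "\<bar>- 2 * a + t - (- 2 * b + t)\<bar> = 2 * \<bar>a - b\<bar>" for a b t :: real
      by (simp add: abs_if)
    ultimately show "\<bar>- 2 * hs_inner G (P ** B) + hs_inner S (B ** B ** Q) - (- 2 * hs_inner H (P ** B) + hs_inner S (B ** B ** Q))\<bar> \<le> C * norm (G - H)"
      unfolding hs_inner_eq_inner inner_diff_left by (simp only:)
  next
    fix G :: "real^'d^'d"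
    have "((\<lambda>H. C * norm (G - H)) \<longlongrightarrow> C * norm (G - G)) (at G)" by (intro tendsto_intros)
    then show "((\<lambda>H. C * norm (G - H)) \<longlongrightarrow> 0) (at G)" by simp
  qed
qed

text \<open>Serves to pass from auxiliary processes to the stated ones, with which they agree as
  soon as \<open>1 \<le> k n\<close> and \<open>k n < n\<close>.\<close>

lemma converges_in_prob_cong:
  assumes ev: "\<forall>\<^sub>F n in sequentially. Z n = Y n" and Z: "converges_in_prob m M Z y"
  shows "converges_in_prob m M Y y"
  unfolding converges_in_prob_def
proof (intro conjI allI impI)
  show "\<forall>\<^sub>F n in sequentially. random_element M m (Y n)"
    using conjunct1[OF Z[unfolded converges_in_prob_def]] ev by eventually_elim simp
  show "y \<in> mspace m" using Z by (simp add: converges_in_prob_def)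
  fix \<delta> :: real assume "\<delta> > 0"
  then have "(\<lambda>n. measure M {\<omega>\<in>space M. mdist m (Z n \<omega>) y > \<delta>}) \<longlonglongrightarrow> 0"
    using Z by (simp add: converges_in_prob_def)
  moreover have "\<forall>\<^sub>F n in sequentially. measure M {\<omega>\<in>space M. mdist m (Z n \<omega>) y > \<delta>} =
     measure M {\<omega>\<in>space M. mdist m (Y n \<omega>) y > \<delta>}"
    using ev by eventually_elim simp
  ultimately show "(\<lambda>n. measure M {\<omega>\<in>space M. mdist m (Y n \<omega>) y > \<delta>}) \<longlonglongrightarrow> 0"
    by (rule Lim_transform_eventually)
qed

lemma converges_weakly_cong:
  assumes ev: "\<forall>\<^sub>F n in F. Z n = Y n" and Z: "converges_weakly m P Z F Q y"
  shows "converges_weakly m P Y F Q y"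
  unfolding converges_weakly_def
proof (intro conjI allI impI)
  show "\<forall>\<^sub>F n in F. random_element (P n) m (Y n)"
    using conjunct1[OF Z[unfolded converges_weakly_def]] ev by eventually_elim simp
  show "random_element Q m y" using Z by (simp add: converges_weakly_def)
  fix H assume H: "continuous_map (mtopology_of m) euclideanreal H \<and> bounded (H ` mspace m)"
  then have "((\<lambda>n. \<integral>\<omega>. H (Z n \<omega>) \<partial>P n) \<longlongrightarrow> (\<integral>\<omega>. H (y \<omega>) \<partial>Q)) F"
    using Z by (simp add: converges_weakly_def)
  moreover have "\<forall>\<^sub>F n in F. (\<integral>\<omega>. H (Z n \<omega>) \<partial>P n) = (\<integral>\<omega>. H (Y n \<omega>) \<partial>P n)"
    using ev by eventually_elim simp
  ultimately show "((\<lambda>n. \<integral>\<omega>. H (Y n \<omega>) \<partial>P n) \<longlongrightarrow> (\<integral>\<omega>. H (y \<omega>) \<partial>Q)) F"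
    by (rule Lim_transform_eventually)
qed

theorem theorem5p3:
  fixes M :: "'a measure" and X :: "'a \<Rightarrow> real^'d" and Xs :: "nat \<Rightarrow> 'a \<Rightarrow> real^'d"
    and \<mu> :: "(real^'d) measure" and w :: "real^'d \<Rightarrow> real"
    and k :: "nat \<Rightarrow> nat" and p :: nat
    and lam :: "nat \<Rightarrow> real" and v :: "nat \<Rightarrow> real^'d" and Vstar :: "(real^'d) set"
    and Vhat :: "nat \<Rightarrow> 'a \<Rightarrow> (real^'d) set"
    and N :: "'b measure" and U :: "'b \<Rightarrow> real^'d^'d"
  assumes "prob_space M"
    and "regularly_varying M X \<mu>"
    and "prob_space.indep_vars M (\<lambda>_. borel) Xs UNIV"
    and "\<And>i. distr M borel (Xs i) = distr M borel X"
    and "w \<in> borel_measurable borel" and "\<And>x. w x > 0"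
    and "\<exists>C. AE \<omega> in M. norm (scaled w (X \<omega>)) \<le> C"
    and "has_limit_model M X \<mu> w"
    and "filterlim k at_top sequentially"
    and "(\<lambda>n. real (k n) / real n) \<longlonglongrightarrow> 0"
    and "1 \<le> p" and "p \<le> CARD('d) - 1"
    and "\<And>i. i \<in> {1..CARD('d)} \<Longrightarrow> Sigma_lim \<mu> w *v v i = lam i *\<^sub>R v i"
    and "\<And>i j. i \<in> {1..CARD('d)} \<Longrightarrow> j \<in> {1..CARD('d)} \<Longrightarrow> v i \<bullet> v j = (if i = j then 1 else 0)"
    and "\<And>i j. 1 \<le> i \<Longrightarrow> i \<le> j \<Longrightarrow> j \<le> CARD('d) \<Longrightarrow> lam j \<le> lam i"
    and "lam p > lam (p + 1)"
    and "Vstar = span (v ` {1..p})"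
    and "condition_B M X w k"
    and "\<And>n \<omega>. 1 \<le> k n \<Longrightarrow> k n < n \<Longrightarrow> \<omega> \<in> space M \<Longrightarrow>
           emp_maximizer w p n (k n) (\<lambda>i. Xs i \<omega>) (Vhat n \<omega>)"
    and "\<And>n. 1 \<le> k n \<Longrightarrow> k n < n \<Longrightarrow> (\<lambda>\<omega>. proj_mat (Vhat n \<omega>)) \<in> borel_measurable M"
    and "prob_space N"
    and "gaussian_matrix N U"
    and "AE \<omega> in N. transpose (U \<omega>) = U \<omega>"
    and "\<And>i j. (\<integral>\<omega>. U \<omega> $ i $ j \<partial>N) = 0"
    and "\<And>i j l m. covar N (\<lambda>\<omega>. U \<omega> $ i $ j) (\<lambda>\<omega>. U \<omega> $ l $ m) =
           covar (limit_model \<mu>) (\<lambda>x. scaled w x $ i * scaled w x $ j)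
                                 (\<lambda>x. scaled w x $ l * scaled w x $ m)"
  shows "\<forall>K. compact K \<and> K \<subseteq> tangent_mats Vstar \<longrightarrow>
     converges_in_prob (CK K) M
       (\<lambda>n \<omega>. \<lambda>B\<in>K. real (k n) *
          (emp_risk w n (k n) (\<lambda>i. Xs i \<omega>)
             (rotated (1 / sqrt (real (k n))) B (proj_mat (Vhat n \<omega>)))
           - emp_risk w n (k n) (\<lambda>i. Xs i \<omega>) (proj_mat (Vhat n \<omega>))))
       (\<lambda>B\<in>K. hs_inner (Sigma_lim \<mu> w) (B ** B ** (proj_mat Vstar - proj_mat (Vstar\<^sup>\<bottom>))))
   \<and> converges_weakly (CK K) (\<lambda>_. M)
       (\<lambda>n \<omega>. \<lambda>B\<in>K. real (k n) *
          (risk M X w n (k n) (rotated (1 / sqrt (real (k n))) B (proj_mat (Vhat n \<omega>)))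
           - risk M X w n (k n) (proj_mat (Vhat n \<omega>))))
       sequentially N
       (\<lambda>\<omega>. \<lambda>B\<in>K. - 2 * hs_inner (U \<omega>) (proj_mat Vstar ** B)
          + hs_inner (Sigma_lim \<mu> w) (B ** B ** (proj_mat Vstar - proj_mat (Vstar\<^sup>\<bottom>))))"
proof (intro allI impI, elim conjE)

  \<comment> \<open>Reduction to the threshold model\<close>
  fix K :: "(real^'d^'d) set" assume K: "compact K" and K_sub: "K \<subseteq> tangent_mats Vstar"
  interpret prob_space M by (rule assms(1))
  obtain c where bnd: "AE \<omega> in M. norm (scaled w (X \<omega>)) \<le> c" using assms(7) by auto
  let ?S = "Sigma_lim \<mu> w"
  have p: "1 \<le> p" "p < CARD('d)" using assms(11,12) by auto
  \<comment> \<open>A vanishing matrix would have all eigenvalues 0 and no gap. This is what rules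
    out an essentially bounded \<open>X\<close>.\<close>
  have nz: "?S \<noteq> 0"
  proof
    assume S0: "?S = 0"
    have "lam i = 0" if "i \<in> {1..CARD('d)}" for i
    proof -
      have "lam i *\<^sub>R v i = 0" using assms(13)[OF that] by (simp add: S0)
      moreover have "v i \<noteq> 0" using assms(14)[OF that that] by auto
      ultimately show ?thesis by simp
    qed
    then show False using assms(16) p by simp
  qed
  note heavy = heavy_tailed_sample_of_limit_model[OF assms(1-5) bnd assms(8) nz assms(9,10,18)]
  interpret P: prob_space "limit_model \<mu>" by (rule heavy(2))
  interpret T: heavy_tailed_sample M X Xs "\<lambda>x. outer (scaled w x)" "c\<^sup>2" k ?S by (rule heavy(1))
  note Xm [measurable] = T.X_measurable
  note Xsm [measurable] = T.Xs_measurable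
  have pos: "prob {\<omega>\<in>space M. norm (X \<omega>) > t} > 0" for t using T.tail_pos by (simp add: T.tail_def)
  have sw [measurable]: "scaled w \<in> borel_measurable borel" unfolding scaled_def using assms(5) by measurable
  have om [measurable]: "outer \<in> borel_measurable (borel :: (real^'d) measure)"
    using continuous_on_outer by (rule borel_measurable_continuous_onI)

  \<comment> \<open>Error terms and constants\<close>
  define g where "g = lam p - lam (p + 1)"
  have g: "g > 0" using assms(16) by (simp add: g_def)
  have Vst: "Vstar \<in> subspaces_of_dim p"
    unfolding assms(17) by (rule eigenspace_dim[OF p assms(13-15)])
  then have subV: "subspace Vstar" by (simp add: subspaces_of_dim_def)
  let ?P = "proj_mat Vstar"
  define Q where "Q = proj_mat Vstar - proj_mat (Vstar\<^sup>\<bottom>)"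
  \<comment> \<open>\<open>Vhat\<close> is constrained only for \<open>1 \<le> k n\<close> and
    \<open>k n < n\<close>; the default 0 gives measurability for all \<open>n\<close>.\<close>
  define Ph where "Ph n \<omega> = (if 1 \<le> k n \<and> k n < n then proj_mat (Vhat n \<omega>) else 0)" for n \<omega>
  have Phm [measurable]: "Ph n \<in> borel_measurable M" for n
    unfolding Ph_def[abs_def] using assms(20)[of n] by (cases "1 \<le> k n \<and> k n < n") auto
  define cc where "cc n = 1 / sqrt (real (k n))" for n
  have cc_lim: "cc \<longlonglongrightarrow> 0" unfolding cc_def by (rule T.inverse_sqrt_k_tendsto)
  define x where "x n \<omega> = norm (T.emp_mean n \<omega> - ?S)" for n \<omega>
  have x_small: "small_in_prob M x" using T.emp_mean_small by (simp add: x_def[abs_def])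
  define q where "q n \<omega> = T.count n (T.th n \<omega>) \<omega> / real (k n)" for n \<omega>
  have q_small: "small_in_prob M (\<lambda>n \<omega>. q n \<omega> - 1)" using T.count_th_small by (simp add: q_def)
  \<comment> \<open>Here \<open>G\<close> is the sum over the deterministic threshold; its distance
    from \<open>emp_dev\<close> is the error \<open>e1\<close>.\<close>
  define G where "G = T.clt_sum"
  define e1 where "e1 n \<omega> = norm (T.emp_dev n \<omega> - G n \<omega>)" for n \<omega>
  define s where "s n = norm (T.cond_mean (T.tn n) - ?S)" for n
  have e1_small: "small_in_prob M e1" using T.emp_dev_clt_sum_small by (simp add: e1_def[abs_def] G_def)
  have s_lim: "s \<longlonglongrightarrow> 0"
    unfolding s_def using tendsto_norm[OF tendsto_diff[OF T.cond_mean_tn_tendsto tendsto_const, of ?S]] by simp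

  obtain Cx where Cx: "Cx \<ge> 0" "\<And>B c P. B \<in> K \<Longrightarrow> 0 \<le> c \<Longrightarrow> c \<le> 1 \<Longrightarrow>
      norm (rotated c B P - (P + c *\<^sub>R commutator P B + c\<^sup>2 *\<^sub>R half_commutator2 P B)) \<le> Cx * c ^ 3 * norm P"
    using rotated_expansion[OF compact_imp_bounded[OF K]] by metis
  obtain Ch where Ch: "Ch \<ge> 0" "\<And>B P. B \<in> K \<Longrightarrow> norm (commutator P B) \<le> Ch * norm P"
    "\<And>B P. B \<in> K \<Longrightarrow> norm (half_commutator2 P B) \<le> Ch * norm P"
    using commutator_bounds[OF compact_imp_bounded[OF K]] by metis
  have inner_comm: "\<bar>A \<bullet> commutator P B\<bar> \<le> norm A * (Ch * norm P)" if "B \<in> K" for A P B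
    by (rule order_trans[OF Cauchy_Schwarz_ineq2]) (intro mult_left_mono Ch(2)[OF that] norm_ge_zero)
  have inner_half: "\<bar>A \<bullet> half_commutator2 P B\<bar> \<le> norm A * (Ch * norm P)" if "B \<in> K" for A P B
    by (rule order_trans[OF Cauchy_Schwarz_ineq2]) (intro mult_left_mono Ch(3)[OF that] norm_ge_zero)

  \<comment> \<open>Risks as linear functionals and the empirical maximizer\<close>
  have emp: "emp_risk w n (k n) (\<lambda>i. Xs i \<omega>) A = T.emp_mean n \<omega> \<bullet> A"
    if "1 \<le> k n" "k n < n" for n \<omega> A
    using that unfolding emp_risk_def T.emp_mean_def T.th_def
    by (simp add: inner_outer[symmetric] inner_sum_left mult.commute)
  have rsk: "risk M X w n (k n) A = T.cond_mean (T.tn n) \<bullet> A" for n A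
  proof -
    have am [measurable]: "(\<lambda>y. y \<bullet> (A *v y)) \<in> borel_measurable borel"
      unfolding inner_outer[symmetric] by measurable
    have "risk M X w n (k n) A = expectation (\<lambda>\<omega>. of_bool (norm (X \<omega>) > T.tn n) *\<^sub>R (scaled w (X \<omega>) \<bullet> (A *v scaled w (X \<omega>)))) /\<^sub>R T.tail (T.tn n)"
      unfolding risk_def T.tn_def[symmetric] T.tail_def by (rule exceed_integral[OF Xm _ pos]) measurable
    also have "expectation (\<lambda>\<omega>. of_bool (norm (X \<omega>) > T.tn n) *\<^sub>R (scaled w (X \<omega>) \<bullet> (A *v scaled w (X \<omega>))))
      = expectation (\<lambda>\<omega>. of_bool (norm (X \<omega>) > T.tn n) *\<^sub>R outer (scaled w (X \<omega>))) \<bullet> A"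
      using integral_inner_left[of A, OF T.integrable_of_bool_z[of "T.tn n"]] by (simp add: inner_outer)
    finally show ?thesis by (simp add: T.cond_mean_def)
  qed

  have sym_mean: "transpose (T.cond_mean t) = T.cond_mean t" for t
    unfolding T.cond_mean_def using T.integrable_of_bool_z[of t]
    by (simp add: transpose_scaleR transpose_integral)
  have sym_G: "transpose (G n \<omega>) = G n \<omega>" for n \<omega>
    by (simp add: G_def T.clt_sum_def T.centered_def transpose_scaleR transpose_sum transpose_diff sym_mean)
  have sym_emp: "transpose (T.emp_mean n \<omega>) = T.emp_mean n \<omega>" for n \<omega>
    by (simp add: T.emp_mean_def transpose_scaleR transpose_sum)

  have Vh: "Vhat n \<omega> \<in> subspaces_of_dim p"
      "\<And>W. W \<in> subspaces_of_dim p \<Longrightarrow> T.emp_mean n \<omega> \<bullet> proj_mat W \<le> T.emp_mean n \<omega> \<bullet> Ph n \<omega>"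
    if kn: "1 \<le> k n" "k n < n" and w: "\<omega> \<in> space M" for n \<omega>
    using assms(19)[OF kn w] kn by (auto simp: emp_maximizer_def emp Ph_def)
  have Ph_norm: "norm (Ph n \<omega>) = sqrt (real p)"
    if kn: "1 \<le> k n" "k n < n" and w: "\<omega> \<in> space M" for n \<omega>
    using Vh(1)[OF that] norm_proj_mat_sq[of "Vhat n \<omega>"] kn
    by (simp add: Ph_def norm_eq_sqrt_inner subspaces_of_dim_def)
  have Ph_comm: "T.emp_mean n \<omega> \<bullet> commutator (Ph n \<omega>) B = 0"
    if kn: "1 \<le> k n" "k n < n" and w: "\<omega> \<in> space M" for n \<omega> B
  proof (rule inner_commutator_eq_0[OF sym_emp])
    have eq: "Ph n \<omega> = proj_mat (Vhat n \<omega>)" using kn by (simp add: Ph_def)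
    show "transpose (Ph n \<omega>) = Ph n \<omega>"
      unfolding eq using Vh(1)[OF that] by (intro transpose_proj_mat) (simp add: subspaces_of_dim_def)
    show "T.emp_mean n \<omega> ** Ph n \<omega> = Ph n \<omega> ** T.emp_mean n \<omega>"
      unfolding eq by (rule maximizer_commutes[OF Vh(1)[OF that] sym_emp]) (rule Vh(2)[OF that, unfolded eq])
  qed
  have Ph_dist: "norm (Ph n \<omega> - ?P) \<le> 2 / g * x n \<omega>"
    if kn: "1 \<le> k n" "k n < n" and w: "\<omega> \<in> space M" for n \<omega>
  proof -
    have eq: "Ph n \<omega> = proj_mat (Vhat n \<omega>)" using kn by (simp add: Ph_def)
    show ?thesis
      unfolding eq assms(17) g_def x_def
      by (rule maximizer_stability[OF p assms(13-16) Vh(1)[OF that] Vh(2)[OF that, unfolded eq]])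
  qed
  have half_star: "half_commutator2 ?P B = B ** B ** Q" if "B \<in> K" for B
    unfolding Q_def using K_sub that by (intro half_commutator2_tangent[OF subV]) auto
  have cc: "0 < cc n" "cc n \<le> 1" "real (k n) * (cc n)\<^sup>2 = 1" "real (k n) * cc n = sqrt (real (k n))"
    if "1 \<le> k n" for n
    using that by (auto simp: cc_def power_divide real_div_sqrt)

  \<comment> \<open>The step size satisfies \<open>k n * (cc n)\<^sup>2 = 1\<close>, and
    \<open>k n * cc n\<close> is the square root of \<open>k n\<close>; of the cubic remainder times
    \<open>k n\<close> one factor \<open>cc n\<close> is left.\<close>
  have expansion: "\<bar>real (k n) * (A \<bullet> rotated (cc n) B P - A \<bullet> P)
      - (sqrt (real (k n)) * (A \<bullet> commutator P B) + A \<bullet> half_commutator2 P B)\<bar> \<le> norm A * Cx * norm P * cc n"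
    if kn: "1 \<le> k n" and B: "B \<in> K" for n A B P
  proof -
    note c = cc[OF kn]
    define R where "R = rotated (cc n) B P - (P + cc n *\<^sub>R commutator P B + (cc n)\<^sup>2 *\<^sub>R half_commutator2 P B)"
    have rot: "rotated (cc n) B P = R + (P + cc n *\<^sub>R commutator P B + (cc n)\<^sup>2 *\<^sub>R half_commutator2 P B)"
      by (simp add: R_def)
    have "real (k n) * (A \<bullet> rotated (cc n) B P - A \<bullet> P) = real (k n) * (A \<bullet> R)
      + (real (k n) * cc n) * (A \<bullet> commutator P B) + (real (k n) * (cc n)\<^sup>2) * (A \<bullet> half_commutator2 P B)"
      unfolding rot by (simp add: inner_add_right distrib_left)
    then have "real (k n) * (A \<bullet> rotated (cc n) B P - A \<bullet> P)
      - (sqrt (real (k n)) * (A \<bullet> commutator P B) + A \<bullet> half_commutator2 P B) = real (k n) * (A \<bullet> R)"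
      unfolding c by simp
    also have "\<bar>\<dots>\<bar> = real (k n) * \<bar>A \<bullet> R\<bar>" by (simp add: abs_mult)
    also have "\<dots> \<le> real (k n) * (norm A * (Cx * cc n ^ 3 * norm P))"
    proof (rule mult_left_mono)
      have "\<bar>A \<bullet> R\<bar> \<le> norm A * norm R" by (rule Cauchy_Schwarz_ineq2)
      also have "\<dots> \<le> norm A * (Cx * cc n ^ 3 * norm P)"
        unfolding R_def using c by (intro mult_left_mono Cx(2)[OF B]) auto
      finally show "\<bar>A \<bullet> R\<bar> \<le> norm A * (Cx * cc n ^ 3 * norm P)" .
    qed simp
    also have "\<dots> = (real (k n) * (cc n)\<^sup>2) * (norm A * Cx * norm P * cc n)"
      by (simp add: power2_eq_square power3_eq_cube)
    finally show ?thesis unfolding c(3) by simp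
  qed

  \<comment> \<open>The two processes in terms of \<open>Ph\<close> and the moment matrices; they
    coincide with the stated ones for all large \<open>n\<close>.\<close>
  define Z1 where "Z1 n \<omega> = (\<lambda>B\<in>K. real (k n) * (T.emp_mean n \<omega> \<bullet> rotated (cc n) B (Ph n \<omega>) - T.emp_mean n \<omega> \<bullet> Ph n \<omega>))" for n \<omega>
  define Z2 where "Z2 n \<omega> = (\<lambda>B\<in>K. real (k n) * (T.cond_mean (T.tn n) \<bullet> rotated (cc n) B (Ph n \<omega>) - T.cond_mean (T.tn n) \<bullet> Ph n \<omega>))" for n \<omega>
  define lim where "lim A = (\<lambda>B\<in>K. - 2 * hs_inner A (?P ** B) + hs_inner ?S (B ** B ** Q))" for A
  define lim1 where "lim1 = (\<lambda>B\<in>K. hs_inner ?S (B ** B ** Q))"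

  have cont: "continuous_map euclidean (mtopology_of (CK K))
      (\<lambda>p. restrict (\<lambda>B. real (k n) * (fst p \<bullet> rotated (cc n) B (snd p) - fst p \<bullet> snd p)) K)" if "1 \<le> k n" for n
    using cc[OF that] by (intro continuous_map_rotated_inner[OF K]) auto
  have re1: "random_element M (CK K) (Z1 n)" if "1 \<le> k n" for n
  proof -
    have "(\<lambda>\<omega>. (T.emp_mean n \<omega>, Ph n \<omega>)) \<in> borel_measurable M" by measurable
    from random_element_continuous_map[OF this cont[OF that]] show ?thesis by (simp add: Z1_def[abs_def])
  qed
  have re2: "random_element M (CK K) (Z2 n)" if "1 \<le> k n" for n
  proof -
    have "(\<lambda>\<omega>. (T.cond_mean (T.tn n), Ph n \<omega>)) \<in> borel_measurable M" by measurable
    from random_element_continuous_map[OF this cont[OF that]] show ?thesis by (simp add: Z2_def[abs_def])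
  qed

  \<comment> \<open>The process of empirical risks\<close>
  have Z1_small: "small_in_prob M (\<lambda>n \<omega>. mdist (CK K) (Z1 n \<omega>) lim1)"
  proof -
    \<comment> \<open>\<open>a1\<close> collects the factors of the estimation error
      \<open>x n\<close>: from the Taylor remainder, from the moment matrix and, via the gap, from
      the projection. \<open>a2\<close> belongs to the remainder at the limit matrix.\<close>
    define a1 where "a1 = Cx * sqrt (real p) + Ch * sqrt (real p) + norm ?S * Ch * (2 / g)"
    define a2 where "a2 = norm ?S * Cx * sqrt (real p)"
    have Y: "small_in_prob M (\<lambda>n \<omega>. a1 * x n \<omega> + a2 * cc n)"
      by (intro small_in_prob_add small_in_prob_cmult x_small small_in_prob_const cc_lim)
    show ?thesis
    proof (rule small_in_prob_mono[OF Y])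
      show "\<forall>\<^sub>F n in sequentially. AE \<omega> in M. \<bar>mdist (CK K) (Z1 n \<omega>) lim1\<bar> \<le> \<bar>a1 * x n \<omega> + a2 * cc n\<bar>"
        using T.eventually_k
      proof eventually_elim
        case (elim n)
        then have kn: "1 \<le> k n" "k n < n" by auto
        show ?case
        proof (rule AE_I2)
          fix \<omega> assume w: "\<omega> \<in> space M"
          let ?T = "T.emp_mean n \<omega>" and ?Ph = "Ph n \<omega>"
          have x0: "0 \<le> x n \<omega>" by (simp add: x_def)
          have nT: "norm ?T \<le> x n \<omega> + norm ?S"
            using norm_triangle_ineq[of "?T - ?S" ?S] by (simp add: x_def)
          have a0: "0 \<le> a1 * x n \<omega> + a2 * cc n"
            using Cx(1) Ch(1) g x0 cc[OF kn(1)] by (simp add: a1_def a2_def)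
          have "mdist (CK K) (Z1 n \<omega>) lim1 \<le> a1 * x n \<omega> + a2 * cc n"
            unfolding Z1_def lim1_def
          proof (rule mdist_CK_le[OF a0])
            fix B assume B: "B \<in> K"
            have "\<bar>real (k n) * (?T \<bullet> rotated (cc n) B ?Ph - ?T \<bullet> ?Ph) - ?T \<bullet> half_commutator2 ?Ph B\<bar>
                \<le> norm ?T * Cx * norm ?Ph * cc n"
              using expansion[OF kn(1) B, of ?T ?Ph] by (simp add: Ph_comm[OF kn w])
            also have "\<dots> = norm ?T * (Cx * sqrt (real p) * cc n)" by (simp add: Ph_norm[OF kn w])
            also have "\<dots> \<le> (x n \<omega> + norm ?S) * (Cx * sqrt (real p) * cc n)"
              using Cx(1) cc[OF kn(1)] by (intro mult_right_mono nT) auto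
            also have "\<dots> \<le> x n \<omega> * (Cx * sqrt (real p)) + norm ?S * (Cx * sqrt (real p) * cc n)"
            proof -
              have "x n \<omega> * (Cx * sqrt (real p)) * cc n \<le> x n \<omega> * (Cx * sqrt (real p))"
                using Cx(1) x0 cc[OF kn(1)] by (intro mult_left_le) auto
              then show ?thesis by (simp add: distrib_right mult.assoc)
            qed
            finally have 1: "\<bar>real (k n) * (?T \<bullet> rotated (cc n) B ?Ph - ?T \<bullet> ?Ph) - ?T \<bullet> half_commutator2 ?Ph B\<bar>
                \<le> x n \<omega> * (Cx * sqrt (real p)) + norm ?S * (Cx * sqrt (real p) * cc n)" .
            have "?T \<bullet> half_commutator2 ?Ph B - ?S \<bullet> half_commutator2 ?P B =
               (?T - ?S) \<bullet> half_commutator2 ?Ph B + ?S \<bullet> half_commutator2 (?Ph - ?P) B"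
              unfolding half_commutator2_diff[symmetric] by (simp add: inner_diff_left inner_diff_right)
            moreover have "\<bar>(?T - ?S) \<bullet> half_commutator2 ?Ph B\<bar> \<le> x n \<omega> * (Ch * sqrt (real p))"
              using inner_half[OF B, of "?T - ?S" ?Ph] by (simp add: x_def Ph_norm[OF kn w])
            moreover have "\<bar>?S \<bullet> half_commutator2 (?Ph - ?P) B\<bar> \<le> norm ?S * (Ch * (2 / g * x n \<omega>))"
              using Ch(1) by (intro order_trans[OF inner_half[OF B]] mult_left_mono Ph_dist[OF kn w]) auto
            ultimately have 2: "\<bar>?T \<bullet> half_commutator2 ?Ph B - ?S \<bullet> half_commutator2 ?P B\<bar>
               \<le> x n \<omega> * (Ch * sqrt (real p)) + norm ?S * (Ch * (2 / g * x n \<omega>))" by linarith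
            have "a1 * x n \<omega> + a2 * cc n = x n \<omega> * (Cx * sqrt (real p)) + norm ?S * (Cx * sqrt (real p) * cc n)
              + (x n \<omega> * (Ch * sqrt (real p)) + norm ?S * (Ch * (2 / g * x n \<omega>)))"
              by (simp add: a1_def a2_def algebra_simps)
            then show "\<bar>real (k n) * (?T \<bullet> rotated (cc n) B ?Ph - ?T \<bullet> ?Ph) - hs_inner ?S (B ** B ** Q)\<bar> \<le> a1 * x n \<omega> + a2 * cc n"
              using 1 2 unfolding hs_inner_eq_inner half_star[OF B, symmetric] by linarith
          qed
          moreover have "0 \<le> mdist (CK K) (Z1 n \<omega>) lim1" by simp
          ultimately show "\<bar>mdist (CK K) (Z1 n \<omega>) lim1\<bar> \<le> \<bar>a1 * x n \<omega> + a2 * cc n\<bar>" by linarith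
        qed
      qed
    qed
  qed

  \<comment> \<open>The process of true risks\<close>
  have Z2_small: "small_in_prob M (\<lambda>n \<omega>. mdist (CK K) (Z2 n \<omega>) (lim (G n \<omega>)))"
  proof -
    let ?h = "Ch * sqrt (real p)" and ?j = "Ch * (2 / g)"
    \<comment> \<open>Bounds the replacement of \<open>y\<close> by \<open>- E\<close> below; the 2
      comes from dividing by \<open>q n\<close>, which is at least 1/2.\<close>
    define Y where "Y n \<omega> = 2 * ?h * ((q n \<omega> - 1) * (e1 n \<omega> + norm (G n \<omega>)))" for n \<omega>
    \<comment> \<open>The six errors, in order: the random factor \<open>q n\<close>, the random
      threshold, the projection in the first order term, the Taylor remainder, and in the second
      order term the moment matrix and the projection.\<close>
    define Y' where "Y' n \<omega> = \<bar>Y n \<omega>\<bar> + ?h * e1 n \<omega> + ?j * (x n \<omega> * norm (G n \<omega>)) + c\<^sup>2 * Cx * sqrt (real p) * cc n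
       + ?h * s n + norm ?S * ?j * x n \<omega>" for n \<omega>
    have "small_in_prob M Y"
      unfolding Y_def using T.emp_dev_bounded
      by (intro small_in_prob_cmult small_in_prob_mult[OF q_small]) (simp add: e1_def[abs_def] G_def)
    then have "small_in_prob M (\<lambda>n \<omega>. \<bar>Y n \<omega>\<bar>)" by (rule small_in_prob_mono) simp
    then have Y': "small_in_prob M Y'"
      unfolding Y'_def using T.clt_sum_bounded
      by (intro small_in_prob_add small_in_prob_cmult e1_small x_small small_in_prob_const cc_lim s_lim
          small_in_prob_mult[OF x_small]) (simp_all add: G_def)
    show ?thesis
    proof (rule small_in_prob_local_mono[OF Y' q_small])
      show "\<forall>\<^sub>F n in sequentially. \<forall>\<omega>\<in>space M. \<bar>q n \<omega> - 1\<bar> \<le> 1/2 \<longrightarrow>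
        \<bar>mdist (CK K) (Z2 n \<omega>) (lim (G n \<omega>))\<bar> \<le> \<bar>Y' n \<omega>\<bar>"
        using T.eventually_k
      proof eventually_elim
        case (elim n)
        then have kn: "1 \<le> k n" "k n < n" by auto
        show ?case
        proof (intro ballI impI)
          fix \<omega> assume w: "\<omega> \<in> space M" and q1: "\<bar>q n \<omega> - 1\<bar> \<le> 1/2"
          let ?N = "T.cond_mean (T.tn n)" and ?Ph = "Ph n \<omega>" and ?G = "G n \<omega>" and ?E = "T.emp_dev n \<omega>"
          have x0: "0 \<le> x n \<omega>" "0 \<le> e1 n \<omega>" "0 \<le> s n" by (simp_all add: x_def e1_def s_def)
          have a0: "0 \<le> Y' n \<omega>"
            using Cx(1) Ch(1) g x0 cc[OF kn(1)] by (simp add: Y'_def)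
          have q2: "q n \<omega> \<ge> 1/2" using q1 by linarith
          have "mdist (CK K) (Z2 n \<omega>) (lim ?G) \<le> Y' n \<omega>"
            unfolding Z2_def lim_def
          proof (rule mdist_CK_le[OF a0])
            fix B assume B: "B \<in> K"
            define y where "y = sqrt (real (k n)) * (?N \<bullet> commutator ?Ph B)"
            define E where "E = ?E \<bullet> commutator ?Ph B"
            have 1: "\<bar>real (k n) * (?N \<bullet> rotated (cc n) B ?Ph - ?N \<bullet> ?Ph) - (y + ?N \<bullet> half_commutator2 ?Ph B)\<bar>
               \<le> c\<^sup>2 * Cx * sqrt (real p) * cc n"
            proof -
              have "norm ?N * Cx * norm ?Ph * cc n \<le> c\<^sup>2 * Cx * norm ?Ph * cc n"
                using Cx(1) cc[OF kn(1)] by (intro mult_right_mono T.norm_cond_mean_le) auto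
              then show ?thesis
                using expansion[OF kn(1) B, of ?N ?Ph] by (simp add: y_def Ph_norm[OF kn w])
            qed
            have "?N \<bullet> half_commutator2 ?Ph B - ?S \<bullet> half_commutator2 ?P B =
               (?N - ?S) \<bullet> half_commutator2 ?Ph B + ?S \<bullet> half_commutator2 (?Ph - ?P) B"
              unfolding half_commutator2_diff[symmetric] by (simp add: inner_diff_left inner_diff_right)
            moreover have "\<bar>(?N - ?S) \<bullet> half_commutator2 ?Ph B\<bar> \<le> s n * ?h"
              using inner_half[OF B, of "?N - ?S" ?Ph] by (simp add: s_def Ph_norm[OF kn w])
            moreover have "\<bar>?S \<bullet> half_commutator2 (?Ph - ?P) B\<bar> \<le> norm ?S * (Ch * (2 / g * x n \<omega>))"
              using Ch(1) by (intro order_trans[OF inner_half[OF B]] mult_left_mono Ph_dist[OF kn w]) auto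
            ultimately have 2: "\<bar>?N \<bullet> half_commutator2 ?Ph B - ?S \<bullet> half_commutator2 ?P B\<bar>
               \<le> ?h * s n + norm ?S * ?j * x n \<omega>" by (simp add: mult_ac)
            \<comment> \<open>\<open>emp_mean\<close> contributes nothing by optimality, so pairing
              \<open>emp_dev\<close> with the commutator returns the first order term of the true
              risk up to the factor \<open>- q n\<close>.\<close>
            have Eq: "E = - (q n \<omega> * y)"
              using Ph_comm[OF kn w, of B]
              by (simp add: E_def y_def T.emp_dev_def q_def inner_diff_left)
            have Ele: "\<bar>E\<bar> \<le> ?h * (e1 n \<omega> + norm ?G)"
            proof -
              have "norm ?E \<le> e1 n \<omega> + norm ?G"
                using norm_triangle_ineq[of "?E - ?G" ?G] by (simp add: e1_def)
              then have "norm ?E * ?h \<le> (e1 n \<omega> + norm ?G) * ?h" using Ch(1) by (intro mult_right_mono) auto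
              then show ?thesis
                using inner_comm[OF B, of ?E ?Ph] by (simp add: E_def Ph_norm[OF kn w] mult.commute)
            qed
            have 3: "\<bar>y + E\<bar> \<le> \<bar>Y n \<omega>\<bar>"
            proof -
              have yq: "\<bar>y\<bar> \<le> 2 * \<bar>E\<bar>"
              proof -
                have "1/2 * \<bar>y\<bar> \<le> q n \<omega> * \<bar>y\<bar>" using q2 by (intro mult_right_mono) auto
                also have "\<dots> = \<bar>E\<bar>" using q2 by (simp add: Eq abs_mult)
                finally show ?thesis by simp
              qed
              have "y + E = (1 - q n \<omega>) * y" by (simp add: Eq left_diff_distrib)
              then have "\<bar>y + E\<bar> = \<bar>q n \<omega> - 1\<bar> * \<bar>y\<bar>" by (simp add: abs_mult abs_minus_commute)
              also have "\<dots> \<le> \<bar>q n \<omega> - 1\<bar> * (2 * (?h * (e1 n \<omega> + norm ?G)))"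
                using yq Ele by (intro mult_left_mono) auto
              also have "\<dots> = \<bar>Y n \<omega>\<bar>"
                using Ch(1) x0 by (simp add: Y_def abs_mult mult_ac)
              finally show ?thesis .
            qed
            have 4: "\<bar>E - ?G \<bullet> commutator ?Ph B\<bar> \<le> ?h * e1 n \<omega>"
              using inner_comm[OF B, of "?E - ?G" ?Ph]
              by (simp add: E_def e1_def Ph_norm[OF kn w] inner_diff_left mult_ac)
            have 5: "\<bar>?G \<bullet> commutator ?Ph B - ?G \<bullet> commutator ?P B\<bar> \<le> ?j * (x n \<omega> * norm ?G)"
            proof -
              have "\<bar>?G \<bullet> commutator (?Ph - ?P) B\<bar> \<le> norm ?G * (Ch * (2 / g * x n \<omega>))"
                using Ch(1) by (intro order_trans[OF inner_comm[OF B]] mult_left_mono Ph_dist[OF kn w]) auto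
              then show ?thesis
                unfolding commutator_diff[symmetric] inner_diff_right by (simp add: mult_ac)
            qed
            have 6: "?G \<bullet> commutator ?P B = 2 * (?G \<bullet> (?P ** B))"
              using K_sub B by (intro inner_commutator_tangent[OF subV _ sym_G]) auto
            show "\<bar>real (k n) * (?N \<bullet> rotated (cc n) B ?Ph - ?N \<bullet> ?Ph) -
                (- 2 * hs_inner ?G (?P ** B) + hs_inner ?S (B ** B ** Q))\<bar> \<le> Y' n \<omega>"
              using 1 2 3 4 5 6 unfolding hs_inner_eq_inner half_star[OF B, symmetric] Y'_def by linarith
          qed
          moreover have "0 \<le> mdist (CK K) (Z2 n \<omega>) (lim ?G)" by simp
          ultimately show "\<bar>mdist (CK K) (Z2 n \<omega>) (lim ?G)\<bar> \<le> \<bar>Y' n \<omega>\<bar>" by linarith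
        qed
      qed
    qed
  qed

  \<comment> \<open>Gaussian limit and transfer to the risk processes\<close>
  have Um [measurable]: "U \<in> borel_measurable N" and Ug: "gaussian_var N (\<lambda>\<omega>. A \<bullet> U \<omega>)" for A
    using assms(22) by (auto simp: gaussian_matrix_def)
  interpret N: prob_space N by (rule assms(21))
  have lim_cont: "continuous_map euclidean (mtopology_of (CK K)) lim"
    unfolding lim_def[abs_def] by (rule continuous_map_limit_process[OF K])
  have AEl: "AE x in limit_model \<mu>. norm (scaled w x) \<le> c"
    by (rule limit_model_bounded[OF Xm assms(5) pos assms(8) heavy(2) bnd])
  have Zl [measurable]: "(\<lambda>x. outer (scaled w x)) \<in> borel_measurable (limit_model \<mu>)"
    using measurable_compose[OF has_limit_model_measurable[OF assms(8)] om] .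
  have Zb: "AE x in limit_model \<mu>. norm (outer (scaled w x)) \<le> c\<^sup>2"
    using AEl by eventually_elim (simp add: norm_outer power_mono)
  have outer_comp: "outer y $ i $ j = y $ i * y $ j" for y :: "real^'d" and i j
    by (simp add: outer_def)
  note variance = gaussian_matrix_variance[OF assms(21) heavy(2) assms(22,24) Zl Zb, folded Sigma_lim_def, unfolded outer_comp, OF assms(25)]
  \<comment> \<open>The limit variance of \<open>u \<bullet> G n \<omega>\<close> and the variance
    of \<open>u \<bullet> U \<omega>\<close> are both the second moment minus the squared mean of
    \<open>u \<bullet> outer (scaled w x)\<close> in the limit model.\<close>
  have char: "(\<lambda>n. char (distr M borel (\<lambda>\<omega>. u \<bullet> G n \<omega>)) 1) \<longlonglongrightarrow> char (distr N borel (\<lambda>\<omega>. u \<bullet> U \<omega>)) 1" for u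
  proof -
    have "continuous_on UNIV (\<lambda>y::real^'d. (u \<bullet> outer y)\<^sup>2)" by (intro continuous_intros continuous_on_outer)
    from limit_model_moment_tendsto[OF Xm assms(5) pos assms(8) heavy(2) bnd this]
    have "((\<lambda>t. expectation (\<lambda>\<omega>. of_bool (norm (X \<omega>) > t) * (u \<bullet> outer (scaled w (X \<omega>)))\<^sup>2) / T.tail t)
      \<longlongrightarrow> (\<integral>x. (u \<bullet> outer (scaled w x))\<^sup>2 \<partial>limit_model \<mu>)) at_top" by (simp add: T.tail_def)
    from T.clt_sum_char_tendsto[OF this] show ?thesis
      unfolding variance(2)[symmetric] G_def
      using N.char_gaussian_var[OF Ug _ variance(1), of u] by simp
  qed
  have conv2: "converges_weakly (CK K) (\<lambda>_. M) Z2 sequentially N (\<lambda>\<omega>. lim (U \<omega>))"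
  proof (rule converges_weakly_perturbed_image[OF assms(1,21)])
    show Gm: "G n \<in> borel_measurable M" for n unfolding G_def by measurable
    show "U \<in> borel_measurable N" by measurable
    show tight: "bounded_in_prob M (\<lambda>n \<omega>. norm (G n \<omega>))" using T.clt_sum_bounded by (simp add: G_def)
    show "(\<lambda>n. \<integral>\<omega>. h (G n \<omega>) \<partial>M) \<longlonglongrightarrow> (\<integral>\<omega>. h (U \<omega>) \<partial>N)"
      if h: "continuous_on UNIV h" "\<And>x. \<bar>h x\<bar> \<le> C" for h :: "real^'d^'d \<Rightarrow> real" and C
    proof (rule expectation_tendsto_if_cos_tendsto[OF assms(1,21) Gm Um _ tight h])
      fix u b
      have "(\<lambda>n. Re (iexp b * char (distr M borel (\<lambda>\<omega>. u \<bullet> G n \<omega>)) 1))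
        \<longlonglongrightarrow> Re (iexp b * char (distr N borel (\<lambda>\<omega>. u \<bullet> U \<omega>)) 1)"
        by (intro tendsto_Re tendsto_mult tendsto_const char)
      then show "(\<lambda>n. \<integral>\<omega>. cos (u \<bullet> G n \<omega> + b) \<partial>M) \<longlonglongrightarrow> (\<integral>\<omega>. cos (u \<bullet> U \<omega> + b) \<partial>N)"
        using Gm by (subst expectation_cos_eq_char, measurable, subst N.expectation_cos_eq_char, measurable)
    qed
    show "continuous_map euclidean (mtopology_of (CK K)) lim" by (rule lim_cont)
    show "\<forall>\<^sub>F n in sequentially. random_element M (CK K) (Z2 n)"
      using T.eventually_k by eventually_elim (auto intro: re2)
    show "random_element N (CK K) (\<lambda>\<omega>. lim (U \<omega>))" by (rule random_element_continuous_map[OF Um lim_cont])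
    show "small_in_prob M (\<lambda>n \<omega>. mdist (CK K) (Z2 n \<omega>) (lim (G n \<omega>)))" by (rule Z2_small)
  qed simp
  have conv1: "converges_in_prob (CK K) M Z1 lim1"
    unfolding converges_in_prob_def
  proof (intro conjI allI impI)
    show "\<forall>\<^sub>F n in sequentially. random_element M (CK K) (Z1 n)"
      using T.eventually_k by eventually_elim (auto intro: re1)
    show "lim1 \<in> mspace (CK K)"
      unfolding lim1_def hs_inner_eq_inner by (intro restrict_in_CK[OF K] continuous_intros matmul.continuous_on)
    fix \<delta> :: real assume "\<delta> > 0"
    then show "(\<lambda>n. prob {\<omega>\<in>space M. mdist (CK K) (Z1 n \<omega>) lim1 > \<delta>}) \<longlonglongrightarrow> 0"
      by (rule small_in_prob_measure_tendsto[OF Z1_small])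
  qed
  let ?Y1 = "\<lambda>n \<omega>. \<lambda>B\<in>K. real (k n) *
          (emp_risk w n (k n) (\<lambda>i. Xs i \<omega>)
             (rotated (1 / sqrt (real (k n))) B (proj_mat (Vhat n \<omega>)))
           - emp_risk w n (k n) (\<lambda>i. Xs i \<omega>) (proj_mat (Vhat n \<omega>)))"
  let ?Y2 = "\<lambda>n \<omega>. \<lambda>B\<in>K. real (k n) *
          (risk M X w n (k n) (rotated (1 / sqrt (real (k n))) B (proj_mat (Vhat n \<omega>)))
           - risk M X w n (k n) (proj_mat (Vhat n \<omega>)))"
  have ev1: "\<forall>\<^sub>F n in sequentially. Z1 n = ?Y1 n"
    using T.eventually_k
  proof eventually_elim
    case (elim n)
    then show ?case by (simp add: Z1_def Ph_def emp cc_def fun_eq_iff)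
  qed
  have ev2: "\<forall>\<^sub>F n in sequentially. Z2 n = ?Y2 n"
    using T.eventually_k
  proof eventually_elim
    case (elim n)
    then show ?case by (simp add: Z2_def Ph_def rsk cc_def fun_eq_iff)
  qed
  show "converges_in_prob (CK K) M ?Y1 (\<lambda>B\<in>K. hs_inner (Sigma_lim \<mu> w) (B ** B ** (proj_mat Vstar - proj_mat (Vstar\<^sup>\<bottom>))))
   \<and> converges_weakly (CK K) (\<lambda>_. M) ?Y2 sequentially N
       (\<lambda>\<omega>. \<lambda>B\<in>K. - 2 * hs_inner (U \<omega>) (proj_mat Vstar ** B)
          + hs_inner (Sigma_lim \<mu> w) (B ** B ** (proj_mat Vstar - proj_mat (Vstar\<^sup>\<bottom>))))"
    using converges_in_prob_cong[OF ev1 conv1] converges_weakly_cong[OF ev2 conv2]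
    by (simp only: lim1_def lim_def Q_def)
qed

end
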